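(* Let $q$ be a prime power, $A=\mathbb{F}_q[t]$, $F=\mathbb{F}_q(t)$, let $K/F$ be a finite extension and $\bar K$ an algebraic closure of $K$. Let $r\ge 2$ and let $\phi,\phi'$ be Drinfeld $A$-modules of rank $r$ and generic characteristic defined over $K$, and let $f:\phi\to\phi'$ be an isogeny defined over $\bar K$. \begin{enumerate} \item Suppose $N\in A$ is nonzero with $\ker f\subset \phi[N]$. Then \[ |h_G(\phi')-h_G(\phi)|\le \deg N+\Big(\frac{q}{q-1}-\frac{q^r}{q^r-1}\Big). \] \item Suppose $r=2$, and let $j=j(\phi)$, $j'=j(\phi')$. Then \[ h(j')-h(j)\le \frac{q^2-1}{2}\log\deg f+\frac{q^2-1}{2}\log\Big[1+\frac1q h(j')\Big]+q . \] \end{enumerate}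
   Context: Throughout, $\log$ denotes the logarithm to base $q$. Places of $F$: for a monic irreducible $P\in A$ the finite place has $|x|=q^{-\deg(P)v_P(x)}$; the infinite place $\infty$ has $|x|_\infty=q^{\deg x}$. For a finite extension $K/F$, every place $v$ of $K$ carries the absolute value $|\cdot|_v$ extending the normalized absolute value of the place of $F$ below it, and $n_v=[K_v:F_v]$ is the local degree. A Drinfeld $A$-module $\phi$ of rank $r$ over $K$ (generic characteristic) is determined by $\phi_t(X)=tX+g_1X^q+\cdots+g_rX^{q^r}$ with $g_i\in K$, $g_r\neq0$. Its graded height is \[ h_G(\phi)=\frac{1}{[K:F]}\sum_{v}n_v\log\max\{|g_1|_v^{1/(q-1)},\dots,|g_r|_v^{1/(q^r-1)}\}, \] the sum over all places $v$ of $K$ (independent of the choice of $K$ containing the $g_i$). An isogeny $f:\phi\to\phi'$ is a nonzero $\mathbb{F}_q$-linear additive polynomial $f(X)$ with $f\circ\phi_t=\phi'_t\circ f$; $\deg f=\#\ker f$ (the number of roots of $f$ in $\bar K$), and $\phi[N]$ is the set of roots of $\phi_N(X)$. For rank $2$, $j(\phi)=g_1^{q+1}/g_2$, and for $x\in K$ the Weil height is $h(x)=\frac{1}{[K:F]}\sum_v n_v\log\max\{1,|x|_v\}$. *)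

theory Defs
  imports
    "HOL-Algebra.QuotRing"
    "HOL-Algebra.Embedded_Algebras"
    "HOL-Algebra.Algebraic_Closure_Type"
    "HOL-Library.Cardinality"
    "HOL-Analysis.Infinite_Sum"
    "HOL-Computational_Algebra.Computational_Algebra"
begin

text \<open>
  The finite field \<open>F\<^sub>q\<close> is a type \<open>'k\<close> of sort \<open>{field, finite}\<close>, so \<open>q = CARD('k)\<close>;
  \<open>A = F\<^sub>q[t]\<close> is \<open>'k poly\<close> and \<open>F = F\<^sub>q(t)\<close> is \<open>'k poly fract\<close>. An extension field of
  \<open>F\<close> is a type together with its structure map \<open>\<iota>\<close>.
\<close>

subsection \<open>Field extensions\<close>

definition field_embedding :: "('a::field \<Rightarrow> 'b::field) \<Rightarrow> bool" where
  "field_embedding \<iota> \<longleftrightarrow> \<iota> \<in> ring_hom ring_of_type_algebra ring_of_type_algebra"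

definition finite_extension :: "('a::field \<Rightarrow> 'b::field) \<Rightarrow> bool" where
  "finite_extension \<iota> \<longleftrightarrow> field_embedding \<iota> \<and>
     ring.finite_dimension ring_of_type_algebra (range \<iota>) (UNIV :: 'b set)"

definition extension_degree :: "('a::field \<Rightarrow> 'b::field) \<Rightarrow> nat" where
  "extension_degree \<iota> = ring.dim ring_of_type_algebra (range \<iota>) (UNIV :: 'b set)"

text \<open>That the codomain is algebraically closed is expressed by its sort.\<close>

definition is_algebraic_closure :: "('a::field \<Rightarrow> 'b::alg_closed_field) \<Rightarrow> bool" where
  "is_algebraic_closure \<kappa> \<longleftrightarrow> field_embedding \<kappa> \<and>
     (\<forall>y. \<exists>p :: 'a poly. p \<noteq> 0 \<and> poly (map_poly \<kappa> p) y = 0)"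

definition embed_A :: "('k::field poly fract \<Rightarrow> 'a::field) \<Rightarrow> 'k poly \<Rightarrow> 'a" where
  "embed_A \<iota> a = \<iota> (Fract a 1)"


subsection \<open>Places and local degrees\<close>

definition absolute_value :: "('a::field \<Rightarrow> real) \<Rightarrow> bool" where
  "absolute_value v \<longleftrightarrow>
     (\<forall>x. 0 \<le> v x) \<and> (\<forall>x. v x = 0 \<longleftrightarrow> x = 0) \<and>
     (\<forall>x y. v (x * y) = v x * v y) \<and> (\<forall>x y. v (x + y) \<le> v x + v y)"

text \<open>The exponent of \<open>P\<close> in \<open>a \<noteq> 0\<close>. (The library's \<^const>\<open>multiplicity\<close> asks for a
  factorial-semiring instance of \<open>'k poly\<close>, which is not available for all fields \<open>'k\<close>.)\<close>

definition ord_at :: "'k::field poly \<Rightarrow> 'k poly \<Rightarrow> nat" where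
  "ord_at P a = Max {n. P ^ n dvd a}"

definition extends_finite_place ::
  "('k::{field,finite} poly fract \<Rightarrow> 'a::field) \<Rightarrow> 'k poly \<Rightarrow> ('a \<Rightarrow> real) \<Rightarrow> bool" where
  "extends_finite_place \<iota> P v \<longleftrightarrow>
     (\<forall>a b. a \<noteq> 0 \<longrightarrow> b \<noteq> 0 \<longrightarrow>
        v (\<iota> (Fract a b)) =
          real CARD('k) powr (- real (Polynomial.degree P) * (real (ord_at P a) - real (ord_at P b))))"

definition extends_infinite_place ::
  "('k::{field,finite} poly fract \<Rightarrow> 'a::field) \<Rightarrow> ('a \<Rightarrow> real) \<Rightarrow> bool" where
  "extends_infinite_place \<iota> v \<longleftrightarrow>
     (\<forall>a b. a \<noteq> 0 \<longrightarrow> b \<noteq> 0 \<longrightarrow>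
        v (\<iota> (Fract a b)) =
          real CARD('k) powr (real (Polynomial.degree a) - real (Polynomial.degree b)))"

text \<open>A place is represented by its normalized absolute value, i.e. the unique absolute value in
  its equivalence class that extends a normalized absolute value of \<open>F\<close>.\<close>

definition places :: "('k::{field,finite} poly fract \<Rightarrow> 'a::field) \<Rightarrow> ('a \<Rightarrow> real) set" where
  "places \<iota> = {v. absolute_value v \<and>
     ((\<exists>P. Polynomial.lead_coeff P = 1 \<and> Factorial_Ring.irreducible P \<and> extends_finite_place \<iota> P v) \<or>
      extends_infinite_place \<iota> v)}"

text \<open>The completion \<open>K\<^sub>v\<close>: Cauchy sequences modulo null sequences.\<close>

definition v_Cauchy :: "('a::field \<Rightarrow> real) \<Rightarrow> (nat \<Rightarrow> 'a) \<Rightarrow> bool" where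
  "v_Cauchy v s \<longleftrightarrow> (\<forall>e>0. \<exists>M. \<forall>m\<ge>M. \<forall>n\<ge>M. v (s m - s n) < e)"

definition Cauchy_ring :: "('a::field \<Rightarrow> real) \<Rightarrow> (nat \<Rightarrow> 'a) ring" where
  "Cauchy_ring v = \<lparr>carrier = {s. v_Cauchy v s}, monoid.mult = (\<lambda>s u n. s n * u n), one = (\<lambda>n. 1),
     ring.zero = (\<lambda>n. 0), add = (\<lambda>s u n. s n + u n)\<rparr>"

definition null_ideal :: "('a::field \<Rightarrow> real) \<Rightarrow> (nat \<Rightarrow> 'a) set" where
  "null_ideal v = {s. (\<lambda>n. v (s n)) \<longlonglongrightarrow> 0}"

definition completion :: "('a::field \<Rightarrow> real) \<Rightarrow> (nat \<Rightarrow> 'a) set ring" where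
  "completion v = Cauchy_ring v Quot null_ideal v"

text \<open>The completion \<open>F\<^sub>v\<close>, as the subfield of \<open>K\<^sub>v\<close> of all limits of Cauchy sequences in \<open>F\<close>.\<close>

definition base_completion :: "('f \<Rightarrow> 'a::field) \<Rightarrow> ('a \<Rightarrow> real) \<Rightarrow> (nat \<Rightarrow> 'a) set set" where
  "base_completion \<iota> v =
     {null_ideal v +>\<^bsub>Cauchy_ring v\<^esub> s | s. s \<in> carrier (Cauchy_ring v) \<and> range s \<subseteq> range \<iota>}"

definition local_degree :: "('f \<Rightarrow> 'a::field) \<Rightarrow> ('a \<Rightarrow> real) \<Rightarrow> nat" where
  "local_degree \<iota> v =
     ring.dim (completion v) (base_completion \<iota> v) (carrier (completion v))"

definition weil_height :: "('k::{field,finite} poly fract \<Rightarrow> 'a::field) \<Rightarrow> 'a \<Rightarrow> real" where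
  "weil_height \<iota> x = 1 / real (extension_degree \<iota>) *
     (\<Sum>\<^sub>\<infinity>v\<in>places \<iota>. real (local_degree \<iota> v) * log (real CARD('k)) (max 1 (v x)))"


subsection \<open>Drinfeld modules\<close>

text \<open>A Drinfeld module is the \<open>F\<^sub>q\<close>-algebra homomorphism \<open>a \<mapsto> \<phi>\<^sub>a\<close> from \<open>A\<close> into the
  \<open>F\<^sub>q\<close>-linear polynomials over \<open>K\<close> under addition and composition, with
  \<open>\<phi>\<^sub>t = t X + g\<^sub>1 X\<^sup>q + \<dots> + g\<^sub>r X\<^bsup>q^r\<^esup>\<close>. The linear coefficient is the image of \<open>t\<close> under
  \<open>A \<subseteq> F \<rightarrow> K\<close>, so the characteristic is generic.\<close>

definition drinfeld_module ::
  "('k::{field,finite} poly fract \<Rightarrow> 'a::field) \<Rightarrow> nat \<Rightarrow> ('k poly \<Rightarrow> 'a poly) \<Rightarrow> bool" where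
  "drinfeld_module \<iota> r \<phi> \<longleftrightarrow>
     (\<forall>a b. \<phi> (a + b) = \<phi> a + \<phi> b) \<and>
     (\<forall>a b. \<phi> (a * b) = pcompose (\<phi> a) (\<phi> b)) \<and>
     (\<forall>c. \<phi> [:c:] = [:0, embed_A \<iota> [:c:]:]) \<and>
     (\<exists>g. g r \<noteq> 0 \<and>
        \<phi> [:0, 1:] = [:0, embed_A \<iota> [:0, 1:]:] + (\<Sum>i=1..r. Polynomial.monom (g i) (CARD('k) ^ i)))"

definition drinfeld_coeff :: "('k::{field,finite} poly \<Rightarrow> 'a::field poly) \<Rightarrow> nat \<Rightarrow> 'a" where
  "drinfeld_coeff \<phi> i = Polynomial.coeff (\<phi> [:0, 1:]) (CARD('k) ^ i)"

definition graded_height ::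
  "('k::{field,finite} poly fract \<Rightarrow> 'a::field) \<Rightarrow> nat \<Rightarrow> ('k poly \<Rightarrow> 'a poly) \<Rightarrow> real" where
  "graded_height \<iota> r \<phi> = 1 / real (extension_degree \<iota>) *
     (\<Sum>\<^sub>\<infinity>v\<in>places \<iota>. real (local_degree \<iota> v) *
        log (real CARD('k))
          (Max ((\<lambda>i. v (drinfeld_coeff \<phi> i) powr (1 / (real CARD('k) ^ i - 1))) ` {1..r})))"

definition j_invariant :: "('k::{field,finite} poly \<Rightarrow> 'a::field poly) \<Rightarrow> 'a" where
  "j_invariant \<phi> = drinfeld_coeff \<phi> 1 ^ (CARD('k) + 1) / drinfeld_coeff \<phi> 2"


subsection \<open>Isogenies\<close>

text \<open>Linearity is stated for the polynomial function; the field is infinite wherever this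
  is used, so this is the same as formal linearity.\<close>

definition Fq_linear :: "('k::field poly fract \<Rightarrow> 'c::field) \<Rightarrow> 'c poly \<Rightarrow> bool" where
  "Fq_linear \<iota> f \<longleftrightarrow>
     (\<forall>x y. poly f (x + y) = poly f x + poly f y) \<and>
     (\<forall>c x. poly f (embed_A \<iota> [:c:] * x) = embed_A \<iota> [:c:] * poly f x)"

text \<open>Isogenies over the algebraic closure \<open>\<kappa> : K \<rightarrow> K\<^sup>a\<^sup>c\<close> between Drinfeld modules over \<open>K\<close>.\<close>

definition isogeny ::
  "('k::{field,finite} poly fract \<Rightarrow> 'a::field) \<Rightarrow> ('a \<Rightarrow> 'c::field) \<Rightarrow>
   ('k poly \<Rightarrow> 'a poly) \<Rightarrow> ('k poly \<Rightarrow> 'a poly) \<Rightarrow> 'c poly \<Rightarrow> bool" where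
  "isogeny \<iota> \<kappa> \<phi> \<phi>' f \<longleftrightarrow> f \<noteq> 0 \<and> Fq_linear (\<kappa> \<circ> \<iota>) f \<and>
     pcompose f (map_poly \<kappa> (\<phi> [:0, 1:])) = pcompose (map_poly \<kappa> (\<phi>' [:0, 1:])) f"

definition poly_kernel :: "'c::field poly \<Rightarrow> 'c set" where
  "poly_kernel f = {x. poly f x = 0}"

definition isogeny_degree :: "'c::field poly \<Rightarrow> nat" where
  "isogeny_degree f = card (poly_kernel f)"

definition torsion :: "('a::field \<Rightarrow> 'c::field) \<Rightarrow> ('k::field poly \<Rightarrow> 'a poly) \<Rightarrow> 'k poly \<Rightarrow> 'c set" where
  "torsion \<kappa> \<phi> N = poly_kernel (map_poly \<kappa> (\<phi> N))"

end

theory Submission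
  imports Defs "HOL-Analysis.Convex"
begin

text \<open>
  At an infinite place let \<open>\<sigma>\<close> be the radius of the largest disc on which the linear term of \<open>\<phi>\<^sub>t\<close>
  dominates. The local contribution to the graded height is \<open>- log \<sigma>\<close> up to an error between
  \<open>1/(q\<^sup>r - 1)\<close> and \<open>1/(q - 1)\<close>. Let \<open>c\<close> be the linear coefficient of the isogeny \<open>f\<close>. Comparing the
  zeros on small discs of both sides of \<open>f \<circ> \<phi>\<^sub>t = \<phi>'\<^sub>t \<circ> f\<close> bounds \<open>\<bar>c\<bar> \<sigma>/\<sigma>'\<close>: if \<open>h \<circ> f = \<phi>\<^sub>N\<close>, then \<open>f\<close>
  is injective wherever \<open>\<phi>\<^sub>N\<close> is, and \<open>\<bar>c\<bar> \<sigma> \<le> q\<^bsup>deg N\<^esup> \<sigma>'\<close>; in rank 2 the growth of the number of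
  zeros of the iterates of \<open>\<phi>'\<^sub>t\<close> gives \<open>(\<bar>c\<bar> \<sigma>/\<sigma>')\<^sup>2 \<le> deg f (1 + log max(1, \<bar>j'\<bar>)/q)\<close>. At a finite place the same
  comparison bounds the size of \<open>\<phi>'\<close> by that of \<open>\<phi>\<close> divided by \<open>\<bar>c\<bar>\<close>. Summed over all places, \<open>c\<close>
  disappears by the product formula; the dual isogeny gives the opposite inequality, and concavity of
  the logarithm turns the local terms in \<open>j'\<close> into \<open>h(j')\<close>.

  The local degree of \<open>v\<close> is computed as the dimension of the integers modulo a uniformizer of \<open>F\<close>.
  The product formula then follows by counting residues, once every element with a zero is known
  to have a pole; the latter comes from Chevalley's extension theorem for valuation rings.
\<close>

subsection \<open>Gauss norms over a field with a nonarchimedean absolute value\<close>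

text \<open>The estimates use Gauss norms over fields that need not be complete; the index in
  \<open>dominates\<close> stands for a number of zeros in a disc, without any zero being located.
  It multiplies under composition, and this turns the commutation of an isogeny with the two actions
  of t into inequalities between radii. The obstacle is that \<open>f\<close> has coefficients in
  the algebraic closure, while the heights are sums over places of K. Each place must be extended to
  the closure, and as the linear coefficient of \<open>f\<close> can have different sizes at
  different extensions, the extension has to be chosen. Origin of the constants: the first part
  loses the difference of the two extreme errors between size and radius. For r = 2 the Weil height
  of j is q^2 - 1 times the graded height, which turns this loss into (q + 1) - 1 = q. The halves in
  the second part come from a square: in rank 2 the index of the iterates of
  \<open>\<phi>'\<^sub>t\<close> is eventually multiplied by q^2 at each step, while the radius on
  which the iterates of \<open>\<phi>\<^sub>t\<close> are injective only shrinks by q.\<close>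

locale nonarch_abs =
  fixes v :: "'a::field \<Rightarrow> real"
  assumes nonneg [simp]: "0 \<le> v x"
    and eq_0_iff [simp]: "v x = 0 \<longleftrightarrow> x = 0"
    and mult: "v (x * y) = v x * v y"
    and ultra: "v (x + y) \<le> max (v x) (v y)"
begin

lemma pos_iff [simp]: "0 < v x \<longleftrightarrow> x \<noteq> 0"
  using nonneg[of x] eq_0_iff[of x] by linarith

lemma zero [simp]: "v 0 = 0"
  by simp

lemma one [simp]: "v 1 = 1"
proof -
  have "v 1 * v 1 = v 1 * 1" using mult[of 1 1] by simp
  then show ?thesis by (subst (asm) mult_cancel_left) simp
qed

lemma power: "v (x ^ n) = v x ^ n"
  by (induction n) (simp_all add: mult)

lemma inverse: "v (inverse x) = inverse (v x)"
proof (cases "x = 0")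
  case False
  then have "v x * v (inverse x) = 1" using mult[of x "inverse x"] by simp
  then show ?thesis using False by (simp add: field_simps)
qed simp

lemma divide: "v (x / y) = v x / v y"
  by (simp add: divide_inverse mult inverse)

lemma minus [simp]: "v (- x) = v x"
proof -
  have "v (-1) ^ 2 = 1" by (simp add: power[symmetric])
  then have "v (-1) = 1" using nonneg[of "-1"] by (simp add: power2_eq_1_iff)
  then show ?thesis using mult[of "-1" x] by simp
qed

lemma ultra_diff: "v (x - y) \<le> max (v x) (v y)"
  using ultra[of x "- y"] by simp

lemma diff_commute: "v (x - y) = v (y - x)"
  using minus[of "x - y"] by simp

lemma ultra_bound: "v x \<le> B \<Longrightarrow> v y \<le> B \<Longrightarrow> v (x + y) \<le> B"
  using ultra[of x y] by simp

lemma ultra_diff_bound: "v x \<le> B \<Longrightarrow> v y \<le> B \<Longrightarrow> v (x - y) \<le> B"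
  using ultra_diff[of x y] by simp

lemma add_dominant:
  assumes "v x < v y"
  shows "v (x + y) = v y" "v (y + x) = v y"
proof -
  have "v y \<le> max (v (x + y)) (v x)" using ultra_diff[of "x + y" x] by simp
  then show "v (x + y) = v y" using assms ultra[of x y] by linarith
  then show "v (y + x) = v y" by (simp add: add.commute)
qed

lemma sum_le: "(\<And>i. i \<in> I \<Longrightarrow> v (g i) \<le> B) \<Longrightarrow> 0 \<le> B \<Longrightarrow> v (\<Sum>i\<in>I. g i) \<le> B"
proof (induction I rule: infinite_finite_induct)
  case (insert i I)
  then show ?case by (auto intro: ultra_bound)
qed auto

lemma sum_less: "(\<And>i. i \<in> I \<Longrightarrow> v (g i) < B) \<Longrightarrow> 0 < B \<Longrightarrow> v (\<Sum>i\<in>I. g i) < B"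
proof (induction I rule: infinite_finite_induct)
  case (insert i I)
  then have "v (g i) < B" "v (\<Sum>i\<in>I. g i) < B" by auto
  then show ?case using ultra[of "g i" "\<Sum>i\<in>I. g i"] insert(1,2) by (simp add: max_def split: if_splits)
qed auto

lemma sum_dominant:
  assumes "finite I" "j \<in> I" "\<And>i. i \<in> I \<Longrightarrow> i \<noteq> j \<Longrightarrow> v (g i) < v (g j)" "g j \<noteq> 0"
  shows "v (\<Sum>i\<in>I. g i) = v (g j)"
proof -
  have "v (\<Sum>i\<in>I - {j}. g i) < v (g j)" using assms by (intro sum_less) auto
  then show ?thesis using assms(1,2) by (simp add: sum.remove add_dominant(2))
qed

text \<open>\<open>dominates \<rho> p d M\<close>: the Gauss norm of \<open>p\<close> on the disc of radius \<open>\<rho>\<close> is \<open>M > 0\<close>, and \<open>d\<close>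
  is the largest index of a coefficient attaining it, i.e. the number of zeros in the disc.\<close>

definition dominates :: "real \<Rightarrow> 'a poly \<Rightarrow> nat \<Rightarrow> real \<Rightarrow> bool" where
  "dominates \<rho> p d M \<longleftrightarrow> 0 < M \<and> v (Polynomial.coeff p d) * \<rho> ^ d = M \<and>
     (\<forall>i. v (Polynomial.coeff p i) * \<rho> ^ i \<le> M) \<and> (\<forall>i>d. v (Polynomial.coeff p i) * \<rho> ^ i < M)"

lemma dominates_exists:
  assumes "\<rho> > 0" "p \<noteq> 0"
  obtains d M where "dominates \<rho> p d M"
proof -
  define w where "w i = v (Polynomial.coeff p i) * \<rho> ^ i" for i
  define M where "M = Max (w ` {..Polynomial.degree p})"
  define S where "S = {i. i \<le> Polynomial.degree p \<and> w i = M}"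
  have w_le: "w i \<le> M" if "i \<le> Polynomial.degree p" for i
    unfolding M_def using that by (intro Max_ge) auto
  have w_deg: "0 < w (Polynomial.degree p)"
    unfolding w_def using assms by simp
  then have "0 < M" using w_le[of "Polynomial.degree p"] by simp
  have w_0: "w i = 0" if "i > Polynomial.degree p" for i
    unfolding w_def using that by (simp add: coeff_eq_0)
  have "M \<in> w ` {..Polynomial.degree p}" unfolding M_def by (intro Max_in) auto
  then have "S \<noteq> {}" "finite S" unfolding S_def by auto
  then have "Max S \<in> S" by (rule Max_in[rotated])
  have "w i \<le> M" for i using w_le w_0 \<open>0 < M\<close> by (cases "i \<le> Polynomial.degree p") auto
  moreover have "w i < M" if "i > Max S" for i
  proof (cases "i \<le> Polynomial.degree p")
    case True
    have "i \<notin> S" using that Max_ge[OF \<open>finite S\<close>, of i] by auto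
    then show ?thesis using True w_le[of i] unfolding S_def by auto
  qed (use w_0 \<open>0 < M\<close> in auto)
  ultimately have "dominates \<rho> p (Max S) M"
    using \<open>Max S \<in> S\<close> \<open>0 < M\<close> unfolding dominates_def S_def w_def by auto
  then show ?thesis by (rule that)
qed

lemma dominates_unique:
  assumes "dominates \<rho> p d M" "dominates \<rho> p d' M'"
  shows "d = d'" "M = M'"
proof -
  show M: "M = M'" using assms unfolding dominates_def by (metis order_antisym)
  show "d = d'" using assms unfolding dominates_def M by (metis linorder_neqE_nat less_irrefl)
qed

lemma dominatesD:
  assumes "dominates \<rho> p d M"
  shows "0 < M" "v (Polynomial.coeff p d) * \<rho> ^ d = M" "v (Polynomial.coeff p i) * \<rho> ^ i \<le> M"
    "i > d \<Longrightarrow> v (Polynomial.coeff p i) * \<rho> ^ i < M"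
  using assms unfolding dominates_def by auto

lemma dominates_le_degree: "dominates \<rho> p d M \<Longrightarrow> d \<le> Polynomial.degree p"
  using dominatesD(1,2)[of \<rho> p d M] by (intro le_degree) auto

lemma dominates_index_pos:
  assumes "dominates \<rho> p d M" "Polynomial.coeff p 0 = 0"
  shows "0 < d"
  using dominatesD(1,2)[OF assms(1)] assms(2) by (cases d) auto

lemma dominates_const: "c \<noteq> 0 \<Longrightarrow> dominates \<rho> [:c:] 0 (v c)"
  unfolding dominates_def by (auto simp: coeff_pCons split: nat.split)

text \<open>Gauss's lemma with indices. A term \<open>T n i\<close> of size \<open>M * N\<close>
  needs \<open>i \<le> d\<close> and \<open>n - i \<le> e\<close>; beyond \<open>n = d + e\<close>
  there is no such term, and at \<open>n = d + e\<close> only \<open>i = d\<close>, so nothing can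
  cancel there.\<close>

lemma dominates_mult:
  assumes p: "dominates \<rho> p d M" and r: "dominates \<rho> r e N" and "\<rho> > 0"
  shows "dominates \<rho> (p * r) (d + e) (M * N)"
proof -
  note pD = dominatesD[OF p] and rD = dominatesD[OF r]
  define T where "T n i = Polynomial.coeff p i * Polynomial.coeff r (n - i)" for n i
  have T: "v (T n i) * \<rho> ^ n = (v (Polynomial.coeff p i) * \<rho> ^ i) * (v (Polynomial.coeff r (n - i)) * \<rho> ^ (n - i))"
    if "i \<le> n" for n i
    unfolding T_def mult using that by (simp add: power_add[symmetric])
  have w: "0 \<le> v x * \<rho> ^ i" for x i using \<open>\<rho> > 0\<close> by simp
  have T_le: "v (T n i) * \<rho> ^ n \<le> M * N" if "i \<le> n" for n i
    unfolding T[OF that] by (intro mult_mono pD rD w) (use pD(1) in auto)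
  have T_less: "v (T n i) * \<rho> ^ n < M * N" if "i \<le> n" "i > d \<or> n - i > e" for n i
    using that(2)
  proof
    assume "i > d"
    then show ?thesis unfolding T[OF that(1)]
      by (intro order.strict_trans1[OF mult_left_mono mult_strict_right_mono] pD rD w)
  next
    assume "n - i > e"
    then show ?thesis unfolding T[OF that(1)]
      by (intro order.strict_trans1[OF mult_right_mono mult_strict_left_mono] pD rD w)
  qed
  have le: "v (Polynomial.coeff (p * r) n) * \<rho> ^ n \<le> M * N" for n
  proof -
    have "v (\<Sum>i\<le>n. T n i) \<le> M * N / \<rho> ^ n"
      using T_le \<open>\<rho> > 0\<close> pD(1) rD(1) by (intro sum_le) (auto simp: field_simps)
    then show ?thesis using \<open>\<rho> > 0\<close> by (simp add: coeff_mult T_def field_simps)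
  qed
  have less: "v (Polynomial.coeff (p * r) n) * \<rho> ^ n < M * N" if "n > d + e" for n
  proof -
    have "v (T n i) < M * N / \<rho> ^ n" if "i \<le> n" for i
    proof -
      have "i > d \<or> n - i > e" using \<open>n > d + e\<close> that by linarith
      from T_less[OF that this] show ?thesis using \<open>\<rho> > 0\<close> by (simp add: field_simps)
    qed
    then have "v (\<Sum>i\<le>n. T n i) < M * N / \<rho> ^ n"
      using \<open>\<rho> > 0\<close> pD(1) rD(1) by (intro sum_less) auto
    then show ?thesis using \<open>\<rho> > 0\<close> by (simp add: coeff_mult T_def field_simps)
  qed
  have Td: "v (T (d + e) d) * \<rho> ^ (d + e) = M * N"
    using T[of d "d + e"] pD(2) rD(2) by simp
  have "v (\<Sum>i\<le>d + e. T (d + e) i) = v (T (d + e) d)"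
  proof (rule sum_dominant)
    fix i assume "i \<in> {..d + e}" "i \<noteq> d"
    then have "i \<le> d + e" "i > d \<or> d + e - i > e" by auto
    from T_less[OF this] show "v (T (d + e) i) < v (T (d + e) d)"
      using \<open>\<rho> > 0\<close> unfolding Td[symmetric] by simp
  next
    have "0 < M * N" using pD(1) rD(1) by simp
    then show "T (d + e) d \<noteq> 0" using Td by auto
  qed auto
  then have "v (Polynomial.coeff (p * r) (d + e)) * \<rho> ^ (d + e) = M * N"
    using Td by (simp add: coeff_mult T_def)
  then show ?thesis
    unfolding dominates_def using le less pD(1) rD(1) by auto
qed

lemma dominates_power:
  assumes "dominates \<rho> p d M" "\<rho> > 0"
  shows "dominates \<rho> (p ^ n) (n * d) (M ^ n)"
proof (induction n)
  case 0
  show ?case using dominates_const[of 1 \<rho>] by (simp add: one_pCons)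
next
  case (Suc n)
  then show ?case using dominates_mult[OF assms(1) Suc assms(2)] by simp
qed

lemma coeff_pcompose_sum:
  "Polynomial.coeff (pcompose g f) n =
     (\<Sum>i\<le>Polynomial.degree g. Polynomial.coeff g i * Polynomial.coeff (f ^ i) n)"
proof -
  have "pcompose g f = (\<Sum>i\<le>Polynomial.degree g. Polynomial.smult (Polynomial.coeff g i) (f ^ i))"
    by (simp add: pcompose_altdef poly_altdef degree_map_poly coeff_map_poly)
  then show ?thesis by (simp add: coeff_sum)
qed

text \<open>On the disc of radius \<rho> the polynomial \<open>f\<close> behaves like its term of
  degree \<open>e\<close>, with image radius \<open>R\<close>. In degree \<open>d * e\<close> the
  terms \<open>i > d\<close> are too small because of \<open>g\<close>, and the terms
  \<open>i < d\<close> because \<open>f ^ i\<close> has index \<open>i * e < d * e\<close>; the last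
  inequality is where \<open>0 < e\<close> enters. All later comparisons of isogenies rest on this
  multiplicativity.\<close>

lemma dominates_pcompose:
  assumes f: "dominates \<rho> f e R" and g: "dominates R g d M" and "\<rho> > 0" "0 < e"
  shows "dominates \<rho> (pcompose g f) (d * e) M"
proof -
  note gD = dominatesD[OF g]
  have R: "0 < R" using dominatesD(1)[OF f] .
  define T where "T n i = Polynomial.coeff g i * Polynomial.coeff (f ^ i) n" for n i
  have T: "v (T n i) * \<rho> ^ n = v (Polynomial.coeff g i) * (v (Polynomial.coeff (f ^ i) n) * \<rho> ^ n)" for n i
    unfolding T_def by (simp add: mult)
  note fi = dominatesD[OF dominates_power[OF f \<open>\<rho> > 0\<close>]]
  have T_le': "v (T n i) * \<rho> ^ n \<le> v (Polynomial.coeff g i) * R ^ i" for n i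
    unfolding T by (intro mult_left_mono fi) simp
  have T_le: "v (T n i) * \<rho> ^ n \<le> M" for n i
    using T_le'[of n i] gD(3)[of i] by linarith
  have T_less: "v (T n i) * \<rho> ^ n < M" if "i > d \<or> n > i * e" for n i
    using that
  proof
    assume "i > d"
    then show ?thesis using T_le'[of n i] gD(4)[of i] by linarith
  next
    assume n: "n > i * e"
    show ?thesis
    proof (cases "Polynomial.coeff g i = 0")
      case True
      then show ?thesis using gD(1) by (simp add: T_def)
    next
      case False
      then have "v (T n i) * \<rho> ^ n < v (Polynomial.coeff g i) * R ^ i"
        unfolding T by (intro mult_strict_left_mono fi n) simp
      then show ?thesis using gD(3)[of i] by linarith
    qed
  qed
  have le: "v (Polynomial.coeff (pcompose g f) n) * \<rho> ^ n \<le> M" for n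
  proof -
    have "v (\<Sum>i\<le>Polynomial.degree g. T n i) \<le> M / \<rho> ^ n"
      using T_le \<open>\<rho> > 0\<close> gD(1) by (intro sum_le) (auto simp: field_simps)
    then show ?thesis using \<open>\<rho> > 0\<close> by (simp add: coeff_pcompose_sum T_def field_simps)
  qed
  have less: "v (Polynomial.coeff (pcompose g f) n) * \<rho> ^ n < M" if "n > d * e" for n
  proof -
    have "i > d \<or> n > i * e" for i
      using that by (meson leI le_less_trans mult_le_mono1)
    then have "v (\<Sum>i\<le>Polynomial.degree g. T n i) < M / \<rho> ^ n"
      using T_less \<open>\<rho> > 0\<close> gD(1) by (intro sum_less) (auto simp: field_simps)
    then show ?thesis using \<open>\<rho> > 0\<close> by (simp add: coeff_pcompose_sum T_def field_simps)
  qed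
  have Td: "v (T (d * e) d) * \<rho> ^ (d * e) = M"
    unfolding T fi(2) by (rule gD)
  have "v (\<Sum>i\<le>Polynomial.degree g. T (d * e) i) = v (T (d * e) d)"
  proof (rule sum_dominant)
    fix i assume "i \<noteq> d"
    then have "i > d \<or> d * e > i * e" using \<open>0 < e\<close> by auto
    from T_less[OF this] show "v (T (d * e) i) < v (T (d * e) d)"
      using \<open>\<rho> > 0\<close> unfolding Td[symmetric] by simp
  next
    show "T (d * e) d \<noteq> 0" using Td gD(1) by auto
  next
    show "d \<in> {..Polynomial.degree g}" using dominates_le_degree[OF g] by simp
  qed auto
  then have "v (Polynomial.coeff (pcompose g f) (d * e)) * \<rho> ^ (d * e) = M"
    using Td by (simp add: coeff_pcompose_sum T_def)
  then show ?thesis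
    unfolding dominates_def using le less gD(1) by auto
qed

end

subsection \<open>Isogenies and graded sizes at one place\<close>

definition graded_size :: "nat \<Rightarrow> nat \<Rightarrow> (nat \<Rightarrow> real) \<Rightarrow> real" where
  "graded_size q r G = Max ((\<lambda>i. G i powr (1 / (real q ^ i - 1))) ` {1..r})"

lemma real_power_minus_one: "2 \<le> q \<Longrightarrow> real q ^ i - 1 = real (q ^ i - 1)"
  by (simp add: of_nat_diff)

lemma powr_inverse_power:
  assumes "0 \<le> x" "0 < n"
  shows "(x powr (1 / real n)) ^ n = x"
proof (cases "x = 0")
  case False
  have "(x powr (1 / real n)) ^ n = x powr (real n * (1 / real n))"
    by (rule powr_power) (use False in simp)
  also have "real n * (1 / real n) = 1" using assms by simp
  finally show ?thesis using assms by simp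
qed (use assms in simp)

lemma power_powr_inverse:
  assumes "0 < x" "0 < n"
  shows "(x ^ n) powr (1 / real n) = x"
proof -
  have "(x ^ n) powr (1 / real n) = x powr (real n * (1 / real n))"
    unfolding powr_realpow[OF assms(1), symmetric] by (rule powr_powr)
  also have "real n * (1 / real n) = 1" using assms by simp
  finally show ?thesis using assms by simp
qed

lemma graded_size_le:
  assumes q: "2 \<le> q" and "1 \<le> r" and "0 < \<rho>" "0 < c" "\<And>i. 0 \<le> G i"
    and le: "\<And>i. i \<in> {1..r} \<Longrightarrow> G i * \<rho> ^ (q ^ i) \<le> c * \<rho>"
  shows "graded_size q r (\<lambda>i. G i / c) \<le> 1 / \<rho>"
  unfolding graded_size_def
proof (intro Max.boundedI)
  fix a assume "a \<in> (\<lambda>i. (G i / c) powr (1 / (real q ^ i - 1))) ` {1..r}"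
  then obtain i where i: "i \<in> {1..r}" and a: "a = (G i / c) powr (1 / (real q ^ i - 1))" by auto
  have qi: "2 \<le> q ^ i" using q i self_le_power[of q i] by auto
  then have "\<rho> ^ (q ^ i) = \<rho> * \<rho> ^ (q ^ i - 1)" by (metis power_eq_if not_numeral_le_zero)
  with le[OF i] have "G i / c \<le> (1 / \<rho>) ^ (q ^ i - 1)"
    using \<open>0 < \<rho>\<close> \<open>0 < c\<close> by (simp add: field_simps power_divide)
  then have "a \<le> ((1 / \<rho>) ^ (q ^ i - 1)) powr (1 / (real q ^ i - 1))"
    unfolding a real_power_minus_one[OF q] using assms(3-5) by (intro powr_mono2) auto
  also have "\<dots> = 1 / \<rho>" unfolding real_power_minus_one[OF q]
    by (rule power_powr_inverse) (use qi \<open>0 < \<rho>\<close> in auto)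
  finally show "a \<le> 1 / \<rho>" .
qed (use \<open>1 \<le> r\<close> in auto)

lemma graded_size_pos:
  assumes "1 \<le> r" "G r > 0"
  shows "graded_size q r G > 0"
proof -
  have "0 < G r powr (1 / (real q ^ r - 1))" using assms by simp
  also have "\<dots> \<le> graded_size q r G"
    unfolding graded_size_def using assms by (intro Max_ge) auto
  finally show ?thesis .
qed

text \<open>With \<open>c\<close> the size of a linear coefficient, \<rho> is the largest radius at
  which no other term exceeds the linear one; that the maximum is attained means that some term ties
  there. It is applied with \<open>c = real q\<close>, the size of t at infinite places, and with
  \<open>c = 1\<close> where t is integral.\<close>

lemma graded_size_radius:
  assumes q: "2 \<le> q" and "1 \<le> r" and "0 < c" "\<And>i. 0 \<le> G i" "G r > 0"
    and \<rho>: "\<rho> = 1 / graded_size q r (\<lambda>i. G i / c)"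
  shows "\<rho> > 0" "\<And>i. i \<in> {1..r} \<Longrightarrow> G i * \<rho> ^ (q ^ i) \<le> c * \<rho>"
    "\<exists>i\<in>{1..r}. G i * \<rho> ^ (q ^ i) = c * \<rho>"
proof -
  define m where "m = graded_size q r (\<lambda>i. G i / c)"
  have "m > 0" unfolding m_def using assms by (intro graded_size_pos) auto
  then show \<rho>_pos: "\<rho> > 0" using \<rho> by (simp add: m_def)
  have qi: "2 \<le> q ^ i" if "i \<in> {1..r}" for i
    using q that self_le_power[of q i] by auto
  have \<rho>_pow: "\<rho> ^ (q ^ i) = \<rho> / m ^ (q ^ i - 1)" if "i \<in> {1..r}" for i
  proof -
    have "\<rho> ^ (q ^ i) = \<rho> * \<rho> ^ (q ^ i - 1)"
      using qi[OF that] by (metis power_eq_if not_numeral_le_zero)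
    then show ?thesis using \<rho> by (simp add: m_def power_divide)
  qed
  have powr: "((G i / c) powr (1 / (real q ^ i - 1))) ^ (q ^ i - 1) = G i / c" if "i \<in> {1..r}" for i
    unfolding real_power_minus_one[OF q]
    by (rule powr_inverse_power) (use qi[OF that] assms(3,4) in auto)
  show "G i * \<rho> ^ (q ^ i) \<le> c * \<rho>" if "i \<in> {1..r}" for i
  proof -
    have "(G i / c) powr (1 / (real q ^ i - 1)) \<le> m"
      unfolding m_def graded_size_def using that by (intro Max_ge) auto
    then have "G i / c \<le> m ^ (q ^ i - 1)"
      using powr[OF that] by (metis power_mono powr_ge_zero)
    then show ?thesis unfolding \<rho>_pow[OF that]
      using \<open>m > 0\<close> \<open>c > 0\<close> \<rho>_pos by (simp add: field_simps mult_left_mono)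
  qed
  have "m \<in> (\<lambda>i. (G i / c) powr (1 / (real q ^ i - 1))) ` {1..r}"
    unfolding m_def graded_size_def using \<open>1 \<le> r\<close> by (intro Max_in) auto
  then obtain i where i: "i \<in> {1..r}" "m = (G i / c) powr (1 / (real q ^ i - 1))" by auto
  then have "G i / c = m ^ (q ^ i - 1)" using powr by simp
  then have "G i * \<rho> ^ (q ^ i) = c * \<rho>"
    unfolding \<rho>_pow[OF i(1)] using \<open>m > 0\<close> \<open>c > 0\<close> by (simp add: field_simps)
  then show "\<exists>i\<in>{1..r}. G i * \<rho> ^ (q ^ i) = c * \<rho>" using i by blast
qed

text \<open>Phrased through coefficients, which are what \<open>dominates\<close> inspects.\<close>

definition tau_poly :: "nat \<Rightarrow> nat \<Rightarrow> 'a::field \<Rightarrow> (nat \<Rightarrow> 'a) \<Rightarrow> 'a poly \<Rightarrow> bool" where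
  "tau_poly q r t g P \<longleftrightarrow> Polynomial.coeff P 1 = t \<and> (\<forall>i\<in>{1..r}. Polynomial.coeff P (q ^ i) = g i) \<and>
     (\<forall>n. n \<noteq> 1 \<and> n \<notin> (\<lambda>i. q ^ i) ` {1..r} \<longrightarrow> Polynomial.coeff P n = 0)"

lemma one_less_q_power: "2 \<le> q \<Longrightarrow> i \<in> {1..r} \<Longrightarrow> 1 < q ^ i" for q :: nat
  by (rule one_less_power) auto

context nonarch_abs
begin

lemma tau_poly_coeff_0: "tau_poly q r t g P \<Longrightarrow> 2 \<le> q \<Longrightarrow> Polynomial.coeff P 0 = 0"
  unfolding tau_poly_def by (metis imageE not_one_le_zero one_less_q_power zero_neq_one not_less_zero)

lemma tau_poly_bound:
  assumes "tau_poly q r t g P" "v t * \<rho> \<le> B" "\<And>i. i \<in> {1..r} \<Longrightarrow> v (g i) * \<rho> ^ (q ^ i) \<le> B" "0 \<le> B"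
  shows "v (Polynomial.coeff P n) * \<rho> ^ n \<le> B"
proof -
  consider "n = 1" | i where "n = q ^ i" "i \<in> {1..r}" | "Polynomial.coeff P n = 0"
    using assms(1) unfolding tau_poly_def by blast
  then show ?thesis
  proof cases
    case 2
    then show ?thesis using assms(1) assms(3)[of i] unfolding tau_poly_def by simp
  qed (use assms in \<open>auto simp: tau_poly_def\<close>)
qed

text \<open>The radius \<open>\<rho> = 1/m\<close> is preserved by \<open>P\<close> in Gauss norm:
  the linear term does not exceed it because \<open>v t \<le> 1\<close>, and another term attains
  it. If \<open>f\<close> takes \<rho> to \<open>R\<close>, the commutation forces \<open>P'\<close>
  to preserve \<open>R\<close>, so that \<open>v (g' i) * R ^ (q ^ i) \<le> R\<close> and the size
  of \<open>P'\<close> is at most \<open>1/R\<close>. The linear term of \<open>f\<close> at radius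
  \<rho> is at most \<open>R\<close>, which gives the factor \<open>v (coeff f 1)\<close>.\<close>

lemma graded_size_isogeny_le:
  assumes q: "2 \<le> q" and r: "1 \<le> r" and P: "tau_poly q r t g P" and P': "tau_poly q r t g' P'"
    and g: "g r \<noteq> 0" and f: "f \<noteq> 0" "Polynomial.coeff f 0 = 0"
    and comm: "pcompose f P = pcompose P' f" and t: "v t \<le> 1"
  shows "graded_size q r (\<lambda>i. v (g' i)) * v (Polynomial.coeff f 1) \<le> graded_size q r (\<lambda>i. v (g i))"
proof -
  define m where "m = graded_size q r (\<lambda>i. v (g i))"
  define \<rho> where "\<rho> = 1 / m"
  have \<rho>: "\<rho> = 1 / graded_size q r (\<lambda>i. v (g i) / 1)" by (simp add: \<rho>_def m_def)
  have "v (g r) > 0" using g by simp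
  note rad = graded_size_radius[where G = "\<lambda>i. v (g i)", OF q r zero_less_one nonneg this \<rho>]
  have \<rho>_pos: "0 < \<rho>" and rad_le: "\<And>i. i \<in> {1..r} \<Longrightarrow> v (g i) * \<rho> ^ (q ^ i) \<le> \<rho>"
    and rad_ex: "\<exists>i\<in>{1..r}. v (g i) * \<rho> ^ (q ^ i) = \<rho>"
    using rad unfolding mult_1_left by blast+
  have "P \<noteq> 0" using P g r unfolding tau_poly_def by auto
  then obtain d M where dP: "dominates \<rho> P d M" using dominates_exists \<rho>_pos by blast
  have "M \<le> \<rho>" unfolding dominatesD(2)[OF dP, symmetric]
    using \<rho>_pos t rad_le by (intro tau_poly_bound[OF P]) (auto simp: mult_left_le_one_le)
  moreover obtain i where "i \<in> {1..r}" "v (g i) * \<rho> ^ (q ^ i) = \<rho>" using rad_ex by blast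
  then have "\<rho> \<le> M" using dominatesD(3)[OF dP, of "q ^ i"] P unfolding tau_poly_def by simp
  ultimately have [simp]: "M = \<rho>" by simp
  obtain e R where df: "dominates \<rho> f e R" using dominates_exists \<rho>_pos f by blast
  have fP: "dominates \<rho> (pcompose f P) (e * d) R"
    using dominates_pcompose[OF dP] df \<rho>_pos dominates_index_pos[OF dP tau_poly_coeff_0[OF P q]] by simp
  have R: "0 < R" using dominatesD(1)[OF df] .
  have "P' \<noteq> 0"
  proof
    assume "P' = 0"
    then have "pcompose f P = 0" using comm by simp
    then show False using dominatesD(1,2)[OF fP] by simp
  qed
  then obtain d' M' where dP': "dominates R P' d' M'" using dominates_exists R by blast
  have "M' = R"
    using dominates_unique[OF dominates_pcompose[OF df dP' \<rho>_pos dominates_index_pos[OF df f(2)]]] fP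
    unfolding comm by simp
  then have le: "v (g' i) * R ^ (q ^ i) \<le> 1 * R" if "i \<in> {1..r}" for i
    using dominatesD(3)[OF dP', of "q ^ i"] P' that unfolding tau_poly_def by simp
  have "graded_size q r (\<lambda>i. v (g' i) / 1) \<le> 1 / R"
    by (rule graded_size_le[OF q r R zero_less_one _ le]) auto
  then have "graded_size q r (\<lambda>i. v (g' i)) * v (Polynomial.coeff f 1) \<le> 1 / R * v (Polynomial.coeff f 1)"
    by (intro mult_right_mono) auto
  also have "\<dots> \<le> 1 / R * (R / \<rho>)"
    using dominatesD(3)[OF df, of 1] R \<rho>_pos by (intro mult_left_mono) (auto simp: field_simps)
  also have "\<dots> = m" using R by (simp add: \<rho>_def)
  finally show ?thesis unfolding m_def .
qed

lemma dominates_tau_poly_small: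
  assumes q: "2 \<le> q" and P: "tau_poly q r t g P" and "t \<noteq> 0" and "0 < \<rho>" "\<rho> < \<sigma>"
    and le: "\<And>i. i \<in> {1..r} \<Longrightarrow> v (g i) * \<sigma> ^ (q ^ i) \<le> v t * \<sigma>"
  shows "dominates \<rho> P 1 (v t * \<rho>)"
proof -
  have tp: "0 < v t * \<rho>" using assms by simp
  have *: "v (g i) * \<rho> ^ (q ^ i) < v t * \<rho>" if i: "i \<in> {1..r}" for i
  proof -
    have "v (g i) * \<rho> ^ (q ^ i) = v (g i) * \<sigma> ^ (q ^ i) * (\<rho> / \<sigma>) ^ (q ^ i)"
      using assms by (simp add: power_divide)
    also have "\<dots> \<le> v t * \<sigma> * (\<rho> / \<sigma>) ^ (q ^ i)"
      using assms le[OF i] by (intro mult_right_mono) auto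
    also have "\<dots> < v t * \<sigma> * (\<rho> / \<sigma>) ^ 1"
      using assms one_less_q_power[OF q i]
      by (intro mult_strict_left_mono power_strict_decreasing) auto
    finally show ?thesis using assms by simp
  qed
  have "v (Polynomial.coeff P n) * \<rho> ^ n < v t * \<rho>" if "n \<noteq> 1" for n
    using * that P tp unfolding tau_poly_def
    by (cases "n \<in> (\<lambda>i. q ^ i) ` {1..r}") auto
  moreover have "Polynomial.coeff P 1 = t" using P unfolding tau_poly_def by simp
  ultimately show ?thesis unfolding dominates_def using tp
    by (metis less_irrefl less_eq_real_def power_one_right)
qed

text \<open>Indices multiply, so an inner factor of a composition of index 1 has index 1
  itself.\<close>

lemma index_factor_one:
  assumes "dominates \<rho> (pcompose h f) 1 M" "0 < \<rho>" "f \<noteq> 0" "Polynomial.coeff f 0 = 0"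
  shows "dominates \<rho> f 1 (v (Polynomial.coeff f 1) * \<rho>)"
proof -
  obtain e R where df: "dominates \<rho> f e R" using dominates_exists assms by blast
  have "h \<noteq> 0" using dominatesD(1,2)[OF assms(1)] by auto
  then obtain d N where dh: "dominates R h d N" using dominates_exists dominatesD(1)[OF df] by blast
  have "d * e = 1"
    using dominates_unique(1)[OF dominates_pcompose[OF df dh] assms(1)] assms(2)
      dominates_index_pos[OF df assms(4)] by simp
  then have "e = 1" by simp
  then show ?thesis using df dominatesD(2)[OF df] by simp
qed

text \<open>Otherwise \<open>f\<close> would have index 1 on the disc of radius
  \<open>\<sigma>'/c\<close>, \<open>c\<close> being the size of its linear coefficient, and take it
  to radius \<open>\<sigma>'\<close>; then \<open>f \<circ> P\<close> would have index 1 there. But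
  \<open>P'\<close> has index above 1 at radius \<open>\<sigma>'\<close>, where a higher term ties
  with the linear one. The last hypothesis is applied with
  \<open>h \<circ> f = \<phi>\<^sub>N\<close> and \<open>n\<close> the size of
  \<open>N\<close>.\<close>

lemma radius_isogeny_le:
  assumes q: "2 \<le> q" and P: "tau_poly q r t g P" and P': "tau_poly q r t g' P'"
    and t: "1 < v t" and f: "f \<noteq> 0" "Polynomial.coeff f 0 = 0" "Polynomial.coeff f 1 \<noteq> 0"
    and comm: "pcompose f P = pcompose P' f"
    and "0 < \<sigma>" "0 < \<sigma>'"
    and le: "\<And>i. i \<in> {1..r} \<Longrightarrow> v (g i) * \<sigma> ^ (q ^ i) \<le> v t * \<sigma>"
    and ex': "\<exists>i\<in>{1..r}. v (g' i) * \<sigma>' ^ (q ^ i) = v t * \<sigma>'"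
    and "1 \<le> n" and N: "\<And>\<rho>. 0 < \<rho> \<Longrightarrow> \<rho> * n < v t * \<sigma> \<Longrightarrow> dominates \<rho> (pcompose h f) 1 (n * \<rho>)"
  shows "v (Polynomial.coeff f 1) * \<sigma> \<le> n * \<sigma>'"
proof (rule ccontr)
  define c where "c = v (Polynomial.coeff f 1)"
  assume "\<not> ?thesis"
  then have lt: "n * \<sigma>' < c * \<sigma>" unfolding c_def by simp
  have "c > 0" using f unfolding c_def by simp
  define \<rho> where "\<rho> = \<sigma>' / c"
  have \<rho>: "0 < \<rho>" "\<rho> * n < \<sigma>" using lt \<open>c > 0\<close> \<open>0 < \<sigma>'\<close> unfolding \<rho>_def by (auto simp: field_simps)
  have "\<rho> \<le> \<rho> * n" using \<rho>(1) \<open>1 \<le> n\<close> by simp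
  with \<rho> have "\<rho> < \<sigma>" by linarith
  have "t \<noteq> 0" using t by auto
  \<comment> \<open>\<open>f\<close> needs index 1 on two discs, of radius \<rho> for
    \<open>P' \<circ> f\<close> and of radius \<open>v t * \<rho>\<close> for
    \<open>f \<circ> P\<close>. The larger disc is the reason for the bound
    \<open>v t * \<sigma>\<close>, and not \<sigma>, in the hypothesis on \<open>h\<close>.\<close>
  have tn: "v t * \<rho> * n < v t * \<sigma>" 
    using mult_strict_left_mono[OF \<rho>(2), of "v t"] t by (simp only: mult.assoc)
  have "\<rho> * n \<le> v t * (\<rho> * n)" using \<rho>(1) \<open>1 \<le> n\<close> t by simp
  then have rn: "\<rho> * n < v t * \<sigma>" using tn by linarith
  have f\<rho>: "dominates \<rho> f 1 \<sigma>'"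
    using index_factor_one[OF N[OF \<rho>(1) rn] \<rho>(1) f(1,2)] \<open>c > 0\<close> by (simp add: \<rho>_def c_def)
  have t\<rho>: "0 < v t * \<rho>" using \<rho> \<open>t \<noteq> 0\<close> by simp
  have ft\<rho>: "dominates (v t * \<rho>) f 1 (v (Polynomial.coeff f 1) * (v t * \<rho>))"
    using index_factor_one[OF N[OF t\<rho> tn] t\<rho> f(1,2)] .
  have dP: "dominates \<rho> P 1 (v t * \<rho>)"
    using dominates_tau_poly_small[OF q P \<open>t \<noteq> 0\<close> \<rho>(1) \<open>\<rho> < \<sigma>\<close> le] .
  have fP: "dominates \<rho> (pcompose f P) (1 * 1) (v (Polynomial.coeff f 1) * (v t * \<rho>))"
    using dominates_pcompose[OF dP ft\<rho> \<rho>(1)] by simp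
  obtain i where i: "i \<in> {1..r}" "v (g' i) * \<sigma>' ^ (q ^ i) = v t * \<sigma>'" using ex' by blast
  have "P' \<noteq> 0" using i \<open>t \<noteq> 0\<close> \<open>0 < \<sigma>'\<close> P' unfolding tau_poly_def by auto
  then obtain d M where dP': "dominates \<sigma>' P' d M" using dominates_exists \<open>0 < \<sigma>'\<close> by blast
  have "d = 1"
    using dominates_unique(1)[OF dominates_pcompose[OF f\<rho> dP' \<rho>(1)]] fP unfolding comm by simp
  then have "v (Polynomial.coeff P' (q ^ i)) * \<sigma>' ^ (q ^ i) < M"
    using dominatesD(4)[OF dP', of "q ^ i"] one_less_q_power[OF q i(1)] by simp
  moreover have "M = v t * \<sigma>'"
    using dominatesD(2)[OF dP'] P' \<open>d = 1\<close> unfolding tau_poly_def by simp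
  ultimately show False using i P' unfolding tau_poly_def by simp
qed

text \<open>Horner's scheme. The last application of \<open>P\<close> needs an input radius below
  \<sigma>, so the output radius may go up to \<open>v t * \<sigma>\<close>. A constant has size at
  most 1 and cannot disturb a linear coefficient of size at least \<open>v t > 1\<close>.\<close>

lemma dominates_module_action:
  fixes \<Phi> :: "'k::field poly \<Rightarrow> 'a poly"
  assumes q: "2 \<le> q" and P: "tau_poly q r t g P" and t: "1 < v t"
    and le: "\<And>i. i \<in> {1..r} \<Longrightarrow> v (g i) * \<sigma> ^ (q ^ i) \<le> v t * \<sigma>"
    and \<Phi>0: "\<Phi> 0 = 0" and \<Phi>: "\<And>c N. \<Phi> (pCons c N) = [:0, \<epsilon> c:] + pcompose P (\<Phi> N)"
    and \<epsilon>: "\<And>c. c \<noteq> 0 \<Longrightarrow> v (\<epsilon> c) = 1" "\<epsilon> 0 = 0"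
    and "N \<noteq> 0" "0 < \<rho>" "\<rho> * v t ^ Polynomial.degree N < v t * \<sigma>"
  shows "dominates \<rho> (\<Phi> N) 1 (v t ^ Polynomial.degree N * \<rho>)"
  using \<open>N \<noteq> 0\<close> \<open>\<rho> * v t ^ Polynomial.degree N < v t * \<sigma>\<close>
proof (induction N)
  case (pCons c N)
  have P0: "pcompose P 0 = 0"
    using tau_poly_coeff_0[OF P q] by (simp add: pcompose_0' )
  show ?case
  proof (cases "N = 0")
    case True
    then have "c \<noteq> 0" using pCons by simp
    have "\<Phi> (pCons c N) = [:0, \<epsilon> c:]" using \<Phi>[of c N] True \<Phi>0 P0 by simp
    then show ?thesis using \<epsilon>(1)[OF \<open>c \<noteq> 0\<close>] True \<open>0 < \<rho>\<close>
      unfolding dominates_def by (auto simp: coeff_pCons split: nat.split)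
  next
    case False
    define n where "n = v t ^ Polynomial.degree N"
    have "n \<ge> 1" unfolding n_def using t by simp
    have "v t * (\<rho> * n) < v t * \<sigma>" using pCons.prems(2) False by (simp add: n_def mult_ac)
    then have lt: "n * \<rho> < \<sigma>" 
      using t mult_less_cancel_left_pos[of "v t" "\<rho> * n" \<sigma>] by (simp only: mult.commute)
    have "\<rho> * n \<le> v t * (\<rho> * n)" using \<open>0 < \<rho>\<close> \<open>1 \<le> n\<close> t by simp
    then have "\<rho> * n < v t * \<sigma>" using \<open>v t * (\<rho> * n) < v t * \<sigma>\<close> by linarith
    then have dN: "dominates \<rho> (\<Phi> N) 1 (n * \<rho>)" using pCons.IH False unfolding n_def by blast
    have n\<rho>: "0 < n * \<rho>" using \<open>0 < \<rho>\<close> \<open>1 \<le> n\<close> by simp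
    have dP: "dominates (n * \<rho>) P 1 (v t * (n * \<rho>))"
      using t by (intro dominates_tau_poly_small[OF q P _ n\<rho> lt le]) auto
    have comp: "dominates \<rho> (pcompose P (\<Phi> N)) 1 (v t * n * \<rho>)"
      using dominates_pcompose[OF dN dP \<open>0 < \<rho>\<close>] by (simp add: mult.assoc)
    have "v (\<epsilon> c) \<le> 1" using \<epsilon> by (cases "c = 0") auto
    moreover have "v t * 1 \<le> v t * n" using \<open>1 \<le> n\<close> by (intro mult_left_mono) auto
    ultimately have small: "v (\<epsilon> c) < v t * n" using t by linarith
    have c1: "v (Polynomial.coeff (pcompose P (\<Phi> N)) 1) = v t * n"
      using dominatesD(2)[OF comp] \<open>0 < \<rho>\<close> by simp
    have 1: "v (Polynomial.coeff (\<Phi> (pCons c N)) 1) = v t * n"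
      using add_dominant(1)[of "\<epsilon> c" "Polynomial.coeff (pcompose P (\<Phi> N)) 1"] small c1
      by (simp add: \<Phi> coeff_pCons)
    have other: "Polynomial.coeff (\<Phi> (pCons c N)) i = Polynomial.coeff (pcompose P (\<Phi> N)) i" if "i \<noteq> 1" for i
      using that by (auto simp: \<Phi> coeff_pCons split: nat.split)
    have le: "v (Polynomial.coeff (\<Phi> (pCons c N)) i) * \<rho> ^ i \<le> v t * n * \<rho>" for i
    proof (cases "i = 1")
      case True
      show ?thesis unfolding True 1 by simp
    next
      case False
      show ?thesis unfolding other[OF False] by (rule dominatesD(3)[OF comp])
    qed
    have less: "v (Polynomial.coeff (\<Phi> (pCons c N)) i) * \<rho> ^ i < v t * n * \<rho>" if "i > 1" for i
      using dominatesD(4)[OF comp that] other[of i] that by simp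
    have deg: "v t ^ Polynomial.degree (pCons c N) * \<rho> = v t * n * \<rho>"
      using False by (simp add: n_def)
    show ?thesis
      unfolding dominates_def deg
    proof (intro conjI allI impI)
      show "0 < v t * n * \<rho>" by (rule dominatesD(1)[OF comp])
      show "v (Polynomial.coeff (\<Phi> (pCons c N)) 1) * \<rho> ^ 1 = v t * n * \<rho>" unfolding 1 by simp
    qed (fact le less)+
  qed
qed simp

end

subsection \<open>Degrees of isogenies of rank two modules\<close>

text \<open>For \<open>P = \<phi>\<^sub>t\<close> the n-th iterate is the action of
  \<open>t ^ n\<close>; iterating a bare polynomial keeps the local estimates free of Drinfeld
  modules.\<close>

primrec iterate_poly :: "'a::comm_semiring_1 poly \<Rightarrow> nat \<Rightarrow> 'a poly" where
  "iterate_poly P 0 = [:0, 1:]"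
| "iterate_poly P (Suc n) = pcompose P (iterate_poly P n)"

lemma iterate_poly_add:
  "iterate_poly P (m + n) = pcompose (iterate_poly P m) (iterate_poly P n)"
  for P :: "'a::comm_ring_1 poly"
  by (induction m) (simp_all add: pcompose_assoc pcompose_pCons)

lemma iterate_poly_commute:
  fixes f P P' :: "'a::comm_ring_1 poly"
  assumes "pcompose f P = pcompose P' f"
  shows "pcompose f (iterate_poly P n) = pcompose (iterate_poly P' n) f"
proof (induction n)
  case 0
  show ?case by (simp add: pcompose_pCons)
next
  case (Suc n)
  have "pcompose f (iterate_poly P (Suc n)) = pcompose (pcompose f P) (iterate_poly P n)"
    by (simp add: pcompose_assoc)
  also have "\<dots> = pcompose P' (pcompose f (iterate_poly P n))"
    unfolding assms by (rule pcompose_assoc[symmetric])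
  also have "\<dots> = pcompose (iterate_poly P' (Suc n)) f"
    unfolding Suc by (simp add: pcompose_assoc)
  finally show ?case .
qed

text \<open>A convex function lies below its chord on [0,1]; this starts the induction in
  \<open>index_growth\<close>.\<close>

lemma powr_le_linear:
  fixes q x :: real
  assumes "1 \<le> q" "0 \<le> x" "x \<le> 1"
  shows "q powr x \<le> 1 + (q - 1) * x"
  using Youngs_inequality_0[of x "1 - x" q 1] assms by (simp add: algebra_simps)

context nonarch_abs
begin

lemma dominates_iterate_small:
  assumes "2 \<le> q" "tau_poly q r t g P" "1 < v t"
    and le: "\<And>i. i \<in> {1..r} \<Longrightarrow> v (g i) * \<sigma> ^ (q ^ i) \<le> v t * \<sigma>"
    and "0 < \<rho>" "\<rho> * v t ^ n < v t * \<sigma>"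
  shows "dominates \<rho> (iterate_poly P n) 1 (v t ^ n * \<rho>)"
  using assms(6)
proof (induction n)
  case 0
  then show ?case unfolding dominates_def using \<open>0 < \<rho>\<close>
    by (auto simp: coeff_pCons split: nat.split)
next
  case (Suc n)
  have p: "0 < v t ^ n * \<rho>" using assms(3,5) by (intro mult_pos_pos zero_less_power) linarith+
  have "v t * (v t ^ n * \<rho>) < v t * \<sigma>" using Suc.prems by (simp add: mult_ac)
  then have lt: "v t ^ n * \<rho> < \<sigma>"
    using mult_less_cancel_left_pos[of "v t"] assms(3) by (simp only:)
  have "1 * (v t ^ n * \<rho>) \<le> v t * (v t ^ n * \<rho>)" using p assms(3) by (intro mult_right_mono) linarith+
  then have "\<rho> * v t ^ n < v t * \<sigma>" using \<open>v t * (v t ^ n * \<rho>) < _\<close> by (simp add: mult_ac)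
  note IH = Suc.IH[OF this]
  have "t \<noteq> 0" using assms(3) by auto
  from dominates_pcompose[OF IH dominates_tau_poly_small[OF assms(1,2) this p lt le] \<open>0 < \<rho>\<close>]
  show ?case by (simp add: mult_ac)
qed

lemma dominates_small_radius:
  assumes "Polynomial.coeff f 0 = 0" "Polynomial.coeff f 1 \<noteq> 0"
  obtains \<epsilon> where "0 < \<epsilon>" "\<And>\<rho>. 0 < \<rho> \<Longrightarrow> \<rho> < \<epsilon> \<Longrightarrow> dominates \<rho> f 1 (v (Polynomial.coeff f 1) * \<rho>)"
proof -
  define B where "B = Max (v ` Polynomial.coeff f ` {..Polynomial.degree f})"
  define c where "c = v (Polynomial.coeff f 1)"
  have c: "0 < c" using assms unfolding c_def by simp
  have B: "v (Polynomial.coeff f i) \<le> B" if "i \<le> Polynomial.degree f" for i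
    unfolding B_def using that by (intro Max_ge) auto
  have "1 \<le> Polynomial.degree f" using assms(2) by (rule le_degree)
  then have "c \<le> B" using B[of 1] by (simp add: c_def)
  show ?thesis
  proof (rule that[of "c / B"])
    show "0 < c / B" using c \<open>c \<le> B\<close> by simp
    fix \<rho> assume \<rho>: "0 < \<rho>" "\<rho> < c / B"
    then have \<rho>B: "\<rho> * B < c" using c \<open>c \<le> B\<close> by (simp add: field_simps)
    have "c / B \<le> 1" using c \<open>c \<le> B\<close> by simp
    then have "\<rho> \<le> 1" using \<rho> by linarith
    have lt: "v (Polynomial.coeff f i) * \<rho> ^ i < c * \<rho>" if "i \<noteq> 1" for i
    proof (cases "i = 0 \<or> i > Polynomial.degree f")
      case True
      then have "Polynomial.coeff f i = 0" using assms(1) by (auto simp: coeff_eq_0)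
      then show ?thesis using c \<rho> by simp
    next
      case False
      then have "2 \<le> i" using that by auto
      have "v (Polynomial.coeff f i) * \<rho> ^ i \<le> B * \<rho> ^ 2"
        using False B[of i] \<rho> \<open>2 \<le> i\<close> c \<open>c \<le> B\<close> \<open>\<rho> \<le> 1\<close>
        by (intro mult_mono power_decreasing) auto
      also have "\<dots> = \<rho> * B * \<rho>" by (simp add: power2_eq_square)
      also have "\<dots> < c * \<rho>" using \<rho>B \<rho> by (intro mult_strict_right_mono)
      finally show ?thesis .
    qed
    have "v (Polynomial.coeff f i) * \<rho> ^ i \<le> c * \<rho>" for i
      using lt[of i] by (cases "i = 1") (auto simp: c_def)
    then show "dominates \<rho> f 1 (v (Polynomial.coeff f 1) * \<rho>)"
      unfolding dominates_def using c \<rho> lt by (simp add: c_def)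
  qed
qed

lemma tau_poly_index:
  assumes "dominates \<rho> P d M" "tau_poly q r t g P"
  obtains "d = 1" "M = v t * \<rho>" | i where "i \<in> {1..r}" "d = q ^ i" "M = v (g i) * \<rho> ^ (q ^ i)"
proof -
  have "Polynomial.coeff P d \<noteq> 0" using dominatesD(1,2)[OF assms(1)] by auto
  then consider "d = 1" | i where "i \<in> {1..r}" "d = q ^ i"
    using assms(2) unfolding tau_poly_def by blast
  then show ?thesis
    using that dominatesD(2)[OF assms(1)] assms(2) unfolding tau_poly_def by cases auto
qed

text \<open>Write \<open>R = \<sigma> * Y\<close> with \<open>Y \<ge> 1\<close>. The term that ties
  with the linear one at \<sigma> is at least as large from there on, which gives an index of at
  least \<open>q\<close> and the growth of the radius. If the \<open>g 1\<close> term ties, the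
  \<open>g 2\<close> term catches up with it once
  \<open>v (g 1) ^ (q + 1) / v (g 2) \<le> q ^ q * Y ^ (q * (q - 1))\<close>; taking logarithms and
  dividing by \<open>q\<close> gives the threshold for \<open>J\<close>.\<close>

lemma index_growth_step:
  assumes q: "2 \<le> q" and P: "tau_poly q 2 t g P" and t: "v t = real q"
    and \<sigma>: "0 < \<sigma>" and le: "\<And>i. i \<in> {1..2} \<Longrightarrow> v (g i) * \<sigma> ^ (q ^ i) \<le> v t * \<sigma>"
    and ex: "\<exists>i\<in>{1..2}. v (g i) * \<sigma> ^ (q ^ i) = v t * \<sigma>"
    and J: "1 \<le> J" "log (real q) (v (g 1) ^ (q + 1) / v (g 2)) \<le> real q * J" and g2: "g 2 \<noteq> 0"
    and R: "\<sigma> \<le> R" and dom: "dominates R P d R'"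
  shows "q \<le> d" "real q * \<sigma> * (R / \<sigma>) ^ q \<le> R'"
    "J \<le> 1 + (real q - 1) * log (real q) (R / \<sigma>) \<Longrightarrow> q ^ 2 \<le> d"
proof -
  define Y where "Y = R / \<sigma>"
  have Y: "1 \<le> Y" "R = \<sigma> * Y" using R \<sigma> by (simp_all add: Y_def field_simps)
  have "0 < R" using R \<sigma> by linarith
  obtain i where i: "i \<in> {1..2}" and gi: "v (g i) * \<sigma> ^ (q ^ i) = real q * \<sigma>" using ex t by auto
  have coeff: "Polynomial.coeff P (q ^ i) = g i" if "i \<in> {1..2}" for i
    using P that unfolding tau_poly_def by blast
  have giR: "v (g i) * R ^ (q ^ i) = real q * \<sigma> * Y ^ (q ^ i)"
    unfolding Y(2) using gi by (simp add: power_mult_distrib mult.assoc[symmetric])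
  have qi: "q \<le> q ^ i" using i q self_le_power[of q i] by auto
  have "real q * \<sigma> * Y ^ q \<le> real q * \<sigma> * Y ^ (q ^ i)"
    using Y(1) \<sigma> qi by (intro mult_left_mono power_increasing) auto
  also have "\<dots> \<le> R'" using dominatesD(3)[OF dom, of "q ^ i"] coeff[OF i] giR by simp
  finally show growth: "real q * \<sigma> * (R / \<sigma>) ^ q \<le> R'" unfolding Y_def .
  have d_cases: "d = 1 \<or> d = q \<or> d = q ^ 2"
  proof (rule tau_poly_index[OF dom P])
    fix i :: nat assume "i \<in> {1..2}" "d = q ^ i"
    then have "i = 1 \<or> i = 2" by auto
    then show ?thesis using \<open>d = q ^ i\<close> by auto
  qed simp
  have "d \<noteq> 1"
  proof
    assume "d = 1"
    then have M: "R' = real q * R" using dominatesD(2)[OF dom] P t unfolding tau_poly_def by simp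
    have "v (g i) * R ^ (q ^ i) < R'"
      using dominatesD(4)[OF dom, of "q ^ i"] coeff[OF i] one_less_q_power[OF q i] \<open>d = 1\<close> by simp
    moreover have "real q * \<sigma> * Y ^ 1 \<le> real q * \<sigma> * Y ^ (q ^ i)"
      using Y(1) \<sigma> qi q by (intro mult_left_mono power_increasing) auto
    then have "real q * R \<le> v (g i) * R ^ (q ^ i)" unfolding giR using Y(2) by (simp add: mult.assoc)
    ultimately show False unfolding M by linarith
  qed
  have qq: "q \<le> q ^ 2" by (rule self_le_power) (use q in auto)
  then show "q \<le> d" using \<open>d \<noteq> 1\<close> d_cases by auto
  assume "J \<le> 1 + (real q - 1) * log (real q) (R / \<sigma>)"
  then have JY: "real q * J \<le> real q * (1 + (real q - 1) * log (real q) Y)"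
    unfolding Y_def by (intro mult_left_mono) auto
  define G1 where "G1 = v (g 1)"
  define G2 where "G2 = v (g 2)"
  have G2: "0 < G2" and G1: "0 \<le> G1" using g2 by (simp_all add: G2_def G1_def)
  have le1: "G1 * \<sigma> ^ q \<le> real q * \<sigma>" and le2: "G2 * \<sigma> ^ (q ^ 2) \<le> real q * \<sigma>"
    using le[of 1] le[of 2] t by (simp_all add: G1_def G2_def)
  have eq12: "G1 * \<sigma> ^ q = real q * \<sigma> \<or> G2 * \<sigma> ^ (q ^ 2) = real q * \<sigma>"
  proof -
    have "i = 1 \<or> i = 2" using i by auto
    then show ?thesis using gi unfolding G1_def G2_def by auto
  qed
  have "real q * R \<le> G2 * R ^ (q ^ 2) \<and> G1 * R ^ q \<le> G2 * R ^ (q ^ 2)"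
    using eq12
  proof
    \<comment> \<open>Here the \<open>g 2\<close> term ties at \<sigma> already, and the threshold
      does not enter.\<close>
    assume e2: "G2 * \<sigma> ^ (q ^ 2) = real q * \<sigma>"
    have e: "G2 * R ^ (q ^ 2) = real q * \<sigma> * Y ^ (q ^ 2)"
      unfolding Y(2) using e2 by (simp add: power_mult_distrib mult.assoc[symmetric])
    have "real q * \<sigma> * Y ^ 1 \<le> real q * \<sigma> * Y ^ (q ^ 2)"
      using Y(1) \<sigma> q by (intro mult_left_mono power_increasing) auto
    moreover have "G1 * R ^ q \<le> real q * \<sigma> * Y ^ q"
      unfolding Y(2) using le1 Y(1)
      by (simp add: power_mult_distrib mult.assoc[symmetric] mult_right_mono)
    moreover have "real q * \<sigma> * Y ^ q \<le> real q * \<sigma> * Y ^ (q ^ 2)"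
      using Y(1) \<sigma> qq by (intro mult_left_mono power_increasing) auto
    moreover have "real q * R = real q * \<sigma> * Y ^ 1" using Y(2) by simp
    ultimately show ?thesis unfolding e by linarith
  next
    assume e1: "G1 * \<sigma> ^ q = real q * \<sigma>"
    then have "0 < G1" using G1 \<sigma> q by (cases "G1 = 0") auto
    have q1: "1 < real q" using q by simp
    have "log (real q) (G1 ^ (q + 1) / G2) \<le> log (real q) (real q ^ q * Y ^ (q * (q - 1)))"
    proof -
      have "log (real q) (real q ^ q * Y ^ (q * (q - 1))) = real q + real (q * (q - 1)) * log (real q) Y"
        using q1 Y(1) by (simp add: log_mult log_nat_power)
      also have "\<dots> = real q * (1 + (real q - 1) * log (real q) Y)"
        using q by (simp add: of_nat_diff algebra_simps)
      finally show ?thesis using J(2) JY unfolding G1_def G2_def by linarith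
    qed
    then have "G1 ^ (q + 1) / G2 \<le> real q ^ q * Y ^ (q * (q - 1))"
      using q1 \<open>0 < G1\<close> G2 Y(1) by (subst (asm) log_le_cancel_iff) auto
    then have "G1 * G1 ^ q \<le> G2 * (real q ^ q * Y ^ (q * (q - 1)))"
      using G2 by (simp add: field_simps)
    \<comment> \<open>The factor \<open>\<sigma> ^ (q ^ 2)\<close> allows the tie
      \<open>G1 * \<sigma> ^ q = q * \<sigma>\<close> to absorb \<open>G1 ^ q\<close>.\<close>
    then have "G1 * G1 ^ q * (\<sigma> ^ q) ^ q \<le> G2 * (real q ^ q * Y ^ (q * (q - 1))) * (\<sigma> ^ q) ^ q"
      using \<sigma> by (intro mult_right_mono) auto
    also have "G1 * G1 ^ q * (\<sigma> ^ q) ^ q = G1 * (real q * \<sigma>) ^ q"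
      unfolding e1[symmetric] by (simp add: power_mult_distrib)
    finally have "real q ^ q * (G1 * \<sigma> ^ q) \<le> real q ^ q * (G2 * Y ^ (q * (q - 1)) * \<sigma> ^ (q ^ 2))"
      by (simp add: power_mult_distrib power_mult[symmetric] power2_eq_square mult_ac)
    then have *: "G1 * \<sigma> ^ q \<le> G2 * Y ^ (q * (q - 1)) * \<sigma> ^ (q ^ 2)"
      using q1 by (subst (asm) mult_le_cancel_left_pos) auto
    have "G1 * R ^ q = G1 * \<sigma> ^ q * Y ^ q" unfolding Y(2) by (simp add: power_mult_distrib)
    also have "\<dots> \<le> G2 * Y ^ (q * (q - 1)) * \<sigma> ^ (q ^ 2) * Y ^ q"
      using * Y(1) by (intro mult_right_mono) auto
    also have "\<dots> = G2 * (\<sigma> ^ (q ^ 2) * Y ^ (q * (q - 1) + q))" by (simp add: power_add mult_ac)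
    also have "q * (q - 1) + q = q ^ 2" using q by (simp add: power2_eq_square algebra_simps)
    finally have A: "G1 * R ^ q \<le> G2 * R ^ (q ^ 2)" unfolding Y(2) by (simp add: power_mult_distrib)
    have "real q * \<sigma> * Y ^ 1 \<le> real q * \<sigma> * Y ^ q"
      using Y(1) \<sigma> q by (intro mult_left_mono power_increasing) auto
    also have "\<dots> = G1 * R ^ q" unfolding Y(2) e1[symmetric] by (simp add: power_mult_distrib)
    finally have "real q * R \<le> G1 * R ^ q" using Y(2) by (simp add: mult.assoc)
    then show ?thesis using A by linarith
  qed
  then have big: "real q * R \<le> v (Polynomial.coeff P (q ^ 2)) * R ^ (q ^ 2)"
    "v (g 1) * R ^ q \<le> v (Polynomial.coeff P (q ^ 2)) * R ^ (q ^ 2)"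
    using coeff[of 2] by (simp_all add: G1_def G2_def)
  show "q ^ 2 \<le> d"
  proof (rule ccontr)
    assume "\<not> q ^ 2 \<le> d"
    then have "v (Polynomial.coeff P (q ^ 2)) * R ^ (q ^ 2) < R'" "d = q"
      using dominatesD(4)[OF dom, of "q ^ 2"] d_cases \<open>d \<noteq> 1\<close> by auto
    moreover have "R' = v (g 1) * R ^ q"
      using dominatesD(2)[OF dom] coeff[of 1] \<open>d = q\<close> by simp
    ultimately show False using big(2) by linarith
  qed
qed

text \<open>The quantity \<open>1 + (q - 1) * log (R / \<sigma>)\<close> is chosen so that each
  application of \<open>P\<close> multiplies it by at least \<open>q\<close>; it starts at
  \<open>q powr x\<close> or above. The index gains a factor of at least \<open>q\<close> at every
  step, and of \<open>q ^ 2\<close> once this quantity has reached \<open>J\<close>. The loss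
  suffered before that point is at most a factor \<open>J\<close>, whence the bound on
  \<open>real d * J\<close>.\<close>

lemma index_growth:
  assumes q: "2 \<le> q" and P: "tau_poly q 2 t g P" and t: "v t = real q"
    and \<sigma>: "0 < \<sigma>" and le: "\<And>i. i \<in> {1..2} \<Longrightarrow> v (g i) * \<sigma> ^ (q ^ i) \<le> v t * \<sigma>"
    and ex: "\<exists>i\<in>{1..2}. v (g i) * \<sigma> ^ (q ^ i) = v t * \<sigma>"
    and J: "1 \<le> J" "log (real q) (v (g 1) ^ (q + 1) / v (g 2)) \<le> real q * J" and g2: "g 2 \<noteq> 0"
    and x: "0 \<le> x" "x \<le> 1" and R0: "R0 = \<sigma> * real q powr x"
  shows "\<exists>d R. dominates R0 (iterate_poly P n) d R \<and> \<sigma> \<le> R \<and>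
    real q powr (real n + x) \<le> 1 + (real q - 1) * log (real q) (R / \<sigma>) \<and>
    real q powr (2 * (real n + x - 1)) \<le> real d * J \<and> real q ^ n \<le> real d"
proof (induction n)
  case 0
  have "1 \<le> real q powr x" using x q by (intro ge_one_powr_ge_zero) auto
  then have R0': "\<sigma> \<le> R0" unfolding R0 using \<sigma> by simp
  then have "dominates R0 [:0, 1:] 1 R0" using \<sigma>
    unfolding dominates_def by (auto simp: coeff_pCons split: nat.split)
  moreover have "real q powr x \<le> 1 + (real q - 1) * log (real q) (R0 / \<sigma>)"
    unfolding R0 using powr_le_linear[of "real q" x] x q \<sigma> by simp
  moreover have "real q powr (2 * (x - 1)) \<le> real q powr 0" using x q by (intro powr_mono) auto
  then have "real q powr (2 * (x - 1)) \<le> J" using J q by simp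
  ultimately show ?case using R0' by (intro exI[of _ "1::nat"] exI[of _ R0]) simp
next
  case (Suc n)
  have q1: "1 < real q" using q by simp
  then obtain d R where dR: "dominates R0 (iterate_poly P n) d R" "\<sigma> \<le> R"
    "real q powr (real n + x) \<le> 1 + (real q - 1) * log (real q) (R / \<sigma>)"
    "real q powr (2 * (real n + x - 1)) \<le> real d * J" "real q ^ n \<le> real d" using Suc by blast
  have "P \<noteq> 0" using P t q unfolding tau_poly_def by auto
  then obtain e R' where dom: "dominates R P e R'"
    using dominates_exists dR(2) \<sigma> by (metis less_le_trans)
  note step = index_growth_step[OF q P t \<sigma> le ex J g2 dR(2) dom]
  have R0_pos: "0 < R0" unfolding R0 using \<sigma> q1 by simp
  have "0 < real q ^ n" using q1 by (intro zero_less_power) linarith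
  then have "0 < real d" using dR(5) by linarith
  then have d_pos: "0 < d" by simp
  note comp = dominates_pcompose[OF dR(1) dom R0_pos d_pos]
  define Y where "Y = R / \<sigma>"
  have Y: "1 \<le> Y" using dR(2) \<sigma> by (simp add: Y_def)
  have R': "real q * Y ^ q \<le> R' / \<sigma>" using step(2) \<sigma> by (simp add: Y_def field_simps)
  have Yq: "1 \<le> Y ^ q" using Y by simp
  have "1 * 1 \<le> real q * Y ^ q" using q1 Yq by (intro mult_mono) auto
  then have "\<sigma> * 1 \<le> \<sigma> * (real q * Y ^ q)" using \<sigma> by (intro mult_left_mono) auto
  moreover have "\<sigma> * (real q * Y ^ q) \<le> R'" using R' \<sigma> by (simp add: field_simps)
  ultimately have R'1: "\<sigma> \<le> R'" by linarith
  have "1 + real q * log (real q) Y = log (real q) (real q * Y ^ q)"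
    using q1 Y by (simp add: log_mult log_nat_power)
  also have "\<dots> \<le> log (real q) (R' / \<sigma>)"
    using R' q1 Y \<sigma> R'1 by (subst log_le_cancel_iff) auto
  finally have "1 + (real q - 1) * (1 + real q * log (real q) Y) \<le> 1 + (real q - 1) * log (real q) (R' / \<sigma>)"
    using q1 by (intro add_left_mono mult_left_mono) auto
  moreover have "1 + (real q - 1) * (1 + real q * log (real q) Y) = real q * (1 + (real q - 1) * log (real q) Y)"
    by (simp add: algebra_simps)
  moreover have "real q powr (real (Suc n) + x) = real q * real q powr (real n + x)"
    using q1 by (simp add: powr_add)
  moreover have "real q * real q powr (real n + x) \<le> real q * (1 + (real q - 1) * log (real q) Y)"
    using dR(3) unfolding Y_def by (intro mult_left_mono) auto
  ultimately have w: "real q powr (real (Suc n) + x) \<le> 1 + (real q - 1) * log (real q) (R' / \<sigma>)" by linarith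
  have "real q * real q ^ n \<le> real e * real d" using step(1) dR(5) by (intro mult_mono) auto
  then have deg: "real q ^ Suc n \<le> real (e * d)" by simp
  have "real q powr (2 * (real (Suc n) + x - 1)) \<le> real (e * d) * J"
  \<comment> \<open>Past the threshold the index gains \<open>q ^ 2\<close>. Before it,
    \<open>J\<close> exceeds \<open>q powr (n + x)\<close> and makes up for the missing factors, as
    the index is at least \<open>q ^ Suc n\<close>.\<close>
  proof (cases "J \<le> real q powr (real n + x)")
    case True
    then have "q ^ 2 \<le> e" using step(3) dR(3) by linarith
    have "real q powr (2 * (real (Suc n) + x - 1)) = real q powr (real 2 + 2 * (real n + x - 1))"
      by (simp add: algebra_simps)
    also have "\<dots> = real q ^ 2 * real q powr (2 * (real n + x - 1))"
      using q1 by (simp only: powr_add powr_realpow)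
    also have "\<dots> \<le> real (q ^ 2) * (real d * J)" using dR(4) by (simp add: mult_left_mono)
    also have "\<dots> \<le> real e * (real d * J)" using \<open>q ^ 2 \<le> e\<close> J by (intro mult_right_mono) (auto simp del: of_nat_power)
    finally show ?thesis by simp
  next
    case False
    have "real q powr (2 * (real (Suc n) + x - 1)) = real q powr (real n + x) * real q powr (real n + x)"
      by (simp add: powr_add[symmetric])
    also have "\<dots> \<le> real q powr (real n + x) * J" using False by (intro mult_left_mono) auto
    also have "real q powr (real n + x) \<le> real q powr (real (Suc n))" using x q1 by (intro powr_mono) auto
    also have "\<dots> = real q ^ Suc n" using q1 by (simp only: powr_realpow)
    finally show ?thesis using deg J
      by (smt (verit, best) mult_right_mono)
  qed
  then show ?case using comp R'1 w deg
    by (intro exI[of _ "e * d"] exI[of _ R']) (simp only: iterate_poly.simps simp_thms)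
qed

text \<open>On a disc where the \<open>m\<close>-th iterate of \<open>P\<close> is injective, \<open>f\<close> composed with it has at most
  \<open>deg f\<close> zeros, while the \<open>m\<close>-th iterate of \<open>P'\<close> composed with \<open>f\<close> has at least as many as that
  iterate has on the image disc, a number bounded below by the preceding lemma.\<close>

lemma degree_isogeny_bound:
  assumes q: "2 \<le> q" and P: "tau_poly q 2 t g P" and P': "tau_poly q 2 t g' P'" and t: "v t = real q"
    and f: "Polynomial.coeff f 0 = 0" "Polynomial.coeff f 1 \<noteq> 0"
    and comm: "pcompose f P = pcompose P' f"
    and \<sigma>: "0 < \<sigma>" and le: "\<And>i. i \<in> {1..2} \<Longrightarrow> v (g i) * \<sigma> ^ (q ^ i) \<le> v t * \<sigma>"
    and \<sigma>': "0 < \<sigma>'" and le': "\<And>i. i \<in> {1..2} \<Longrightarrow> v (g' i) * \<sigma>' ^ (q ^ i) \<le> v t * \<sigma>'"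
    and ex': "\<exists>i\<in>{1..2}. v (g' i) * \<sigma>' ^ (q ^ i) = v t * \<sigma>'"
    and J: "1 \<le> J" "log (real q) (v (g' 1) ^ (q + 1) / v (g' 2)) \<le> real q * J" and g2: "g' 2 \<noteq> 0"
  shows "(v (Polynomial.coeff f 1) * \<sigma> / \<sigma>') ^ 2 \<le> real (Polynomial.degree f) * J"
proof -
  define c where "c = v (Polynomial.coeff f 1)"
  define x where "x = c * \<sigma> / \<sigma>'"
  have c: "0 < c" using f unfolding c_def by simp
  have q1: "1 < real q" using q by simp
  have vt: "1 < v t" using t q1 by simp
  have D: "1 \<le> Polynomial.degree f" using f(2) by (rule le_degree)
  have DJ: "1 \<le> real (Polynomial.degree f) * J"
    using mult_mono[of 1 "real (Polynomial.degree f)" 1 J] D J(1) by simp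
  have x0: "0 \<le> x" using c \<sigma> \<sigma>' unfolding x_def by simp
  \<comment> \<open>A \<open>y\<close> strictly below \<open>x\<close> leaves room for a disc on
    which the iterates of \<open>P\<close> still have index 1; the bound for \<open>x\<close>
    follows by letting \<open>y\<close> tend to \<open>x\<close>.\<close>
  have bound: "y ^ 2 \<le> real (Polynomial.degree f) * J" if y: "1 < y" "y < x" for y
  proof -
    \<comment> \<open>This writes \<open>y = q powr (m + z - 1)\<close> with
      \<open>m \<ge> 1\<close> and \<open>0 \<le> z < 1\<close>. The exponent \<open>z\<close> fixes
      a starting radius \<open>R0\<close> between \<open>\<sigma>'\<close> and
      \<open>q * \<sigma>'\<close>, as \<open>index_growth\<close> requires, and \<open>m\<close> is
      the number of iterates applied from there.\<close>
    define s where "s = log (real q) y"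
    define m where "m = nat \<lfloor>s\<rfloor> + 1"
    define z where "z = s + 1 - real m"
    have "0 < s" using y q1 unfolding s_def by simp
    then have z: "0 \<le> z" "z < 1" unfolding z_def m_def by linarith+
    have ys: "y = real q powr (real m + z - 1)" using y q1 unfolding z_def s_def by simp
    define R0 where "R0 = \<sigma>' * real q powr z"
    have R0: "0 < R0" using \<sigma>' q1 unfolding R0_def by simp
    have "real q powr z < real q powr 1" using z q1 by (intro powr_less_mono) auto
    then have R0_less: "R0 < real q * \<sigma>'" unfolding R0_def using \<sigma>' q1 by (simp add: mult.commute)
    obtain \<epsilon> where \<epsilon>: "0 < \<epsilon>" "\<And>\<rho>. 0 < \<rho> \<Longrightarrow> \<rho> < \<epsilon> \<Longrightarrow> dominates \<rho> f 1 (c * \<rho>)"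
      using dominates_small_radius[OF f] unfolding c_def by blast
    \<comment> \<open>\<open>n\<close> is so large that \<open>f\<close> has index 1 on the disc
      that it takes to radius \<open>R0 / q ^ n\<close>; \<open>n\<close> iterates of
      \<open>P'\<close> then expand this radius to \<open>R0\<close>, still with index 1.\<close>
    obtain n where n: "R0 / (c * \<epsilon>) < real q ^ n" using real_arch_pow[OF q1] by blast
    define \<rho> where "\<rho> = R0 / (c * real q ^ n)"
    have qn: "0 < real q ^ n" using q1 by (intro zero_less_power) linarith
    have \<rho>: "0 < \<rho>" "\<rho> < \<epsilon>" using R0 c \<epsilon>(1) n qn unfolding \<rho>_def by (auto simp: field_simps)
    have c\<rho>: "c * \<rho> = R0 / real q ^ n" using c unfolding \<rho>_def by simp
    have r0: "0 < R0 / real q ^ n" "R0 / real q ^ n * v t ^ n < v t * \<sigma>'" "v t ^ n * (R0 / real q ^ n) = R0"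
      using R0 R0_less qn t by auto
    have df: "dominates \<rho> f 1 (R0 / real q ^ n)" using \<epsilon>(2)[OF \<rho>] unfolding c\<rho> .
    have dn: "dominates (R0 / real q ^ n) (iterate_poly P' n) 1 R0"
      using dominates_iterate_small[OF q P' vt le' r0(1,2)] unfolding r0(3) .
    obtain d R where dm: "dominates R0 (iterate_poly P' m) d R"
      and dJ: "real q powr (2 * (real m + z - 1)) \<le> real d * J"
      using index_growth[OF q P' t \<sigma>' le' ex' J g2 z(1) less_imp_le[OF z(2)] R0_def, of m] by blast
    have dmn: "dominates (R0 / real q ^ n) (iterate_poly P' (m + n)) d R"
      using dominates_pcompose[OF dn dm r0(1)] unfolding iterate_poly_add by simp
    have total': "dominates \<rho> (pcompose (iterate_poly P' (m + n)) f) d R"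
      using dominates_pcompose[OF df dmn \<rho>(1)] by simp
    have "\<rho> * v t ^ (m + n) = \<sigma>' * y * real q / c"
    proof -
      have "\<rho> * v t ^ (m + n) = \<sigma>' * (real q powr z * real q ^ m) / c"
        unfolding \<rho>_def R0_def t using qn by (simp add: power_add)
      also have "real q powr z * real q ^ m = real q powr (z + real m)"
        using q1 by (simp add: powr_add powr_realpow)
      also have "z + real m = (real m + z - 1) + 1" by simp
      also have "real q powr ((real m + z - 1) + 1) = y * real q"
        unfolding ys using q1 by (subst powr_add) simp
      finally show ?thesis by (simp add: mult.assoc)
    qed
    \<comment> \<open>This is \<open>y < x = c * \<sigma> / \<sigma>'\<close> multiplied
      out.\<close>
    also have "\<dots> < v t * \<sigma>"
      using y(2) q1 c \<sigma>' unfolding x_def t by (simp add: field_simps)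
    finally have lt: "\<rho> * v t ^ (m + n) < v t * \<sigma>" .
    have dP: "dominates \<rho> (iterate_poly P (m + n)) 1 (v t ^ (m + n) * \<rho>)"
      using dominates_iterate_small[OF q P vt le \<rho>(1) lt] .
    have "f \<noteq> 0" using f(2) by auto
    then obtain e E where de: "dominates (v t ^ (m + n) * \<rho>) f e E"
      using dominates_exists dominatesD(1)[OF dP] by blast
    have "dominates \<rho> (pcompose f (iterate_poly P (m + n))) e E"
      using dominates_pcompose[OF dP de \<rho>(1)] by simp
    then have "d = e"
      using dominates_unique(1)[OF total'] unfolding iterate_poly_commute[OF comm] by simp
    then have "real d * J \<le> real (Polynomial.degree f) * J"
      using dominates_le_degree[OF de] J(1) by (intro mult_right_mono) auto
    moreover have "y ^ 2 = real q powr (2 * (real m + z - 1))"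
      unfolding ys by (simp add: power2_eq_square powr_add[symmetric] algebra_simps)
    ultimately show ?thesis using dJ by linarith
  qed
  have "x ^ 2 \<le> real (Polynomial.degree f) * J"
  proof (cases "x \<le> 1")
    case True
    then have "x ^ 2 \<le> 1" using x0 by (simp add: power_le_one)
    then show ?thesis using DJ by linarith
  next
    case False
    have "x \<le> sqrt (real (Polynomial.degree f) * J)"
    proof (rule dense_le_bounded[of 1])
      fix y assume "1 < y" "y < x"
      then show "y \<le> sqrt (real (Polynomial.degree f) * J)" using bound by (intro real_le_rsqrt)
    qed (use False in simp)
    then have "x ^ 2 \<le> (sqrt (real (Polynomial.degree f) * J)) ^ 2" using x0 by (rule power_mono)
    then show ?thesis using DJ by simp
  qed
  then show ?thesis unfolding x_def c_def .
qed

end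

subsection \<open>Valuation rings and extensions of absolute values\<close>

locale field_morphism =
  fixes h :: "'a::field \<Rightarrow> 'b::field"
  assumes add: "h (x + y) = h x + h y" and mult: "h (x * y) = h x * h y" and one [simp]: "h 1 = 1"
begin

lemma zero [simp]: "h 0 = 0"
proof -
  have "h 0 + h 0 = h 0 + 0" using add[of 0 0] by simp
  then show ?thesis by (subst (asm) add_left_cancel)
qed

lemma minus: "h (- x) = - h x"
  using add[of x "- x"] by (simp add: eq_neg_iff_add_eq_0 add.commute)

lemma diff: "h (x - y) = h x - h y"
  using add[of x "- y"] by (simp add: minus)

lemma eq_0_iff [simp]: "h x = 0 \<longleftrightarrow> x = 0"
proof
  assume "h x = 0"
  then have "x \<noteq> 0 \<Longrightarrow> h 1 = 0" using mult[of x "inverse x"] by simp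
  then show "x = 0" by auto
qed simp

lemma inj: "h x = h y \<longleftrightarrow> x = y"
  using eq_0_iff[of "x - y"] by (simp add: diff)

lemma inverse: "h (inverse x) = inverse (h x)"
proof (cases "x = 0")
  case False
  then have "h x * h (inverse x) = 1" using mult[of x "inverse x"] by simp
  then show ?thesis using False by (simp add: field_simps)
qed simp

lemma divide: "h (x / y) = h x / h y"
  by (simp add: divide_inverse mult inverse)

lemma power: "h (x ^ n) = h x ^ n"
  by (induction n) (simp_all add: mult)

lemma sum: "h (sum g I) = (\<Sum>i\<in>I. h (g i))"
  by (induction I rule: infinite_finite_induct) (simp_all add: add)

lemma coeff_map [simp]: "Polynomial.coeff (map_poly h p) n = h (Polynomial.coeff p n)"
  by (rule coeff_map_poly) simp

lemma degree_map [simp]: "Polynomial.degree (map_poly h p) = Polynomial.degree p"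
  by (rule degree_map_poly) simp

lemma map_poly_add: "map_poly h (p + r) = map_poly h p + map_poly h r"
  by (rule poly_eqI) (simp add: add)

lemma map_poly_mult: "map_poly h (p * r) = map_poly h p * map_poly h r"
  by (rule poly_eqI) (simp add: coeff_mult sum mult)

lemma map_poly_pcompose: "map_poly h (pcompose p r) = pcompose (map_poly h p) (map_poly h r)"
  by (induction p) (simp_all add: pcompose_pCons map_poly_pCons map_poly_add map_poly_mult)

end

lemma field_embedding_iff: "field_embedding h \<longleftrightarrow> field_morphism h"
  by (auto simp: field_embedding_def field_morphism_def ring_hom_def ring_of_type_algebra_def)

definition subring_of :: "'a::comm_ring_1 set \<Rightarrow> bool" where
  "subring_of R \<longleftrightarrow> 1 \<in> R \<and> (\<forall>x\<in>R. - x \<in> R) \<and> (\<forall>x\<in>R. \<forall>y\<in>R. x + y \<in> R \<and> x * y \<in> R)"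

definition valuation_subring :: "'a::field set \<Rightarrow> bool" where
  "valuation_subring R \<longleftrightarrow> subring_of R \<and> (\<forall>x. x \<in> R \<or> inverse x \<in> R)"

definition unit_of :: "'a::field set \<Rightarrow> 'a \<Rightarrow> bool" where
  "unit_of R u \<longleftrightarrow> u \<noteq> 0 \<and> u \<in> R \<and> inverse u \<in> R"

lemma subring_ofD:
  assumes "subring_of R"
  shows "1 \<in> R" "0 \<in> R" "x \<in> R \<Longrightarrow> - x \<in> R" "x \<in> R \<Longrightarrow> y \<in> R \<Longrightarrow> x + y \<in> R"
    "x \<in> R \<Longrightarrow> y \<in> R \<Longrightarrow> x * y \<in> R" "x \<in> R \<Longrightarrow> y \<in> R \<Longrightarrow> x - y \<in> R" "x \<in> R \<Longrightarrow> x ^ n \<in> R"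
proof -
  show 1: "1 \<in> R" "x \<in> R \<Longrightarrow> - x \<in> R" "x \<in> R \<Longrightarrow> y \<in> R \<Longrightarrow> x + y \<in> R"
    "x \<in> R \<Longrightarrow> y \<in> R \<Longrightarrow> x * y \<in> R" for x y
    using assms unfolding subring_of_def by auto
  show "0 \<in> R" using 1(1) 1(2)[of 1] 1(3)[of 1 "- 1"] by simp
  show "x \<in> R \<Longrightarrow> y \<in> R \<Longrightarrow> x - y \<in> R" using 1(2)[of y] 1(3)[of x "- y"] by simp
  show "x \<in> R \<Longrightarrow> x ^ n \<in> R" using 1 by (induction n) auto
qed

lemma subring_of_sum: "subring_of R \<Longrightarrow> (\<And>i. i \<in> I \<Longrightarrow> g i \<in> R) \<Longrightarrow> sum g I \<in> R"
  by (induction I rule: infinite_finite_induct) (auto intro: subring_ofD)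

definition adjoin :: "'a::comm_ring_1 set \<Rightarrow> 'a \<Rightarrow> 'a set" where
  "adjoin R x = {poly p x | p. \<forall>i. Polynomial.coeff p i \<in> R}"

lemma subring_of_adjoin:
  assumes "subring_of R"
  shows "subring_of (adjoin R x)"
  unfolding subring_of_def
proof (intro conjI ballI)
  note R = subring_ofD[OF assms]
  show "1 \<in> adjoin R x" unfolding adjoin_def
    by (intro CollectI exI[of _ "[:1:]"]) (auto simp: coeff_pCons R split: nat.split)
  fix a assume "a \<in> adjoin R x"
  then obtain p where p: "a = poly p x" "\<And>i. Polynomial.coeff p i \<in> R" unfolding adjoin_def by auto
  show "- a \<in> adjoin R x" unfolding adjoin_def
    by (intro CollectI exI[of _ "- p"]) (auto simp: p R)
  fix b assume "b \<in> adjoin R x"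
  then obtain r where r: "b = poly r x" "\<And>i. Polynomial.coeff r i \<in> R" unfolding adjoin_def by auto
  show "a + b \<in> adjoin R x" unfolding adjoin_def
    by (intro CollectI exI[of _ "p + r"]) (auto simp: p r R)
  show "a * b \<in> adjoin R x" unfolding adjoin_def
    by (intro CollectI exI[of _ "p * r"]) (auto simp: p r R coeff_mult intro!: subring_of_sum[OF assms])
qed

lemma adjoin_incl:
  assumes "subring_of R"
  shows "R \<subseteq> adjoin R x" "x \<in> adjoin R x"
proof
  note R = subring_ofD[OF assms]
  fix a assume "a \<in> R"
  then show "a \<in> adjoin R x" unfolding adjoin_def
    by (intro CollectI exI[of _ "[:a:]"]) (auto simp: coeff_pCons R split: nat.split)
next
  note R = subring_ofD[OF assms]
  show "x \<in> adjoin R x" unfolding adjoin_def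
    by (intro CollectI exI[of _ "[:0, 1:]"]) (auto simp: coeff_pCons R split: nat.split)
qed

text \<open>The step of Chevalley's extension argument: of two relations \<open>1 \<in> y R[x]\<close> and
  \<open>1 \<in> y R[1/x]\<close>, the shorter one lowers the degree of the longer one.\<close>

lemma shorten_relation:
  fixes x y :: "'a::field"
  assumes R: "subring_of R" and "x \<noteq> 0"
    and I: "I = (\<lambda>a. y * a) ` R" and "y \<in> R"
    and p: "\<And>i. Polynomial.coeff p i \<in> I" "poly p x = 1"
    and r: "\<And>i. Polynomial.coeff r i \<in> I" "poly r (inverse x) = 1"
    and deg: "0 < Polynomial.degree r" "Polynomial.degree r \<le> Polynomial.degree p"
  shows "\<exists>p'. (\<forall>i. Polynomial.coeff p' i \<in> I) \<and> poly p' x = 1 \<and> Polynomial.degree p' < Polynomial.degree p"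
proof -
  note RD = subring_ofD[OF R]
  have I_mult: "b * a \<in> I" if "a \<in> I" "b \<in> R" for a b
    using that RD(5) unfolding I by (auto simp: mult.left_commute)
  have I_add: "a + b \<in> I" if "a \<in> I" "b \<in> I" for a b
    using that RD(4) unfolding I by (auto simp: distrib_left[symmetric])
  have I_R: "I \<subseteq> R" using RD(5) \<open>y \<in> R\<close> unfolding I by auto
  have I_minus: "- a \<in> I" if "a \<in> I" for a using I_mult[OF that, of "- 1"] RD by simp
  have I_0: "0 \<in> I" using RD(2) unfolding I by force
  define n where "n = Polynomial.degree p"
  define m where "m = Polynomial.degree r"
  define b where "b = Polynomial.coeff r 0"
  define a where "a = Polynomial.coeff p n"
  \<comment> \<open>Reversing \<open>r\<close> turns \<open>poly r (inverse x) = 1\<close> into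
    \<open>poly Q x = x ^ m * (1 - b)\<close>, with the monomial of \<open>b\<close> moved to the
    other side. In \<open>(1 - b) * p\<close> the top term is replaced by
    \<open>a * x ^ (n - m) * Q\<close>, which has the same value at \<open>x\<close> but degree
    below \<open>n\<close>; adding \<open>b\<close> restores the value 1.\<close>
  define Q where "Q = reflect_poly r - Polynomial.monom b m"
  define p1 where "p1 = p - Polynomial.monom a n"
  define p' where "p' = Polynomial.smult (1 - b) p1 + [:b:] + Polynomial.smult a (Polynomial.monom 1 (n - m) * Q)"
  have ab: "a \<in> I" "b \<in> I" using p r by (auto simp: a_def b_def)
  have Q_I: "Polynomial.coeff Q i \<in> I" for i
  proof -
    have "Polynomial.coeff (reflect_poly r) i \<in> I" using r(1) I_0 by (simp add: coeff_reflect_poly)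
    moreover have "Polynomial.coeff (Polynomial.monom b m) i \<in> I" using ab I_0 by simp
    ultimately show ?thesis unfolding Q_def using I_add I_minus by (simp add: diff_conv_add_uminus del: add_uminus_conv_diff)
  qed
  have p1_I: "Polynomial.coeff p1 i \<in> I" for i
    unfolding p1_def using p(1)[of i] I_0 by (auto simp: a_def)
  have "1 - b \<in> R" using ab I_R RD by auto
  have "Polynomial.coeff (Polynomial.monom 1 (n - m) * Q) i \<in> I" for i
    using Q_I I_0 by (simp add: coeff_monom_mult)
  then have p'_I: "Polynomial.coeff p' i \<in> I" for i
    unfolding p'_def using ab I_0 p1_I I_R \<open>1 - b \<in> R\<close>
    by (auto simp: coeff_pCons split: nat.split intro!: I_add I_mult)
  have "poly Q x = x ^ m * (1 - b)"
    unfolding Q_def m_def using poly_reflect_poly_nz[OF \<open>x \<noteq> 0\<close>, of r] r(2)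
    by (simp add: poly_monom algebra_simps)
  then have "poly p' x = (1 - b) * (1 - a * x ^ n) + b + a * (x ^ (n - m) * x ^ m) * (1 - b)"
    unfolding p'_def p1_def using p(2) by (simp add: poly_monom mult_ac)
  also have "x ^ (n - m) * x ^ m = x ^ n" using deg unfolding n_def m_def by (simp add: power_add[symmetric])
  finally have "poly p' x = 1" by (simp add: algebra_simps)
  have "Polynomial.coeff p' i = 0" if "i \<ge> n" for i
  proof -
    have "Polynomial.coeff p1 i = 0" using that unfolding p1_def a_def
      by (cases "i = n") (auto simp: coeff_eq_0 n_def)
    moreover have "i \<noteq> 0" using that deg unfolding n_def m_def by auto
    moreover have "Polynomial.coeff Q (i - (n - m)) = 0"
    proof (cases "i = n")
      case True
      then have "i - (n - m) = m" using deg unfolding n_def m_def by simp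
      then show ?thesis unfolding Q_def b_def m_def by (simp add: coeff_reflect_poly)
    next
      case False
      then have "m < i - (n - m)" using that deg unfolding n_def m_def by simp
      then show ?thesis unfolding Q_def m_def by (simp add: coeff_reflect_poly)
    qed
    ultimately show ?thesis unfolding p'_def
      by (auto simp: coeff_pCons coeff_monom_mult split: nat.split)
  qed
  moreover have "0 < n" using deg unfolding n_def by simp
  ultimately have "Polynomial.degree p' < n" by (intro degree_lessI) auto
  then show ?thesis using p'_I \<open>poly p' x = 1\<close> unfolding n_def by auto
qed

text \<open>Zorn's lemma gives \<open>M\<close>, maximal among the rings that contain
  \<open>R0\<close> but not \<open>inverse y\<close>. The ideal \<open>y * M\<close> serves in place
  of a maximal ideal: if \<open>x \<notin> M\<close>, maximality puts \<open>inverse y\<close> into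
  \<open>M[x]\<close>, that is, \<open>1 \<in> y * M[x]\<close>. If
  \<open>inverse x \<notin> M\<close> as well, of two relations of least degree the longer one could
  be shortened.\<close>

lemma exists_valuation_subring:
  fixes y :: "'a::field"
  assumes R0: "subring_of R0" "y \<in> R0" "inverse y \<notin> R0"
  obtains R where "valuation_subring R" "R0 \<subseteq> R" "inverse y \<notin> R"
proof -
  define \<A> where "\<A> = {R. subring_of R \<and> R0 \<subseteq> R \<and> inverse y \<notin> R}"
  have "\<A> \<noteq> {}" using R0 unfolding \<A>_def by auto
  moreover have "\<Union>\<C> \<in> \<A>" if ne: "\<C> \<noteq> {}" and chain: "subset.chain \<A> \<C>" for \<C>
  proof -
    have sub: "\<And>C. C \<in> \<C> \<Longrightarrow> subring_of C \<and> R0 \<subseteq> C \<and> inverse y \<notin> C"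
      using chain unfolding subset.chain_def \<A>_def by auto
    have "subring_of (\<Union>\<C>)"
      unfolding subring_of_def
    proof (intro conjI ballI)
      show "1 \<in> \<Union>\<C>" using ne sub subring_ofD(1) by blast
      fix a assume a: "a \<in> \<Union>\<C>"
      then show "- a \<in> \<Union>\<C>" using sub subring_ofD(3) by blast
      fix b assume b: "b \<in> \<Union>\<C>"
      obtain C where "C \<in> \<C>" "a \<in> C" "b \<in> C"
        using a b chain unfolding subset.chain_def by blast
      then show "a + b \<in> \<Union>\<C>" "a * b \<in> \<Union>\<C>" using sub subring_ofD(4,5) by blast+
    qed
    then show ?thesis using sub ne unfolding \<A>_def by blast
  qed
  ultimately obtain M where M: "M \<in> \<A>" and max: "\<And>Z. Z \<in> \<A> \<Longrightarrow> M \<subseteq> Z \<Longrightarrow> Z = M"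
    using subset_Zorn_nonempty[of \<A>] by blast
  then have sM: "subring_of M" "R0 \<subseteq> M" "inverse y \<notin> M" unfolding \<A>_def by auto
  note MD = subring_ofD[OF sM(1)]
  have yM: "y \<in> M" "y \<noteq> 0" using sM R0 MD(2) by auto
  define I where "I = (\<lambda>a. y * a) ` M"
  define rel where "rel x p \<longleftrightarrow> (\<forall>i. Polynomial.coeff p i \<in> I) \<and> poly p x = 1" for x and p :: "'a poly"
  have ex_rel: "\<exists>p. rel x p" if "x \<notin> M" for x
  proof -
    have "inverse y \<in> adjoin M x"
    proof (rule ccontr)
      assume "inverse y \<notin> adjoin M x"
      then have "adjoin M x \<in> \<A>"
        unfolding \<A>_def using subring_of_adjoin[OF sM(1)] adjoin_incl(1)[OF sM(1)] sM(2) by blast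
      then have "adjoin M x = M" using max adjoin_incl(1)[OF sM(1)] by blast
      then show False using adjoin_incl(2)[OF sM(1), of x] that by simp
    qed
    then obtain p where "inverse y = poly p x" "\<And>i. Polynomial.coeff p i \<in> M" unfolding adjoin_def by auto
    then have "rel x (Polynomial.smult y p)" unfolding rel_def I_def using yM(2)
      by (metis coeff_smult imageI poly_smult right_inverse)
    then show ?thesis by blast
  qed
  have deg_pos: "0 < Polynomial.degree p" if "rel x p" for x p
  proof (rule ccontr)
    assume "\<not> ?thesis"
    then obtain c where "p = [:c:]" using degree_eq_zeroE[of p] by auto
    then have "1 \<in> I" using that unfolding rel_def by (metis coeff_pCons_0 mult_zero_right add_0_right poly_pCons poly_0)
    then obtain a where "a \<in> M" "1 = y * a" unfolding I_def by auto
    then have "inverse y = a" using yM(2) by (simp add: field_simps)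
    then show False using sM(3) \<open>a \<in> M\<close> by simp
  qed
  define P where "P x = arg_min Polynomial.degree (rel x)" for x
  have Pmin: "rel x (P x)" "\<And>p. rel x p \<Longrightarrow> Polynomial.degree (P x) \<le> Polynomial.degree p" if "x \<notin> M" for x
    using ex_rel[OF that] arg_min_nat_lemma[of "rel x" _ Polynomial.degree] unfolding P_def by auto
  have contra: False
    if x: "x \<notin> M" "inverse x \<notin> M" "Polynomial.degree (P (inverse x)) \<le> Polynomial.degree (P x)" for x
  proof -
    have "x \<noteq> 0" using x(1) MD(2) by auto
    have "\<exists>p'. rel x p' \<and> Polynomial.degree p' < Polynomial.degree (P x)"
      using shorten_relation[OF sM(1) \<open>x \<noteq> 0\<close> I_def yM(1), of "P x" "P (inverse x)"]
        Pmin(1)[OF x(1)] Pmin(1)[OF x(2)] deg_pos[OF Pmin(1)[OF x(2)]] x(3)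
      unfolding rel_def by blast
    then show False using Pmin(2)[OF x(1)] by (meson not_le)
  qed
  have "valuation_subring M"
    unfolding valuation_subring_def
  proof (intro conjI allI sM(1))
    fix x show "x \<in> M \<or> inverse x \<in> M"
      using contra[of x] contra[of "inverse x"] nat_le_linear by (metis inverse_inverse_eq)
  qed
  then show ?thesis using that sM by blast
qed

lemma valuation_subringD:
  assumes "valuation_subring R"
  shows "subring_of R" "x \<in> R \<or> inverse x \<in> R"
  using assms unfolding valuation_subring_def by auto

lemma unit_of_mult: "subring_of R \<Longrightarrow> unit_of R a \<Longrightarrow> unit_of R b \<Longrightarrow> unit_of R (a * b)"
  unfolding unit_of_def by (auto dest: subring_ofD(5))

lemma unit_of_inverse: "unit_of R a \<Longrightarrow> unit_of R (inverse a)"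
  unfolding unit_of_def by auto

lemma unit_of_one: "subring_of R \<Longrightarrow> unit_of R 1"
  unfolding unit_of_def by (auto dest: subring_ofD)

lemma unit_of_power: "subring_of R \<Longrightarrow> unit_of R a \<Longrightarrow> unit_of R (a ^ n)"
  by (induction n) (auto intro: unit_of_mult unit_of_one)

lemma valuation_subring_power_closed:
  assumes "valuation_subring R" "x ^ n \<in> R" "0 < n"
  shows "x \<in> R"
proof (rule ccontr)
  note R = subring_ofD[OF valuation_subringD(1)[OF assms(1)]]
  assume "x \<notin> R"
  then have "inverse x \<in> R" "x \<noteq> 0" using valuation_subringD(2)[OF assms(1)] R(2) by auto
  then have "x ^ n * inverse x ^ (n - 1) \<in> R" using R assms(2) by auto
  also have "x ^ n * inverse x ^ (n - 1) = x"
    using \<open>x \<noteq> 0\<close> \<open>0 < n\<close> by (cases n) (simp_all add: field_simps)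
  finally show False using \<open>x \<notin> R\<close> by simp
qed

text \<open>If \<open>x / y\<close> lies in \<open>R\<close>, then \<open>x + y\<close> is
  \<open>y\<close> times an element of \<open>R\<close>, and with it \<open>y\<close> would be a
  unit; of \<open>x / y\<close> and \<open>y / x\<close> one always lies in
  \<open>R\<close>.\<close>

lemma valuation_subring_nonunit_add:
  assumes R: "valuation_subring R" and x: "x \<in> R" "\<not> unit_of R x" and y: "y \<in> R" "\<not> unit_of R y"
  shows "x + y \<in> R \<and> \<not> unit_of R (x + y)"
proof -
  note RD = subring_ofD[OF valuation_subringD(1)[OF R]]
  have *: "\<not> unit_of R (a + b)" if "a \<in> R" "b \<in> R" "\<not> unit_of R b" "b \<noteq> 0" "a / b \<in> R" for a b
  proof
    assume "unit_of R (a + b)"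
    then have "(1 + a / b) * inverse (a + b) \<in> R" "a + b \<noteq> 0" unfolding unit_of_def using that RD by auto
    moreover have "(1 + a / b) * inverse (a + b) = inverse b"
      using \<open>b \<noteq> 0\<close> \<open>a + b \<noteq> 0\<close> by (simp add: field_simps)
    ultimately show False using that unfolding unit_of_def by auto
  qed
  show ?thesis
  proof (cases "x = 0 \<or> y = 0")
    case True
    then show ?thesis using x y by auto
  next
    case False
    then have "x / y \<in> R \<or> y / x \<in> R" using valuation_subringD(2)[OF R, of "x / y"] by simp
    then show ?thesis using *[of x y] *[of y x] x y False RD by (auto simp: add.commute)
  qed
qed

lemma valuation_subring_sum_nonunit:
  assumes "valuation_subring R" "\<And>i. i \<in> I \<Longrightarrow> g i \<in> R \<and> \<not> unit_of R (g i)"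
  shows "sum g I \<in> R \<and> \<not> unit_of R (sum g I)"
  using assms(2)
proof (induction I rule: infinite_finite_induct)
  case (insert x F)
  then show ?case using valuation_subring_nonunit_add[OF assms(1), of "g x" "sum g F"] by auto
qed (use subring_ofD(2)[OF valuation_subringD(1)[OF assms(1)]] in \<open>auto simp: unit_of_def\<close>)

text \<open>Some term \<open>c j\<close> divides all the others in \<open>R\<close>. If each of the
  others were a nonunit multiple of it, so would be their sum, which is
  \<open>- c j\<close>.\<close>

lemma valuation_subring_two_terms:
  fixes c :: "'i \<Rightarrow> 'a::field"
  assumes R: "valuation_subring R" and fin: "finite I" "I \<noteq> {}"
    and nz: "\<And>i. i \<in> I \<Longrightarrow> c i \<noteq> 0" and sum: "(\<Sum>i\<in>I. c i) = 0"
  shows "\<exists>i\<in>I. \<exists>j\<in>I. i \<noteq> j \<and> unit_of R (c i / c j)"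
proof (rule ccontr)
  assume neg: "\<not> ?thesis"
  note RD = subring_ofD[OF valuation_subringD(1)[OF R]]
  have "\<exists>j\<in>I. \<forall>i\<in>I. c i / c j \<in> R"
    using fin nz
  proof (induction rule: finite_ne_induct)
    case (singleton x)
    then show ?case using RD by simp
  next
    case (insert x F)
    then obtain j where j: "j \<in> F" "\<forall>i\<in>F. c i / c j \<in> R" by auto
    consider "c x / c j \<in> R" | "c j / c x \<in> R"
      using valuation_subringD(2)[OF R, of "c x / c j"] by auto
    then show ?case
    proof cases
      case 1
      then show ?thesis using j by auto
    next
      case 2
      have "c i / c x \<in> R" if "i \<in> F" for i
      proof -
        have "(c i / c j) * (c j / c x) \<in> R" using 2 j that RD by blast
        then show ?thesis using insert.prems j(1) by simp
      qed
      then show ?thesis using RD insert.prems by auto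
    qed
  qed
  then obtain j where j: "j \<in> I" "\<And>i. i \<in> I \<Longrightarrow> c i / c j \<in> R" by auto
  have "\<not> unit_of R (\<Sum>i\<in>I - {j}. c i / c j)"
    using valuation_subring_sum_nonunit[OF R, of "I - {j}" "\<lambda>i. c i / c j"] neg j by auto
  moreover have "(\<Sum>i\<in>I - {j}. c i / c j) = - 1"
  proof -
    have "c j + (\<Sum>i\<in>I - {j}. c i) = 0" using sum fin(1) j(1) by (simp add: sum.remove)
    then have "(\<Sum>i\<in>I - {j}. c i) = - c j" by (simp add: eq_neg_iff_add_eq_0 add.commute)
    then show ?thesis using nz[OF j(1)] by (simp add: sum_divide_distrib[symmetric])
  qed
  ultimately show False using RD unfolding unit_of_def by simp
qed

definition algebraic_via :: "('a::field \<Rightarrow> 'b::field) \<Rightarrow> 'b \<Rightarrow> bool" where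
  "algebraic_via h x \<longleftrightarrow> (\<exists>p. p \<noteq> 0 \<and> poly (map_poly h p) x = 0)"

text \<open>Two terms of equal value in an algebraic equation for \<open>x\<close> have as quotient
  a power of \<open>x\<close> times an element of the base field. Values of algebraic elements are
  therefore roots of values from below.\<close>

lemma (in field_morphism) valuation_subring_algebraic:
  assumes R: "valuation_subring R" and "algebraic_via h x" "x \<noteq> 0"
  shows "\<exists>m>0. \<exists>a. a \<noteq> 0 \<and> unit_of R (x ^ m / h a)"
proof -
  obtain p where p: "p \<noteq> 0" "poly (map_poly h p) x = 0" using assms(2) unfolding algebraic_via_def by auto
  define I where "I = {i. i \<le> Polynomial.degree p \<and> Polynomial.coeff p i \<noteq> 0}"
  define c where "c i = h (Polynomial.coeff p i) * x ^ i" for i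
  have "(\<Sum>i\<le>Polynomial.degree p. c i) = 0" using p(2) by (simp add: poly_altdef c_def)
  moreover have "(\<Sum>i\<le>Polynomial.degree p. c i) = (\<Sum>i\<in>I. c i)"
    unfolding I_def c_def by (rule sum.mono_neutral_right) auto
  ultimately have "(\<Sum>i\<in>I. c i) = 0" by simp
  moreover have "Polynomial.degree p \<in> I" using p(1) unfolding I_def by simp
  moreover have "finite I" "\<And>i. i \<in> I \<Longrightarrow> c i \<noteq> 0" using \<open>x \<noteq> 0\<close> unfolding I_def c_def by auto
  ultimately obtain i j where ij: "i \<in> I" "j \<in> I" "i \<noteq> j" "unit_of R (c i / c j)"
    using valuation_subring_two_terms[OF R, of I c] by blast
  have "unit_of R (c j / c i)" using unit_of_inverse[OF ij(4)] by simp
  then obtain k l where kl: "k \<in> I" "l \<in> I" "k < l" "unit_of R (c l / c k)"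
    using ij by (metis linorder_neqE_nat)
  have "c l / c k = x ^ (l - k) / h (Polynomial.coeff p k / Polynomial.coeff p l)"
    using kl \<open>x \<noteq> 0\<close> unfolding c_def I_def by (simp add: divide field_simps power_diff)
  moreover have "Polynomial.coeff p k / Polynomial.coeff p l \<noteq> 0" using kl unfolding I_def by simp
  ultimately show ?thesis using kl by (metis zero_less_diff)
qed

text \<open>The rational valuation belonging to \<open>R\<close>, normalized to 1 at \<pi>. It is a
  relation because existence and uniqueness of the value have to be derived from properties of
  \<open>R\<close> and \<pi>.\<close>

definition ord_relation :: "'a::field set \<Rightarrow> 'a \<Rightarrow> 'a \<Rightarrow> real \<Rightarrow> bool" where
  "ord_relation R \<pi> x r \<longleftrightarrow> (\<exists>m>0. \<exists>k u. unit_of R u \<and> x ^ m = u * \<pi> powi k \<and> r = of_int k / of_nat m)"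

context
  fixes R :: "'a::field set" and \<pi> :: 'a
  assumes R: "valuation_subring R" and \<pi>: "\<pi> \<in> R" "\<pi> \<noteq> 0" "inverse \<pi> \<notin> R"
begin

lemma subring_R: "subring_of R" and RD: "x \<in> R \<Longrightarrow> y \<in> R \<Longrightarrow> x * y \<in> R"
  using valuation_subringD(1)[OF R] subring_ofD(5) by auto

lemma powi_in_iff: "\<pi> powi k \<in> R \<longleftrightarrow> 0 \<le> k"
proof
  assume "\<pi> powi k \<in> R"
  show "0 \<le> k"
  proof (rule ccontr)
    assume "\<not> 0 \<le> k"
    define n where "n = nat (- k - 1)"
    have n: "k = - int (Suc n)" using \<open>\<not> 0 \<le> k\<close> unfolding n_def by simp
    have "\<pi> powi k * \<pi> ^ n \<in> R" by (intro RD \<open>\<pi> powi k \<in> R\<close> subring_ofD(7)[OF subring_R] \<pi>(1))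
    moreover have "\<pi> powi k = inverse (\<pi> ^ Suc n)"
      unfolding n by (simp only: power_int_minus power_int_of_nat)
    then have "\<pi> powi k * \<pi> ^ n = inverse \<pi>" using \<pi>(2) by simp
    ultimately show False using \<pi>(3) by simp
  qed
next
  assume "0 \<le> k"
  then obtain n where "k = int n" using nonneg_int_cases by blast
  then show "\<pi> powi k \<in> R" using \<pi>(1) subring_ofD(7)[OF subring_R] by simp
qed

lemma ord_relation_mult:
  assumes "ord_relation R \<pi> x r" "ord_relation R \<pi> y s"
  shows "ord_relation R \<pi> (x * y) (r + s)"
proof -
  obtain m k u where x: "m > 0" "unit_of R u" "x ^ m = u * \<pi> powi k" "r = of_int k / of_nat m"
    using assms(1) unfolding ord_relation_def by auto
  obtain n l w where y: "n > 0" "unit_of R w" "y ^ n = w * \<pi> powi l" "s = of_int l / of_nat n"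
    using assms(2) unfolding ord_relation_def by auto
  have "(x * y) ^ (m * n) = (x ^ m) ^ n * (y ^ n) ^ m"
    by (simp add: power_mult_distrib power_mult[symmetric] mult.commute)
  also have "\<dots> = (u ^ n * w ^ m) * (\<pi> powi (k * int n) * \<pi> powi (l * int m))"
    unfolding x y by (simp add: power_mult_distrib power_int_mult)
  also have "\<pi> powi (k * int n) * \<pi> powi (l * int m) = \<pi> powi (k * int n + l * int m)"
    using \<pi>(2) by (simp add: power_int_add)
  finally have "(x * y) ^ (m * n) = (u ^ n * w ^ m) * \<pi> powi (k * int n + l * int m)" .
  moreover have "unit_of R (u ^ n * w ^ m)" using x y subring_R by (intro unit_of_mult unit_of_power)
  moreover have "r + s = of_int (k * int n + l * int m) / of_nat (m * n)"
    using x y by (simp add: field_simps)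
  ultimately show ?thesis unfolding ord_relation_def using x(1) y(1) by (metis nat_0_less_mult_iff)
qed

lemma ord_relation_nonneg_iff:
  assumes "ord_relation R \<pi> x r"
  shows "x \<in> R \<longleftrightarrow> 0 \<le> r"
proof -
  obtain m k u where x: "m > 0" "unit_of R u" "x ^ m = u * \<pi> powi k" "r = of_int k / of_nat m"
    using assms(1) unfolding ord_relation_def by auto
  have "0 \<le> r \<longleftrightarrow> 0 \<le> k" using x by (simp add: zero_le_divide_iff)
  also have "\<dots> \<longleftrightarrow> \<pi> powi k \<in> R" by (simp add: powi_in_iff)
  also have "\<dots> \<longleftrightarrow> x ^ m \<in> R"
  proof
    assume "x ^ m \<in> R"
    then have "x ^ m * inverse u \<in> R" using x(2) RD unfolding unit_of_def by blast
    moreover have "x ^ m * inverse u = \<pi> powi k"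
      using x(2,3) unfolding unit_of_def by (simp add: field_simps)
    ultimately show "\<pi> powi k \<in> R" by simp
  qed (use x RD in \<open>auto simp: unit_of_def\<close>)
  also have "\<dots> \<longleftrightarrow> x \<in> R"
    using valuation_subring_power_closed[OF R _ x(1)] subring_ofD(7)[OF subring_R] by blast
  finally show ?thesis by simp
qed

lemma ord_relation_inverse:
  assumes "ord_relation R \<pi> x r"
  shows "ord_relation R \<pi> (inverse x) (- r)"
proof -
  obtain m k u where x: "m > 0" "unit_of R u" "x ^ m = u * \<pi> powi k" "r = of_int k / of_nat m"
    using assms(1) unfolding ord_relation_def by auto
  have "inverse x ^ m = inverse u * \<pi> powi (- k)"
    unfolding power_inverse x by (simp add: power_int_minus)
  moreover have "- r = of_int (- k) / of_nat m" using x by simp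
  ultimately show ?thesis using x unit_of_inverse unfolding ord_relation_def by blast
qed

lemma ord_relation_one_zero: "ord_relation R \<pi> 1 r \<Longrightarrow> r = 0"
  using ord_relation_nonneg_iff[of 1 r] ord_relation_nonneg_iff[OF ord_relation_inverse, of 1 r]
    subring_ofD(1)[OF subring_R] by auto

lemma ord_relation_unique:
  assumes "ord_relation R \<pi> x r" "ord_relation R \<pi> x s" "x \<noteq> 0"
  shows "r = s"
  using ord_relation_one_zero[of "r + - s"] ord_relation_mult[OF assms(1) ord_relation_inverse[OF assms(2)]] assms(3)
  by simp

text \<open>The ultrametric inequality is the closure of \<open>R\<close> under addition, applied to
  \<open>1 + y / x\<close> when \<open>y\<close> is not larger than \<open>x\<close>. The base
  \<theta> is left free so that the normalization of a given place can be matched.\<close>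

lemma exists_abs_of_valuation_subring:
  assumes ex: "\<And>x. x \<noteq> 0 \<Longrightarrow> \<exists>r. ord_relation R \<pi> x r" and \<theta>: "0 < \<theta>" "\<theta> < 1"
  shows "\<exists>w. nonarch_abs w \<and> (\<forall>x. w x \<le> 1 \<longleftrightarrow> x \<in> R) \<and>
    (\<forall>x r. x \<noteq> 0 \<longrightarrow> ord_relation R \<pi> x r \<longrightarrow> w x = \<theta> powr r)"
proof -
  define w where "w x = (if x = 0 then 0 else \<theta> powr (SOME r. ord_relation R \<pi> x r))" for x
  have w: "w x = \<theta> powr r" if "x \<noteq> 0" "ord_relation R \<pi> x r" for x r
  proof -
    have "ord_relation R \<pi> x (SOME r. ord_relation R \<pi> x r)" using someI_ex[OF ex[OF that(1)]] .
    then have "(SOME r. ord_relation R \<pi> x r) = r" using ord_relation_unique that by blast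
    then show ?thesis unfolding w_def using that by simp
  qed
  have w_le: "w x \<le> 1 \<longleftrightarrow> x \<in> R" for x
  proof (cases "x = 0")
    case True
    then show ?thesis using subring_ofD(2)[OF subring_R] by (simp add: w_def)
  next
    case False
    then obtain r where r: "ord_relation R \<pi> x r" using ex by blast
    have "w x \<le> 1 \<longleftrightarrow> \<theta> powr r \<le> \<theta> powr 0" using w[OF False r] \<theta> by simp
    also have "\<dots> \<longleftrightarrow> 0 \<le> r"
      using \<theta> powr_mono'[of 0 r \<theta>] powr_less_mono'[of \<theta> r 0] by (cases "0 \<le> r") auto
    finally show ?thesis using ord_relation_nonneg_iff[OF r] by simp
  qed
  have mult: "w (x * y) = w x * w y" for x y
  proof (cases "x = 0 \<or> y = 0")
    case False
    then obtain r s where r: "ord_relation R \<pi> x r" "ord_relation R \<pi> y s" using ex by blast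
    then show ?thesis using w[OF _ r(1)] w[OF _ r(2)] w[OF _ ord_relation_mult[OF r]] False
      by (simp add: powr_add)
  qed (auto simp: w_def)
  have nonneg: "0 \<le> w x" and eq0: "w x = 0 \<longleftrightarrow> x = 0" for x using \<theta> by (auto simp: w_def)
  have key: "w (x + y) \<le> w x" if "w y \<le> w x" "x \<noteq> 0" for x y
  proof -
    have "w (y / x) * w x = w y" using mult[of "y / x" x] that by simp
    moreover have "0 < w x" using nonneg[of x] eq0[of x] that(2) by linarith
    ultimately have "w (y / x) \<le> 1" using that(1) mult_le_cancel_right_pos[of "w x" "w (y / x)" 1] by simp
    then have "w (1 + y / x) \<le> 1" using w_le subring_ofD(1,4)[OF subring_R] by blast
    then have "w (1 + y / x) * w x \<le> 1 * w x" using nonneg by (intro mult_right_mono) auto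
    moreover have "(1 + y / x) * x = x + y" using that by (simp add: field_simps)
    ultimately show ?thesis using mult[of "1 + y / x" x] by simp
  qed
  have "w (x + y) \<le> max (w x) (w y)" for x y
  proof (cases "x = 0 \<or> y = 0")
    case False
    then show ?thesis using key[of x y] key[of y x] by (cases "w y \<le> w x") (auto simp: add.commute)
  qed auto
  then have "nonarch_abs w" using mult nonneg eq0 by unfold_locales
  then show ?thesis using w w_le by blast
qed

end

context nonarch_abs
begin

lemma le_0_iff [simp]: "v x \<le> 0 \<longleftrightarrow> x = 0"
  using nonneg[of x] eq_0_iff[of x] by linarith

lemma valuation_subring_unit_ball: "valuation_subring {x. v x \<le> 1}"
  unfolding valuation_subring_def subring_of_def
proof (intro conjI ballI allI)
  fix x y assume "x \<in> {x. v x \<le> 1}" "y \<in> {x. v x \<le> 1}"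
  then show "x + y \<in> {x. v x \<le> 1}" "x * y \<in> {x. v x \<le> 1}"
    by (auto intro: ultra_bound simp: mult mult_le_one)
next
  fix x show "x \<in> {x. v x \<le> 1} \<or> inverse x \<in> {x. v x \<le> 1}"
    by (cases "x = 0") (auto simp: inverse inverse_le_1_iff)
qed auto

lemma unit_of_unit_ball: "unit_of {x. v x \<le> 1} u \<longleftrightarrow> v u = 1"
  unfolding unit_of_def
  by (cases "u = 0") (auto simp: inverse inverse_le_1_iff intro: order_antisym)

lemma power_int: "v (x powi k) = v x powi k"
  by (cases k rule: int_cases4) (simp_all add: power_int_minus inverse power)

lemma algebraic_value:
  assumes "field_morphism h" "algebraic_via h x" "x \<noteq> 0"
  shows "\<exists>m>0. \<exists>a. a \<noteq> 0 \<and> v x ^ m = v (h a)"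
proof -
  interpret h: field_morphism h by fact
  obtain m a where ma: "m > 0" "a \<noteq> 0" "v (x ^ m / h a) = 1"
    using h.valuation_subring_algebraic[OF valuation_subring_unit_ball assms(2,3)]
    unfolding unit_of_unit_ball by auto
  then have "v x ^ m = v (h a)" by (simp add: divide power)
  then show ?thesis using ma by blast
qed

text \<open>Chevalley's theorem is applied to a ring \<open>R0\<close> that may be larger than the
  image of the integers of \<open>v\<close>, so that the extension can be forced to be at most 1 on
  further elements. By \<open>group\<close> all values are commensurable with the value at \<pi>;
  hence the valuation ring determines the extension once its value at \<pi> is fixed.\<close>

lemma extend_abs:
  fixes h :: "'a \<Rightarrow> 'b::field"
  assumes h: "field_morphism h" and alg: "\<And>x. algebraic_via h x"
    and \<pi>: "\<pi> \<noteq> 0" "v \<pi> < 1" and group: "\<And>x. x \<noteq> 0 \<Longrightarrow> \<exists>m>0. \<exists>k. v x ^ m = v \<pi> powi k"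
    and R0: "subring_of R0" "\<And>x. v x \<le> 1 \<Longrightarrow> h x \<in> R0" "inverse (h \<pi>) \<notin> R0"
  obtains w where "nonarch_abs w" "\<And>x. w (h x) = v x" "\<And>x. x \<in> R0 \<Longrightarrow> w x \<le> 1"
proof -
  interpret h: field_morphism h by fact
  obtain R where R: "valuation_subring R" "R0 \<subseteq> R" "inverse (h \<pi>) \<notin> R"
    using exists_valuation_subring[OF R0(1) _ R0(3)] R0(2) \<pi> by (metis less_imp_le)
  have h\<pi>: "h \<pi> \<in> R" "h \<pi> \<noteq> 0" using R0(2) R(2) \<pi> by auto
  note sR = valuation_subringD(1)[OF R(1)]
  have unit_h: "unit_of R (h x)" if "v x = 1" for x
    using that R0(2)[of x] R0(2)[of "inverse x"] R(2) unfolding unit_of_def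
    by (auto simp: inverse h.inverse[symmetric])
  have ord_h: "ord_relation R (h \<pi>) (h x) (of_int k / of_nat m)"
    if "x \<noteq> 0" "m > 0" "v x ^ m = v \<pi> powi k" for x m k
  proof -
    have "v (x ^ m / \<pi> powi k) = 1" using that \<pi> by (simp add: divide power power_int)
    then have "unit_of R (h (x ^ m / \<pi> powi k))" by (rule unit_h)
    moreover have "h x ^ m = h (x ^ m / \<pi> powi k) * h (\<pi> powi k)"
      using \<pi>(1) by (simp add: h.divide h.power)
    moreover have "h (\<pi> powi k) = h \<pi> powi k"
      by (cases k rule: int_cases4) (simp_all add: power_int_minus h.inverse h.power)
    ultimately show ?thesis unfolding ord_relation_def using that(2) by metis
  qed
  have ex: "\<exists>r. ord_relation R (h \<pi>) x r" if x: "x \<noteq> 0" for x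
  proof -
    obtain m a where ma: "m > 0" "a \<noteq> 0" "unit_of R (x ^ m / h a)"
      using h.valuation_subring_algebraic[OF R(1) alg x] by blast
    obtain n k where nk: "n > 0" "v a ^ n = v \<pi> powi k" using group[OF ma(2)] by blast
    obtain l c u where u: "l > 0" "unit_of R u" "h a ^ l = u * h \<pi> powi c"
      using ord_h[OF ma(2) nk] unfolding ord_relation_def by blast
    have "x ^ (m * l) = (x ^ m / h a) ^ l * h a ^ l"
      using ma(2) by (simp add: power_mult power_divide)
    also have "\<dots> = ((x ^ m / h a) ^ l * u) * h \<pi> powi c" unfolding u by (simp add: mult.assoc)
    finally have "x ^ (m * l) = ((x ^ m / h a) ^ l * u) * h \<pi> powi c" .
    moreover have "unit_of R ((x ^ m / h a) ^ l * u)" using sR ma u by (intro unit_of_mult unit_of_power)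
    ultimately show ?thesis unfolding ord_relation_def using ma(1) u(1) by (metis nat_0_less_mult_iff)
  qed
  obtain w where w: "nonarch_abs w" "\<And>x. w x \<le> 1 \<longleftrightarrow> x \<in> R"
    "\<And>x r. x \<noteq> 0 \<Longrightarrow> ord_relation R (h \<pi>) x r \<Longrightarrow> w x = v \<pi> powr r"
    using exists_abs_of_valuation_subring[OF R(1) h\<pi> R(3) ex, of "v \<pi>"] \<pi> pos_iff by blast
  have "w (h x) = v x" for x
  proof (cases "x = 0")
    case True
    then show ?thesis using nonarch_abs.zero[OF w(1)] by simp
  next
    case False
    obtain m k where mk: "m > 0" "v x ^ m = v \<pi> powi k" using group[OF False] by blast
    have "w (h x) = v \<pi> powr (of_int k / of_nat m)" using w(3) ord_h[OF False mk] False by simp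
    also have "\<dots> = (v \<pi> powr of_int k) powr (1 / of_nat m)" by (simp add: powr_powr)
    also have "v \<pi> powr of_int k = v x ^ m" using mk(2) \<pi>(1) by (simp add: powr_real_of_int')
    also have "(v x ^ m) powr (1 / of_nat m) = v x"
      using power_powr_inverse[of "v x" m] mk(1) False by simp
    finally show ?thesis .
  qed
  then show ?thesis using that w R(2) by blast
qed

end

section \<open>Minimal polynomials and extensions bounded by the constant term\<close>

definition minimal_polynomial :: "('a::field \<Rightarrow> 'b::field) \<Rightarrow> 'b \<Rightarrow> 'a poly \<Rightarrow> bool" where
  "minimal_polynomial h c m \<longleftrightarrow> Polynomial.lead_coeff m = 1 \<and> poly (map_poly h m) c = 0 \<and>
     (\<forall>p. p \<noteq> 0 \<longrightarrow> poly (map_poly h p) c = 0 \<longrightarrow> Polynomial.degree m \<le> Polynomial.degree p)"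

context field_morphism
begin

lemma map_poly_smult: "map_poly h (Polynomial.smult a p) = Polynomial.smult (h a) (map_poly h p)"
  by (rule poly_eqI) (simp add: mult)

lemma exists_minimal_polynomial:
  assumes "algebraic_via h c"
  obtains m where "minimal_polynomial h c m"
proof -
  define m where "m = arg_min Polynomial.degree (\<lambda>p. p \<noteq> 0 \<and> poly (map_poly h p) c = 0)"
  have m: "m \<noteq> 0" "poly (map_poly h m) c = 0"
    "\<And>p. p \<noteq> 0 \<Longrightarrow> poly (map_poly h p) c = 0 \<Longrightarrow> Polynomial.degree m \<le> Polynomial.degree p"
    using assms arg_min_nat_lemma[of "\<lambda>p. p \<noteq> 0 \<and> poly (map_poly h p) c = 0" _ Polynomial.degree]
    unfolding algebraic_via_def m_def by auto
  have "minimal_polynomial h c (Polynomial.smult (inverse (Polynomial.lead_coeff m)) m)"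
    unfolding minimal_polynomial_def using m by (simp add: map_poly_smult)
  then show ?thesis by (rule that)
qed

lemma minimal_polynomial_dvd:
  assumes m: "minimal_polynomial h c m" and p: "poly (map_poly h p) c = 0"
  shows "m dvd p"
proof -
  have m': "m \<noteq> 0" "poly (map_poly h m) c = 0" using m unfolding minimal_polynomial_def by auto
  have "poly (map_poly h (p div m * m + p mod m)) c = 0" using p by simp
  then have "poly (map_poly h (p mod m)) c = 0"
    unfolding map_poly_add map_poly_mult using m' by simp
  moreover have "p mod m = 0 \<or> Polynomial.degree (p mod m) < Polynomial.degree m"
    using degree_mod_less[OF m'(1)] by blast
  ultimately have "p mod m = 0" using m unfolding minimal_polynomial_def by (meson not_le)
  then show ?thesis by (simp add: dvd_eq_mod_eq_0)
qed

lemma minimal_polynomial_coeff_0: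
  assumes m: "minimal_polynomial h c m" and "c \<noteq> 0"
  shows "Polynomial.coeff m 0 \<noteq> 0" "0 < Polynomial.degree m"
proof -
  have m': "m \<noteq> 0" "poly (map_poly h m) c = 0" using m unfolding minimal_polynomial_def by auto
  show pos: "0 < Polynomial.degree m"
  proof (rule ccontr)
    assume "\<not> ?thesis"
    then obtain a where "m = [:a:]" using degree_eq_zeroE[of m] by auto
    then show False using m' by (simp add: map_poly_pCons)
  qed
  show "Polynomial.coeff m 0 \<noteq> 0"
  proof
    assume "Polynomial.coeff m 0 = 0"
    then obtain p where p: "m = pCons 0 p" by (cases m) auto
    then have "p \<noteq> 0" "poly (map_poly h p) c = 0" using m' \<open>c \<noteq> 0\<close> by (auto simp: map_poly_pCons)
    then have "Polynomial.degree m \<le> Polynomial.degree p" using m unfolding minimal_polynomial_def by blast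
    then show False using p \<open>p \<noteq> 0\<close> by simp
  qed
qed

end

context nonarch_abs
begin

text \<open>Some extension of \<open>v\<close> makes \<open>c\<close> at most as large as the geometric mean of its conjugates:
  otherwise the ring generated by \<open>c ^ n / a\<close> over the valuation ring would contain the inverse of
  \<open>\<pi>\<close>, and Gauss's lemma would show that the constant term \<open>a\<close> of \<open>m\<close> strictly dominates on the
  circle of radius \<open>(v a)\<^bsup>1/n\<^esup>\<close>, where the leading term is just as large.\<close>

lemma extend_abs_le_constant_term:
  fixes h :: "'a \<Rightarrow> 'b::field"
  assumes h: "field_morphism h" and alg: "\<And>x. algebraic_via h x"
    and \<pi>: "\<pi> \<noteq> 0" "v \<pi> < 1" and group: "\<And>x. x \<noteq> 0 \<Longrightarrow> \<exists>m>0. \<exists>k. v x ^ m = v \<pi> powi k"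
    and m: "minimal_polynomial h c m" and "c \<noteq> 0"
  obtains w where "nonarch_abs w" "\<And>x. w (h x) = v x"
    "w c ^ Polynomial.degree m \<le> v (Polynomial.coeff m 0)"
proof -
  interpret h: field_morphism h by fact
  define n where "n = Polynomial.degree m"
  define a where "a = Polynomial.coeff m 0"
  have n: "0 < n" and a: "a \<noteq> 0" using h.minimal_polynomial_coeff_0[OF m \<open>c \<noteq> 0\<close>] by (simp_all add: n_def a_def)
  \<comment> \<open>The aim is \<open>w b \<le> 1\<close>, so \<open>b\<close> is adjoined before
    the ring is extended.\<close>
  define b where "b = c ^ n / h a"
  have S: "subring_of (h ` {x. v x \<le> 1})"
    unfolding subring_of_def
  proof (intro conjI ballI)
    show "1 \<in> h ` {x. v x \<le> 1}" by (rule image_eqI[of _ _ 1]) auto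
    fix x assume "x \<in> h ` {x. v x \<le> 1}"
    then obtain x' where x: "x = h x'" "v x' \<le> 1" by auto
    then show "- x \<in> h ` {x. v x \<le> 1}" by (intro image_eqI[of _ _ "- x'"]) (auto simp: h.minus)
    fix y assume "y \<in> h ` {x. v x \<le> 1}"
    then obtain y' where y: "y = h y'" "v y' \<le> 1" by auto
    show "x + y \<in> h ` {x. v x \<le> 1}" using x y
      by (intro image_eqI[of _ _ "x' + y'"]) (auto simp: h.add intro: ultra_bound)
    show "x * y \<in> h ` {x. v x \<le> 1}" using x y
      by (intro image_eqI[of _ _ "x' * y'"]) (auto simp: h.mult mult mult_le_one)
  qed
  have "inverse (h \<pi>) \<notin> adjoin (h ` {x. v x \<le> 1}) b"
  proof
    assume "inverse (h \<pi>) \<in> adjoin (h ` {x. v x \<le> 1}) b"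
    then obtain p where p: "inverse (h \<pi>) = poly p b" "\<And>i. Polynomial.coeff p i \<in> h ` {x. v x \<le> 1}"
      unfolding adjoin_def by auto
    have "\<forall>i. \<exists>x. v x \<le> 1 \<and> Polynomial.coeff p i = h x" using p(2) by auto
    then obtain d where d: "\<And>i. v (d i) \<le> 1" "\<And>i. Polynomial.coeff p i = h (d i)" by metis
    define p' where "p' = (\<Sum>i\<le>Polynomial.degree p. Polynomial.monom (d i) i)"
    have p'_coeff: "Polynomial.coeff p' i = (if i \<le> Polynomial.degree p then d i else 0)" for i
      unfolding p'_def by (simp add: coeff_sum)
    have p': "v (Polynomial.coeff p' i) \<le> 1" for i using d p'_coeff by simp
    have "map_poly h p' = p"
    proof (rule poly_eqI)
      fix i
      show "Polynomial.coeff (map_poly h p') i = Polynomial.coeff p i"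
        using p'_coeff[of i] d(2)[of i] by (cases "i \<le> Polynomial.degree p") (auto simp: coeff_eq_0)
    qed
    \<comment> \<open>\<open>W\<close> is \<open>p'\<close> evaluated at \<open>X ^ n / a\<close>:
      its value at \<open>c\<close> is \<open>poly p b\<close>, which is the inverse of \<pi>. Hence
      \<open>G\<close> vanishes at \<open>c\<close> and is divisible by \<open>m\<close>.\<close>
    define W where "W = pcompose p' (Polynomial.monom (inverse a) n)"
    define G where "G = 1 - Polynomial.smult \<pi> W"
    have "poly (map_poly h W) c = poly p b"
    proof -
      have "poly (map_poly h (Polynomial.monom (inverse a) n)) c = b"
        unfolding b_def by (simp add: map_poly_monom poly_monom h.inverse divide_inverse mult.commute)
      then show ?thesis unfolding W_def h.map_poly_pcompose poly_pcompose \<open>map_poly h p' = p\<close> by simp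
    qed
    then have "poly (map_poly h (Polynomial.smult \<pi> W)) c = 1"
      unfolding h.map_poly_smult using p(1) \<pi>(1) by (metis poly_smult right_inverse h.eq_0_iff)
    moreover have "map_poly h (G + Polynomial.smult \<pi> W) = 1" unfolding G_def by simp
    ultimately have "poly (map_poly h G) c = 0"
      unfolding h.map_poly_add by (metis add_cancel_left_left poly_1 poly_add)
    then have "m dvd G" using h.minimal_polynomial_dvd[OF m] by blast
    then obtain k where k: "G = m * k" by auto
    define \<rho> where "\<rho> = v a powr (1 / real n)"
    have \<rho>: "0 < \<rho>" "\<rho> ^ n = v a" using a n powr_inverse_power[of "v a" n] by (simp_all add: \<rho>_def)
    have W: "v (Polynomial.coeff W j) * \<rho> ^ j \<le> 1" for j
    proof -
      have "v (Polynomial.coeff W j) \<le> 1 / \<rho> ^ j"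
        unfolding W_def coeff_pcompose_sum
      proof (rule sum_le)
        fix i assume "i \<in> {..Polynomial.degree p'}"
        show "v (Polynomial.coeff p' i * Polynomial.coeff (Polynomial.monom (inverse a) n ^ i) j) \<le> 1 / \<rho> ^ j"
        proof (cases "j = n * i")
          case True
          have "v (inverse a ^ i) = 1 / \<rho> ^ j"
            unfolding power inverse True power_mult \<rho>(2) by (simp add: power_inverse divide_inverse)
          then show ?thesis unfolding monom_power using p'[of i] \<rho>(1) True
            by (simp add: mult divide_right_mono mult_left_le_one_le)
        next
          case False
          then show ?thesis unfolding monom_power using \<rho>(1) by (simp add: mult.commute)
        qed
      qed (use \<rho>(1) in simp)
      then show ?thesis using \<rho>(1) by (simp add: field_simps)
    qed
    have \<pi>W: "v (Polynomial.coeff (Polynomial.smult \<pi> W) j) * \<rho> ^ j < 1" for j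
    proof -
      have "v \<pi> * (v (Polynomial.coeff W j) * \<rho> ^ j) \<le> v \<pi> * 1" using W by (intro mult_left_mono) auto
      then show ?thesis using \<pi>(2) by (simp add: mult mult.assoc)
    qed
    have G0: "v (Polynomial.coeff G 0) = 1"
      using \<pi>W[of 0] add_dominant(2)[of "- Polynomial.coeff (Polynomial.smult \<pi> W) 0" 1]
      unfolding G_def by simp
    have Gj: "v (Polynomial.coeff G j) * \<rho> ^ j < 1" if "j > 0" for j
      using \<pi>W[of j] that unfolding G_def by (simp add: coeff_1 del: coeff_smult)
    have "dominates \<rho> G 0 1"
      unfolding dominates_def using G0 Gj by (metis less_eq_real_def mult_1_right neq0_conv power_0 zero_less_one)
    moreover have "m \<noteq> 0" "k \<noteq> 0" using G0 k by auto
    then obtain i M j N where "dominates \<rho> m i M" "dominates \<rho> k j N" using dominates_exists \<rho>(1) by metis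
    ultimately have "dominates \<rho> m 0 M" using dominates_unique(1)[of \<rho> G] dominates_mult[OF _ _ \<rho>(1)] k by fastforce
    then have "v (Polynomial.coeff m n) * \<rho> ^ n < v (Polynomial.coeff m 0) * \<rho> ^ 0"
      using dominatesD(2,4) n by blast
    then show False using m \<rho>(2) unfolding minimal_polynomial_def n_def[symmetric] a_def[symmetric]
      by simp
  qed
  moreover have "h x \<in> adjoin (h ` {x. v x \<le> 1}) b" if "v x \<le> 1" for x
    using adjoin_incl(1)[OF S] that by blast
  ultimately obtain w where w: "nonarch_abs w" "\<And>x. w (h x) = v x"
    "\<And>x. x \<in> adjoin (h ` {x. v x \<le> 1}) b \<Longrightarrow> w x \<le> 1"
    using extend_abs[OF h alg \<pi> group subring_of_adjoin[OF S]] by metis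
  interpret w: nonarch_abs w by fact
  have "w b \<le> 1" using w(3) adjoin_incl(2)[OF S] by blast
  moreover have "0 < v a" using a by simp
  ultimately have "w c ^ n \<le> v a"
    unfolding b_def w.divide w.power w(2) by (simp only: pos_divide_le_eq mult_1_left)
  then show ?thesis using that w(1,2) unfolding n_def a_def by blast
qed

end

section \<open>Weak approximation\<close>

lemma exists_power_less:
  fixes x \<epsilon> :: real
  assumes "0 \<le> x" "x < 1" "0 < \<epsilon>"
  shows "\<forall>\<^sub>F n in sequentially. x ^ n < \<epsilon>"
  using order_tendstoD(2)[OF LIMSEQ_realpow_zero[OF assms(1,2)] assms(3)] .

text \<open>The induction of Artin and Whaples: \<open>z\<close> works for \<open>S\<close> and
  \<open>y\<close> for the new \<open>u\<close>. If \<open>u z \<le> 1\<close>, a power of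
  \<open>z\<close> times \<open>y\<close> works for both; otherwise \<open>y\<close> is multiplied
  by \<open>z ^ n / (1 + z ^ n)\<close>, which has size 1 at \<open>v\<close> and \<open>u\<close>
  and is small on \<open>S\<close>.\<close>

lemma exists_separating_element:
  assumes "finite S" "nonarch_abs v" "\<And>w. w \<in> S \<Longrightarrow> nonarch_abs w" "\<exists>z. v z > 1"
    and "\<And>w. w \<in> S \<Longrightarrow> \<exists>z. v z > 1 \<and> w z < 1"
  shows "\<exists>z. v z > 1 \<and> (\<forall>w\<in>S. w z < 1)"
  using assms(1,3,5)
proof (induction S)
  case empty
  show ?case using assms(4) by simp
next
  case (insert u S)
  interpret v: nonarch_abs v by fact
  interpret u: nonarch_abs u using insert.prems(1) by simp
  obtain z where z: "v z > 1" "\<And>w. w \<in> S \<Longrightarrow> w z < 1" using insert by auto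
  obtain y where y: "v y > 1" "u y < 1" using insert.prems(2) by auto
  have "\<forall>\<^sub>F n in sequentially. \<forall>w\<in>S. w z ^ n * w y < 1"
  proof (rule eventually_ball_finite[OF insert.hyps(1)], rule ballI)
    fix w assume w: "w \<in> S"
    then interpret w: nonarch_abs w using insert.prems(1) by simp
    have "0 < 1 + w y" using w.nonneg[of y] by linarith
    then have "\<forall>\<^sub>F n in sequentially. w z ^ n < 1 / (1 + w y)"
      using z(2)[OF w] by (intro exists_power_less) auto
    then show "\<forall>\<^sub>F n in sequentially. w z ^ n * w y < 1"
    proof eventually_elim
      case (elim n)
      have "w z ^ n * w y \<le> w z ^ n * (1 + w y)" by (intro mult_left_mono) auto
      also have "\<dots> < 1" using elim w.nonneg[of y] by (simp add: pos_less_divide_eq)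
      finally show ?case .
    qed
  qed
  then have "\<forall>\<^sub>F n in sequentially. (\<forall>w\<in>S. w z ^ n * w y < 1) \<and> n \<ge> 1"
    using eventually_ge_at_top[of 1] by (rule eventually_conj)
  then obtain n where n: "\<And>w. w \<in> S \<Longrightarrow> w z ^ n * w y < 1" "n \<ge> 1"
    using eventually_happens'[OF sequentially_bot] by blast
  have vzn: "1 < v z ^ n" using z(1) n(2) by simp
  show ?case
  proof (cases "u z \<le> 1")
    case True
    have "w (z ^ n * y) < 1" if "w \<in> insert u S" for w
    proof (cases "w = u")
      case True
      have "u z ^ n * u y \<le> 1 * u y" using \<open>u z \<le> 1\<close> by (intro mult_right_mono power_le_one) auto
      then show ?thesis using y(2) True by (simp add: u.mult u.power)
    next
      case False
      then show ?thesis using n(1)[of w] that nonarch_abs.mult nonarch_abs.power insert.prems(1) by (metis insertE)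
    qed
    moreover have "1 * 1 < v z ^ n * v y" using vzn y(1) by (intro mult_strict_mono) auto
    then have "v (z ^ n * y) > 1" by (simp add: v.mult v.power)
    ultimately show ?thesis by blast
  next
    case False
    have one_plus: "w (1 + z ^ n) = w z ^ n" if "nonarch_abs w" "w z > 1" for w
    proof -
      interpret w: nonarch_abs w by fact
      have "w 1 < w (z ^ n)" using that(2) n(2) by (simp add: w.power)
      then show ?thesis using w.add_dominant(1)[of 1 "z ^ n"] by (simp add: w.power)
    qed
    define x where "x = z ^ n / (1 + z ^ n) * y"
    have "z \<noteq> 0" using z(1) by auto
    then have "v x = v y" unfolding x_def using one_plus[OF v.nonarch_abs_axioms z(1)] vzn
      by (simp add: v.mult v.divide v.power)
    moreover have "w x < 1" if "w \<in> insert u S" for w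
    proof (cases "w = u")
      case True
      have "u z > 1" "z \<noteq> 0" using False by auto
      then have "u x = u y" unfolding x_def using one_plus[OF u.nonarch_abs_axioms]
        by (simp add: u.mult u.divide u.power)
      then show ?thesis using y True by simp
    next
      case False
      then have "w \<in> S" using that by simp
      then interpret w: nonarch_abs w using insert.prems(1) by simp
      have "w z ^ n < 1" using z(2)[OF \<open>w \<in> S\<close>] n(2) by (simp add: power_less_one_iff)
      then have "w (z ^ n) < w 1" by (simp add: w.power)
      then have "w (1 + z ^ n) = 1" using w.add_dominant(2)[of "z ^ n" 1] by simp
      then have "w x = w z ^ n * w y" unfolding x_def by (simp add: w.mult w.divide w.power)
      then show ?thesis using n(1)[OF \<open>w \<in> S\<close>] by simp
    qed
    ultimately show ?thesis using y(1) by (intro exI[of _ x]) simp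
  qed
qed

text \<open>With \<open>z\<close> large at \<open>v\<close> and small on \<open>S\<close>, the
  element \<open>z ^ n / (1 + z ^ n)\<close> tends to 1 at \<open>v\<close> and to 0 on
  \<open>S\<close>.\<close>

lemma exists_idempotent_approximation:
  assumes "finite S" "nonarch_abs v" "\<And>w. w \<in> S \<Longrightarrow> nonarch_abs w" "\<exists>z. v z > 1"
    and "\<And>w. w \<in> S \<Longrightarrow> \<exists>z. v z > 1 \<and> w z < 1" and "0 < \<epsilon>"
  shows "\<exists>e. v (e - 1) < \<epsilon> \<and> (\<forall>w\<in>S. w e < \<epsilon>)"
proof -
  interpret v: nonarch_abs v by fact
  obtain z where z: "v z > 1" "\<And>w. w \<in> S \<Longrightarrow> w z < 1"
    using exists_separating_element[OF assms(1-5)] by blast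
  have "\<forall>\<^sub>F n in sequentially. \<forall>w\<in>S. w z ^ n < \<epsilon>"
  proof (rule eventually_ball_finite[OF assms(1)], rule ballI)
    fix w assume w: "w \<in> S"
    then interpret w: nonarch_abs w using assms(3) by simp
    show "\<forall>\<^sub>F n in sequentially. w z ^ n < \<epsilon>"
      using z(2)[OF w] assms(6) by (intro exists_power_less) auto
  qed
  moreover have "0 < v z" using z(1) by linarith
  then have "1 / v z < 1" using z(1) by (simp only: divide_less_eq_1_pos)
  then have "\<forall>\<^sub>F n in sequentially. (1 / v z) ^ n < \<epsilon>"
    using assms(6) by (intro exists_power_less) auto
  ultimately have "\<forall>\<^sub>F n in sequentially. ((\<forall>w\<in>S. w z ^ n < \<epsilon>) \<and> (1 / v z) ^ n < \<epsilon>) \<and> n \<ge> 1"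
    using eventually_ge_at_top[of 1] by (intro eventually_conj)
  then obtain n where n: "\<And>w. w \<in> S \<Longrightarrow> w z ^ n < \<epsilon>" "(1 / v z) ^ n < \<epsilon>" "n \<ge> 1"
    using eventually_happens'[OF sequentially_bot] by blast
  have vzn: "1 < v z ^ n" using z(1) n(3) by simp
  have "v 1 < v (z ^ n)" using vzn by (simp add: v.power)
  then have v1: "v (1 + z ^ n) = v z ^ n" using v.add_dominant(1)[of 1 "z ^ n"] by (simp add: v.power)
  then have nz: "1 + z ^ n \<noteq> 0" using vzn by (metis v.zero not_one_less_zero)
  define e where "e = z ^ n / (1 + z ^ n)"
  have "e - 1 = - 1 / (1 + z ^ n)" unfolding e_def using nz by (simp add: field_simps)
  then have "v (e - 1) = (1 / v z) ^ n" using v1 by (simp add: v.divide power_divide)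
  moreover have "w e < \<epsilon>" if "w \<in> S" for w
  proof -
    interpret w: nonarch_abs w using assms(3) that by simp
    have "w z ^ n < 1" using z(2)[OF that] n(3) by (simp add: power_less_one_iff)
    then have "w (z ^ n) < w 1" by (simp add: w.power)
    then have "w (1 + z ^ n) = 1" using w.add_dominant(2)[of "z ^ n" 1] by simp
    then show ?thesis unfolding e_def using n(1)[OF that] by (simp add: w.divide w.power)
  qed
  ultimately show ?thesis using n(2) by (intro exI[of _ e]) simp
qed

lemma weak_approximation:
  assumes fin: "finite S" and na: "\<And>w. w \<in> S \<Longrightarrow> nonarch_abs w" and nt: "\<And>w. w \<in> S \<Longrightarrow> \<exists>z. w z > 1"
    and sep: "\<And>w w'. w \<in> S \<Longrightarrow> w' \<in> S \<Longrightarrow> w \<noteq> w' \<Longrightarrow> \<exists>z. w z > 1 \<and> w' z < 1" and "0 < \<epsilon>"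
  shows "\<exists>x. \<forall>w\<in>S. w (x - \<alpha> w) < \<epsilon>"
proof -
  \<comment> \<open>\<open>B\<close> exceeds every target at every place of \<open>S\<close>,
    including the targets that belong to other places; multiplying an error by a target costs at
    most this factor.\<close>
  define B where "B = 1 + (\<Sum>w\<in>S. \<Sum>w'\<in>S. w (\<alpha> w'))"
  have nonneg: "0 \<le> (\<Sum>w'\<in>S. w (\<alpha> w'))" if "w \<in> S" for w
    using nonarch_abs.nonneg[OF na[OF that]] by (intro sum_nonneg)
  have B: "w (\<alpha> w') < B" if "w \<in> S" "w' \<in> S" for w w'
  proof -
    have "w (\<alpha> w') \<le> (\<Sum>w'\<in>S. w (\<alpha> w'))"
      using that fin nonarch_abs.nonneg[OF na] by (intro member_le_sum) auto
    also have "\<dots> \<le> (\<Sum>w\<in>S. \<Sum>w'\<in>S. w (\<alpha> w'))"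
      using that fin nonneg by (intro member_le_sum[where f = "\<lambda>w. \<Sum>w'\<in>S. w (\<alpha> w')"]) auto
    finally show ?thesis unfolding B_def by simp
  qed
  have "0 < B" unfolding B_def using nonneg by (simp add: add_pos_nonneg sum_nonneg)
  have "\<exists>e. v (e - 1) < \<epsilon> / B \<and> (\<forall>w\<in>S - {v}. w e < \<epsilon> / B)" if "v \<in> S" for v
    using that fin na nt sep \<open>0 < B\<close> \<open>0 < \<epsilon>\<close> by (intro exists_idempotent_approximation) auto
  then obtain e where e: "\<And>v. v \<in> S \<Longrightarrow> v (e v - 1) < \<epsilon> / B"
    "\<And>v w. v \<in> S \<Longrightarrow> w \<in> S \<Longrightarrow> w \<noteq> v \<Longrightarrow> w (e v) < \<epsilon> / B" by (metis insert_Diff insert_iff)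
  have "w ((\<Sum>v\<in>S. e v * \<alpha> v) - \<alpha> w) < \<epsilon>" if w: "w \<in> S" for w
  proof -
    interpret w: nonarch_abs w using na w .
    have small: "w (a * \<alpha> v) < \<epsilon>" if "w a < \<epsilon> / B" "v \<in> S" for a v
    proof -
      have "w a * w (\<alpha> v) \<le> w a * B" using B[OF w that(2)] by (intro mult_left_mono) auto
      also have "\<dots> < \<epsilon>" using that(1) \<open>0 < B\<close> by (simp add: field_simps)
      finally show ?thesis by (simp add: w.mult)
    qed
    have "(\<Sum>v\<in>S. e v * \<alpha> v) - \<alpha> w = (\<Sum>v\<in>S. (if v = w then e v - 1 else e v) * \<alpha> v)"
    proof -
      have "(\<Sum>v\<in>S. (if v = w then e v - 1 else e v) * \<alpha> v)
        = (\<Sum>v\<in>S. e v * \<alpha> v - (if v = w then \<alpha> v else 0))"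
        by (rule sum.cong) (auto simp: algebra_simps)
      then show ?thesis using fin w by (simp add: sum_subtractf)
    qed
    also have "w \<dots> < \<epsilon>"
      using e w \<open>0 < \<epsilon>\<close> by (intro w.sum_less small) auto
    finally show ?thesis .
  qed
  then show ?thesis by blast
qed

subsection \<open>Places of a function field\<close>

locale function_field =
  fixes \<iota> :: "'k::{field,finite} poly fract \<Rightarrow> 'a::field"
    and q :: nat
  assumes finite_ext: "finite_extension \<iota>" and q_eq: "q = CARD('k)"
begin

sublocale hom: field_morphism \<iota>
  using finite_ext unfolding finite_extension_def field_embedding_iff by simp

definition K_ring :: "'a ring" where "K_ring = ring_of_type_algebra"

lemma K_ring_simps [simp]:
  "carrier K_ring = UNIV" "x \<otimes>\<^bsub>K_ring\<^esub> y = x * y" "x \<oplus>\<^bsub>K_ring\<^esub> y = x + y"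
  "\<one>\<^bsub>K_ring\<^esub> = 1" "\<zero>\<^bsub>K_ring\<^esub> = 0"
  by (simp_all add: K_ring_def ring_of_type_algebra_def)

lemma field_K_ring: "Ring.field K_ring"
  unfolding K_ring_def by (rule field_from_type_algebra)

lemma ring_K_ring: "ring K_ring"
  unfolding K_ring_def by (rule ring_from_type_algebra)

lemma subfield_range: "subfield (range \<iota>) K_ring"
proof -
  interpret F: Ring.field "ring_of_type_algebra :: 'k poly fract ring" by (rule field_from_type_algebra)
  interpret K: Ring.field K_ring by (rule field_K_ring)
  interpret h: ring_hom_ring "ring_of_type_algebra :: 'k poly fract ring" K_ring \<iota>
    using finite_ext unfolding finite_extension_def field_embedding_def K_ring_def[symmetric]
    by (intro ring_hom_ringI2 F.ring_axioms K.ring_axioms) simp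
  show ?thesis
    using h.img_is_subfield(2)[OF F.carrier_is_subfield] by (simp add: ring_of_type_algebra_def)
qed

lemma dimension_K: "ring.dimension K_ring (extension_degree \<iota>) (range \<iota>) UNIV"
  using ring.finite_dimensionE[OF ring_K_ring subfield_range] finite_ext
  unfolding extension_degree_def finite_extension_def K_ring_def by (simp add: over_def)

lemma combine_K_ring:
  "ring.combine K_ring Ks Us = (\<Sum>i<min (length Ks) (length Us). Ks ! i * Us ! i)"
proof -
  interpret K: ring K_ring by (rule ring_K_ring)
  show ?thesis
  proof (induction Ks Us rule: K.combine.induct)
    case (1 k Ks u Us)
    then show ?case by (simp add: sum.lessThan_Suc_shift del: sum.lessThan_Suc)
  qed auto
qed

text \<open>Passage from the list-based linear combinations of \<open>combine\<close> to plain sums;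
  all later bounds by the degree go through it.\<close>

lemma independent_le_nat:
  assumes ind: "\<And>a. (\<Sum>i<n. \<iota> (a i) * u i) = 0 \<Longrightarrow> \<forall>i<n. a i = 0"
  shows "n \<le> extension_degree \<iota>"
proof -
  interpret K: ring K_ring by (rule ring_K_ring)
  have "K.independent (range \<iota>) (map u [0..<n])"
  proof (rule K.trivial_combine_imp_independent[OF subfield_range])
    fix Ks assume Ks: "set Ks \<subseteq> range \<iota>" "K.combine Ks (map u [0..<n]) = \<zero>\<^bsub>K_ring\<^esub>"
    define a where "a i = (if i < length Ks then inv_into UNIV \<iota> (Ks ! i) else 0)" for i
    have a: "\<iota> (a i) = Ks ! i" if "i < length Ks" for i
      using Ks(1) that unfolding a_def by (auto simp: f_inv_into_f nth_mem subset_iff)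
    have "(\<Sum>i<n. \<iota> (a i) * u i) = (\<Sum>i<min (length Ks) n. \<iota> (a i) * u i)"
      by (rule sum.mono_neutral_right) (auto simp: a_def)
    also have "\<dots> = (\<Sum>i<min (length Ks) n. Ks ! i * map u [0..<n] ! i)"
      by (rule sum.cong) (auto simp: a)
    also have "\<dots> = 0" using Ks(2) by (simp add: combine_K_ring)
    finally have "a i = 0" if "i < n" for i using ind that by blast
    then have "Ks ! i = 0" if "i < length Ks" "i < n" for i using a[OF that(1)] that by simp
    then show "set (take (length (map u [0..<n])) Ks) \<subseteq> {\<zero>\<^bsub>K_ring\<^esub>}"
      by (auto simp: in_set_conv_nth)
  qed auto
  from K.independent_length_le_dimension[OF subfield_range dimension_K this] show ?thesis by simp
qed

lemma independent_le:
  assumes "finite I" and ind: "\<And>a. (\<Sum>i\<in>I. \<iota> (a i) * u i) = 0 \<Longrightarrow> \<forall>i\<in>I. a i = 0"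
  shows "card I \<le> extension_degree \<iota>"
proof -
  obtain g where g: "bij_betw g {..<card I} I"
    using ex_bij_betw_nat_finite[OF assms(1)] by (auto simp: lessThan_atLeast0)
  show ?thesis
  proof (rule independent_le_nat)
    fix a assume a: "(\<Sum>i<card I. \<iota> (a i) * u (g i)) = 0"
    define b where "b i = a (inv_into {..<card I} g i)" for i
    have bg: "b (g i) = a i" if "i < card I" for i
      using bij_betw_inv_into_left[OF g] that unfolding b_def by simp
    have "(\<Sum>i\<in>I. \<iota> (b i) * u i) = (\<Sum>i<card I. \<iota> (b (g i)) * u (g i))"
      using sum.reindex_bij_betw[OF g, of "\<lambda>i. \<iota> (b i) * u i"] by simp
    also have "\<dots> = 0" using a by (simp add: bg)
    finally have "\<forall>i\<in>I. b i = 0" by (rule ind)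
    then show "\<forall>i<card I. a i = 0" using bg g by (metis bij_betwE lessThan_iff)
  qed
qed

lemma extension_degree_pos: "0 < extension_degree \<iota>"
  using independent_le_nat[where n = 1 and u = "\<lambda>_. 1"] by simp

lemma algebraic: "algebraic_via \<iota> x"
proof -
  have "\<not> (\<forall>a. (\<Sum>i<Suc (extension_degree \<iota>). \<iota> (a i) * x ^ i) = 0 \<longrightarrow> (\<forall>i<Suc (extension_degree \<iota>). a i = 0))"
    using independent_le_nat[where n = "Suc (extension_degree \<iota>)" and u = "\<lambda>i. x ^ i"] by (metis Suc_n_not_le_n)
  then obtain a j where a: "(\<Sum>i<Suc (extension_degree \<iota>). \<iota> (a i) * x ^ i) = 0"
    "j < Suc (extension_degree \<iota>)" "a j \<noteq> 0" by blast
  define p where "p = (\<Sum>i<Suc (extension_degree \<iota>). Polynomial.monom (a i) i)"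
  have "Polynomial.coeff p j = a j" unfolding p_def using a(2) by (simp add: coeff_sum)
  then have "p \<noteq> 0" using a(3) by auto
  moreover have "map_poly \<iota> p = (\<Sum>i<Suc (extension_degree \<iota>). Polynomial.monom (\<iota> (a i)) i)"
    unfolding p_def by (rule poly_eqI) (simp add: coeff_sum if_distrib hom.sum cong: if_cong)
  then have "poly (map_poly \<iota> p) x = 0" using a(1) by (simp add: poly_sum poly_monom)
  ultimately show ?thesis unfolding algebraic_via_def by blast
qed

lemma q_ge_2: "2 \<le> q"
proof -
  have "card {0, 1 :: 'k} \<le> CARD('k)" by (rule card_mono) auto
  then show ?thesis unfolding q_eq by simp
qed

lemma q_gt_1: "1 < real q"
  using q_ge_2 by simp

definition \<epsilon> :: "'k \<Rightarrow> 'a" where "\<epsilon> c = embed_A \<iota> [:c:]"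

lemma \<epsilon>_add: "\<epsilon> (a + b) = \<epsilon> a + \<epsilon> b" and \<epsilon>_mult: "\<epsilon> (a * b) = \<epsilon> a * \<epsilon> b"
  and \<epsilon>_1 [simp]: "\<epsilon> 1 = 1" and \<epsilon>_0 [simp]: "\<epsilon> 0 = 0"
  unfolding \<epsilon>_def embed_A_def
  by (simp_all add: hom.add[symmetric] hom.mult[symmetric] mult.commute one_pCons[symmetric] One_fract_def[symmetric] Zero_fract_def[symmetric])

lemma \<epsilon>_power: "\<epsilon> (a ^ n) = \<epsilon> a ^ n"
  by (induction n) (simp_all add: \<epsilon>_mult)

lemma prime_CHAR: "prime CHAR('a)"
proof -
  have "\<epsilon> (of_nat n) = of_nat n" for n by (induction n) (simp_all add: \<epsilon>_add)
  from this[of "CHAR('k)"] have "of_nat CHAR('k) = (0::'a)" by simp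
  moreover have "0 < CHAR('k)" by (rule finite_imp_CHAR_pos) simp
  ultimately have "\<exists>n>0. of_nat n = (0::'a)" by blast
  then have "0 < CHAR('a)" by (simp only: CHAR_pos_iff)
  then show ?thesis by (rule prime_CHAR_semidom)
qed

lemma finite_field_power_eq_1:
  fixes c :: 'k
  assumes "c \<noteq> 0"
  shows "\<exists>n>0. c ^ n = 1"
proof -
  have "\<not> inj_on (\<lambda>n. c ^ n) (UNIV :: nat set)"
    using finite_imageD[of "\<lambda>n. c ^ n" "UNIV :: nat set"] by (auto intro: finite_subset)
  then obtain i j where "i \<noteq> j" "c ^ i = c ^ j" by (auto simp: inj_on_def)
  then obtain i j where ij: "i < j" "c ^ i = c ^ j" by (metis linorder_neqE_nat)
  have "c ^ i * c ^ (j - i) = c ^ j" using ij(1) by (simp add: power_add[symmetric])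
  then have "c ^ i * c ^ (j - i) = c ^ i * 1" using ij(2) by simp
  then have "c ^ (j - i) = 1" using assms by simp
  then show ?thesis using ij(1) by (metis zero_less_diff)
qed

text \<open>Places are only required to satisfy the triangle inequality. In characteristic p,
  raising to the power p^n is additive, so \<open>v (x + y)\<close> raised to p^n is at most 2 times
  the same power of \<open>M\<close>, for every n; the factor 2 disappears on taking roots.\<close>

lemma absolute_value_nonarch:
  fixes v :: "'a \<Rightarrow> real"
  assumes "absolute_value v"
  shows "nonarch_abs v"
proof
  have av: "\<And>x. 0 \<le> v x" "\<And>x. v x = 0 \<longleftrightarrow> x = 0" "\<And>x y. v (x * y) = v x * v y" "\<And>x y. v (x + y) \<le> v x + v y"
    using assms unfolding absolute_value_def by auto
  have "v 1 * v 1 = v 1 * 1" using av(3)[of 1 1] by simp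
  then have v1: "v 1 = 1" by (subst (asm) mult_cancel_left) (use av(2)[of 1] in auto)
  have pow: "v (x ^ n) = v x ^ n" for x n by (induction n) (simp_all add: v1 av)
  show "v (x + y) \<le> max (v x) (v y)" for x y
  proof (cases "x = 0 \<and> y = 0")
    case False
    define M where "M = max (v x) (v y)"
    have M: "0 < M" unfolding M_def using False av(1,2) by (metis less_max_iff_disj order_le_less)
    have bound: "(v (x + y) / M) ^ (CHAR('a) ^ n) \<le> 2" for n
    proof -
      have "v (x + y) ^ (CHAR('a) ^ n) = v (x ^ (CHAR('a) ^ n) + y ^ (CHAR('a) ^ n))"
        using freshmans_dream'[OF prime_CHAR refl, of x y n] pow[of "x + y" "CHAR('a) ^ n"] by simp
      also have "\<dots> \<le> v x ^ (CHAR('a) ^ n) + v y ^ (CHAR('a) ^ n)" unfolding pow[symmetric] by (rule av(4))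
      also have "\<dots> \<le> M ^ (CHAR('a) ^ n) + M ^ (CHAR('a) ^ n)"
        unfolding M_def using av(1) by (intro add_mono power_mono) auto
      finally show ?thesis using M by (simp add: power_divide field_simps)
    qed
    have "v (x + y) / M \<le> 1"
    proof (rule ccontr)
      assume "\<not> ?thesis"
      then obtain n where n: "2 < (v (x + y) / M) ^ n" using real_arch_pow[of "v (x + y) / M" 2] by auto
      have "n \<le> CHAR('a) ^ n" using prime_gt_1_nat[OF prime_CHAR] by (simp add: less_imp_le power_gt_expt)
      then have "(v (x + y) / M) ^ n \<le> (v (x + y) / M) ^ (CHAR('a) ^ n)"
        using \<open>\<not> v (x + y) / M \<le> 1\<close> by (intro power_increasing) auto
      then show False using n bound[of n] by linarith
    qed
    then show ?thesis using M unfolding M_def by simp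
  qed (use av(2) in simp)
qed (use assms in \<open>auto simp: absolute_value_def\<close>)

lemma places_nonarch: "v \<in> places \<iota> \<Longrightarrow> nonarch_abs v"
  unfolding places_def by (auto intro: absolute_value_nonarch)

lemma abs_\<epsilon>:
  assumes "nonarch_abs v" "c \<noteq> 0"
  shows "v (\<epsilon> c) = 1"
proof -
  interpret nonarch_abs v by fact
  obtain n where n: "n > 0" "c ^ n = 1" using finite_field_power_eq_1[OF assms(2)] by blast
  have "v (\<epsilon> c) ^ n = 1" using n(2) by (simp add: power[symmetric] \<epsilon>_power[symmetric])
  then show ?thesis using n(1) power_eq_imp_eq_base[of "v (\<epsilon> c)" n 1] by simp
qed

end

text \<open>The condition is on coefficients because, with \<open>degree 0 = 0\<close>, a strict
  bound on the degree would give the wrong set for \<open>n = 0\<close>, where the zero polynomial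
  alone is counted.\<close>

lemma card_poly_degree_less:
  "finite {p :: 'k::{field,finite} poly. \<forall>i\<ge>n. Polynomial.coeff p i = 0} \<and>
   card {p :: 'k poly. \<forall>i\<ge>n. Polynomial.coeff p i = 0} = CARD('k) ^ n"
proof (induction n)
  case 0
  have "{p :: 'k poly. \<forall>i\<ge>0. Polynomial.coeff p i = 0} = {0}" by (auto simp: poly_eq_iff)
  then show ?case by simp
next
  case (Suc n)
  let ?S = "\<lambda>n. {p :: 'k poly. \<forall>i\<ge>n. Polynomial.coeff p i = 0}"
  have eq: "?S (Suc n) = (\<lambda>(c, p). pCons c p) ` (UNIV \<times> ?S n)"
  proof (intro equalityI subsetI)
    fix p :: "'k poly" assume p: "p \<in> ?S (Suc n)"
    obtain c r where cr: "p = pCons c r" by (cases p)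
    have "Polynomial.coeff r i = 0" if "n \<le> i" for i
      using p that unfolding cr by (auto dest: spec[of _ "Suc i"])
    then show "p \<in> (\<lambda>(c, p). pCons c p) ` (UNIV \<times> ?S n)" unfolding cr by force
  next
    fix p :: "'k poly" assume "p \<in> (\<lambda>(c, p). pCons c p) ` (UNIV \<times> ?S n)"
    then show "p \<in> ?S (Suc n)" by (auto simp: coeff_pCons split: nat.splits)
  qed
  have "inj_on (\<lambda>(c, p). pCons c p) (UNIV \<times> ?S n)" by (auto simp: inj_on_def)
  then show ?case unfolding eq using Suc by (simp add: card_image card_cartesian_product)
qed

lemma poly_degree_less_iff:
  "0 < n \<Longrightarrow> Polynomial.degree p < n \<longleftrightarrow> (\<forall>i\<ge>n. Polynomial.coeff p i = 0)"
  by (metis coeff_eq_0 degree_lessI le_degree not_le order_less_le_trans)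

lemma finite_poly_degree_le: "finite {p :: 'k::{field,finite} poly. Polynomial.degree p \<le> n}"
proof -
  have "{p :: 'k poly. Polynomial.degree p \<le> n} \<subseteq> {p. \<forall>i\<ge>Suc n. Polynomial.coeff p i = 0}"
    by (auto intro: coeff_eq_0)
  then show ?thesis using card_poly_degree_less[of "Suc n"] by (blast intro: finite_subset)
qed

lemma irreducible_degree_pos:
  fixes P :: "'k::field poly"
  assumes "Factorial_Ring.irreducible P"
  shows "0 < Polynomial.degree P"
  using assms unfolding Factorial_Ring.irreducible_def by (metis gr0I is_unit_iff_degree)

lemma ord_at_decompose:
  fixes P :: "'k::field poly"
  assumes "Polynomial.degree P > 0" "a \<noteq> 0"
  obtains a' where "a = P ^ ord_at P a * a'" "\<not> P dvd a'"
proof -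
  have P0: "P \<noteq> 0" using assms by auto
  have bound: "n \<le> Polynomial.degree a" if "P ^ n dvd a" for n
  proof -
    have "n * Polynomial.degree P \<le> Polynomial.degree a"
      using dvd_imp_degree_le[OF that assms(2)] P0 by (simp add: degree_power_eq)
    moreover have "n * 1 \<le> n * Polynomial.degree P" using assms(1) by (intro mult_le_mono) auto
    ultimately show ?thesis by linarith
  qed
  then have "{n. P ^ n dvd a} \<subseteq> {..Polynomial.degree a}" by (intro subsetI) simp
  then have fin: "finite {n. P ^ n dvd a}" by (rule finite_subset) simp
  have "0 \<in> {n. P ^ n dvd a}" by simp
  then have "P ^ ord_at P a dvd a" unfolding ord_at_def using Max_in[OF fin] by blast
  then obtain a' where a': "a = P ^ ord_at P a * a'" by (elim dvdE)
  moreover have "\<not> P dvd a'"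
  proof
    assume "P dvd a'"
    then have "P ^ Suc (ord_at P a) dvd a"
      using a' by (metis mult.commute mult_dvd_mono power_Suc dvd_refl)
    then have "Suc (ord_at P a) \<le> ord_at P a" unfolding ord_at_def using Max_ge[OF fin] by blast
    then show False by simp
  qed
  ultimately show ?thesis by (rule that)
qed

lemma ord_at_eq:
  fixes P :: "'k::field poly"
  assumes "P \<noteq> 0" "\<not> P dvd a'"
  shows "ord_at P (P ^ k * a') = k"
proof -
  have "P ^ n dvd P ^ k * a' \<longleftrightarrow> n \<le> k" for n
  proof
    assume dvd: "P ^ n dvd P ^ k * a'"
    show "n \<le> k"
    proof (rule ccontr)
      assume "\<not> n \<le> k"
      then have "P ^ n = P ^ k * P ^ (n - k)" by (simp add: power_add[symmetric])
      then have "P ^ (n - k) dvd a'" using dvd assms(1) by simp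
      moreover have "P dvd P ^ (n - k)" using \<open>\<not> n \<le> k\<close> by (simp add: dvd_power)
      ultimately show False using assms(2) dvd_trans by blast
    qed
  qed (simp add: le_imp_power_dvd dvd_mult2)
  then have "{n. P ^ n dvd P ^ k * a'} = {..k}" by auto
  then show ?thesis unfolding ord_at_def by (simp add: Max_eq_iff)
qed

lemma monic_irreducible_dvd_eq:
  fixes P R :: "'k::field poly"
  assumes "Factorial_Ring.irreducible P" "Factorial_Ring.irreducible R" "P dvd R"
    "Polynomial.lead_coeff P = 1" "Polynomial.lead_coeff R = 1"
  shows "P = R"
proof -
  obtain u where u: "R = P * u" using assms(3) by (elim dvdE)
  then have "u dvd 1" using assms(1,2) unfolding Factorial_Ring.irreducible_def by blast
  then obtain c where c: "u = [:c:]" by (metis is_unit_iff_degree degree_eq_zeroE not_is_unit_0)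
  then have "Polynomial.lead_coeff R = Polynomial.lead_coeff P * c" unfolding u lead_coeff_mult by simp
  then have "1 = 1 * c" unfolding assms(4,5) .
  then show ?thesis using u c by simp
qed

section \<open>Places of F: uniformizers and residue fields\<close>

context function_field
begin

lemma embed_A_simps:
  "embed_A \<iota> (a + b) = embed_A \<iota> a + embed_A \<iota> b" "embed_A \<iota> (a * b) = embed_A \<iota> a * embed_A \<iota> b"
  "embed_A \<iota> (a - b) = embed_A \<iota> a - embed_A \<iota> b" "embed_A \<iota> 1 = 1" "embed_A \<iota> 0 = 0"
  unfolding embed_A_def
  by (simp_all add: hom.add[symmetric] hom.mult[symmetric] hom.diff[symmetric] One_fract_def[symmetric] Zero_fract_def[symmetric])

lemma embed_A_eq_0_iff [simp]: "embed_A \<iota> a = 0 \<longleftrightarrow> a = 0"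
  unfolding embed_A_def by (simp add: Zero_fract_def eq_fract)

lemma embed_A_power: "embed_A \<iota> (a ^ n) = embed_A \<iota> a ^ n"
  by (induction n) (simp_all add: embed_A_simps)

lemma \<iota>_Fract: "\<iota> (Fraction_Field.Fract a b) = embed_A \<iota> a / embed_A \<iota> b"
  unfolding embed_A_def by (simp add: hom.divide[symmetric])

definition finite_place :: "'k poly \<Rightarrow> ('a \<Rightarrow> real) \<Rightarrow> bool" where
  "finite_place P v \<longleftrightarrow> v \<in> places \<iota> \<and> Polynomial.lead_coeff P = 1 \<and> Factorial_Ring.irreducible P \<and>
     extends_finite_place \<iota> P v"

definition infinite_place :: "('a \<Rightarrow> real) \<Rightarrow> bool" where
  "infinite_place v \<longleftrightarrow> v \<in> places \<iota> \<and> extends_infinite_place \<iota> v"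

lemma places_cases:
  assumes "v \<in> places \<iota>"
  obtains P where "finite_place P v" | "infinite_place v"
  using assms unfolding places_def finite_place_def infinite_place_def by blast

lemma finite_place_ord:
  assumes "finite_place P v" "a \<noteq> 0"
  shows "v (embed_A \<iota> a) = real q powr (- real (Polynomial.degree P) * real (ord_at P a))"
proof -
  have "0 < Polynomial.degree P" using assms(1) irreducible_degree_pos unfolding finite_place_def by blast
  moreover from this have "P \<noteq> 0" by auto
  ultimately have "P \<noteq> 0" "\<not> P dvd 1" using is_unit_iff_degree[of P] by auto
  then have "ord_at P 1 = 0" using ord_at_eq[of P 1 0] by simp
  moreover have "v (\<iota> (Fraction_Field.Fract a 1)) =
      real CARD('k) powr (- real (Polynomial.degree P) * (real (ord_at P a) - real (ord_at P 1)))"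
    using assms unfolding finite_place_def extends_finite_place_def by (metis one_neq_zero)
  ultimately show ?thesis unfolding embed_A_def q_eq by simp
qed

lemma infinite_place_degree:
  assumes "infinite_place v" "a \<noteq> 0"
  shows "v (embed_A \<iota> a) = real q ^ Polynomial.degree a"
proof -
  have "v (\<iota> (Fraction_Field.Fract a 1)) =
      real CARD('k) powr (real (Polynomial.degree a) - real (Polynomial.degree (1 :: 'k poly)))"
    using assms unfolding infinite_place_def extends_infinite_place_def by (metis one_neq_zero)
  then show ?thesis unfolding embed_A_def q_eq by (simp add: powr_realpow)
qed

lemma finite_place_less_1_iff:
  assumes "finite_place P v" "a \<noteq> 0"
  shows "v (embed_A \<iota> a) < 1 \<longleftrightarrow> P dvd a" "v (embed_A \<iota> a) \<le> 1"
proof -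
  have deg: "0 < Polynomial.degree P" using assms(1) irreducible_degree_pos unfolding finite_place_def by blast
  obtain a' where a': "a = P ^ ord_at P a * a'" "\<not> P dvd a'" using ord_at_decompose[OF deg assms(2)] .
  have "P dvd a \<longleftrightarrow> 0 < ord_at P a"
    using a' by (metis dvd_mult2 dvd_power gr0I mult_1 power_0)
  moreover have "v (embed_A \<iota> a) < 1 \<longleftrightarrow> 0 < ord_at P a"
  proof (cases "ord_at P a = 0")
    case False
    then have "real q powr (- real (Polynomial.degree P) * real (ord_at P a)) < real q powr 0"
      using q_gt_1 deg by (intro powr_less_mono) auto
    then show ?thesis unfolding finite_place_ord[OF assms] using False q_gt_1 by simp
  qed (use q_gt_1 in \<open>simp add: finite_place_ord[OF assms]\<close>)
  ultimately show "v (embed_A \<iota> a) < 1 \<longleftrightarrow> P dvd a" by simp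
  show "v (embed_A \<iota> a) \<le> 1"
    unfolding finite_place_ord[OF assms] using q_gt_1 powr_mono[of "- real (Polynomial.degree P) * real (ord_at P a)" 0 "real q"]
    by simp
qed

text \<open>The structure of the completion of \<open>F\<close> at the place below \<open>v\<close>: a uniformizer \<open>\<pi>\<close> and a set
  \<open>T\<close> of representatives of the residue field, which has \<open>q ^ d\<close> elements.\<close>

definition base_place :: "('a \<Rightarrow> real) \<Rightarrow> 'k poly fract \<Rightarrow> nat \<Rightarrow> 'k poly fract set \<Rightarrow> bool" where
  "base_place v \<pi> d T \<longleftrightarrow> 0 < d \<and> \<pi> \<noteq> 0 \<and> v (\<iota> \<pi>) = real q powr (- real d) \<and>
     (\<forall>x. x \<noteq> 0 \<longrightarrow> (\<exists>k. v (\<iota> x) = v (\<iota> \<pi>) powi k)) \<and> finite T \<and> card T = q ^ d \<and>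
     (\<forall>s\<in>T. v (\<iota> s) \<le> 1) \<and> (\<forall>x. v (\<iota> x) \<le> 1 \<longrightarrow> (\<exists>!s. s \<in> T \<and> v (\<iota> (x - s)) < 1))"

lemma inj_Fract_1: "inj (\<lambda>a :: 'k poly. Fraction_Field.Fract a 1)"
  by (auto simp: inj_on_def eq_fract)

text \<open>Remainders modulo \<open>P\<close> represent the residue field. They are distinct there
  because \<open>P\<close> cannot divide a nonzero difference of smaller degree. To reach an
  arbitrary integral fraction, the power of \<open>P\<close> in the denominator is cancelled, after
  which the denominator \<open>b'\<close> is prime to \<open>P\<close> and has to be
  inverted.\<close>

lemma finite_place_base:
  assumes P: "finite_place P v"
  shows "base_place v (Fraction_Field.Fract P 1) (Polynomial.degree P)
    ((\<lambda>a. Fraction_Field.Fract a 1) ` {a. Polynomial.degree a < Polynomial.degree P})"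
proof -
  interpret v: nonarch_abs v using P places_nonarch unfolding finite_place_def by blast
  define d where "d = Polynomial.degree P"
  have d: "0 < d" using P irreducible_degree_pos unfolding finite_place_def d_def by blast
  then have P0: "P \<noteq> 0" unfolding d_def by auto
  have "\<not> P dvd 1" using d is_unit_iff_degree[OF P0] unfolding d_def by simp
  then have "ord_at P P = 1" using ord_at_eq[OF P0, of 1 1] by simp
  then have v\<pi>: "v (\<iota> (Fraction_Field.Fract P 1)) = real q powr (- real d)"
    using finite_place_ord[OF P P0] unfolding embed_A_def d_def by simp
  have group: "\<exists>k. v (\<iota> x) = v (\<iota> (Fraction_Field.Fract P 1)) powi k" if "x \<noteq> 0" for x
  proof (cases x rule: Fract_cases_nonzero)
    case (Fract a b)
    have "v (\<iota> x) = v (embed_A \<iota> a) / v (embed_A \<iota> b)" unfolding Fract(1) \<iota>_Fract by (rule v.divide)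
    also have "\<dots> = real q powr (- real d * real_of_int (int (ord_at P a) - int (ord_at P b)))"
      unfolding finite_place_ord[OF P Fract(2)] finite_place_ord[OF P Fract(3)] d_def
      by (simp add: powr_diff[symmetric] algebra_simps)
    also have "\<dots> = (real q powr (- real d)) powr real_of_int (int (ord_at P a) - int (ord_at P b))"
      by (simp only: powr_powr)
    also have "\<dots> = (real q powr (- real d)) powi (int (ord_at P a) - int (ord_at P b))"
      using q_gt_1 by (intro powr_real_of_int') auto
    finally show ?thesis unfolding v\<pi> by blast
  qed (use that in simp)
  define S where "S = {a :: 'k poly. Polynomial.degree a < d}"
  have S: "finite S" "card S = q ^ d"
    using card_poly_degree_less[of d, where 'k = 'k] unfolding S_def q_eq by (simp_all add: poly_degree_less_iff[OF d])
  have small_eq: "s = s'" if "s \<in> S" "s' \<in> S" "v (embed_A \<iota> (s - s')) < 1" for s s'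
  proof (rule ccontr)
    assume "s \<noteq> s'"
    then have "P dvd s - s'" using finite_place_less_1_iff[OF P] that(3) by simp
    then have "d \<le> Polynomial.degree (s - s')" unfolding d_def using \<open>s \<noteq> s'\<close> by (intro dvd_imp_degree_le) auto
    then show False using that(1,2) degree_diff_less[of s d s'] unfolding S_def by simp
  qed
  have exist: "\<exists>s\<in>S. v (\<iota> x - embed_A \<iota> s) < 1" if x: "v (\<iota> x) \<le> 1" for x
  proof (cases x rule: Fract_cases_nonzero)
    case 0
    then show ?thesis using d by (intro bexI[of _ 0]) (auto simp: S_def embed_A_simps)
  next
    case (Fract a b)
    obtain a' where a': "a = P ^ ord_at P a * a'" "\<not> P dvd a'"
      using ord_at_decompose[of P a] d Fract unfolding d_def by blast
    obtain b' where b': "b = P ^ ord_at P b * b'" "\<not> P dvd b'"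
      using ord_at_decompose[of P b] d Fract unfolding d_def by blast
    have nz: "a' \<noteq> 0" "b' \<noteq> 0" using a' b' by auto
    have "0 < v (embed_A \<iota> b)" using Fract by simp
    then have "v (embed_A \<iota> a) \<le> v (embed_A \<iota> b)"
      using x unfolding Fract(1) \<iota>_Fract v.divide by (simp only: pos_divide_le_eq mult_1_left)
    then have "ord_at P b \<le> ord_at P a"
      unfolding finite_place_ord[OF P Fract(2)] finite_place_ord[OF P Fract(3)]
      using q_gt_1 d unfolding d_def by simp
    define c where "c = P ^ (ord_at P a - ord_at P b) * a'"
    have ac: "a = P ^ ord_at P b * c"
      using a' \<open>ord_at P b \<le> ord_at P a\<close> unfolding c_def by (simp add: mult.assoc[symmetric] power_add[symmetric])
    have \<iota>x: "\<iota> x = embed_A \<iota> c / embed_A \<iota> b'"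
    proof -
      have "\<iota> x = (embed_A \<iota> (P ^ ord_at P b) * embed_A \<iota> c) / (embed_A \<iota> (P ^ ord_at P b) * embed_A \<iota> b')"
        unfolding Fract(1) \<iota>_Fract using ac b'(1) by (metis embed_A_simps(2))
      then show ?thesis using P0 by simp
    qed
    have vb': "v (embed_A \<iota> b') = 1"
      using finite_place_less_1_iff[OF P nz(2)] b'(2) by simp
    \<comment> \<open>Multiplication by \<open>b'\<close> modulo \<open>P\<close> is injective on
      the finite set of remainders, hence onto; this inverts \<open>b'\<close> in the residue
      field.\<close>
    have "inj_on (\<lambda>s. (b' * s) mod P) S"
    proof (rule inj_onI)
      fix s s' assume s: "s \<in> S" "s' \<in> S" "(b' * s) mod P = (b' * s') mod P"
      show "s = s'"
      proof (rule ccontr)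
        assume ne: "s \<noteq> s'"
        have "P dvd b' * (s - s')" using s(3) by (simp add: mod_eq_dvd_iff algebra_simps)
        then have "v (embed_A \<iota> (b' * (s - s'))) < 1"
          using finite_place_less_1_iff(1)[OF P, of "b' * (s - s')"] ne nz by simp
        then have "v (embed_A \<iota> (s - s')) < 1" unfolding embed_A_simps(2) v.mult vb' by simp
        then show False using small_eq s ne by blast
      qed
    qed
    moreover have mod_S: "y mod P \<in> S" for y
      using degree_mod_less[OF P0, of y] d unfolding S_def d_def by (cases "y mod P = 0") auto
    then have "(\<lambda>s. (b' * s) mod P) ` S \<subseteq> S" by blast
    ultimately have surj: "(\<lambda>s. (b' * s) mod P) ` S = S" by (intro endo_inj_surj S(1))
    have "c mod P \<in> (\<lambda>s. (b' * s) mod P) ` S" unfolding surj by (rule mod_S)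
    then obtain s where s: "s \<in> S" "c mod P = (b' * s) mod P" by auto
    then have dvd: "P dvd c - b' * s" by (simp add: mod_eq_dvd_iff)
    have "v (embed_A \<iota> (c - b' * s)) < 1"
      using finite_place_less_1_iff(1)[OF P, of "c - b' * s"] dvd by (cases "c - b' * s = 0") (auto simp: embed_A_simps)
    moreover have "\<iota> x - embed_A \<iota> s = embed_A \<iota> (c - b' * s) / embed_A \<iota> b'"
      unfolding \<iota>x embed_A_simps using nz by (simp add: field_simps)
    ultimately show ?thesis using s(1) vb' by (metis v.divide div_by_1)
  qed
  have ex1: "\<exists>!s. s \<in> (\<lambda>a. Fraction_Field.Fract a 1) ` S \<and> v (\<iota> (x - s)) < 1" if x: "v (\<iota> x) \<le> 1" for x
  proof -
    obtain s where s: "s \<in> S" "v (\<iota> x - embed_A \<iota> s) < 1" using exist[OF x] by blast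
    show ?thesis
    proof (rule ex1I[of _ "Fraction_Field.Fract s 1"])
      show "Fraction_Field.Fract s 1 \<in> (\<lambda>a. Fraction_Field.Fract a 1) ` S \<and> v (\<iota> (x - Fraction_Field.Fract s 1)) < 1"
        using s by (simp add: hom.diff embed_A_def)
      fix y assume "y \<in> (\<lambda>a. Fraction_Field.Fract a 1) ` S \<and> v (\<iota> (x - y)) < 1"
      then obtain s' where s': "s' \<in> S" "y = Fraction_Field.Fract s' 1" "v (\<iota> x - embed_A \<iota> s') < 1"
        by (auto simp: hom.diff embed_A_def)
      have "embed_A \<iota> (s' - s) = (\<iota> x - embed_A \<iota> s) - (\<iota> x - embed_A \<iota> s')" by (simp add: embed_A_simps)
      then have "v (embed_A \<iota> (s' - s)) < 1"
        using v.ultra_diff[of "\<iota> x - embed_A \<iota> s" "\<iota> x - embed_A \<iota> s'"] s(2) s'(3) by simp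
      then show "y = Fraction_Field.Fract s 1" using small_eq s(1) s'(1,2) by blast
    qed
  qed
  have "card ((\<lambda>a. Fraction_Field.Fract a 1) ` S) = q ^ d"
    using card_image[OF inj_on_subset[OF inj_Fract_1], of S] S by simp
  moreover have "v (\<iota> s) \<le> 1" if s: "s \<in> (\<lambda>a. Fraction_Field.Fract a 1) ` S" for s
  proof -
    obtain a where "s = Fraction_Field.Fract a 1" using s by auto
    then show ?thesis using finite_place_less_1_iff(2)[OF P, of a] by (cases "a = 0") (auto simp: embed_A_def[symmetric] embed_A_simps)
  qed
  moreover have "Fraction_Field.Fract P 1 \<noteq> 0" using P0 by (simp add: Zero_fract_def eq_fract)
  ultimately show ?thesis
    unfolding base_place_def S_def[symmetric] d_def[symmetric] using d v\<pi> group S(1) ex1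
    by (intro conjI allI impI ballI) auto
qed

text \<open>At infinity \<open>1/t\<close> is a uniformizer. The residue of an integral fraction is
  the quotient of the two coefficients in the degree of the denominator, which is 0 when the
  numerator has smaller degree.\<close>

lemma infinite_place_base:
  assumes P: "infinite_place v"
  shows "base_place v (Fraction_Field.Fract 1 [:0, 1:]) 1 (range (\<lambda>c. Fraction_Field.Fract [:c:] 1))"
proof -
  interpret v: nonarch_abs v using P places_nonarch unfolding infinite_place_def by blast
  have v\<pi>: "v (\<iota> (Fraction_Field.Fract 1 [:0, 1:])) = real q powr (- real 1)"
    unfolding \<iota>_Fract v.divide using infinite_place_degree[OF P, of 1] infinite_place_degree[OF P, of "[:0, 1:]"]
    using q_gt_1 by (simp add: powr_minus divide_inverse)
  have v_Fract: "v (\<iota> (Fraction_Field.Fract a b)) = real q ^ Polynomial.degree a / real q ^ Polynomial.degree b"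
    if "a \<noteq> 0" "b \<noteq> 0" for a b
    unfolding \<iota>_Fract v.divide using infinite_place_degree[OF P] that by simp
  have group: "\<exists>k. v (\<iota> x) = v (\<iota> (Fraction_Field.Fract 1 [:0, 1:])) powi k" if "x \<noteq> 0" for x
  proof (cases x rule: Fract_cases_nonzero)
    case (Fract a b)
    have "v (\<iota> x) = (real q powr (- real 1)) powi (int (Polynomial.degree b) - int (Polynomial.degree a))"
      unfolding Fract(1) v_Fract[OF Fract(3,2)] using q_gt_1
      by (simp add: powr_minus power_int_diff power_inverse field_simps)
    then show ?thesis unfolding v\<pi> by blast
  qed (use that in simp)
  have exist: "\<exists>c. v (\<iota> x - \<epsilon> c) < 1" if x: "v (\<iota> x) \<le> 1" for x
  proof (cases x rule: Fract_cases_nonzero)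
    case 0
    then show ?thesis by (intro exI[of _ 0]) simp
  next
    case (Fract a b)
    have "real q ^ Polynomial.degree a \<le> real q ^ Polynomial.degree b"
      using x v_Fract[OF Fract(3,2)] q_gt_1 unfolding Fract(1) by (simp add: divide_le_eq_1)
    then have deg: "Polynomial.degree a \<le> Polynomial.degree b" using q_gt_1 by simp
    define n where "n = Polynomial.degree b"
    define c where "c = Polynomial.coeff a n / Polynomial.coeff b n"
    define r where "r = a - [:c:] * b"
    have "Polynomial.coeff b n \<noteq> 0" unfolding n_def using Fract by simp
    then have "Polynomial.coeff r i = 0" if "n \<le> i" for i
      using that deg unfolding r_def c_def n_def by (cases "i = n") (auto simp: coeff_eq_0 n_def)
    then have r: "r = 0 \<or> Polynomial.degree r < n" by (metis degree_lessI leading_coeff_0_iff not_le)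
    have "\<iota> x - \<epsilon> c = \<iota> (Fraction_Field.Fract r b)"
      unfolding Fract(1) \<iota>_Fract r_def \<epsilon>_def embed_A_simps using Fract(2) by (simp add: field_simps)
    also have "v \<dots> < 1"
    proof (cases "r = 0")
      case True
      then show ?thesis by (simp add: \<iota>_Fract embed_A_simps)
    next
      case False
      then show ?thesis using v_Fract[OF False Fract(2)] r q_gt_1 by (simp add: n_def power_strict_increasing)
    qed
    finally show ?thesis by blast
  qed
  have ex1: "\<exists>!s. s \<in> range (\<lambda>c. Fraction_Field.Fract [:c:] 1) \<and> v (\<iota> (x - s)) < 1" if x: "v (\<iota> x) \<le> 1" for x
  proof -
    obtain c where c: "v (\<iota> x - \<epsilon> c) < 1" using exist[OF x] by blast
    show ?thesis
    proof (rule ex1I[of _ "Fraction_Field.Fract [:c:] 1"])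
      show "Fraction_Field.Fract [:c:] 1 \<in> range (\<lambda>c. Fraction_Field.Fract [:c:] 1) \<and> v (\<iota> (x - Fraction_Field.Fract [:c:] 1)) < 1"
        using c by (simp add: hom.diff embed_A_def \<epsilon>_def)
      fix y assume "y \<in> range (\<lambda>c. Fraction_Field.Fract [:c:] 1) \<and> v (\<iota> (x - y)) < 1"
      then obtain c' where c': "y = Fraction_Field.Fract [:c':] 1" "v (\<iota> x - \<epsilon> c') < 1"
        by (auto simp: hom.diff embed_A_def \<epsilon>_def)
      have "\<epsilon> (c' - c) + \<epsilon> c = \<epsilon> c'" by (simp add: \<epsilon>_add[symmetric])
      then have "\<epsilon> (c' - c) = (\<iota> x - \<epsilon> c) - (\<iota> x - \<epsilon> c')" by (simp add: algebra_simps)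
      then have "v (\<epsilon> (c' - c)) < 1"
        using v.ultra_diff[of "\<iota> x - \<epsilon> c" "\<iota> x - \<epsilon> c'"] c c'(2) by simp
      then have "c' - c = 0" using abs_\<epsilon>[OF v.nonarch_abs_axioms, of "c' - c"] by fastforce
      then show "y = Fraction_Field.Fract [:c:] 1" using c' by simp
    qed
  qed
  have "inj (\<lambda>c :: 'k. Fraction_Field.Fract [:c:] 1)" by (auto simp: inj_on_def eq_fract)
  then have "card (range (\<lambda>c :: 'k. Fraction_Field.Fract [:c:] 1)) = q ^ 1" using card_image q_eq by simp
  moreover have "v (\<iota> s) \<le> 1" if s: "s \<in> range (\<lambda>c. Fraction_Field.Fract [:c:] 1)" for s
  proof -
    obtain c where "s = Fraction_Field.Fract [:c:] 1" using s by auto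
    then have "\<iota> s = \<epsilon> c" by (simp add: \<epsilon>_def embed_A_def)
    then show ?thesis using abs_\<epsilon>[OF v.nonarch_abs_axioms, of c] by (cases "c = 0") auto
  qed
  moreover have "Fraction_Field.Fract 1 [:0, 1 :: 'k:] \<noteq> 0" by (simp add: Zero_fract_def eq_fract)
  ultimately show ?thesis
    unfolding base_place_def using v\<pi> group ex1 by (intro conjI allI impI ballI) auto
qed

lemma places_base:
  assumes "v \<in> places \<iota>"
  obtains \<pi> d T where "base_place v \<pi> d T"
  using places_cases[OF assms] finite_place_base infinite_place_base by metis

end

section \<open>Separation, approximation and finiteness of places\<close>

context function_field
begin

lemma base_placeD:
  assumes "base_place v \<pi> d T"
  shows "0 < d" "\<pi> \<noteq> 0" "v (\<iota> \<pi>) = real q powr (- real d)" "x \<noteq> 0 \<Longrightarrow> \<exists>k. v (\<iota> x) = v (\<iota> \<pi>) powi k"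
    "finite T" "card T = q ^ d" "s \<in> T \<Longrightarrow> v (\<iota> s) \<le> 1"
    "v (\<iota> x) \<le> 1 \<Longrightarrow> \<exists>!s. s \<in> T \<and> v (\<iota> (x - s)) < 1" "0 < v (\<iota> \<pi>)" "v (\<iota> \<pi>) < 1"
proof -
  show "0 < v (\<iota> \<pi>)" "v (\<iota> \<pi>) < 1"
    using assms q_gt_1 powr_less_mono[of "- real d" 0 "real q"] unfolding base_place_def by auto
qed (use assms in \<open>auto simp: base_place_def\<close>)

lemma base_place_cong:
  assumes "base_place v \<pi> d T" "\<And>x. w (\<iota> x) = v (\<iota> x)"
  shows "base_place w \<pi> d T"
  using assms(1) unfolding base_place_def assms(2) .

lemma base_place_discrete:
  assumes "base_place v \<pi> d T" "v (\<iota> x) < 1" "nonarch_abs v"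
  shows "v (\<iota> x) \<le> v (\<iota> \<pi>)"
proof (cases "x = 0")
  case True
  then show ?thesis using nonarch_abs.zero[OF assms(3)] nonarch_abs.nonneg[OF assms(3)] by simp
next
  case False
  obtain k where k: "v (\<iota> x) = v (\<iota> \<pi>) powi k" using base_placeD(4)[OF assms(1) False] by blast
  note \<pi> = base_placeD(9,10)[OF assms(1)]
  have "1 \<le> k"
  proof (rule ccontr)
    assume "\<not> 1 \<le> k"
    then have "v (\<iota> \<pi>) powi 0 \<le> v (\<iota> \<pi>) powi k" using \<pi> by (intro power_int_decreasing) auto
    then show False using k assms(2) by simp
  qed
  then have "v (\<iota> \<pi>) powi k \<le> v (\<iota> \<pi>) powi 1" using \<pi> by (intro power_int_decreasing) auto
  then show ?thesis using k by simp
qed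

lemma places_value:
  assumes "v \<in> places \<iota>" "base_place v \<pi> d T" "x \<noteq> 0"
  shows "\<exists>m>0. \<exists>k. v x ^ m = v (\<iota> \<pi>) powi k"
proof -
  interpret v: nonarch_abs v by (rule places_nonarch[OF assms(1)])
  obtain m a where "m > 0" "a \<noteq> 0" "v x ^ m = v (\<iota> a)"
    using v.algebraic_value[OF hom.field_morphism_axioms algebraic assms(3)] by blast
  then show ?thesis using base_placeD(4)[OF assms(2)] by metis
qed

lemma places_nontrivial:
  assumes "v \<in> places \<iota>"
  shows "\<exists>z. v z > 1"
proof -
  interpret v: nonarch_abs v by (rule places_nonarch[OF assms(1)])
  obtain \<pi> d T where b: "base_place v \<pi> d T" using places_base[OF assms] .
  have "v (inverse (\<iota> \<pi>)) > 1" unfolding v.inverse using base_placeD(9,10)[OF b] by (simp only: one_less_inverse)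
  then show ?thesis by blast
qed

lemma infinite_place_\<iota>_eq: "infinite_place v \<Longrightarrow> infinite_place w \<Longrightarrow> v (\<iota> x) = w (\<iota> x)"
  and finite_place_\<iota>_eq: "finite_place P v \<Longrightarrow> finite_place P w \<Longrightarrow> v (\<iota> x) = w (\<iota> x)"
proof -
  have *: "v (\<iota> x) = w (\<iota> x)" if "nonarch_abs v" "nonarch_abs w"
    "\<And>a. a \<noteq> 0 \<Longrightarrow> v (embed_A \<iota> a) = w (embed_A \<iota> a)" for v w :: "'a \<Rightarrow> real"
  proof (cases x rule: Fract_cases_nonzero)
    case (Fract a b)
    then show ?thesis unfolding Fract(1) \<iota>_Fract nonarch_abs.divide[OF that(1)] nonarch_abs.divide[OF that(2)]
      using that(3) by simp
  next
    case 0
    then show ?thesis by (simp add: nonarch_abs.zero[OF that(1)] nonarch_abs.zero[OF that(2)])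
  qed
  show "infinite_place v \<Longrightarrow> infinite_place w \<Longrightarrow> v (\<iota> x) = w (\<iota> x)"
    by (rule *) (auto simp: infinite_place_degree infinite_place_def intro: places_nonarch)
  show "finite_place P v \<Longrightarrow> finite_place P w \<Longrightarrow> v (\<iota> x) = w (\<iota> x)"
    by (rule *) (auto simp: finite_place_ord, auto simp: finite_place_def intro: places_nonarch)
qed

text \<open>The prime \<open>P\<close> of a finite place has size at least 1 at all places over
  other primes and at infinity; for an infinite place \<open>1/t\<close> has the same
  effect.\<close>

lemma places_separated_base:
  assumes v: "v \<in> places \<iota>" and w: "w \<in> places \<iota>" and ne: "v (\<iota> x) \<noteq> w (\<iota> x)"
  shows "\<exists>y. v y < 1 \<and> w y \<ge> 1"
  using v
proof (cases rule: places_cases)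
  case P: (1 P)
  then have irr: "Factorial_Ring.irreducible P" "Polynomial.lead_coeff P = 1" unfolding finite_place_def by auto
  then have P0: "P \<noteq> 0" by auto
  have vP: "v (embed_A \<iota> P) < 1" using finite_place_less_1_iff(1)[OF P P0] by simp
  show ?thesis
    using w
  proof (cases rule: places_cases)
    case R: (1 R)
    then have "P \<noteq> R" using ne P finite_place_\<iota>_eq by blast
    then have "\<not> R dvd P" using monic_irreducible_dvd_eq irr R unfolding finite_place_def by blast
    then have "w (embed_A \<iota> P) \<ge> 1" using finite_place_less_1_iff(1)[OF R P0] by simp
    then show ?thesis using vP by blast
  next
    case R: 2
    have "w (embed_A \<iota> P) \<ge> 1" unfolding infinite_place_degree[OF R P0] using q_gt_1 by simp
    then show ?thesis using vP by blast
  qed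
next
  case P: 2
  interpret w: nonarch_abs w by (rule places_nonarch[OF w])
  interpret v: nonarch_abs v by (rule places_nonarch[OF v])
  obtain R where R: "finite_place R w" using w P ne infinite_place_\<iota>_eq by (metis places_cases)
  have "w (embed_A \<iota> [:0, 1:]) \<le> 1" using finite_place_less_1_iff(2)[OF R] by simp
  then have "w (inverse (embed_A \<iota> [:0, 1:])) \<ge> 1" unfolding w.inverse by (intro one_le_inverse) auto
  moreover have "v (inverse (embed_A \<iota> [:0, 1:])) < 1"
    unfolding v.inverse using infinite_place_degree[OF P, of "[:0, 1:]"] q_gt_1 by (simp add: inverse_less_1_iff)
  ultimately show ?thesis by blast
qed

text \<open>Otherwise \<open>v\<close> and \<open>w\<close> agree on F, and \<open>v y < 1\<close>
  implies \<open>w y < 1\<close>. For \<open>v u = 1\<close> the elements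
  \<open>u ^ n * \<pi>\<close> are below 1 at \<open>v\<close>, hence at \<open>w\<close>; so the
  powers of \<open>w u\<close> stay bounded and \<open>w u \<le> 1\<close>. Applied to the inverse
  as well, this makes units of \<open>v\<close> units of \<open>w\<close>. Every
  \<open>x \<noteq> 0\<close> has a power that is such a unit times an element of F, so
  \<open>v\<close> and \<open>w\<close> agree everywhere.\<close>

lemma places_separated_weak:
  assumes v: "v \<in> places \<iota>" and w: "w \<in> places \<iota>" and ne: "v \<noteq> w"
  shows "\<exists>y. v y < 1 \<and> w y \<ge> 1"
proof (rule ccontr)
  assume neg: "\<not> ?thesis"
  then have eq: "v (\<iota> x) = w (\<iota> x)" for x using places_separated_base[OF v w] by blast
  have imp: "w y < 1" if "v y < 1" for y using neg that by (meson not_le)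
  interpret v: nonarch_abs v by (rule places_nonarch[OF v])
  interpret w: nonarch_abs w by (rule places_nonarch[OF w])
  obtain \<pi> d T where b: "base_place v \<pi> d T" using places_base[OF v] .
  note \<pi> = base_placeD(9,10)[OF b]
  have le: "w u \<le> 1" if "v u = 1" for u
  proof (rule ccontr)
    assume "\<not> w u \<le> 1"
    then obtain n where n: "1 / v (\<iota> \<pi>) < w u ^ n" using real_arch_pow[of "w u"] by auto
    have "v (u ^ n * \<iota> \<pi>) < 1" using that \<pi> by (simp add: v.mult v.power)
    then have "w (u ^ n * \<iota> \<pi>) < 1" by (rule imp)
    then have "w u ^ n * v (\<iota> \<pi>) < 1" using eq by (simp add: w.mult w.power)
    then show False using n \<pi>(1) by (simp add: field_simps)
  qed
  have unit: "w u = 1" if "v u = 1" for u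
  proof -
    have "u \<noteq> 0" using that by auto
    have "w (inverse u) \<le> 1" using le[of "inverse u"] that by (simp add: v.inverse)
    then have "1 \<le> w u" unfolding w.inverse using \<open>u \<noteq> 0\<close> by (simp add: inverse_le_1_iff)
    then show ?thesis using le[OF that] by simp
  qed
  have "v x = w x" for x
  proof (cases "x = 0")
    case False
    obtain m a where a: "m > 0" "a \<noteq> 0" "v x ^ m = v (\<iota> a)"
      using v.algebraic_value[OF hom.field_morphism_axioms algebraic False] by blast
    then have "v (x ^ m / \<iota> a) = 1" by (simp add: v.divide v.power)
    then have "w (x ^ m / \<iota> a) = 1" by (rule unit)
    then have "w x ^ m = v x ^ m" using a eq by (simp add: w.divide w.power)
    then show ?thesis using power_eq_imp_eq_base[of "w x" m "v x"] a(1) by simp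
  qed simp
  then show False using ne by blast
qed

lemma places_separated:
  assumes "v \<in> places \<iota>" "w \<in> places \<iota>" "v \<noteq> w"
  shows "\<exists>z. v z > 1 \<and> w z < 1"
proof -
  interpret v: nonarch_abs v by (rule places_nonarch[OF assms(1)])
  interpret w: nonarch_abs w by (rule places_nonarch[OF assms(2)])
  obtain x where x: "v x < 1" "w x \<ge> 1" using places_separated_weak[OF assms] by blast
  obtain y where y: "w y < 1" "v y \<ge> 1" using places_separated_weak[OF assms(2,1)] assms(3) by blast
  obtain \<pi> d T where b: "base_place v \<pi> d T" using places_base[OF assms(1)] .
  show ?thesis
  proof (cases "x = 0")
    case True
    then show ?thesis using x(2) by simp
  next
    case False
    then have "0 < v x" "0 < w x" by simp_all
    have "v (y / x) > 1" unfolding v.divide using x(1) y(2) \<open>0 < v x\<close> by (simp only: less_divide_eq_1_pos)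
    moreover have "w (y / x) < 1" unfolding w.divide using x(2) y(1) \<open>0 < w x\<close> by (simp only: divide_less_eq_1_pos)
    ultimately show ?thesis by blast
  qed
qed

lemma places_approximation:
  assumes "finite S" "S \<subseteq> places \<iota>" "0 < \<delta>"
  shows "\<exists>x. \<forall>v\<in>S. v (x - \<alpha> v) < \<delta>"
  using assms by (intro weak_approximation) (auto intro: places_nonarch places_nontrivial places_separated)

text \<open>Elements that are independent over the residue field below, in the reductions modulo \<open>\<pi>\<close> at
  several places above it, are independent over \<open>F\<close> after approximation.\<close>

lemma independent_mod_le:
  fixes M :: "('a \<Rightarrow> real) \<Rightarrow> 'i set" and u :: "('a \<Rightarrow> real) \<Rightarrow> 'i \<Rightarrow> 'a"
  assumes S: "finite S" "S \<subseteq> places \<iota>" and b: "\<And>v. v \<in> S \<Longrightarrow> base_place v \<pi> d T"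
    and eq: "\<And>v w x. v \<in> S \<Longrightarrow> w \<in> S \<Longrightarrow> v (\<iota> x) = w (\<iota> x)"
    and M: "\<And>v. v \<in> S \<Longrightarrow> finite (M v)"
    and ind: "\<And>v c. v \<in> S \<Longrightarrow> (\<And>i. i \<in> M v \<Longrightarrow> v (\<iota> (c i)) \<le> 1) \<Longrightarrow>
      v (\<Sum>i\<in>M v. \<iota> (c i) * u v i) \<le> v (\<iota> \<pi>) \<Longrightarrow> \<forall>i\<in>M v. v (\<iota> (c i)) < 1"
  shows "(\<Sum>v\<in>S. card (M v)) \<le> extension_degree \<iota>"
proof (cases "S = {}")
  case False
  then obtain v0 where v0: "v0 \<in> S" by blast
  define \<theta> where "\<theta> = v0 (\<iota> \<pi>)"
  have \<theta>: "0 < \<theta>" using base_placeD(9)[OF b[OF v0]] unfolding \<theta>_def .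
  \<comment> \<open>\<open>z v i\<close> will be close to \<open>u v i\<close> at \<open>v\<close>
    and close to 0 at the other places of \<open>S\<close>; an error below \<theta> is invisible
    modulo \<pi>.\<close>
  have "\<exists>x. \<forall>w\<in>S. w (x - (if w = v then u v i else 0)) < \<theta>" for v i
    using places_approximation[OF S \<theta>, of "\<lambda>w. if w = v then u v i else 0"] .
  then obtain z where z: "\<And>v i w. w \<in> S \<Longrightarrow> w (z v i - (if w = v then u v i else 0)) < \<theta>" by metis
  define I where "I = Sigma S M"
  have fin: "finite I" unfolding I_def using S M by blast
  have "card I \<le> extension_degree \<iota>"
  proof (rule independent_le[OF fin, where u = "\<lambda>(v, i). z v i"])
    fix a assume sum0: "(\<Sum>p\<in>I. \<iota> (a p) * (case p of (v, i) \<Rightarrow> z v i)) = 0"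
    show "\<forall>p\<in>I. a p = 0"
    proof (rule ccontr)
      assume "\<not> ?thesis"
      then obtain p0 where p0: "p0 \<in> I" "a p0 \<noteq> 0" by blast
      \<comment> \<open>A relation is divided by a coefficient of largest size at the place of F
        below. At the place \<open>v\<close> to which this coefficient belongs, only the terms of
        \<open>v\<close> survive modulo \<pi>, against the independence assumed there.\<close>
      define m where "m = Max ((\<lambda>p. v0 (\<iota> (a p))) ` I)"
      have m_ge: "v0 (\<iota> (a p)) \<le> m" if "p \<in> I" for p unfolding m_def using that fin by (intro Max_ge) auto
      have "m \<in> (\<lambda>p. v0 (\<iota> (a p))) ` I" unfolding m_def using fin p0 by (intro Max_in) auto
      then obtain p1 where p1: "p1 \<in> I" "m = v0 (\<iota> (a p1))" by blast
      interpret v0: nonarch_abs v0 using v0 S places_nonarch by blast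
      have "0 < v0 (\<iota> (a p0))" using p0 by simp
      then have "0 < m" using m_ge[OF p0(1)] by linarith
      then have a1: "a p1 \<noteq> 0" using p1(2) by auto
      define c where "c p = a p / a p1" for p
      have c_le: "v0 (\<iota> (c p)) \<le> 1" if "p \<in> I" for p
        unfolding c_def hom.divide v0.divide p1(2)[symmetric] using m_ge[OF that] \<open>0 < m\<close> by simp
      have c1: "v0 (\<iota> (c p1)) = 1" unfolding c_def using a1 by simp
      obtain v i where p1_eq: "p1 = (v, i)" "v \<in> S" "i \<in> M v" using p1(1) unfolding I_def by auto
      interpret v: nonarch_abs v using p1_eq S places_nonarch by blast
      have veq: "v (\<iota> x) = v0 (\<iota> x)" for x using eq p1_eq(2) v0 by blast
      have zero: "(\<Sum>p\<in>I. \<iota> (c p) * (case p of (v, i) \<Rightarrow> z v i)) = 0"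
      proof -
        have "(\<Sum>p\<in>I. \<iota> (c p) * (case p of (v, i) \<Rightarrow> z v i))
          = inverse (\<iota> (a p1)) * (\<Sum>p\<in>I. \<iota> (a p) * (case p of (v, i) \<Rightarrow> z v i))"
          unfolding sum_distrib_left c_def by (rule sum.cong) (simp_all add: hom.mult hom.inverse divide_inverse mult_ac)
        then show ?thesis using sum0 by simp
      qed
      define D where "D = (\<Sum>p\<in>I. \<iota> (c p) * (case p of (w, i) \<Rightarrow> z w i - (if v = w then u w i else 0)))"
      have reduce: "(\<Sum>p\<in>I. \<iota> (c p) * (case p of (w, i) \<Rightarrow> if v = w then u w i else 0)) = (\<Sum>i\<in>M v. \<iota> (c (v, i)) * u v i)"
      proof -
        have "(\<Sum>p\<in>I. \<iota> (c p) * (case p of (w, i) \<Rightarrow> if v = w then u w i else 0))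
          = (\<Sum>w\<in>S. \<Sum>i\<in>M w. if v = w then \<iota> (c (w, i)) * u w i else 0)"
          unfolding I_def using S M by (subst sum.Sigma) (auto intro!: sum.cong)
        also have "\<dots> = (\<Sum>w\<in>S. if v = w then (\<Sum>i\<in>M v. \<iota> (c (v, i)) * u v i) else 0)"
          by (intro sum.cong) auto
        finally show ?thesis using S p1_eq(2) by simp
      qed
      have D_eq: "D = (\<Sum>p\<in>I. \<iota> (c p) * (case p of (v, i) \<Rightarrow> z v i))
        - (\<Sum>p\<in>I. \<iota> (c p) * (case p of (w, i) \<Rightarrow> if v = w then u w i else 0))"
        unfolding D_def sum_subtractf[symmetric] by (intro sum.cong) (auto simp: algebra_simps)
      have D: "(\<Sum>i\<in>M v. \<iota> (c (v, i)) * u v i) = - D" unfolding D_eq zero reduce by simp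
      have "v D < \<theta>"
        unfolding D_def
      proof (rule v.sum_less[OF _ \<theta>])
        fix p assume p: "p \<in> I"
        obtain w i where wi: "p = (w, i)" by (cases p)
        have "v (\<iota> (c p)) * v (z w i - (if v = w then u w i else 0)) \<le> 1 * v (z w i - (if v = w then u w i else 0))"
          using c_le[OF p] by (intro mult_right_mono) (auto simp: veq)
        also have "\<dots> < \<theta>" using z[OF p1_eq(2), of w i] by simp
        finally show "v (\<iota> (c p) * (case p of (w, i) \<Rightarrow> z w i - (if v = w then u w i else 0))) < \<theta>"
          unfolding wi by (simp add: v.mult)
      qed
      then have "v (\<Sum>i\<in>M v. \<iota> (c (v, i)) * u v i) \<le> v (\<iota> \<pi>)" unfolding D veq \<theta>_def by simp
      moreover have "v (\<iota> (c (v, i))) \<le> 1" if "i \<in> M v" for i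
        unfolding veq using c_le[of "(v, i)"] that p1_eq(2) unfolding I_def by simp
      ultimately have "\<forall>i\<in>M v. v (\<iota> (c (v, i))) < 1" using ind[OF p1_eq(2), of "\<lambda>i. c (v, i)"] by blast
      then have "v (\<iota> (c p1)) < 1" using p1_eq by blast
      then show False using c1 unfolding veq by simp
    qed
  qed
  then show ?thesis unfolding I_def using S M by (simp add: card_SigmaI)
qed simp

text \<open>Through the single element 1, each place above the given one contributes 1 to the sum in
  \<open>independent_mod_le\<close>.\<close>

lemma finite_places_above:
  assumes "v0 \<in> places \<iota>"
  shows "finite {v \<in> places \<iota>. \<forall>x. v (\<iota> x) = v0 (\<iota> x)}"
proof (rule ccontr)
  assume inf: "infinite {v \<in> places \<iota>. \<forall>x. v (\<iota> x) = v0 (\<iota> x)}"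
  then obtain S where S: "S \<subseteq> {v \<in> places \<iota>. \<forall>x. v (\<iota> x) = v0 (\<iota> x)}" "finite S" "card S = Suc (extension_degree \<iota>)"
    using infinite_arbitrarily_large[OF inf, of "Suc (extension_degree \<iota>)"] by (elim exE conjE)
  obtain \<pi> d T where b: "base_place v0 \<pi> d T" using places_base[OF assms] .
  have Sv: "v (\<iota> x) = v0 (\<iota> x)" if "v \<in> S" for v x using S(1) that by blast
  have bv: "base_place v \<pi> d T" if "v \<in> S" for v by (rule base_place_cong[OF b Sv[OF that]])
  have "(\<Sum>v\<in>S. card {()}) \<le> extension_degree \<iota>"
  proof (rule independent_mod_le[where u = "\<lambda>_ _. 1" and S = S and \<pi> = \<pi> and d = d and T = T])
    show "S \<subseteq> places \<iota>" using S(1) by blast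
    show "v (\<iota> x) = w (\<iota> x)" if "v \<in> S" "w \<in> S" for v w x
      unfolding Sv[OF that(1)] Sv[OF that(2)] ..
    show "\<forall>i\<in>{()}. v (\<iota> (c i)) < 1"
      if v: "v \<in> S" "v (\<Sum>i\<in>{()}. \<iota> (c i) * 1) \<le> v (\<iota> \<pi>)" for v c
    proof -
      have "v (\<iota> (c ())) \<le> v (\<iota> \<pi>)" using v(2) by simp
      then show ?thesis using base_placeD(10)[OF bv[OF v(1)]] by simp
    qed
  qed (fact S(2) bv finite.emptyI | simp)+
  then show False using S(2,3) by simp
qed

lemma finite_places_finite: "finite {v. finite_place P v}"
proof (cases "\<exists>v0. finite_place P v0")
  case True
  then obtain v0 where v0: "finite_place P v0" by blast
  have "{v. finite_place P v} \<subseteq> {v \<in> places \<iota>. \<forall>x. v (\<iota> x) = v0 (\<iota> x)}"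
    using finite_place_\<iota>_eq[OF _ v0] unfolding finite_place_def by blast
  then show ?thesis using finite_places_above v0 unfolding finite_place_def by (blast intro: finite_subset)
qed simp

lemma finite_infinite_places: "finite {v. infinite_place v}"
proof (cases "\<exists>v0. infinite_place v0")
  case True
  then obtain v0 where v0: "infinite_place v0" by blast
  have "{v. infinite_place v} \<subseteq> {v \<in> places \<iota>. \<forall>x. v (\<iota> x) = v0 (\<iota> x)}"
    using infinite_place_\<iota>_eq[OF _ v0] unfolding infinite_place_def by blast
  then show ?thesis using finite_places_above v0 unfolding infinite_place_def by (blast intro: finite_subset)
qed simp

lemma finite_poles_base: "finite {v \<in> places \<iota>. 1 < v (\<iota> y)}"
proof (cases y rule: Fract_cases_nonzero)
  case (Fract a b)
  have "{v \<in> places \<iota>. 1 < v (\<iota> y)} \<subseteq>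
    {v. infinite_place v} \<union> (\<Union>P\<in>{P. Polynomial.degree P \<le> Polynomial.degree b}. {v. finite_place P v})"
  proof
    fix v assume "v \<in> {v \<in> places \<iota>. 1 < v (\<iota> y)}"
    then have v: "v \<in> places \<iota>" "1 < v (\<iota> y)" by auto
    interpret v: nonarch_abs v by (rule places_nonarch[OF v(1)])
    show "v \<in> {v. infinite_place v} \<union> (\<Union>P\<in>{P. Polynomial.degree P \<le> Polynomial.degree b}. {v. finite_place P v})"
      using v(1)
    proof (cases rule: places_cases)
      case P: (1 P)
      have "0 < v (embed_A \<iota> b)" using Fract by simp
      then have "v (embed_A \<iota> b) < v (embed_A \<iota> a)"
        using v(2) unfolding Fract(1) \<iota>_Fract v.divide by (simp only: less_divide_eq_1_pos)
      then have "v (embed_A \<iota> b) < 1" using finite_place_less_1_iff(2)[OF P Fract(3)] by linarith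
      then have "P dvd b" using finite_place_less_1_iff(1)[OF P Fract(2)] by simp
      then have "Polynomial.degree P \<le> Polynomial.degree b" using Fract by (intro dvd_imp_degree_le) auto
      then show ?thesis using P by blast
    qed auto
  qed
  then show ?thesis
    by (rule finite_subset) (intro finite_UnI finite_UN_I finite_infinite_places finite_places_finite finite_poly_degree_le)
next
  case 0
  have "\<not> 1 < v (\<iota> y)" if "v \<in> places \<iota>" for v
    using nonarch_abs.zero[OF places_nonarch[OF that]] 0 by simp
  then have "{v \<in> places \<iota>. 1 < v (\<iota> y)} = {}" by blast
  then show ?thesis by (simp only: finite.emptyI)
qed

text \<open>A pole of \<open>x\<close> is a pole of some coefficient of its monic minimal
  polynomial, as otherwise the leading term would dominate.\<close>

lemma finite_poles: "finite {v \<in> places \<iota>. 1 < v x}"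
proof -
  obtain m where m: "minimal_polynomial \<iota> x m" using hom.exists_minimal_polynomial[OF algebraic] .
  define n where "n = Polynomial.degree m"
  have lc: "Polynomial.coeff m n = 1" and root: "poly (map_poly \<iota> m) x = 0"
    using m unfolding minimal_polynomial_def n_def by auto
  have "{v \<in> places \<iota>. 1 < v x} \<subseteq> (\<Union>i\<in>{..<n}. {v \<in> places \<iota>. 1 < v (\<iota> (Polynomial.coeff m i))})"
  proof
    fix v assume "v \<in> {v \<in> places \<iota>. 1 < v x}"
    then have v: "v \<in> places \<iota>" "1 < v x" by auto
    interpret v: nonarch_abs v by (rule places_nonarch[OF v(1)])
    show "v \<in> (\<Union>i\<in>{..<n}. {v \<in> places \<iota>. 1 < v (\<iota> (Polynomial.coeff m i))})"
    proof (rule ccontr)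
      assume "\<not> ?thesis"
      then have small: "v (\<iota> (Polynomial.coeff m i)) \<le> 1" if "i < n" for i using that v(1) by (force simp: not_less)
      have xn: "x \<noteq> 0" using v(2) by auto
      have sum: "(\<Sum>i\<le>n. \<iota> (Polynomial.coeff m i) * x ^ i) = 0"
        using root by (simp add: poly_altdef n_def)
      have "v (\<Sum>i\<le>n. \<iota> (Polynomial.coeff m i) * x ^ i) = v (\<iota> (Polynomial.coeff m n) * x ^ n)"
      proof (rule v.sum_dominant)
        fix i assume "i \<in> {..n}" "i \<noteq> n"
        then have "i < n" by simp
        have "v (\<iota> (Polynomial.coeff m i)) * v x ^ i \<le> 1 * v x ^ i"
          using small[OF \<open>i < n\<close>] by (intro mult_right_mono) auto
        also have "\<dots> < v x ^ n" using v(2) \<open>i < n\<close> by simp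
        finally show "v (\<iota> (Polynomial.coeff m i) * x ^ i) < v (\<iota> (Polynomial.coeff m n) * x ^ n)"
          by (simp add: v.mult v.power lc)
      qed (use xn lc in auto)
      then show False using sum xn lc by simp
    qed
  qed
  then show ?thesis by (rule finite_subset) (intro finite_UN_I finite_poles_base finite_lessThan)
qed

lemma finite_support:
  assumes "x \<noteq> 0"
  shows "finite {v \<in> places \<iota>. v x \<noteq> 1}"
proof -
  have "{v \<in> places \<iota>. v x \<noteq> 1} \<subseteq> {v \<in> places \<iota>. 1 < v x} \<union> {v \<in> places \<iota>. 1 < v (inverse x)}"
  proof
    fix v assume "v \<in> {v \<in> places \<iota>. v x \<noteq> 1}"
    then have v: "v \<in> places \<iota>" "v x \<noteq> 1" by auto
    interpret v: nonarch_abs v by (rule places_nonarch[OF v(1)])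
    have "0 < v x" using assms by simp
    then have "1 < v x \<or> 1 < v (inverse x)" unfolding v.inverse using v(2) one_less_inverse[of "v x"] by linarith
    then show "v \<in> {v \<in> places \<iota>. 1 < v x} \<union> {v \<in> places \<iota>. 1 < v (inverse x)}" using v(1) by blast
  qed
  then show ?thesis by (rule finite_subset) (intro finite_UnI finite_poles)
qed

end

subsection \<open>Local degrees\<close>

text \<open>Representatives of the valuation ring modulo the ideal of elements of size at most
  \<open>r\<close>. Counting them converts local degrees into cardinalities, which is the form that
  the product formula uses.\<close>

definition transversal :: "('a::field \<Rightarrow> real) \<Rightarrow> real \<Rightarrow> 'a set \<Rightarrow> bool" where
  "transversal v r Z \<longleftrightarrow> finite Z \<and> (\<forall>z\<in>Z. v z \<le> 1) \<and> (\<forall>y. v y \<le> 1 \<longrightarrow> (\<exists>!z. z \<in> Z \<and> v (y - z) \<le> r))"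

lemma transversal_nonempty:
  assumes "nonarch_abs v" "transversal v r Z"
  shows "0 < card Z"
proof -
  have "v 0 \<le> 1" using nonarch_abs.zero[OF assms(1)] by simp
  then have "Z \<noteq> {}" using assms(2) unfolding transversal_def by blast
  then show ?thesis using assms(2) unfolding transversal_def by (simp add: card_gt_0_iff)
qed

context nonarch_abs
begin

lemma transversal_card_le:
  assumes Z: "transversal v r Z" and Z': "transversal v r Z'" and "0 \<le> r"
  shows "card Z \<le> card Z'"
proof -
  have "\<exists>z'. z' \<in> Z' \<and> v (z - z') \<le> r" if "z \<in> Z" for z
    using Z Z' that unfolding transversal_def by blast
  then obtain f where f: "\<And>z. z \<in> Z \<Longrightarrow> f z \<in> Z' \<and> v (z - f z) \<le> r" by metis
  have "inj_on f Z"
  proof (rule inj_onI)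
    fix x y assume xy: "x \<in> Z" "y \<in> Z" "f x = f y"
    have "v ((x - f x) - (y - f y)) \<le> r" 
      using ultra_diff_bound[of "x - f x" r "y - f y"] f[OF xy(1)] f[OF xy(2)] by blast
    then have "v (x - y) \<le> r" using xy(3) by simp
    moreover have "v (x - x) \<le> r" "v x \<le> 1" using \<open>0 \<le> r\<close> Z xy(1) unfolding transversal_def by auto
    ultimately show "x = y" using Z xy unfolding transversal_def by blast
  qed
  then show ?thesis using card_inj_on_le[of f Z Z'] f Z' unfolding transversal_def by blast
qed

lemma transversal_card_eq:
  "transversal v r Z \<Longrightarrow> transversal v r Z' \<Longrightarrow> 0 \<le> r \<Longrightarrow> card Z = card Z'"
  using transversal_card_le order_antisym by blast

text \<open>Multiplicativity of the index of ideals: \<open>a + x * b\<close> represents residues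
  modulo \<open>x * y\<close> when \<open>a\<close> runs modulo \<open>x\<close> and
  \<open>b\<close> modulo \<open>y\<close>.\<close>

lemma transversal_mult:
  assumes Z: "transversal v (v x) Z" and Z': "transversal v (v y) Z'" and x: "x \<noteq> 0" "v x \<le> 1" and y: "v y \<le> 1"
  shows "\<exists>Z''. transversal v (v (x * y)) Z'' \<and> card Z'' = card Z * card Z'"
proof -
  define W where "W = (\<lambda>(a, b). a + x * b) ` (Z \<times> Z')"
  have ZD: "finite Z" "\<And>z. z \<in> Z \<Longrightarrow> v z \<le> 1" "\<And>y. v y \<le> 1 \<Longrightarrow> \<exists>!z. z \<in> Z \<and> v (y - z) \<le> v x"
    using Z unfolding transversal_def by auto
  have Z'D: "finite Z'" "\<And>z. z \<in> Z' \<Longrightarrow> v z \<le> 1" "\<And>w. v w \<le> 1 \<Longrightarrow> \<exists>!z. z \<in> Z' \<and> v (w - z) \<le> v y"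
    using Z' unfolding transversal_def by auto
  have uniq: "a = a' \<and> b = b'" if ab: "a \<in> Z" "b \<in> Z'" "a' \<in> Z" "b' \<in> Z'"
    "v ((a + x * b) - (a' + x * b')) \<le> v (x * y)" for a b a' b'
  proof -
    have xy: "v (x * y) \<le> v x" using y by (simp add: mult mult_left_le)
    have "v (x * (b' - b)) \<le> v x" using ZD(2) Z'D(2)[OF ab(2)] Z'D(2)[OF ab(4)]
      by (simp add: mult mult_left_le ultra_diff_bound)
    moreover have "v ((a + x * b) - (a' + x * b')) \<le> v x" using ab(5) xy by linarith
    moreover have "a - a' = ((a + x * b) - (a' + x * b')) + x * (b' - b)" by (simp add: algebra_simps)
    ultimately have "v (a - a') \<le> v x" using ultra_bound by metis
    then have "a = a'" using ZD(3)[OF ZD(2)[OF ab(1)]] ab(1,3) by (metis diff_self nonneg zero)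
    have "v (x * (b - b')) \<le> v x * v y" using ab(5) \<open>a = a'\<close> by (simp add: algebra_simps mult)
    moreover have "0 < v x" using x(1) by simp
    ultimately have "v (b - b') \<le> v y" unfolding mult by (simp only: mult_le_cancel_left_pos)
    then have "b = b'" using Z'D(3)[OF Z'D(2)[OF ab(2)]] ab(2,4) by (metis diff_self nonneg zero)
    then show ?thesis using \<open>a = a'\<close> by simp
  qed
  have "inj_on (\<lambda>(a, b). a + x * b) (Z \<times> Z')"
  proof (rule inj_onI, clarify)
    fix a b a' b' assume "a \<in> Z" "b \<in> Z'" "a' \<in> Z" "b' \<in> Z'" "a + x * b = a' + x * b'"
    then show "a = a' \<and> b = b'" using uniq[of a b a' b'] by simp
  qed
  then have card: "card W = card Z * card Z'" unfolding W_def by (simp add: card_image card_cartesian_product)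
  have "transversal v (v (x * y)) W"
    unfolding transversal_def
  proof (intro conjI ballI allI impI)
    show "finite W" unfolding W_def using ZD(1) Z'D(1) by simp
    fix z assume "z \<in> W"
    then obtain a b where "z = a + x * b" "a \<in> Z" "b \<in> Z'" unfolding W_def by auto
    then show "v z \<le> 1" using ZD(2) Z'D(2) x(2) by (auto intro!: ultra_bound simp: mult mult_le_one)
  next
    fix w assume w: "v w \<le> 1"
    obtain a where a: "a \<in> Z" "v (w - a) \<le> v x" using ZD(3)[OF w] by blast
    have "v ((w - a) / x) \<le> 1" using a(2) x(1) by (simp add: divide divide_le_eq_1)
    then obtain b where b: "b \<in> Z'" "v ((w - a) / x - b) \<le> v y" using Z'D(3) by blast
    have "w - (a + x * b) = x * ((w - a) / x - b)" using x(1) by (simp add: field_simps)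
    then have le: "v (w - (a + x * b)) \<le> v (x * y)" using b(2) by (simp add: mult mult_left_mono)
    show "\<exists>!z. z \<in> W \<and> v (w - z) \<le> v (x * y)"
    proof (rule ex1I[of _ "a + x * b"])
      show "a + x * b \<in> W \<and> v (w - (a + x * b)) \<le> v (x * y)" using le a b unfolding W_def by auto
      fix z assume z: "z \<in> W \<and> v (w - z) \<le> v (x * y)"
      then obtain a' b' where z': "z = a' + x * b'" "a' \<in> Z" "b' \<in> Z'" unfolding W_def by auto
      have "(a' + x * b') - (a + x * b) = (w - (a + x * b)) - (w - z)" using z' by simp
      then have "v ((a' + x * b') - (a + x * b)) \<le> v (x * y)" using ultra_diff_bound le z by metis
      then show "z = a + x * b" using uniq[OF z'(2,3) a(1) b(1)] z'(1) by simp
    qed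
  qed
  then show ?thesis using card by blast
qed

lemma transversal_power:
  assumes "transversal v (v x) Z" "x \<noteq> 0" "v x \<le> 1"
  shows "\<exists>Z'. transversal v (v (x ^ n)) Z' \<and> card Z' = card Z ^ n"
proof (induction n)
  case 0
  have "transversal v (v (x ^ 0)) {0}" unfolding transversal_def by auto
  then show ?case by (intro exI[of _ "{0}"]) simp
next
  case (Suc n)
  then obtain Z' where "transversal v (v (x ^ n)) Z'" "card Z' = card Z ^ n" by blast
  moreover have "v (x ^ n) \<le> 1" using assms(3) by (simp add: power power_le_one)
  ultimately show ?case using transversal_mult[OF assms(1) _ assms(2,3), of "x ^ n" Z'] by simp
qed

lemma transversal_coarser:
  assumes Z: "transversal v r Z" and "r \<le> r'" "0 \<le> r"
  shows "\<exists>Z'. transversal v r' Z'"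
proof -
  \<comment> \<open>The chosen representative depends only on the class of \<open>y\<close>, because
    equivalent elements satisfy the same predicate; so the image of \<open>f\<close> meets each
    class once.\<close>
  define f where "f y = (SOME z. z \<in> Z \<and> v (y - z) \<le> r')" for y
  have f: "f y \<in> Z \<and> v (y - f y) \<le> r'" if "v y \<le> 1" for y
  proof -
    have "\<exists>z. z \<in> Z \<and> v (y - z) \<le> r'" using Z that \<open>r \<le> r'\<close> unfolding transversal_def by (meson order_trans)
    then show ?thesis unfolding f_def by (rule someI_ex)
  qed
  have f_cong: "f y = f y'" if "v (y - y') \<le> r'" for y y'
  proof -
    have "v (y - z) \<le> r' \<longleftrightarrow> v (y' - z) \<le> r'" for z
      using ultra_diff_bound[of "y - z" r' "y - y'"] ultra_bound[of "y - y'" r' "y' - z"] that by auto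
    then show ?thesis unfolding f_def by simp
  qed
  define Z' where "Z' = f ` {y. v y \<le> 1}"
  have sub: "Z' \<subseteq> Z" unfolding Z'_def using f by auto
  have "transversal v r' Z'"
    unfolding transversal_def
  proof (intro conjI ballI allI impI)
    show "finite Z'" using sub Z unfolding transversal_def by (blast intro: finite_subset)
    show "v z \<le> 1" if "z \<in> Z'" for z using sub Z that unfolding transversal_def by blast
    fix y assume y: "v y \<le> 1"
    show "\<exists>!z. z \<in> Z' \<and> v (y - z) \<le> r'"
    proof (rule ex1I[of _ "f y"])
      show "f y \<in> Z' \<and> v (y - f y) \<le> r'" unfolding Z'_def using f[OF y] y by blast
      fix z assume z: "z \<in> Z' \<and> v (y - z) \<le> r'"
      then obtain w where w: "z = f w" "v w \<le> 1" unfolding Z'_def by blast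
      have "v ((w - f w) + (f w - y)) \<le> r'"
        using ultra_bound[of "w - f w" r' "f w - y"] f[OF w(2)] z w(1) diff_commute[of "f w" y] by metis
      then show "z = f y" using f_cong[of w y] w(1) by simp
    qed
  qed
  then show ?thesis by blast
qed

end

locale place = function_field +
  fixes v :: "'b \<Rightarrow> real" and \<pi> d T
  assumes v_place: "v \<in> places \<iota>" and base: "base_place v \<pi> d T"
begin

sublocale v: nonarch_abs v
  by (rule places_nonarch[OF v_place])

definition \<theta> :: real where "\<theta> = v (\<iota> \<pi>)"

lemma \<theta>: "0 < \<theta>" "\<theta> < 1" "\<theta> = real q powr (- real d)"
  using base_placeD(3,9,10)[OF base] unfolding \<theta>_def by simp_all

lemma discrete: "v (\<iota> x) < 1 \<Longrightarrow> v (\<iota> x) \<le> \<theta>"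
  using base_place_discrete[OF base _ v.nonarch_abs_axioms] unfolding \<theta>_def by simp

text \<open>Integers are reduced modulo a uniformizer of the place of \<open>F\<close>, not of \<open>v\<close>: the dimension
  over the residue field of \<open>F\<close> is then the product of residue degree and ramification index.\<close>

definition residue_independent :: "nat \<Rightarrow> (nat \<Rightarrow> 'b) \<Rightarrow> bool" where
  "residue_independent n u \<longleftrightarrow> (\<forall>i<n. v (u i) \<le> 1) \<and>
     (\<forall>c. (\<forall>i<n. v (\<iota> (c i)) \<le> 1) \<longrightarrow> v (\<Sum>i<n. \<iota> (c i) * u i) \<le> \<theta> \<longrightarrow> (\<forall>i<n. v (\<iota> (c i)) < 1))"

lemma residue_independent_le:
  assumes "residue_independent n u"
  shows "n \<le> extension_degree \<iota>"
proof -
  have "(\<Sum>w\<in>{v}. card {..<n}) \<le> extension_degree \<iota>"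
  proof (rule independent_mod_le[where u = "\<lambda>_. u" and S = "{v}" and \<pi> = \<pi> and d = d and T = T])
    fix w c assume w: "w \<in> {v}" "\<And>i. i \<in> {..<n} \<Longrightarrow> w (\<iota> (c i)) \<le> 1" "w (\<Sum>i\<in>{..<n}. \<iota> (c i) * u i) \<le> w (\<iota> \<pi>)"
    then show "\<forall>i\<in>{..<n}. w (\<iota> (c i)) < 1"
      using assms unfolding residue_independent_def \<theta>_def by auto
  qed (use v_place base in auto)
  then show ?thesis by simp
qed

definition residue_basis :: "nat \<Rightarrow> (nat \<Rightarrow> 'b) \<Rightarrow> bool" where
  "residue_basis n u \<longleftrightarrow> residue_independent n u \<and>
     (\<forall>x. v x \<le> 1 \<longrightarrow> (\<exists>c. (\<forall>i<n. v (\<iota> (c i)) \<le> 1) \<and> v (x - (\<Sum>i<n. \<iota> (c i) * u i)) \<le> \<theta>))"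

text \<open>The length of a residually independent family is bounded by the degree, so a longest one
  exists. Adding an integral \<open>x\<close> to it gives a relation in which the coefficient of
  \<open>x\<close> is a unit, and \<open>x\<close> can be solved for modulo \<pi>.\<close>

lemma exists_residue_basis:
  obtains n u where "residue_basis n u"
proof -
  define N where "N = {n. \<exists>u. residue_independent n u}"
  have "N \<subseteq> {..extension_degree \<iota>}" unfolding N_def using residue_independent_le by blast
  then have fin: "finite N" by (rule finite_subset) simp
  have "0 \<in> N" unfolding N_def residue_independent_def by simp
  define n where "n = Max N"
  have "n \<in> N" unfolding n_def using fin \<open>0 \<in> N\<close> by (intro Max_in) auto
  then obtain u where u: "residue_independent n u" unfolding N_def by blast
  have "Suc n \<notin> N" using Max_ge[OF fin, of "Suc n"] unfolding n_def by auto
  have "\<exists>c. (\<forall>i<n. v (\<iota> (c i)) \<le> 1) \<and> v (x - (\<Sum>i<n. \<iota> (c i) * u i)) \<le> \<theta>" if x: "v x \<le> 1" for x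
  proof -
    define w where "w = u(n := x)"
    have "\<not> residue_independent (Suc n) w" using \<open>Suc n \<notin> N\<close> unfolding N_def by blast
    moreover have "\<forall>i<Suc n. v (w i) \<le> 1" using u x unfolding residue_independent_def w_def by auto
    ultimately obtain c j where c: "\<And>i. i < Suc n \<Longrightarrow> v (\<iota> (c i)) \<le> 1" "v (\<Sum>i<Suc n. \<iota> (c i) * w i) \<le> \<theta>"
      "j < Suc n" "\<not> v (\<iota> (c j)) < 1"
      unfolding residue_independent_def by blast
    define s where "s = (\<Sum>i<n. \<iota> (c i) * u i)"
    have "(\<Sum>i<n. \<iota> (c i) * w i) = s" unfolding s_def w_def by (intro sum.cong) auto
    then have sum: "v (s + \<iota> (c n) * x) \<le> \<theta>" using c(2) by (simp add: w_def)
    \<comment> \<open>Otherwise the term with \<open>x\<close> would itself be 0 modulo \<pi>, and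
      the remaining relation would contradict the independence of \<open>u\<close>.\<close>
    have cn: "v (\<iota> (c n)) = 1"
    proof (rule ccontr)
      assume "v (\<iota> (c n)) \<noteq> 1"
      then have "v (\<iota> (c n)) < 1" using c(1)[of n] by simp
      then have "v (\<iota> (c n)) * v x \<le> \<theta> * 1" using discrete x by (intro mult_mono) (auto simp: \<theta>(1) less_imp_le)
      then have "v ((s + \<iota> (c n) * x) - \<iota> (c n) * x) \<le> \<theta>"
        using v.ultra_diff_bound[OF sum, of "\<iota> (c n) * x"] by (simp add: v.mult)
      then have "\<forall>i<n. v (\<iota> (c i)) < 1" using u c(1) unfolding residue_independent_def s_def by simp
      then show False using c(3,4) \<open>v (\<iota> (c n)) < 1\<close> by (metis less_Suc_eq)
    qed
    then have "\<iota> (c n) \<noteq> 0" by auto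
    define e where "e i = - c i / c n" for i
    have "x - (\<Sum>i<n. \<iota> (e i) * u i) = (s + \<iota> (c n) * x) / \<iota> (c n)"
    proof -
      have "(\<Sum>i<n. \<iota> (e i) * u i) = - s / \<iota> (c n)"
        unfolding s_def e_def sum_negf[symmetric] sum_divide_distrib
        by (intro sum.cong) (auto simp: hom.divide hom.minus)
      then show ?thesis using \<open>\<iota> (c n) \<noteq> 0\<close> by (simp add: field_simps)
    qed
    then have "v (x - (\<Sum>i<n. \<iota> (e i) * u i)) \<le> \<theta>" using sum cn by (simp add: v.divide)
    moreover have "\<forall>i<n. v (\<iota> (e i)) \<le> 1" using c(1) cn unfolding e_def by (simp add: hom.divide hom.minus v.divide)
    ultimately show ?thesis by blast
  qed
  then have "residue_basis n u" unfolding residue_basis_def using u by blast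
  then show ?thesis by (rule that)
qed

context
  fixes n :: nat and u :: "nat \<Rightarrow> 'b"
  assumes basis: "residue_basis n u"
begin

lemma residue_independentD:
  "(\<And>i. i < n \<Longrightarrow> v (\<iota> (c i)) \<le> 1) \<Longrightarrow> v (\<Sum>i<n. \<iota> (c i) * u i) \<le> \<theta> \<Longrightarrow> j < n \<Longrightarrow> v (\<iota> (c j)) < 1"
  using basis unfolding residue_basis_def residue_independent_def by blast

lemma residue_spanD:
  assumes "v x \<le> 1"
  obtains c where "\<And>i. i < n \<Longrightarrow> v (\<iota> (c i)) \<le> 1" "v (x - (\<Sum>i<n. \<iota> (c i) * u i)) \<le> \<theta>"
  using basis assms unfolding residue_basis_def by blast

lemma u_le: "i < n \<Longrightarrow> v (u i) \<le> 1"
  using basis unfolding residue_basis_def residue_independent_def by blast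

text \<open>After division by the largest coefficient, independence says that the sum has size above
  \<theta>. Through this bound null and Cauchy sequences have null and Cauchy coordinates.\<close>

lemma coefficient_bound:
  assumes "j < n"
  shows "\<theta> * v (\<iota> (a j)) \<le> v (\<Sum>i<n. \<iota> (a i) * u i)"
proof -
  define m where "m = Max ((\<lambda>i. v (\<iota> (a i))) ` {..<n})"
  have ge: "v (\<iota> (a i)) \<le> m" if "i < n" for i unfolding m_def using that by (intro Max_ge) auto
  have "m \<in> (\<lambda>i. v (\<iota> (a i))) ` {..<n}" unfolding m_def using assms by (intro Max_in) auto
  then obtain k where k: "k < n" "m = v (\<iota> (a k))" by auto
  show ?thesis
  proof (cases "a k = 0")
    case True
    then have "v (\<iota> (a j)) \<le> 0" using ge[OF assms] k by simp
    then show ?thesis by simp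
  next
    case False
    then have "0 < m" using k by simp
    define c where "c i = a i / a k" for i
    have "v (\<iota> (c i)) \<le> 1" if "i < n" for i
      unfolding c_def hom.divide v.divide k(2)[symmetric] using ge[OF that] \<open>0 < m\<close> by simp
    moreover have "v (\<iota> (c k)) = 1" unfolding c_def using False by simp
    ultimately have "\<theta> < v (\<Sum>i<n. \<iota> (c i) * u i)" using residue_independentD[of c k] k(1) by fastforce
    moreover have "(\<Sum>i<n. \<iota> (c i) * u i) = (\<Sum>i<n. \<iota> (a i) * u i) / \<iota> (a k)"
      unfolding sum_divide_distrib c_def by (intro sum.cong) (auto simp: hom.divide)
    ultimately have "\<theta> * m < v (\<Sum>i<n. \<iota> (a i) * u i)" using \<open>0 < m\<close> k(2) by (simp add: v.divide field_simps)
    moreover have "\<theta> * v (\<iota> (a j)) \<le> \<theta> * m" using ge[OF assms] \<theta> by (intro mult_left_mono) auto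
    ultimately show ?thesis by linarith
  qed
qed

text \<open>Successive approximation: the error of an expansion modulo \<pi> is divisible by \<pi>,
  and the quotient is expanded in turn.\<close>

lemma residue_dense_integral:
  assumes "v x \<le> 1"
  shows "\<exists>a. v (x - (\<Sum>i<n. \<iota> (a i) * u i)) \<le> \<theta> ^ k"
  using assms
proof (induction k arbitrary: x)
  case 0
  then show ?case by (intro exI[of _ "\<lambda>_. 0"]) simp
next
  case (Suc k)
  obtain c where c: "v (x - (\<Sum>i<n. \<iota> (c i) * u i)) \<le> \<theta>" using residue_spanD[OF Suc.prems] by blast
  define y where "y = (x - (\<Sum>i<n. \<iota> (c i) * u i)) / \<iota> \<pi>"
  have \<pi>0: "\<pi> \<noteq> 0" using base_placeD(2)[OF base] .
  have "v y \<le> 1" unfolding y_def v.divide \<theta>_def[symmetric] using c \<theta> by simp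
  then obtain a where a: "v (y - (\<Sum>i<n. \<iota> (a i) * u i)) \<le> \<theta> ^ k" using Suc.IH by blast
  have "x - (\<Sum>i<n. \<iota> (c i + \<pi> * a i) * u i) = \<iota> \<pi> * (y - (\<Sum>i<n. \<iota> (a i) * u i))"
  proof -
    have "(\<Sum>i<n. \<iota> (c i + \<pi> * a i) * u i) = (\<Sum>i<n. \<iota> (c i) * u i) + \<iota> \<pi> * (\<Sum>i<n. \<iota> (a i) * u i)"
      unfolding sum_distrib_left sum.distrib[symmetric]
      by (intro sum.cong) (auto simp: hom.add hom.mult algebra_simps)
    moreover have "\<iota> \<pi> * y = x - (\<Sum>i<n. \<iota> (c i) * u i)" unfolding y_def using \<pi>0 by simp
    ultimately show ?thesis by (simp add: algebra_simps)
  qed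
  then have "v (x - (\<Sum>i<n. \<iota> (c i + \<pi> * a i) * u i)) \<le> \<theta> * \<theta> ^ k"
    using a \<theta> by (simp add: v.mult \<theta>_def[symmetric])
  then show ?case by (intro exI[of _ "\<lambda>i. c i + \<pi> * a i"]) simp
qed

lemma residue_dense: "\<exists>a. v (x - (\<Sum>i<n. \<iota> (a i) * u i)) \<le> \<theta> ^ k"
proof -
  have \<pi>0: "\<pi> \<noteq> 0" using base_placeD(2)[OF base] .
  have "\<forall>\<^sub>F j in sequentially. \<theta> ^ j < 1 / (1 + v x)"
    using \<theta> v.nonneg[of x] by (intro exists_power_less) (auto simp: add_pos_nonneg)
  then obtain j where j: "\<theta> ^ j < 1 / (1 + v x)" using eventually_happens'[OF sequentially_bot] by blast
  have "\<theta> ^ j * (1 + v x) < 1" using j v.nonneg[of x] by (simp add: pos_less_divide_eq add_pos_nonneg)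
  moreover have "\<theta> ^ j * v x \<le> \<theta> ^ j * (1 + v x)" using \<theta> by (intro mult_left_mono) auto
  ultimately have "v (\<iota> \<pi> ^ j * x) \<le> 1" by (simp add: v.mult v.power \<theta>_def[symmetric])
  then obtain a where a: "v (\<iota> \<pi> ^ j * x - (\<Sum>i<n. \<iota> (a i) * u i)) \<le> \<theta> ^ (j + k)"
    using residue_dense_integral by blast
  have "\<iota> \<pi> ^ j * (x - (\<Sum>i<n. \<iota> (a i / \<pi> ^ j) * u i)) = \<iota> \<pi> ^ j * x - (\<Sum>i<n. \<iota> (a i) * u i)"
    unfolding right_diff_distrib sum_distrib_left using \<pi>0
    by (intro arg_cong2[where f = minus] refl sum.cong) (auto simp: hom.divide hom.power)
  then have "\<theta> ^ j * v (x - (\<Sum>i<n. \<iota> (a i / \<pi> ^ j) * u i)) \<le> \<theta> ^ j * \<theta> ^ k"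
    using a by (metis v.mult v.power \<theta>_def power_add)
  moreover have "0 < \<theta> ^ j" using \<theta> by simp
  ultimately have "v (x - (\<Sum>i<n. \<iota> (a i / \<pi> ^ j) * u i)) \<le> \<theta> ^ k" by (simp only: mult_le_cancel_left_pos)
  then show ?thesis by (rule exI[of _ "\<lambda>i. a i / \<pi> ^ j"])
qed

text \<open>The coordinates with respect to the basis run independently through the representatives
  \<open>T\<close> of the residue field below, which has \<open>q ^ d\<close> elements.\<close>

lemma transversal_uniformizer: "\<exists>Z. transversal v \<theta> Z \<and> card Z = q ^ (d * n)"
proof -
  define E where "E = PiE {..<n} (\<lambda>_. T)"
  define f where "f s = (\<Sum>i<n. \<iota> (s i) * u i)" for s
  have T: "finite T" "card T = q ^ d" "\<And>s. s \<in> T \<Longrightarrow> v (\<iota> s) \<le> 1"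
    "\<And>x. v (\<iota> x) \<le> 1 \<Longrightarrow> \<exists>!s. s \<in> T \<and> v (\<iota> (x - s)) < 1"
    using base_placeD(5-8)[OF base] by blast+
  have E: "finite E" "card E = q ^ (d * n)"
    unfolding E_def using T by (auto intro: finite_PiE simp: card_PiE power_mult)
  have sT: "s i \<in> T" if "s \<in> E" "i < n" for s i using that unfolding E_def by auto
  have uniq: "s = s'" if s: "s \<in> E" "s' \<in> E" "v (f s - f s') \<le> \<theta>" for s s'
  proof (rule PiE_ext[of s "{..<n}" "\<lambda>_. T"])
    fix i assume i: "i \<in> {..<n}"
    have "f s - f s' = (\<Sum>i<n. \<iota> (s i - s' i) * u i)"
      unfolding f_def sum_subtractf[symmetric] by (intro sum.cong) (auto simp: hom.diff algebra_simps)
    moreover have "v (\<iota> (s i - s' i)) \<le> 1" if "i < n" for i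
      unfolding hom.diff using T(3) sT s that by (intro v.ultra_diff_bound) auto
    ultimately have "v (\<iota> (s i - s' i)) < 1" using residue_independentD[of "\<lambda>i. s i - s' i" i] s(3) i by simp
    then show "s i = s' i" using T(4)[OF T(3), of "s i"] sT[OF s(1)] sT[OF s(2)] i
      by (metis diff_self hom.zero lessThan_iff v.zero zero_less_one)
  qed (use s in \<open>auto simp: E_def\<close>)
  have "inj_on f E" using uniq \<theta> by (auto intro!: inj_onI)
  then have card: "card (f ` E) = q ^ (d * n)" using E by (simp add: card_image)
  have f_le: "v (f s) \<le> 1" if "s \<in> E" for s
    unfolding f_def using T(3) sT[OF that] u_le by (intro v.sum_le) (auto simp: v.mult mult_le_one)
  have "transversal v \<theta> (f ` E)"
    unfolding transversal_def
  proof (intro conjI ballI allI impI)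
    show "finite (f ` E)" using E by simp
    show "v z \<le> 1" if "z \<in> f ` E" for z using f_le that by auto
    fix y assume y: "v y \<le> 1"
    obtain c where c: "\<And>i. i < n \<Longrightarrow> v (\<iota> (c i)) \<le> 1" "v (y - (\<Sum>i<n. \<iota> (c i) * u i)) \<le> \<theta>"
      using residue_spanD[OF y] by blast
    have "\<exists>s. s \<in> T \<and> v (\<iota> (c i - s)) < 1" if "i < n" for i using T(4)[OF c(1)[OF that]] by blast
    then obtain s where s: "\<And>i. i < n \<Longrightarrow> s i \<in> T \<and> v (\<iota> (c i - s i)) < 1" by metis
    define s' where "s' = restrict s {..<n}"
    have s'E: "s' \<in> E" unfolding E_def s'_def using s by auto
    have "v ((\<Sum>i<n. \<iota> (c i) * u i) - f s') \<le> \<theta>"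
    proof -
      have "(\<Sum>i<n. \<iota> (c i) * u i) - f s' = (\<Sum>i<n. \<iota> (c i - s i) * u i)"
        unfolding f_def s'_def sum_subtractf[symmetric] by (intro sum.cong) (auto simp: hom.diff algebra_simps)
      moreover have "v (\<iota> (c i - s i) * u i) \<le> \<theta>" if "i < n" for i
      proof -
        have "v (\<iota> (c i - s i)) * v (u i) \<le> \<theta> * 1"
          using discrete s[OF that] u_le[OF that] \<theta> by (intro mult_mono) auto
        then show ?thesis by (simp add: v.mult)
      qed
      ultimately show ?thesis using \<theta> by (auto intro!: v.sum_le)
    qed
    from v.ultra_bound[OF c(2) this] have le: "v (y - f s') \<le> \<theta>" by simp
    show "\<exists>!z. z \<in> f ` E \<and> v (y - z) \<le> \<theta>"
    proof (rule ex1I[of _ "f s'"])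
      show "f s' \<in> f ` E \<and> v (y - f s') \<le> \<theta>" using le s'E by blast
      fix z assume z: "z \<in> f ` E \<and> v (y - z) \<le> \<theta>"
      then obtain s'' where s'': "s'' \<in> E" "z = f s''" by blast
      have "v ((y - f s') - (y - f s'')) \<le> \<theta>" 
        using v.ultra_diff_bound[of "y - f s'" \<theta> "y - f s''"] le z s''(2) by simp
      then have "s'' = s'" using uniq[OF s''(1) s'E] by simp
      then show "z = f s'" using s'' by simp
    qed
  qed
  then show ?thesis using card by blast
qed

text \<open>Some power \<open>x ^ m\<close> has the same value as \<open>\<pi> ^ l\<close>, so the
  index belonging to \<open>x\<close> follows from \<open>(card Z) ^ m = (q ^ (d * n)) ^ l\<close>
  without choosing a uniformizer of \<open>v\<close> itself. The system \<open>Z\<close> arises by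
  coarsening one modulo \<open>x ^ m\<close>.\<close>

lemma transversal_count:
  assumes x: "x \<noteq> 0" "v x \<le> 1"
  shows "\<exists>Z. transversal v (v x) Z \<and> log (real q) (real (card Z)) = - real n * log (real q) (v x)"
proof -
  obtain Z0 where Z0: "transversal v \<theta> Z0" "card Z0 = q ^ (d * n)" using transversal_uniformizer by blast
  have \<pi>0: "\<iota> \<pi> \<noteq> 0" using base_placeD(2)[OF base] by simp
  have \<pi>le: "v (\<iota> \<pi>) \<le> 1" using \<theta> unfolding \<theta>_def by simp
  obtain m k where m: "m > 0" "v x ^ m = v (\<iota> \<pi>) powi k" using places_value[OF v_place base x(1)] by blast
  have "0 \<le> k"
  proof (rule ccontr)
    assume "\<not> 0 \<le> k"
    then have "\<theta> powi 0 < \<theta> powi k" using \<theta> by (intro power_int_strict_decreasing) auto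
    moreover have "v x ^ m \<le> 1" using x by (intro power_le_one) auto
    ultimately show False using m(2) unfolding \<theta>_def by simp
  qed
  then obtain l where l: "k = int l" using nonneg_int_cases by blast
  then have xm: "v (x ^ m) = v (\<iota> \<pi> ^ l)" using m(2) by (simp add: v.power)
  obtain Zl where Zl: "transversal v (v (\<iota> \<pi> ^ l)) Zl" "card Zl = (q ^ (d * n)) ^ l"
    using v.transversal_power[OF Z0(1)[unfolded \<theta>_def] \<pi>0 \<pi>le, of l] Z0(2) by metis
  have "v (x ^ m) \<le> v x"
    unfolding v.power using x m(1) power_decreasing[of 1 m "v x"] by simp
  then obtain Z where Z: "transversal v (v x) Z" using v.transversal_coarser[OF Zl(1), of "v x"] xm by auto
  obtain Zm where "transversal v (v (x ^ m)) Zm" "card Zm = card Z ^ m"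
    using v.transversal_power[OF Z x] by blast
  then have "card Z ^ m = (q ^ (d * n)) ^ l"
    using v.transversal_card_eq[of "v (x ^ m)" Zm Zl] Zl xm by simp
  then have "real (card Z) ^ m = (real q ^ (d * n)) ^ l" by (metis of_nat_power)
  have cZ: "0 < real (card Z)" using transversal_nonempty[OF v.nonarch_abs_axioms Z] by simp
  have "real m * log (real q) (real (card Z)) = log (real q) (real (card Z) ^ m)"
    using cZ by (simp add: log_nat_power)
  also have "\<dots> = log (real q) ((real q ^ (d * n)) ^ l)" using \<open>real (card Z) ^ m = _\<close> by simp
  also have "\<dots> = real l * real (d * n)" using q_gt_1 by (simp add: log_nat_power)
  finally have "real m * log (real q) (real (card Z)) = real l * real (d * n)" .
  moreover have "real m * log (real q) (v x) = - (real l * real d)"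
  proof -
    have "real m * log (real q) (v x) = log (real q) (v x ^ m)" using x by (simp add: log_nat_power)
    also have "v x ^ m = (real q powr (- real d)) ^ l" using xm \<theta>(3) by (simp add: v.power \<theta>_def)
    also have "log (real q) \<dots> = real l * (- real d)" using q_gt_1 by (simp add: log_nat_power)
    finally show ?thesis by simp
  qed
  moreover have "real m * (- real n * log (real q) (v x)) = - real n * (real m * log (real q) (v x))"
    by simp
  ultimately have "real m * log (real q) (real (card Z)) = real m * (- real n * log (real q) (v x))"
    by simp
  moreover have "real m \<noteq> 0" using m(1) by simp
  ultimately have "log (real q) (real (card Z)) = - real n * log (real q) (v x)"
    using mult_left_cancel by blast
  then show ?thesis using Z by blast
qed

end

end

section \<open>The completion as Cauchy sequences modulo null sequences\<close>

context nonarch_abs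
begin

lemma v_CauchyD: "v_Cauchy v s \<Longrightarrow> 0 < e \<Longrightarrow> \<exists>M. \<forall>m\<ge>M. \<forall>n\<ge>M. v (s m - s n) < e"
  unfolding v_Cauchy_def by blast

lemma v_Cauchy_const: "v_Cauchy v (\<lambda>_. c)"
  unfolding v_Cauchy_def by simp

lemma v_Cauchy_add:
  assumes "v_Cauchy v s" "v_Cauchy v u"
  shows "v_Cauchy v (\<lambda>n. s n + u n)"
  unfolding v_Cauchy_def
proof (intro allI impI)
  fix e :: real assume "e > 0"
  obtain M where M: "\<And>m n. m \<ge> M \<Longrightarrow> n \<ge> M \<Longrightarrow> v (s m - s n) < e" using v_CauchyD[OF assms(1) \<open>e > 0\<close>] by blast
  obtain N where N: "\<And>m n. m \<ge> N \<Longrightarrow> n \<ge> N \<Longrightarrow> v (u m - u n) < e" using v_CauchyD[OF assms(2) \<open>e > 0\<close>] by blast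
  have "v (s m + u m - (s n + u n)) < e" if "m \<ge> max M N" "n \<ge> max M N" for m n
  proof -
    have "v ((s m - s n) + (u m - u n)) \<le> max (v (s m - s n)) (v (u m - u n))" by (rule ultra)
    also have "\<dots> < e" using M[of m n] N[of m n] that by simp
    finally show ?thesis by (simp add: algebra_simps)
  qed
  then show "\<exists>M. \<forall>m\<ge>M. \<forall>n\<ge>M. v (s m + u m - (s n + u n)) < e" by blast
qed

lemma v_Cauchy_bounded:
  assumes "v_Cauchy v s"
  obtains B where "0 < B" "\<And>n. v (s n) \<le> B"
proof -
  obtain M where M: "\<And>m n. m \<ge> M \<Longrightarrow> n \<ge> M \<Longrightarrow> v (s m - s n) < 1" using v_CauchyD[OF assms, of 1] by auto
  define B where "B = 1 + (\<Sum>n\<le>M. v (s n))"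
  have le: "v (s n) \<le> B - 1" if "n \<le> M" for n unfolding B_def using that by (auto intro!: member_le_sum)
  have "0 < B" unfolding B_def by (simp add: add_pos_nonneg sum_nonneg)
  have "v (s n) \<le> B" for n
  proof (cases "n \<le> M")
    case True
    then show ?thesis using le by force
  next
    case False
    then have "v (s n - s M) < 1" using M[of n M] by simp
    moreover have "1 \<le> B" unfolding B_def by (simp add: sum_nonneg)
    ultimately have "v ((s n - s M) + s M) \<le> B" using le[of M] by (intro ultra_bound[of "s n - s M"]) auto
    then show ?thesis by simp
  qed
  then show ?thesis using that \<open>0 < B\<close> by blast
qed

lemma v_Cauchy_mult:
  assumes "v_Cauchy v s" "v_Cauchy v u"
  shows "v_Cauchy v (\<lambda>n. s n * u n)"
  unfolding v_Cauchy_def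
proof (intro allI impI)
  fix e :: real assume "e > 0"
  obtain A where A: "0 < A" "\<And>n. v (s n) \<le> A" using v_Cauchy_bounded[OF assms(1)] by blast
  obtain B where B: "0 < B" "\<And>n. v (u n) \<le> B" using v_Cauchy_bounded[OF assms(2)] by blast
  obtain M where M: "\<And>m n. m \<ge> M \<Longrightarrow> n \<ge> M \<Longrightarrow> v (s m - s n) < e / B"
    using v_CauchyD[OF assms(1), of "e / B"] \<open>e > 0\<close> B(1) by auto
  obtain N where N: "\<And>m n. m \<ge> N \<Longrightarrow> n \<ge> N \<Longrightarrow> v (u m - u n) < e / A"
    using v_CauchyD[OF assms(2), of "e / A"] \<open>e > 0\<close> A(1) by auto
  have "v (s m * u m - s n * u n) < e" if "m \<ge> max M N" "n \<ge> max M N" for m n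
  proof -
    have "v (s m) * v (u m - u n) \<le> A * v (u m - u n)" using A(2) by (intro mult_right_mono) auto
    also have "\<dots> < e" using N[of m n] that A(1) by (simp add: field_simps)
    finally have 1: "v (s m * (u m - u n)) < e" by (simp add: mult)
    have "v (s m - s n) * v (u n) \<le> v (s m - s n) * B" using B(2) by (intro mult_left_mono) auto
    also have "\<dots> < e" using M[of m n] that B(1) by (simp add: field_simps)
    finally have 2: "v ((s m - s n) * u n) < e" by (simp add: mult)
    have "s m * u m - s n * u n = s m * (u m - u n) + (s m - s n) * u n" by (simp add: algebra_simps)
    then have "v (s m * u m - s n * u n) \<le> max (v (s m * (u m - u n))) (v ((s m - s n) * u n))"
      using ultra[of "s m * (u m - u n)" "(s m - s n) * u n"] by (simp only:)
    also have "\<dots> < e" using 1 2 by (simp only: max_less_iff_conj)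
    finally show ?thesis .
  qed
  then show "\<exists>M. \<forall>m\<ge>M. \<forall>n\<ge>M. v (s m * u m - s n * u n) < e" by blast
qed

lemma v_Cauchy_minus: "v_Cauchy v s \<Longrightarrow> v_Cauchy v (\<lambda>n. - s n)"
  using v_Cauchy_mult[OF v_Cauchy_const[of "- 1"]] by simp

lemma v_Cauchy_null: "(\<lambda>n. v (s n)) \<longlonglongrightarrow> 0 \<Longrightarrow> v_Cauchy v s"
  unfolding v_Cauchy_def
proof (intro allI impI)
  fix e :: real assume lim: "(\<lambda>n. v (s n)) \<longlonglongrightarrow> 0" and "e > 0"
  then have "\<forall>\<^sub>F n in sequentially. v (s n) < e" by (intro order_tendstoD(2))
  then obtain M where M: "\<And>n. n \<ge> M \<Longrightarrow> v (s n) < e" unfolding eventually_sequentially by blast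
  have "v (s m - s n) < e" if "m \<ge> M" "n \<ge> M" for m n
    using ultra_diff[of "s m" "s n"] M[OF that(1)] M[OF that(2)] by simp
  then show "\<exists>M. \<forall>m\<ge>M. \<forall>n\<ge>M. v (s m - s n) < e" by blast
qed

lemma Cauchy_ring_simps [simp]:
  "s \<in> carrier (Cauchy_ring v) \<longleftrightarrow> v_Cauchy v s" "s \<otimes>\<^bsub>Cauchy_ring v\<^esub> u = (\<lambda>n. s n * u n)"
  "s \<oplus>\<^bsub>Cauchy_ring v\<^esub> u = (\<lambda>n. s n + u n)" "\<one>\<^bsub>Cauchy_ring v\<^esub> = (\<lambda>_. 1)" "\<zero>\<^bsub>Cauchy_ring v\<^esub> = (\<lambda>_. 0)"
  by (simp_all add: Cauchy_ring_def)

lemma cring_Cauchy_ring: "cring (Cauchy_ring v)"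
proof (rule cringI)
  show "abelian_group (Cauchy_ring v)"
  proof (rule abelian_groupI)
    fix s assume "s \<in> carrier (Cauchy_ring v)"
    then show "\<exists>u\<in>carrier (Cauchy_ring v). u \<oplus>\<^bsub>Cauchy_ring v\<^esub> s = \<zero>\<^bsub>Cauchy_ring v\<^esub>"
      by (intro bexI[of _ "\<lambda>n. - s n"]) (auto simp: v_Cauchy_minus)
  qed (auto simp: v_Cauchy_add v_Cauchy_const algebra_simps)
  show "comm_monoid (Cauchy_ring v)"
    by (rule comm_monoidI) (auto simp: v_Cauchy_mult v_Cauchy_const algebra_simps)
qed (auto simp: algebra_simps)

lemma Cauchy_ring_minus:
  assumes "v_Cauchy v s" "v_Cauchy v u"
  shows "s \<ominus>\<^bsub>Cauchy_ring v\<^esub> u = (\<lambda>n. s n - u n)"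
proof -
  interpret R: cring "Cauchy_ring v" by (rule cring_Cauchy_ring)
  have "\<ominus>\<^bsub>Cauchy_ring v\<^esub> u = (\<lambda>n. - u n)"
    using assms by (intro R.minus_equality) (auto simp: v_Cauchy_minus)
  then show ?thesis by (simp add: R.minus_eq)
qed

lemma null_mult:
  assumes "(\<lambda>n. v (s n)) \<longlonglongrightarrow> 0" "v_Cauchy v u"
  shows "(\<lambda>n. v (u n * s n)) \<longlonglongrightarrow> 0"
proof -
  obtain B where B: "0 < B" "\<And>n. v (u n) \<le> B" using v_Cauchy_bounded[OF assms(2)] by blast
  have "(\<lambda>n. B * v (s n)) \<longlonglongrightarrow> B * 0" using assms(1) by (intro tendsto_mult_left)
  then have lim: "(\<lambda>n. B * v (s n)) \<longlonglongrightarrow> 0" by simp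
  show ?thesis
    by (rule tendsto_sandwich[OF _ _ tendsto_const lim]) (auto simp: mult intro!: always_eventually mult_right_mono B)
qed

lemma null_add:
  assumes "(\<lambda>n. v (s n)) \<longlonglongrightarrow> 0" "(\<lambda>n. v (u n)) \<longlonglongrightarrow> 0"
  shows "(\<lambda>n. v (s n + u n)) \<longlonglongrightarrow> 0"
proof -
  have "(\<lambda>n. v (s n) + v (u n)) \<longlonglongrightarrow> 0 + 0" using assms by (intro tendsto_add)
  then have lim: "(\<lambda>n. v (s n) + v (u n)) \<longlonglongrightarrow> 0" by simp
  have "v (s n + u n) \<le> v (s n) + v (u n)" for n
    using ultra[of "s n" "u n"] nonneg[of "s n"] nonneg[of "u n"] by linarith
  then show ?thesis
    by (intro tendsto_sandwich[OF _ _ tendsto_const lim]) (auto intro!: always_eventually)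
qed

lemma ideal_null_ideal: "ideal (null_ideal v) (Cauchy_ring v)"
proof -
  interpret R: cring "Cauchy_ring v" by (rule cring_Cauchy_ring)
  show ?thesis
  proof (rule idealI[OF R.ring_axioms])
    show "subgroup (null_ideal v) (add_monoid (Cauchy_ring v))"
    proof (rule R.add.subgroupI)
      show "null_ideal v \<subseteq> carrier (Cauchy_ring v)" by (auto simp: null_ideal_def v_Cauchy_null)
      have "(\<lambda>_. 0) \<in> null_ideal v" by (simp add: null_ideal_def)
      then show "null_ideal v \<noteq> {}" by blast
      fix a assume a: "a \<in> null_ideal v"
      have "\<ominus>\<^bsub>Cauchy_ring v\<^esub> a = (\<lambda>n. - a n)"
        using a by (intro R.minus_equality) (auto simp: null_ideal_def v_Cauchy_minus v_Cauchy_null)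
      then show "\<ominus>\<^bsub>Cauchy_ring v\<^esub> a \<in> null_ideal v" using a by (simp add: null_ideal_def)
      fix b assume "b \<in> null_ideal v"
      then show "a \<oplus>\<^bsub>Cauchy_ring v\<^esub> b \<in> null_ideal v" using a by (simp add: null_ideal_def null_add)
    qed
    fix a x assume "a \<in> null_ideal v" "x \<in> carrier (Cauchy_ring v)"
    then show "x \<otimes>\<^bsub>Cauchy_ring v\<^esub> a \<in> null_ideal v" "a \<otimes>\<^bsub>Cauchy_ring v\<^esub> x \<in> null_ideal v"
      using null_mult[of a x] by (simp_all add: null_ideal_def mult.commute)
  qed
qed

definition cls :: "(nat \<Rightarrow> 'a) \<Rightarrow> (nat \<Rightarrow> 'a) set" where
  "cls s = null_ideal v +>\<^bsub>Cauchy_ring v\<^esub> s"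

lemma cring_completion: "cring (completion v)"
  unfolding completion_def by (rule ideal.quotient_is_cring[OF ideal_null_ideal cring_Cauchy_ring])

lemma cls_hom: "ring_hom_ring (Cauchy_ring v) (completion v) cls"
  using ideal.rcos_ring_hom_ring[OF ideal_null_ideal] unfolding completion_def cls_def .

lemma carrier_completion: "carrier (completion v) = cls ` {s. v_Cauchy v s}"
  unfolding completion_def FactRing_def A_RCOSETS_def' cls_def by auto

lemma cls_simps:
  assumes "v_Cauchy v s" "v_Cauchy v u"
  shows "cls s \<otimes>\<^bsub>completion v\<^esub> cls u = cls (\<lambda>n. s n * u n)"
    "cls s \<oplus>\<^bsub>completion v\<^esub> cls u = cls (\<lambda>n. s n + u n)"
proof -
  interpret h: ring_hom_ring "Cauchy_ring v" "completion v" cls by (rule cls_hom)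
  show "cls s \<otimes>\<^bsub>completion v\<^esub> cls u = cls (\<lambda>n. s n * u n)"
    "cls s \<oplus>\<^bsub>completion v\<^esub> cls u = cls (\<lambda>n. s n + u n)"
    using h.hom_mult[of s u] h.hom_add[of s u] assms by simp_all
qed

lemma cls_one: "\<one>\<^bsub>completion v\<^esub> = cls (\<lambda>_. 1)" and cls_zero: "\<zero>\<^bsub>completion v\<^esub> = cls (\<lambda>_. 0)"
proof -
  interpret h: ring_hom_ring "Cauchy_ring v" "completion v" cls by (rule cls_hom)
  show "\<one>\<^bsub>completion v\<^esub> = cls (\<lambda>_. 1)" "\<zero>\<^bsub>completion v\<^esub> = cls (\<lambda>_. 0)"
    using h.hom_one h.hom_zero by simp_all
qed

lemma cls_eq_iff:
  assumes "v_Cauchy v s" "v_Cauchy v u"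
  shows "cls s = cls u \<longleftrightarrow> (\<lambda>n. v (s n - u n)) \<longlonglongrightarrow> 0"
proof -
  interpret R: cring "Cauchy_ring v" by (rule cring_Cauchy_ring)
  show ?thesis
    using R.quotient_eq_iff_same_a_r_cos[OF ideal_null_ideal, of s u] assms
    by (simp add: Cauchy_ring_minus cls_def null_ideal_def)
qed

text \<open>Terms of size at least \<open>e\<close> occur arbitrarily far out, and past
  \<open>M\<close> all differences are below \<open>e\<close>; by the ultrametric inequality every
  term past \<open>M\<close> then has size at least \<open>e\<close>. Earlier terms, which may
  vanish, are replaced by 0.\<close>

lemma v_Cauchy_inverse:
  assumes s: "v_Cauchy v s" and "\<not> (\<lambda>n. v (s n)) \<longlonglongrightarrow> 0"
  obtains M where "\<And>n. n \<ge> M \<Longrightarrow> s n \<noteq> 0" "v_Cauchy v (\<lambda>n. if n \<ge> M then inverse (s n) else 0)"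
proof -
  obtain e where e: "e > 0" "\<And>M. \<exists>n\<ge>M. v (s n) \<ge> e"
    using assms(2) unfolding LIMSEQ_def by (auto simp: not_less)
  obtain M where M: "\<And>m n. m \<ge> M \<Longrightarrow> n \<ge> M \<Longrightarrow> v (s m - s n) < e" using v_CauchyD[OF s e(1)] by blast
  obtain n0 where n0: "n0 \<ge> M" "v (s n0) \<ge> e" using e(2) by blast
  have ge: "v (s n) \<ge> e" if "n \<ge> M" for n
  proof -
    have "v (s n - s n0) < v (s n0)" using M[OF that n0(1)] n0(2) by linarith
    then have "v ((s n - s n0) + s n0) = v (s n0)" by (rule add_dominant)
    then show ?thesis using n0 by simp
  qed
  have nz: "s n \<noteq> 0" if "n \<ge> M" for n using ge[OF that] e(1) by auto
  have "v_Cauchy v (\<lambda>n. if n \<ge> M then inverse (s n) else 0)"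
    unfolding v_Cauchy_def
  proof (intro allI impI)
    fix \<epsilon> :: real assume "\<epsilon> > 0"
    then have "0 < \<epsilon> * e * e" using e(1) by simp
    then obtain N where N: "\<And>m n. m \<ge> N \<Longrightarrow> n \<ge> N \<Longrightarrow> v (s m - s n) < \<epsilon> * e * e" using v_CauchyD[OF s] by blast
    have "v (inverse (s m) - inverse (s n)) < \<epsilon>" if "m \<ge> max M N" "n \<ge> max M N" for m n
    proof -
      have mn: "s m \<noteq> 0" "s n \<noteq> 0" using nz that by auto
      have "inverse (s m) - inverse (s n) = (s n - s m) / (s m * s n)" using mn by (simp add: field_simps)
      then have "v (inverse (s m) - inverse (s n)) = v (s n - s m) / (v (s m) * v (s n))" by (simp add: divide mult)
      also have "\<dots> \<le> v (s n - s m) / (e * e)"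
        using ge[of m] ge[of n] that e(1) mn by (intro divide_left_mono mult_mono mult_pos_pos) auto
      also have "\<dots> < \<epsilon>" using N[of n m] that e(1) by (simp add: field_simps)
      finally show ?thesis .
    qed
    then show "\<exists>K. \<forall>m\<ge>K. \<forall>n\<ge>K. v ((if m \<ge> M then inverse (s m) else 0) - (if n \<ge> M then inverse (s n) else 0)) < \<epsilon>"
      by (intro exI[of _ "max M N"]) auto
  qed
  then show ?thesis using nz that by blast
qed

lemma v_Cauchy_sum:
  "(\<And>i. i \<in> I \<Longrightarrow> v_Cauchy v (s i)) \<Longrightarrow> v_Cauchy v (\<lambda>n. \<Sum>i\<in>I. s i n)"
  by (induction I rule: infinite_finite_induct) (auto intro: v_Cauchy_add v_Cauchy_const)

lemma combine_cls:
  assumes "\<And>s. s \<in> set ss \<Longrightarrow> v_Cauchy v s"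
  shows "ring.combine (completion v) (map cls ss) (map (\<lambda>u. cls (\<lambda>_. u)) us)
    = cls (\<lambda>k. \<Sum>i<min (length ss) (length us). (ss ! i) k * us ! i)"
proof -
  interpret Q: cring "completion v" by (rule cring_completion)
  show ?thesis
    using assms
  proof (induction ss arbitrary: us)
    case Nil
    then show ?case by (simp add: cls_zero)
  next
    case (Cons s ss)
    show ?case
    proof (cases us)
      case Nil
      then show ?thesis by (simp add: cls_zero)
    next
      case us: (Cons u us')
      have 1: "v_Cauchy v (\<lambda>k. s k * u)" using Cons.prems by (auto intro: v_Cauchy_mult v_Cauchy_const)
      have 2: "v_Cauchy v (\<lambda>k. \<Sum>i<min (length ss) (length us'). (ss ! i) k * us' ! i)"
        using Cons.prems by (intro v_Cauchy_sum v_Cauchy_mult v_Cauchy_const) auto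
      show ?thesis
        using Cons.IH[of us'] Cons.prems 1 2
        by (simp add: us cls_simps v_Cauchy_const sum.lessThan_Suc_shift del: sum.lessThan_Suc)
    qed
  qed
qed

end

section \<open>The local degree as a dimension modulo a uniformizer of F\<close>

context place
begin

abbreviation Q :: "(nat \<Rightarrow> 'b) set ring" where "Q \<equiv> completion v"

lemma base_completion_eq: "base_completion \<iota> v = v.cls ` {s. v_Cauchy v s \<and> range s \<subseteq> range \<iota>}"
  unfolding base_completion_def v.cls_def by auto

lemma subring_base: "subring {s. v_Cauchy v s \<and> range s \<subseteq> range \<iota>} (Cauchy_ring v)"
proof -
  interpret R: cring "Cauchy_ring v" by (rule v.cring_Cauchy_ring)
  show ?thesis
  proof (rule R.subringI)
    show "\<one>\<^bsub>Cauchy_ring v\<^esub> \<in> {s. v_Cauchy v s \<and> range s \<subseteq> range \<iota>}"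
      using hom.one v.v_Cauchy_const by (auto intro: range_eqI[of _ _ 1])
    fix s assume s: "s \<in> {s. v_Cauchy v s \<and> range s \<subseteq> range \<iota>}"
    then have "\<ominus>\<^bsub>Cauchy_ring v\<^esub> s = (\<lambda>n. - s n)"
      by (intro R.minus_equality) (auto simp: v.v_Cauchy_minus)
    moreover have "- s n \<in> range \<iota>" for n
    proof -
      have "s n \<in> range \<iota>" using s by auto
      then obtain x where "s n = \<iota> x" by auto
      then show ?thesis by (simp add: hom.minus[symmetric])
    qed
    ultimately show "\<ominus>\<^bsub>Cauchy_ring v\<^esub> s \<in> {s. v_Cauchy v s \<and> range s \<subseteq> range \<iota>}"
      using s by (auto simp: v.v_Cauchy_minus)
    fix u assume u: "u \<in> {s. v_Cauchy v s \<and> range s \<subseteq> range \<iota>}"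
    have "s n * u n \<in> range \<iota> \<and> s n + u n \<in> range \<iota>" for n
    proof -
      have "s n \<in> range \<iota>" "u n \<in> range \<iota>" using s u by auto
      then obtain x y where "s n = \<iota> x" "u n = \<iota> y" by auto
      then show ?thesis by (simp add: hom.mult[symmetric] hom.add[symmetric])
    qed
    then show "s \<otimes>\<^bsub>Cauchy_ring v\<^esub> u \<in> {s. v_Cauchy v s \<and> range s \<subseteq> range \<iota>}"
      "s \<oplus>\<^bsub>Cauchy_ring v\<^esub> u \<in> {s. v_Cauchy v s \<and> range s \<subseteq> range \<iota>}"
      using s u by (auto simp: v.v_Cauchy_mult v.v_Cauchy_add)
  qed auto
qed

lemma subfield_base: "subfield (base_completion \<iota> v) Q"
proof -
  interpret Q: cring Q by (rule v.cring_completion)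
  interpret h: ring_hom_ring "Cauchy_ring v" Q v.cls by (rule v.cls_hom)
  have sub: "subring (base_completion \<iota> v) Q"
    unfolding base_completion_eq by (rule h.img_is_subring[OF subring_base])
  have one_zero: "\<one>\<^bsub>Q\<^esub> \<noteq> \<zero>\<^bsub>Q\<^esub>"
    unfolding v.cls_one v.cls_zero v.cls_eq_iff[OF v.v_Cauchy_const v.v_Cauchy_const]
    by (simp add: LIMSEQ_const_iff)
  show ?thesis
  proof (rule Q.subfieldI)
    show "subcring (base_completion \<iota> v) Q"
      using Q.subcringI[OF sub] Q.m_comm subringE(1)[OF sub] by auto
    show "Units (Q\<lparr>carrier := base_completion \<iota> v\<rparr>) = base_completion \<iota> v - {\<zero>\<^bsub>Q\<^esub>}"
    proof (intro equalityI subsetI)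
      fix x assume "x \<in> Units (Q\<lparr>carrier := base_completion \<iota> v\<rparr>)"
      then obtain y where "x \<in> base_completion \<iota> v" "y \<in> base_completion \<iota> v" "y \<otimes>\<^bsub>Q\<^esub> x = \<one>\<^bsub>Q\<^esub>"
        unfolding Units_def by auto
      then show "x \<in> base_completion \<iota> v - {\<zero>\<^bsub>Q\<^esub>}"
        using one_zero subringE(1)[OF sub] by (auto simp: subset_iff)
    next
      fix x assume x: "x \<in> base_completion \<iota> v - {\<zero>\<^bsub>Q\<^esub>}"
      then obtain s where s: "x = v.cls s" "v_Cauchy v s" "range s \<subseteq> range \<iota>" unfolding base_completion_eq by auto
      have "\<not> (\<lambda>n. v (s n)) \<longlonglongrightarrow> 0"
        using x s v.cls_eq_iff[OF s(2) v.v_Cauchy_const, of 0] unfolding v.cls_zero by auto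
      then obtain M where M: "\<And>n. n \<ge> M \<Longrightarrow> s n \<noteq> 0" "v_Cauchy v (\<lambda>n. if n \<ge> M then inverse (s n) else 0)"
        using v.v_Cauchy_inverse[OF s(2)] by blast
      define u where "u n = (if n \<ge> M then inverse (s n) else 0)" for n
      have u: "v_Cauchy v u" using M(2) unfolding u_def .
      have "u n \<in> range \<iota>" for n
      proof -
        have "s n \<in> range \<iota>" using s(3) by auto
        then obtain x where "s n = \<iota> x" by auto
        then show ?thesis unfolding u_def using hom.zero by (auto simp: hom.inverse[symmetric] intro: range_eqI[of _ _ 0])
      qed
      then have y: "v.cls u \<in> base_completion \<iota> v" unfolding base_completion_eq using u by auto
      have "\<forall>\<^sub>F n in sequentially. v (u n * s n - 1) = 0"
        unfolding eventually_sequentially u_def using M(1) by (intro exI[of _ M]) auto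
      then have "(\<lambda>n. v (u n * s n - 1)) \<longlonglongrightarrow> 0" by (rule tendsto_eventually)
      then have ux: "v.cls u \<otimes>\<^bsub>Q\<^esub> x = \<one>\<^bsub>Q\<^esub>"
        unfolding s(1) v.cls_one v.cls_simps(1)[OF u s(2)]
        using v.cls_eq_iff[OF v.v_Cauchy_mult[OF u s(2)] v.v_Cauchy_const] by simp
      have "x \<in> carrier Q" "v.cls u \<in> carrier Q" using subringE(1)[OF sub] x y by blast+
      then have "x \<otimes>\<^bsub>Q\<^esub> v.cls u = \<one>\<^bsub>Q\<^esub>" using ux Q.m_comm by simp
      then show "x \<in> Units (Q\<lparr>carrier := base_completion \<iota> v\<rparr>)"
        unfolding Units_def using x y ux by auto
    qed
  qed
qed

text \<open>The residue basis is a basis of \<open>K\<^sub>v\<close> over \<open>F\<^sub>v\<close>.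
  By \<open>coefficient_bound\<close>, a combination that is null has null coordinates, which is
  independence; and the coordinates of the approximations to a Cauchy sequence are Cauchy
  themselves, so that they have limits in \<open>F\<^sub>v\<close>, which is spanning.\<close>

lemma local_degree_eq:
  assumes basis: "residue_basis n u"
  shows "local_degree \<iota> v = n"
proof -
  interpret Q: cring Q by (rule v.cring_completion)
  define Us where "Us = map (\<lambda>u. v.cls (\<lambda>_. u)) (map u [0..<n])"
  have Us: "set Us \<subseteq> carrier Q" unfolding Us_def v.carrier_completion using v.v_Cauchy_const by auto
  have ind: "Q.independent (base_completion \<iota> v) Us"
  proof (rule Q.trivial_combine_imp_independent[OF subfield_base Us])
    fix Ks assume Ks: "set Ks \<subseteq> base_completion \<iota> v" "Q.combine Ks Us = \<zero>\<^bsub>Q\<^esub>"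
    have "\<forall>k\<in>set Ks. \<exists>s. k = v.cls s \<and> v_Cauchy v s \<and> range s \<subseteq> range \<iota>"
      using Ks(1) unfolding base_completion_eq by auto
    then obtain g where g: "\<And>k. k \<in> set Ks \<Longrightarrow> k = v.cls (g k) \<and> v_Cauchy v (g k) \<and> range (g k) \<subseteq> range \<iota>" by metis
    define ss where "ss = map g Ks"
    have Ks_eq: "Ks = map v.cls ss" unfolding ss_def using g by (simp add: map_idI)
    have ss: "v_Cauchy v s" "range s \<subseteq> range \<iota>" if "s \<in> set ss" for s using that g unfolding ss_def by auto
    \<comment> \<open>\<open>combine\<close> stops at the shorter of its two lists, and
      \<open>Ks\<close> need not have length \<open>n\<close>; missing coordinates are set to
      0.\<close>
    define l where "l = min (length ss) n"
    define t where "t k = (\<Sum>i<l. (ss ! i) k * u i)" for k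
    have t: "v_Cauchy v t" unfolding t_def l_def
      using ss by (intro v.v_Cauchy_sum v.v_Cauchy_mult v.v_Cauchy_const) auto
    have "v.cls (\<lambda>k. \<Sum>i<min (length ss) (length (map u [0..<n])). (ss ! i) k * map u [0..<n] ! i) = v.cls (\<lambda>_. 0)"
      using Ks(2) v.combine_cls[OF ss(1), of ss "map u [0..<n]"] unfolding Us_def Ks_eq v.cls_zero by simp
    moreover have "(\<lambda>k. \<Sum>i<min (length ss) (length (map u [0..<n])). (ss ! i) k * map u [0..<n] ! i) = t"
      unfolding t_def l_def by (intro ext sum.cong) auto
    ultimately have lim: "(\<lambda>k. v (t k)) \<longlonglongrightarrow> 0" using v.cls_eq_iff[OF t v.v_Cauchy_const, of 0] by simp
    define a where "a k i = (if i < l then inv_into UNIV \<iota> ((ss ! i) k) else 0)" for k i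
    have a: "\<iota> (a k i) = (ss ! i) k" if "i < l" for k i
    proof -
      have "(ss ! i) k \<in> range \<iota>" using ss(2)[of "ss ! i"] that unfolding l_def by auto
      then show ?thesis unfolding a_def using that by (simp add: f_inv_into_f)
    qed
    have t_a: "t k = (\<Sum>i<n. \<iota> (a k i) * u i)" for k
    proof -
      have "(\<Sum>i<n. \<iota> (a k i) * u i) = (\<Sum>i<l. \<iota> (a k i) * u i)"
        by (rule sum.mono_neutral_right) (auto simp: a_def l_def)
      then show ?thesis unfolding t_def by (simp add: a)
    qed
    have zero: "Ks ! i = \<zero>\<^bsub>Q\<^esub>" if "i < l" for i
    proof -
      have i: "i < n" "i < length ss" using that unfolding l_def by auto
      have "\<theta> * v ((ss ! i) k) \<le> v (t k)" for k
        using coefficient_bound[OF basis i(1), of "a k"] a[OF that] t_a by simp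
      then have le: "v ((ss ! i) k) \<le> inverse \<theta> * v (t k)" for k using \<theta>(1) by (simp add: field_simps)
      have "(\<lambda>k. inverse \<theta> * v (t k)) \<longlonglongrightarrow> inverse \<theta> * 0" using lim by (intro tendsto_mult_left)
      then have lim': "(\<lambda>k. inverse \<theta> * v (t k)) \<longlonglongrightarrow> 0" by simp
      have "(\<lambda>k. v ((ss ! i) k)) \<longlonglongrightarrow> 0"
        by (rule tendsto_sandwich[OF _ _ tendsto_const lim']) (auto intro!: always_eventually le)
      then have "v.cls (ss ! i) = \<zero>\<^bsub>Q\<^esub>"
        unfolding v.cls_zero using v.cls_eq_iff[OF ss(1) v.v_Cauchy_const, of "ss ! i" 0] i(2) by simp
      then show ?thesis unfolding Ks_eq using i(2) by simp
    qed
    have "length Us = n" "length Ks = length ss" unfolding Us_def Ks_eq by simp_all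
    then show "set (take (length Us) Ks) \<subseteq> {\<zero>\<^bsub>Q\<^esub>}"
      using zero by (auto simp: in_set_conv_nth l_def)
  qed
  have span: "Q.Span (base_completion \<iota> v) Us = carrier Q"
  proof
    show "Q.Span (base_completion \<iota> v) Us \<subseteq> carrier Q"
      using Q.Span_subgroup_props(1)[OF subfield_base Us] .
    show "carrier Q \<subseteq> Q.Span (base_completion \<iota> v) Us"
    proof
      fix x assume "x \<in> carrier Q"
      then obtain s where s: "x = v.cls s" "v_Cauchy v s" unfolding v.carrier_completion by auto
      obtain a where a: "\<And>k. v (s k - (\<Sum>i<n. \<iota> (a k i) * u i)) \<le> \<theta> ^ k"
        using residue_dense[OF basis, of "s k" k for k] by metis
      have \<theta>_lim: "(\<lambda>k. \<theta> ^ k) \<longlonglongrightarrow> 0" using \<theta> by (intro LIMSEQ_realpow_zero) auto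
      have diff_lim: "(\<lambda>k. v (s k - (\<Sum>i<n. \<iota> (a k i) * u i))) \<longlonglongrightarrow> 0"
        by (rule tendsto_sandwich[OF _ _ tendsto_const \<theta>_lim]) (auto intro!: always_eventually a)
      define t where "t k = (\<Sum>i<n. \<iota> (a k i) * u i)" for k
      have "v_Cauchy v (\<lambda>k. s k - t k)" unfolding t_def by (rule v.v_Cauchy_null[OF diff_lim])
      then have "v_Cauchy v (\<lambda>k. s k + - (s k - t k))" by (intro v.v_Cauchy_add[OF s(2)] v.v_Cauchy_minus)
      then have t: "v_Cauchy v t" by simp
      have coeff: "v_Cauchy v (\<lambda>k. \<iota> (a k i))" if "i < n" for i
        unfolding v_Cauchy_def
      proof (intro allI impI)
        fix e :: real assume "e > 0"
        then have "0 < \<theta> * e" using \<theta> by simp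
        then obtain M where M: "\<And>m k. m \<ge> M \<Longrightarrow> k \<ge> M \<Longrightarrow> v (t m - t k) < \<theta> * e" using v.v_CauchyD[OF t] by blast
        have "v (\<iota> (a m i) - \<iota> (a k i)) < e" if "m \<ge> M" "k \<ge> M" for m k
        proof -
          have "t m - t k = (\<Sum>i<n. \<iota> (a m i - a k i) * u i)"
            unfolding t_def sum_subtractf[symmetric] by (intro sum.cong) (auto simp: hom.diff algebra_simps)
          then have "\<theta> * v (\<iota> (a m i - a k i)) \<le> v (t m - t k)"
            using coefficient_bound[OF basis \<open>i < n\<close>, of "\<lambda>i. a m i - a k i"] by simp
          then have "\<theta> * v (\<iota> (a m i - a k i)) < \<theta> * e" using M[OF that] by linarith
          then show ?thesis using \<theta>(1) by (simp add: hom.diff)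
        qed
        then show "\<exists>M. \<forall>m\<ge>M. \<forall>k\<ge>M. v (\<iota> (a m i) - \<iota> (a k i)) < e" by blast
      qed
      define ss where "ss = map (\<lambda>i k. \<iota> (a k i)) [0..<n]"
      have ss: "v_Cauchy v r" if "r \<in> set ss" for r using that coeff unfolding ss_def by auto
      have "set (map v.cls ss) \<subseteq> base_completion \<iota> v"
        unfolding base_completion_eq ss_def using coeff by auto
      moreover have "x = Q.combine (map v.cls ss) Us"
      proof -
        have "Q.combine (map v.cls ss) Us = v.cls (\<lambda>k. \<Sum>i<min (length ss) (length (map u [0..<n])). (ss ! i) k * map u [0..<n] ! i)"
          unfolding Us_def by (rule v.combine_cls[OF ss])
        also have "(\<lambda>k. \<Sum>i<min (length ss) (length (map u [0..<n])). (ss ! i) k * map u [0..<n] ! i) = t"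
          unfolding t_def ss_def by (intro ext sum.cong) auto
        finally show ?thesis using v.cls_eq_iff[OF s(2) t] diff_lim unfolding s(1) t_def by simp
      qed
      moreover have "length (map v.cls ss) = length Us" unfolding ss_def Us_def by simp
      ultimately show "x \<in> Q.Span (base_completion \<iota> v) Us"
        using Q.Span_mem_iff_length_version[OF subfield_base Us] by blast
    qed
  qed
  have "Q.dimension (length Us) (base_completion \<iota> v) (carrier Q)"
    by (rule Q.dimensionI[OF subfield_base ind span])
  from Q.dimI[OF subfield_base this] show ?thesis
    unfolding local_degree_def over_def Us_def by simp
qed

lemma local_count:
  assumes "x \<noteq> 0" "v x \<le> 1"
  shows "\<exists>Z. transversal v (v x) Z \<and> log (real q) (real (card Z)) = - real (local_degree \<iota> v) * log (real q) (v x)"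
proof -
  obtain n u where basis: "residue_basis n u" using exists_residue_basis .
  show ?thesis using transversal_count[OF basis assms] unfolding local_degree_eq[OF basis] .
qed

end

subsection \<open>The product formula\<close>

lemma nonunit_mult:
  assumes "subring_of R" "x \<in> R" "y \<in> R" "\<not> unit_of R y"
  shows "\<not> unit_of R (x * y)"
proof
  assume "unit_of R (x * y)"
  then have *: "x * inverse (x * y) \<in> R" "x * y \<noteq> 0" unfolding unit_of_def using assms subring_ofD(5) by auto
  then have eq: "x * inverse (x * y) = inverse y" by (simp add: field_simps)
  have "inverse y \<in> R" using *(1) unfolding eq .
  moreover have "y \<noteq> 0" using *(2) by auto
  ultimately show False using assms unfolding unit_of_def by blast
qed

lemma nonunit_minus: "subring_of R \<Longrightarrow> unit_of R (- x) \<Longrightarrow> unit_of R x"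
  unfolding unit_of_def using subring_ofD(3)[of R "- x"] subring_ofD(3)[of R "inverse (- x)"] by auto

context function_field
begin

lemma subring_range_\<epsilon>: "subring_of (range \<epsilon>)"
proof -
  have "\<epsilon> (- c) = - \<epsilon> c" for c
    using \<epsilon>_add[of c "- c"] by (simp add: eq_neg_iff_add_eq_0 add.commute)
  then show ?thesis unfolding subring_of_def
    by (auto simp: \<epsilon>_add[symmetric] \<epsilon>_mult[symmetric] intro: range_eqI[of _ _ 1]) (metis rangeI)
qed

lemma embed_A_pCons: "embed_A \<iota> (pCons c a) = \<epsilon> c + embed_A \<iota> [:0, 1:] * embed_A \<iota> a"
proof -
  have "pCons c a = [:c:] + [:0, 1:] * a" by simp
  then show ?thesis unfolding \<epsilon>_def by (metis embed_A_simps(1,2))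
qed

text \<open>The place is finite or infinite according to whether t lies in \<open>R\<close>. If it
  does, so does all of A, and a monic polynomial of least degree among the nonzero nonunits of
  \<open>R\<close> is the prime of the place. If not, \<open>1/t\<close> is a nonunit of
  \<open>R\<close>, and every nonzero polynomial is a unit times a power of t.\<close>

lemma place_of_valuation_subring:
  assumes R: "valuation_subring R" and \<epsilon>R: "range \<epsilon> \<subseteq> R" and z: "z \<notin> R"
  obtains v where "v \<in> places \<iota>" "v z > 1"
proof -
  note goal = that
  note sR = valuation_subringD(1)[OF R]
  note RD = subring_ofD[OF sR]
  define t where "t = embed_A \<iota> [:0, 1:]"
  have A_pCons: "embed_A \<iota> (pCons c a) = \<epsilon> c + t * embed_A \<iota> a" for c a
    unfolding t_def by (rule embed_A_pCons)
  have unit_\<epsilon>: "unit_of R (\<epsilon> c)" if "c \<noteq> 0" for c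
  proof -
    have "\<epsilon> c * \<epsilon> (inverse c) = 1" using that by (simp add: \<epsilon>_mult[symmetric])
    then have "inverse (\<epsilon> c) = \<epsilon> (inverse c)" "\<epsilon> c \<noteq> 0" by (auto simp: inverse_unique)
    then show ?thesis unfolding unit_of_def using \<epsilon>R by auto
  qed
  \<comment> \<open>Both cases end alike: once every nonzero polynomial is a unit of
    \<open>R\<close> times a power of one element \<pi>, all nonzero elements of K have a rational
    order, and the absolute value with base \<theta> defined by it is the place sought.\<close>
  have finish: thesis
    if \<pi>: "\<pi> \<in> R" "\<pi> \<noteq> 0" "inverse \<pi> \<notin> R" and \<theta>: "0 < \<theta>" "\<theta> < 1"
      and dec: "\<And>a. a \<noteq> 0 \<Longrightarrow> \<exists>w. unit_of R w \<and> embed_A \<iota> a = w * \<pi> powi (e a)"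
      and pl: "\<And>v. nonarch_abs v \<Longrightarrow> (\<And>a. a \<noteq> 0 \<Longrightarrow> v (embed_A \<iota> a) = \<theta> powr (e a)) \<Longrightarrow> v \<in> places \<iota>"
    for \<pi> \<theta> e
  proof -
    have decF: "\<exists>w k. unit_of R w \<and> \<iota> x = w * \<pi> powi k" if "x \<noteq> 0" for x
    proof (cases x rule: Fract_cases_nonzero)
      case (Fract a b)
      obtain w where w: "unit_of R w" "embed_A \<iota> a = w * \<pi> powi (e a)" using dec Fract by blast
      obtain w' where w': "unit_of R w'" "embed_A \<iota> b = w' * \<pi> powi (e b)" using dec Fract by blast
      have "\<iota> x = (w * inverse w') * \<pi> powi (e a - e b)"
        unfolding Fract(1) \<iota>_Fract w w' using \<pi>(2) by (simp add: power_int_diff field_simps)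
      then show ?thesis using unit_of_mult[OF sR w(1) unit_of_inverse[OF w'(1)]] by blast
    qed (use that in simp)
    have ex: "\<exists>r. ord_relation R \<pi> x r" if x: "x \<noteq> 0" for x
    proof -
      obtain m a where ma: "m > 0" "a \<noteq> 0" "unit_of R (x ^ m / \<iota> a)"
        using hom.valuation_subring_algebraic[OF R algebraic x] by blast
      obtain w k where w: "unit_of R w" "\<iota> a = w * \<pi> powi k" using decF[OF ma(2)] by blast
      have "x ^ m = (x ^ m / \<iota> a) * \<iota> a" using ma(2) by simp
      then have "x ^ m = ((x ^ m / \<iota> a) * w) * \<pi> powi k" using w(2) by (metis mult.assoc)
      then show ?thesis unfolding ord_relation_def using unit_of_mult[OF sR ma(3) w(1)] ma(1) by blast
    qed
    obtain v where v: "nonarch_abs v" "\<And>x. v x \<le> 1 \<longleftrightarrow> x \<in> R"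
      "\<And>x r. x \<noteq> 0 \<Longrightarrow> ord_relation R \<pi> x r \<Longrightarrow> v x = \<theta> powr r"
      using exists_abs_of_valuation_subring[OF R \<pi> ex \<theta>] by blast
    have "v (embed_A \<iota> a) = \<theta> powr (e a)" if a: "a \<noteq> 0" for a
    proof (rule v(3))
      obtain w where w: "unit_of R w" "embed_A \<iota> a = w * \<pi> powi (e a)" using dec[OF a] by blast
      then show "ord_relation R \<pi> (embed_A \<iota> a) (e a)"
        unfolding ord_relation_def by (intro exI[of _ 1] exI[of _ "e a"] exI[of _ w] conjI) auto
    qed (use a in simp)
    then have "v \<in> places \<iota>" using pl[OF v(1)] by blast
    moreover have "v z > 1" using v(2)[of z] z by simp
    ultimately show thesis by (rule goal)
  qed
  have abs: "absolute_value v" if "nonarch_abs v" for v :: "'a \<Rightarrow> real"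
  proof -
    interpret v: nonarch_abs v by fact
    have "v (x + y) \<le> v x + v y" for x y
      using v.ultra[of x y] v.nonneg[of x] v.nonneg[of y] by linarith
    then show ?thesis unfolding absolute_value_def by (simp add: v.mult)
  qed
  show thesis
  proof (cases "t \<in> R")
    case True
    have AR: "embed_A \<iota> a \<in> R" for a
    proof (induction a)
      case (pCons c a)
      then show ?case unfolding A_pCons using True \<epsilon>R by (intro RD) auto
    qed (simp add: embed_A_simps RD)
    \<comment> \<open>If all nonzero polynomials were units of \<open>R\<close>, so would be all
      nonzero elements of F, and a power of the algebraic element \<open>z\<close> would be a unit,
      although \<open>z\<close> is not in \<open>R\<close>.\<close>
    have "\<exists>a. a \<noteq> 0 \<and> \<not> unit_of R (embed_A \<iota> a)"
    proof (rule ccontr)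
      assume "\<not> ?thesis"
      then have u: "\<And>a. a \<noteq> 0 \<Longrightarrow> unit_of R (embed_A \<iota> a)" by blast
      have uF: "unit_of R (\<iota> x)" if "x \<noteq> 0" for x
      proof (cases x rule: Fract_cases_nonzero)
        case (Fract a b)
        then show ?thesis unfolding Fract(1) \<iota>_Fract divide_inverse
          by (intro unit_of_mult[OF sR] unit_of_inverse u)
      qed (use that in simp)
      have "z \<noteq> 0" using z RD(2) by auto
      then obtain m a where ma: "m > 0" "a \<noteq> 0" "unit_of R (z ^ m / \<iota> a)"
        using hom.valuation_subring_algebraic[OF R algebraic] by blast
      have "z ^ m = (z ^ m / \<iota> a) * \<iota> a" using ma(2) by simp
      then have "unit_of R (z ^ m)" using unit_of_mult[OF sR ma(3) uF[OF ma(2)]] by metis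
      then show False using valuation_subring_power_closed[OF R _ ma(1)] z unfolding unit_of_def by blast
    qed
    then obtain P0 where P0: "P0 \<noteq> 0" "\<not> unit_of R (embed_A \<iota> P0)"
      "\<And>a. a \<noteq> 0 \<Longrightarrow> Polynomial.degree a < Polynomial.degree P0 \<Longrightarrow> unit_of R (embed_A \<iota> a)"
      using exists_least_iff[of "\<lambda>n. \<exists>a. a \<noteq> 0 \<and> \<not> unit_of R (embed_A \<iota> a) \<and> Polynomial.degree a = n"] by blast
    define P where "P = Polynomial.smult (inverse (Polynomial.lead_coeff P0)) P0"
    have lc: "Polynomial.lead_coeff P = 1" using P0(1) unfolding P_def by simp
    then have Pn0: "P \<noteq> 0" by auto
    have degP: "Polynomial.degree P = Polynomial.degree P0" using P0(1) unfolding P_def by simp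
    have P_non: "\<not> unit_of R (embed_A \<iota> P)"
    proof -
      have "P = [:inverse (Polynomial.lead_coeff P0):] * P0" unfolding P_def by simp
      then have "embed_A \<iota> P = \<epsilon> (inverse (Polynomial.lead_coeff P0)) * embed_A \<iota> P0"
        unfolding \<epsilon>_def by (metis embed_A_simps(2))
      then show ?thesis using nonunit_mult[OF sR _ AR P0(2)] \<epsilon>R by auto
    qed
    have P_min: "unit_of R (embed_A \<iota> a)" if "a \<noteq> 0" "Polynomial.degree a < Polynomial.degree P" for a
      using P0(3) that unfolding degP by blast
    have degP_pos: "0 < Polynomial.degree P"
    proof (rule ccontr)
      assume "\<not> ?thesis"
      then obtain c where "P = [:c:]" using degree_eq_zeroE[of P] by auto
      then have "unit_of R (embed_A \<iota> P)" using unit_\<epsilon>[of c] Pn0 unfolding \<epsilon>_def by auto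
      then show False using P_non by blast
    qed
    have irr: "Factorial_Ring.irreducible P"
    proof (rule Factorial_Ring.irreducibleI)
      show "\<not> P dvd 1" using degP_pos is_unit_iff_degree[OF Pn0] by simp
      fix a b assume ab: "P = a * b"
      then have ab0: "a \<noteq> 0" "b \<noteq> 0" using Pn0 by auto
      show "a dvd 1 \<or> b dvd 1"
      proof (rule ccontr)
        assume "\<not> ?thesis"
        then have "0 < Polynomial.degree a" "0 < Polynomial.degree b" using is_unit_iff_degree ab0 by blast+
        then have "unit_of R (embed_A \<iota> a)" "unit_of R (embed_A \<iota> b)"
          using P_min ab ab0 by (auto simp: degree_mult_eq)
        then show False using P_non unit_of_mult[OF sR] unfolding ab embed_A_simps by blast
      qed
    qed (fact Pn0)
    have unit_ndvd: "unit_of R (embed_A \<iota> b)" if "\<not> P dvd b" for b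
    proof (rule ccontr)
      \<comment> \<open>The remainder of \<open>b\<close> modulo \<open>P\<close> is a unit by
        minimality of the degree, but it would also be a sum of two nonunits.\<close>
      assume b: "\<not> unit_of R (embed_A \<iota> b)"
      define r where "r = b mod P"
      have r0: "r \<noteq> 0" using that unfolding r_def by (simp add: dvd_eq_mod_eq_0)
      then have "unit_of R (embed_A \<iota> r)" using P_min degree_mod_less[OF Pn0, of b] unfolding r_def by blast
      moreover have "r = b + (- (b div P)) * P" unfolding r_def by (simp add: minus_div_mult_eq_mod[symmetric])
      then have "embed_A \<iota> r = embed_A \<iota> b + embed_A \<iota> (- (b div P)) * embed_A \<iota> P" by (metis embed_A_simps(1,2))
      moreover have "\<not> unit_of R (embed_A \<iota> b + embed_A \<iota> (- (b div P)) * embed_A \<iota> P)"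
        using valuation_subring_nonunit_add[OF R AR b _ nonunit_mult[OF sR AR AR P_non]] RD(5) AR by blast
      ultimately show False by simp
    qed
    have q1: "1 < real q" by (rule q_gt_1)
    show thesis
    proof (rule finish[of "embed_A \<iota> P" "real q powr (- real (Polynomial.degree P))" "\<lambda>a. int (ord_at P a)"])
      show "embed_A \<iota> P \<in> R" by (rule AR)
      show "embed_A \<iota> P \<noteq> 0" using Pn0 by simp
      show "inverse (embed_A \<iota> P) \<notin> R" using P_non AR Pn0 unfolding unit_of_def by auto
      show "0 < real q powr (- real (Polynomial.degree P))" using q1 by simp
      have "real q powr (- real (Polynomial.degree P)) < real q powr 0" using q1 degP_pos by (intro powr_less_mono) auto
      then show "real q powr (- real (Polynomial.degree P)) < 1" using q1 by simp
      show "\<exists>w. unit_of R w \<and> embed_A \<iota> a = w * embed_A \<iota> P powi int (ord_at P a)" if a: "a \<noteq> 0" for a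
      proof -
        obtain a' where a': "a = P ^ ord_at P a * a'" "\<not> P dvd a'" using ord_at_decompose[OF degP_pos a] .
        have "embed_A \<iota> a = embed_A \<iota> a' * embed_A \<iota> P ^ ord_at P a"
          using a'(1) by (metis embed_A_simps(2) embed_A_power mult.commute)
        then show ?thesis using unit_ndvd[OF a'(2)] by auto
      qed
      show "v \<in> places \<iota>" if v: "nonarch_abs v"
        "\<And>a. a \<noteq> 0 \<Longrightarrow> v (embed_A \<iota> a) = (real q powr (- real (Polynomial.degree P))) powr real_of_int (int (ord_at P a))" for v
      proof -
        have "v (\<iota> (Fraction_Field.Fract a b)) =
          real CARD('k) powr (- real (Polynomial.degree P) * (real (ord_at P a) - real (ord_at P b)))"
          if "a \<noteq> 0" "b \<noteq> 0" for a b
          unfolding \<iota>_Fract nonarch_abs.divide[OF v(1)] v(2)[OF that(1)] v(2)[OF that(2)] q_eq[symmetric]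
          by (simp add: powr_powr powr_diff[symmetric] algebra_simps)
        then have "extends_finite_place \<iota> P v" unfolding extends_finite_place_def by blast
        then show ?thesis unfolding places_def using abs[OF v(1)] lc irr by blast
      qed
    qed
  next
    case False
    then have t0: "t \<noteq> 0" using RD(2) by auto
    have it: "inverse t \<in> R" using valuation_subringD(2)[OF R] False by blast
    have it_non: "\<not> unit_of R (inverse t)" using False unfolding unit_of_def by simp
    have embed_poly: "embed_A \<iota> a = (\<Sum>i\<le>Polynomial.degree a. \<epsilon> (Polynomial.coeff a i) * t ^ i)" for a
    proof -
      have "embed_A \<iota> a = poly (map_poly \<epsilon> a) t"
        by (induction a) (simp_all add: embed_A_simps map_poly_pCons A_pCons)
      moreover have "\<epsilon> c = 0 \<longleftrightarrow> c = 0" for c using unit_\<epsilon>[of c] unfolding unit_of_def by auto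
      then have "Polynomial.degree (map_poly \<epsilon> a) = Polynomial.degree a" by (intro degree_map_poly) auto
      ultimately show ?thesis by (simp add: poly_altdef coeff_map_poly)
    qed
    have dec: "unit_of R (embed_A \<iota> a / t ^ Polynomial.degree a)" if "a \<noteq> 0" for a
    proof (rule ccontr)
      define n where "n = Polynomial.degree a"
      assume non: "\<not> unit_of R (embed_A \<iota> a / t ^ Polynomial.degree a)"
      \<comment> \<open>The terms below the leading one, divided by \<open>t ^ n\<close>, all carry
        positive powers of the nonunit \<open>1/t\<close>.\<close>
      define s where "s = (\<Sum>i<n. \<epsilon> (Polynomial.coeff a i) * inverse t ^ (n - i))"
      have nonunit_term: "\<epsilon> (Polynomial.coeff a i) * inverse t ^ (n - i) \<in> R \<and> \<not> unit_of R (\<epsilon> (Polynomial.coeff a i) * inverse t ^ (n - i))"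
        if "i < n" for i
      proof -
        have eq: "inverse t ^ (n - i) = inverse t ^ (n - i - 1) * inverse t"
          using that by (metis Suc_diff_1 power_Suc2 zero_less_diff)
        have "\<epsilon> (Polynomial.coeff a i) * inverse t ^ (n - i - 1) \<in> R" using \<epsilon>R it by (intro RD) auto
        then show ?thesis using nonunit_mult[OF sR _ it it_non] RD(5) it unfolding eq mult.assoc[symmetric] by blast
      qed
      have s: "s \<in> R \<and> \<not> unit_of R s" unfolding s_def by (rule valuation_subring_sum_nonunit[OF R]) (use nonunit_term in auto)
      have "embed_A \<iota> a / t ^ n = \<epsilon> (Polynomial.lead_coeff a) + s"
      proof -
        have "{..n} = insert n {..<n}" by auto
        then have "embed_A \<iota> a = \<epsilon> (Polynomial.lead_coeff a) * t ^ n + (\<Sum>i<n. \<epsilon> (Polynomial.coeff a i) * t ^ i)"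
          unfolding embed_poly n_def[symmetric] by simp
        moreover have "(\<Sum>i<n. \<epsilon> (Polynomial.coeff a i) * t ^ i) = s * t ^ n"
          unfolding s_def sum_distrib_right
        proof (rule sum.cong)
          fix i assume "i \<in> {..<n}"
          then have "t ^ n = t ^ (n - i) * t ^ i" by (simp add: power_add[symmetric])
          then show "\<epsilon> (Polynomial.coeff a i) * t ^ i = \<epsilon> (Polynomial.coeff a i) * inverse t ^ (n - i) * t ^ n"
            using t0 by (simp add: power_inverse)
        qed simp
        ultimately show ?thesis using t0 by (simp add: field_simps)
      qed
      moreover have "embed_A \<iota> a / t ^ n + - s \<in> R \<and> \<not> unit_of R (embed_A \<iota> a / t ^ n + - s)"
      proof (rule valuation_subring_nonunit_add[OF R])
        show "embed_A \<iota> a / t ^ n \<in> R" using calculation s \<epsilon>R by (auto intro: RD)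
        show "\<not> unit_of R (embed_A \<iota> a / t ^ n)" using non unfolding n_def .
        show "- s \<in> R" "\<not> unit_of R (- s)" using s RD(3) nonunit_minus[OF sR] by blast+
      qed
      ultimately have "\<not> unit_of R (\<epsilon> (Polynomial.lead_coeff a))" by simp
      then show False using unit_\<epsilon> that by simp
    qed
    have q1: "1 < real q" by (rule q_gt_1)
    show thesis
    proof (rule finish[of "inverse t" "1 / real q" "\<lambda>a. - int (Polynomial.degree a)"])
      show "inverse t \<in> R" by (rule it)
      show "inverse t \<noteq> 0" using t0 by simp
      show "inverse (inverse t) \<notin> R" using False by simp
      show "0 < 1 / real q" "1 / real q < 1" using q1 by auto
      show "\<exists>w. unit_of R w \<and> embed_A \<iota> a = w * inverse t powi (- int (Polynomial.degree a))" if "a \<noteq> 0" for a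
        using dec[OF that] t0
        by (intro exI[of _ "embed_A \<iota> a / t ^ Polynomial.degree a"]) (simp add: power_int_minus power_inverse)
      show "v \<in> places \<iota>" if v: "nonarch_abs v"
        "\<And>a. a \<noteq> 0 \<Longrightarrow> v (embed_A \<iota> a) = (1 / real q) powr real_of_int (- int (Polynomial.degree a))" for v
      proof -
        have v': "v (embed_A \<iota> a) = real q powr real (Polynomial.degree a)" if "a \<noteq> 0" for a
          using v(2)[OF that] q1 by (simp add: powr_divide powr_minus field_simps)
        have "v (\<iota> (Fraction_Field.Fract a b)) = real CARD('k) powr (real (Polynomial.degree a) - real (Polynomial.degree b))"
          if "a \<noteq> 0" "b \<noteq> 0" for a b
          unfolding \<iota>_Fract nonarch_abs.divide[OF v(1)] v'[OF that(1)] v'[OF that(2)] q_eq[symmetric]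
          by (simp add: powr_diff)
        then have "extends_infinite_place \<iota> v" unfolding extends_infinite_place_def by blast
        then show ?thesis unfolding places_def using abs[OF v(1)] by blast
      qed
    qed
  qed
qed

text \<open>At a zero of \<open>z\<close> the inverse \<open>y\<close> is large, and a nonzero
  polynomial in \<open>y\<close> with constant coefficients has size at least 1 there; so
  \<open>z\<close> is not in the ring generated by \<open>y\<close> over the constants. A valuation
  ring containing this ring but not \<open>z\<close> belongs to a place where \<open>z\<close> has a
  pole.\<close>

lemma no_zero_without_pole:
  assumes "z \<noteq> 0" "v0 \<in> places \<iota>" "v0 z < 1"
  shows "\<exists>v\<in>places \<iota>. v z > 1"
proof -
  interpret v0: nonarch_abs v0 by (rule places_nonarch[OF assms(2)])
  define y where "y = inverse z"
  have y0: "y \<noteq> 0" using assms(1) unfolding y_def by simp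
  have "0 < v0 z" using assms(1) by simp
  then have vy: "1 < v0 y" unfolding y_def v0.inverse using assms(3) by (rule one_less_inverse)
  have "z \<notin> adjoin (range \<epsilon>) y"
  proof
    assume "z \<in> adjoin (range \<epsilon>) y"
    then obtain p where p: "z = poly p y" "\<And>i. Polynomial.coeff p i \<in> range \<epsilon>" unfolding adjoin_def by auto
    have coeff: "v0 (Polynomial.coeff p i) = 1" if "Polynomial.coeff p i \<noteq> 0" for i
    proof -
      obtain c where c: "Polynomial.coeff p i = \<epsilon> c" using p(2)[of i] by auto
      then have "c \<noteq> 0" using that by auto
      then show ?thesis using abs_\<epsilon>[OF v0.nonarch_abs_axioms] c by simp
    qed
    define n where "n = Polynomial.degree p"
    have "p \<noteq> 0" using p(1) assms(1) by auto
    then have lc: "v0 (Polynomial.coeff p n) = 1" using coeff unfolding n_def by simp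
    have "v0 (\<Sum>i\<le>n. Polynomial.coeff p i * y ^ i) = v0 (Polynomial.coeff p n * y ^ n)"
    proof (rule v0.sum_dominant)
      fix i assume "i \<in> {..n}" "i \<noteq> n"
      then have "i < n" by simp
      have "v0 (Polynomial.coeff p i) \<le> 1" using coeff[of i] by (cases "Polynomial.coeff p i = 0") auto
      then have "v0 (Polynomial.coeff p i) * v0 y ^ i \<le> 1 * v0 y ^ i" by (intro mult_right_mono) auto
      also have "\<dots> < v0 y ^ n" using vy \<open>i < n\<close> by simp
      finally show "v0 (Polynomial.coeff p i * y ^ i) < v0 (Polynomial.coeff p n * y ^ n)"
        by (simp add: v0.mult v0.power lc)
    qed (use y0 \<open>p \<noteq> 0\<close> in \<open>auto simp: n_def\<close>)
    then have "v0 z = v0 y ^ n" using p(1) lc by (simp add: poly_altdef n_def v0.mult v0.power)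
    moreover have "1 \<le> v0 y ^ n" using vy by simp
    ultimately show False using assms(3) by simp
  qed
  then obtain R where R: "valuation_subring R" "adjoin (range \<epsilon>) y \<subseteq> R" "z \<notin> R"
    using exists_valuation_subring[OF subring_of_adjoin[OF subring_range_\<epsilon>] adjoin_incl(2)[OF subring_range_\<epsilon>], of y]
    unfolding y_def by auto
  have "range \<epsilon> \<subseteq> R" using adjoin_incl(1)[OF subring_range_\<epsilon>] R(2) by blast
  from place_of_valuation_subring[OF R(1) this R(3)] show ?thesis by blast
qed

end

lemma log_prod_pos:
  fixes f :: "'i \<Rightarrow> real"
  assumes "finite S" "\<And>i. i \<in> S \<Longrightarrow> 0 < f i"
  shows "log b (\<Prod>i\<in>S. f i) = (\<Sum>i\<in>S. log b (f i))"
  using assms by (induction S rule: finite_induct) (simp_all add: log_mult_pos prod_pos)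

primrec digits_value :: "('s \<Rightarrow> 'a::comm_ring_1) \<Rightarrow> 'a \<Rightarrow> 's list \<Rightarrow> 'a" where
  "digits_value x y [] = 0"
| "digits_value x y (s # w) = x s + y * digits_value x y w"

lemma le_of_linear_bound:
  fixes A B C :: real
  assumes "\<And>l::nat. real l * A \<le> C + real l * B"
  shows "A \<le> B"
proof (rule ccontr)
  assume "\<not> A \<le> B"
  then obtain l where "C < real l * (A - B)" using reals_Archimedean3[of "A - B"] by auto
  then show False using assms[of l] by (simp add: algebra_simps)
qed

context function_field
begin

lemma places_count:
  assumes "v \<in> places \<iota>" "x \<noteq> 0" "v x \<le> 1"
  shows "\<exists>Z. transversal v (v x) Z \<and> log (real q) (real (card Z)) = - real (local_degree \<iota> v) * log (real q) (v x)"
proof -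
  obtain \<pi> d T where b: "base_place v \<pi> d T" using places_base[OF assms(1)] .
  interpret place \<iota> q v \<pi> d T using assms(1) b by unfold_locales
  show ?thesis by (rule local_count[OF assms(2,3)])
qed

definition log_size :: "'a \<Rightarrow> ('a \<Rightarrow> real) \<Rightarrow> real" where
  "log_size y v = real (local_degree \<iota> v) * log (real q) (v y)"

text \<open>Counting argument: the sums \<open>x\<^sub>0 + y x\<^sub>1 + \<dots> + y\<^bsup>l-1\<^esup> x\<^bsub>l-1\<^esub>\<close>, with digits representing the
  residues modulo the zeros of \<open>y\<close>, are pairwise distinct, and their number is limited by their
  sizes at the poles of \<open>y\<close>.\<close>

lemma product_formula_nonneg:
  assumes "y \<noteq> 0"
  shows "0 \<le> (\<Sum>v\<in>{v \<in> places \<iota>. v y \<noteq> 1}. log_size y v)"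
proof (cases "\<exists>v0\<in>places \<iota>. v0 y < 1")
  case False
  then have "1 \<le> v y" if "v \<in> places \<iota>" for v using that by (meson not_less)
  then show ?thesis using q_gt_1 unfolding log_size_def by (intro sum_nonneg mult_nonneg_nonneg) (auto simp: zero_le_log_cancel_iff order_less_le_trans[OF zero_less_one])
next
  case True
  then obtain v0 where v0: "v0 \<in> places \<iota>" "v0 y < 1" by blast
  define Zr where "Zr = {v \<in> places \<iota>. v y < 1}"
  have na: "nonarch_abs v" if "v \<in> places \<iota>" for v by (rule places_nonarch[OF that])
  have pos: "0 < v z" if "v \<in> places \<iota>" "z \<noteq> 0" for v z using nonarch_abs.pos_iff[OF na[OF that(1)]] that(2) by blast
  have fin_supp: "finite {v \<in> places \<iota>. v y \<noteq> 1}" by (rule finite_support[OF assms])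
  have Zr: "finite Zr" "Zr \<subseteq> places \<iota>" "v0 \<in> Zr"
    unfolding Zr_def using v0 by (auto intro: finite_subset[OF _ fin_supp])
  have "\<exists>Z. transversal v (v y) Z \<and> log (real q) (real (card Z)) = - log_size y v" if "v \<in> Zr" for v
    using places_count[of v y] assms that unfolding Zr_def log_size_def by auto
  then obtain Z where Z: "\<And>v. v \<in> Zr \<Longrightarrow> transversal v (v y) (Z v)"
    "\<And>v. v \<in> Zr \<Longrightarrow> log (real q) (real (card (Z v))) = - log_size y v" by metis
  have ZD: "finite (Z v)" "\<And>z. z \<in> Z v \<Longrightarrow> v z \<le> 1" "\<And>x. v x \<le> 1 \<Longrightarrow> \<exists>!z. z \<in> Z v \<and> v (x - z) \<le> v y"
    if "v \<in> Zr" for v using Z(1)[OF that] unfolding transversal_def by auto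
  have Zcard: "0 < card (Z v)" if "v \<in> Zr" for v
    using transversal_nonempty[OF na Z(1)[OF that]] Zr(2) that by blast
  \<comment> \<open>One residue modulo \<open>y\<close> at each zero of \<open>y\<close>. The
    logarithm of \<open>card E\<close> is minus the sum of \<open>log_size y\<close> over the
    zeros.\<close>
  define E where "E = PiE Zr Z"
  have finE: "finite E" unfolding E_def using Zr ZD(1) by (intro finite_PiE) auto
  define \<delta> where "\<delta> = Min ((\<lambda>v. v y) ` Zr)"
  have "\<delta> \<in> (\<lambda>v. v y) ` Zr" unfolding \<delta>_def using Zr by (intro Min_in) auto
  then have \<delta>: "0 < \<delta>" using pos assms Zr(2) by auto
  have \<delta>_le: "\<delta> \<le> v y" if "v \<in> Zr" for v unfolding \<delta>_def using Zr that by (intro Min_le) auto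
  have "\<exists>x. \<forall>v\<in>Zr. v (x - s v) < \<delta>" for s by (rule places_approximation[OF Zr(1,2) \<delta>])
  then obtain x where x: "\<And>s v. v \<in> Zr \<Longrightarrow> v (x s - s v) < \<delta>" by metis
  have x_close: "v (x s - s v) \<le> v y" if "v \<in> Zr" for s v using x[OF that, of s] \<delta>_le[OF that] by simp
  have x_le: "v (x s) \<le> 1" if "v \<in> Zr" "s \<in> E" for s v
  proof -
    interpret v: nonarch_abs v using na Zr(2) that(1) by blast
    have "v y \<le> 1" using that(1) unfolding Zr_def by simp
    then have "v (x s - s v) \<le> 1" using x_close[OF that(1), of s] by linarith
    moreover have "v (s v) \<le> 1" using ZD(2)[OF that(1)] that unfolding E_def by auto
    ultimately show ?thesis using v.ultra_bound[of "x s - s v" 1 "s v"] by simp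
  qed
  define F where "F = digits_value x y"
  have F_le: "v (F w) \<le> 1" if v: "v \<in> Zr" "set w \<subseteq> E" for v w
  proof -
    interpret v: nonarch_abs v using na Zr(2) that(1) by blast
    have vy: "v y \<le> 1" using that(1) unfolding Zr_def by simp
    show ?thesis using v(2) unfolding F_def
      by (induction w) (auto intro!: v.ultra_bound x_le[OF v(1)] simp: v.mult mult_le_one vy)
  qed
  \<comment> \<open>Digits can be recovered one at a time: modulo \<open>y\<close> at the zeros, the
    value of a word is its first digit, and the rest is then divided by \<open>y\<close>.\<close>
  have F_inj: "w = w'" if "length w = length w'" "set w \<subseteq> E" "set w' \<subseteq> E" "F w = F w'" for w w'
    using that
  proof (induction w w' rule: list_induct2)
    case (Cons s w s' w')
    have eq: "x s + y * F w = x s' + y * F w'" using Cons.prems(3) unfolding F_def by simp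
    have "s = s'"
    proof (rule PiE_ext[of s Zr Z])
      fix v assume v: "v \<in> Zr"
      interpret v: nonarch_abs v using na Zr(2) v by blast
      have "v (F w' - F w) \<le> 1" using F_le[OF v] Cons.prems by (intro v.ultra_diff_bound) auto
      then have "v y * v (F w' - F w) \<le> v y * 1" by (intro mult_left_mono) auto
      moreover have "x s - x s' = y * (F w' - F w)" using eq by (simp add: algebra_simps)
      ultimately have "v (x s - x s') \<le> v y" by (simp add: v.mult)
      then have "v ((x s - x s') - (x s - s v)) \<le> v y" using x_close[OF v, of s] by (rule v.ultra_diff_bound)
      then have "v ((x s' - s' v) + ((x s - x s') - (x s - s v))) \<le> v y" using x_close[OF v, of s'] v.ultra_bound by blast
      then have "v (s v - s' v) \<le> v y" by simp
      moreover have "v (s v - s v) \<le> v y" by simp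
      moreover have "s v \<in> Z v" "s' v \<in> Z v" using Cons.prems v unfolding E_def by auto
      ultimately show "s v = s' v" using ZD(3)[OF v ZD(2)[OF v]] by blast
    qed (use Cons.prems in \<open>auto simp: E_def\<close>)
    moreover have "F w = F w'" using eq \<open>s = s'\<close> assms by simp
    ultimately show ?case using Cons by simp
  qed simp
  \<comment> \<open>Outside \<open>S\<close>, both \<open>y\<close> and all digits are integral, and
    with them all values \<open>F w\<close>.\<close>
  define S where "S = {v \<in> places \<iota>. v y \<noteq> 1} \<union> (\<Union>s\<in>E. {v \<in> places \<iota>. 1 < v (x s)})"
  have S: "finite S" "S \<subseteq> places \<iota>" "Zr \<subseteq> S"
    unfolding S_def Zr_def using fin_supp finE finite_poles by auto
  have "\<exists>b. b \<noteq> 0 \<and> 1 \<le> v b \<and> (\<forall>s\<in>E. v (x s) \<le> v b)" if v: "v \<in> S" for v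
  proof -
    have vp: "v \<in> places \<iota>" using S(2) v by blast
    interpret v: nonarch_abs v by (rule na[OF vp])
    obtain g where g: "1 < v g" using places_nontrivial[OF vp] by blast
    obtain k where k: "(\<Sum>s\<in>E. v (x s)) < v g ^ k" using real_arch_pow[OF g] by blast
    have "v (x s) \<le> v (g ^ k)" if "s \<in> E" for s
    proof -
      have "v (x s) \<le> (\<Sum>s\<in>E. v (x s))" using finE that by (intro member_le_sum) auto
      then show ?thesis using k by (simp add: v.power)
    qed
    moreover have "g ^ k \<noteq> 0" using g by auto
    moreover have "1 \<le> v (g ^ k)" using g by (simp add: v.power)
    ultimately show ?thesis by blast
  qed
  then obtain \<beta> where \<beta>: "\<And>v. v \<in> S \<Longrightarrow> \<beta> v \<noteq> 0" "\<And>v. v \<in> S \<Longrightarrow> 1 \<le> v (\<beta> v)"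
    "\<And>v s. v \<in> S \<Longrightarrow> s \<in> E \<Longrightarrow> v (x s) \<le> v (\<beta> v)" by metis
  \<comment> \<open>Values of \<open>F\<close> that agree modulo \<open>g v\<close> differ by less
    than 1 at \<open>v\<close>; this strictness makes their difference vanish at \<open>v0\<close>,
    as \<open>no_zero_without_pole\<close> requires.\<close>
  have "\<exists>g. g \<noteq> 0 \<and> v g < 1" if v: "v \<in> S" for v
  proof -
    obtain \<pi> d T where "base_place v \<pi> d T" using places_base[of v] S(2) v by blast
    then show ?thesis using base_placeD(2,10) by (metis hom.eq_0_iff)
  qed
  then obtain g where g: "\<And>v. v \<in> S \<Longrightarrow> g v \<noteq> 0" "\<And>v. v \<in> S \<Longrightarrow> v (g v) < 1" by metis
  define Po where "Po v = (if 1 < v y then 1 else 0 :: real)" for v :: "'a \<Rightarrow> real"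
  \<comment> \<open>A bound for \<open>F\<close> on words of length \<open>l\<close> that grows with
    \<open>l\<close> only at the poles of \<open>y\<close>. Dividing by it makes all values integral
    on \<open>S\<close>, so that residues can be counted.\<close>
  define \<eta> where "\<eta> l v = \<beta> v * (if 1 < v y then y ^ l else 1)" for l :: nat and v :: "'a \<Rightarrow> real"
  have \<eta>0: "\<eta> l v \<noteq> 0" if "v \<in> S" for l v using \<beta>(1)[OF that] assms unfolding \<eta>_def by simp
  have F_bound: "v (F w) \<le> v (\<eta> (length w) v)" if v: "v \<in> S" "set w \<subseteq> E" for v w
  proof -
    interpret v: nonarch_abs v using na S(2) v(1) by blast
    show ?thesis
    proof (cases "1 < v y")
      case True
      have "v (F w) \<le> v (\<beta> v) * v y ^ length w"
        using v(2) unfolding F_def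
      proof (induction w)
        case (Cons s w)
        have "v (x s) * 1 \<le> v (\<beta> v) * v y ^ length (s # w)"
          using \<beta>(3)[OF v(1), of s] Cons.prems True by (intro mult_mono one_le_power) auto
        moreover have "v y * v (digits_value x y w) \<le> v y * (v (\<beta> v) * v y ^ length w)"
          using Cons by (intro mult_left_mono) auto
        ultimately show ?case by (auto intro!: v.ultra_bound simp: v.mult mult_ac)
      qed simp
      then show ?thesis unfolding \<eta>_def using True by (simp add: v.mult v.power)
    next
      case False
      have "v (F w) \<le> v (\<beta> v)"
        using v(2) unfolding F_def
      proof (induction w)
        case (Cons s w)
        have "v y * v (digits_value x y w) \<le> 1 * v (\<beta> v)"
          using Cons False by (intro mult_mono) auto
        then show ?case using \<beta>(3)[OF v(1), of s] Cons.prems by (auto intro!: v.ultra_bound simp: v.mult)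
      qed simp
      then show ?thesis unfolding \<eta>_def using False by simp
    qed
  qed
  \<comment> \<open>\<open>C\<close> collects what does not depend on \<open>l\<close>;
    \<open>B\<close> is the sum of \<open>log_size y\<close> over the poles.\<close>
  define C where "C = (\<Sum>v\<in>S. real (local_degree \<iota> v) * (log (real q) (v (\<beta> v)) - log (real q) (v (g v))))"
  define B where "B = (\<Sum>v\<in>S. log_size y v * Po v)"
  have "real l * log (real q) (real (card E)) \<le> C + real l * B" for l
  proof -
    have mod: "g v / \<eta> l v \<noteq> 0" "v (g v / \<eta> l v) \<le> 1"
      "log (real q) (v (g v / \<eta> l v)) = log (real q) (v (g v)) - log (real q) (v (\<beta> v)) - real l * (Po v * log (real q) (v y))"
      if v: "v \<in> S" for v
    proof -
      interpret v: nonarch_abs v using na S(2) v by blast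
      show "g v / \<eta> l v \<noteq> 0" using g(1)[OF v] \<eta>0[OF v] by simp
      have "1 * 1 \<le> v (\<beta> v) * v (if 1 < v y then y ^ l else 1)"
        using \<beta>(2)[OF v] by (intro mult_mono) (auto simp: v.power one_le_power)
      then have \<eta>1: "1 \<le> v (\<eta> l v)" unfolding \<eta>_def v.mult by simp
      moreover have "0 < v (\<eta> l v)" using \<eta>1 by linarith
      ultimately show "v (g v / \<eta> l v) \<le> 1"
        unfolding v.divide using g(2)[OF v] by (simp only: pos_divide_le_eq)
      have pg: "0 < v (g v)" and p\<beta>: "0 < v (\<beta> v)" and py: "0 < v y" using g(1)[OF v] \<beta>(1)[OF v] assms by simp_all
      have "log (real q) (v (\<eta> l v)) = log (real q) (v (\<beta> v)) + real l * (Po v * log (real q) (v y))"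
        unfolding \<eta>_def Po_def v.mult using p\<beta> py q_gt_1
        by (auto simp: log_mult_pos v.power log_nat_power simp del: v.pos_iff)
      then show "log (real q) (v (g v / \<eta> l v)) = log (real q) (v (g v)) - log (real q) (v (\<beta> v)) - real l * (Po v * log (real q) (v y))"
        unfolding v.divide using pg \<open>0 < v (\<eta> l v)\<close> q_gt_1 by (simp add: log_divide_pos del: v.pos_iff)
    qed
    have "\<exists>W. transversal v (v (g v / \<eta> l v)) W \<and>
      log (real q) (real (card W)) = - real (local_degree \<iota> v) * log (real q) (v (g v / \<eta> l v))" if v: "v \<in> S" for v
      using places_count[of v "g v / \<eta> l v"] mod(1,2)[OF v] S(2) v by blast
    then obtain W where W: "\<And>v. v \<in> S \<Longrightarrow> transversal v (v (g v / \<eta> l v)) (W v)"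
      "\<And>v. v \<in> S \<Longrightarrow> log (real q) (real (card (W v))) = - real (local_degree \<iota> v) * log (real q) (v (g v / \<eta> l v))"
      by metis
    have Wfin: "finite (W v)" and Wcard: "0 < card (W v)" if "v \<in> S" for v
      using W(1)[OF that] transversal_nonempty[OF na W(1)[OF that]] S(2) that unfolding transversal_def by auto
    define L where "L = {w. set w \<subseteq> E \<and> length w = l}"
    have cardL: "card L = card E ^ l" "finite L"
      unfolding L_def using card_lists_length_eq[OF finE] finite_lists_length_eq[OF finE] by auto
    have ex_residue: "\<exists>z. z \<in> W v \<and> v (F w / \<eta> l v - z) \<le> v (g v / \<eta> l v)" if v: "v \<in> S" and w: "w \<in> L" for v w
    proof -
      interpret v: nonarch_abs v using na S(2) v by blast
      have "0 < v (\<eta> l v)" using \<eta>0[OF v] by simp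
      then have "v (F w / \<eta> l v) \<le> 1" unfolding v.divide using F_bound[OF v, of w] w unfolding L_def
        by (simp add: pos_divide_le_eq del: v.pos_iff)
      then show ?thesis using W(1)[OF v] unfolding transversal_def by blast
    qed
    define \<Phi> where "\<Phi> w v = (SOME z. z \<in> W v \<and> v (F w / \<eta> l v - z) \<le> v (g v / \<eta> l v))" for w v
    have \<Phi>: "\<Phi> w v \<in> W v \<and> v (F w / \<eta> l v - \<Phi> w v) \<le> v (g v / \<eta> l v)" if "v \<in> S" "w \<in> L" for v w
      unfolding \<Phi>_def by (rule someI_ex[OF ex_residue[OF that]])
    have "inj_on (\<lambda>w. restrict (\<Phi> w) S) L"
    proof (rule inj_onI)
      fix w w' assume ww: "w \<in> L" "w' \<in> L" "restrict (\<Phi> w) S = restrict (\<Phi> w') S"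
      have small: "v (F w - F w') < 1" if v: "v \<in> S" for v
      proof -
        interpret v: nonarch_abs v using na S(2) v by blast
        have "\<Phi> w v = \<Phi> w' v" using ww(3) v by (metis restrict_apply')
        then have "v ((F w / \<eta> l v - \<Phi> w v) - (F w' / \<eta> l v - \<Phi> w v)) \<le> v (g v / \<eta> l v)"
          using \<Phi>[OF v ww(1)] \<Phi>[OF v ww(2)] v.ultra_diff_bound by metis
        then have "v ((F w - F w') / \<eta> l v) \<le> v (g v / \<eta> l v)" by (simp add: diff_divide_distrib)
        moreover have "0 < v (\<eta> l v)" using \<eta>0[OF v] by simp
        ultimately have "v (F w - F w') \<le> v (g v)" unfolding v.divide by (simp only: divide_le_cancel)
        then show ?thesis using g(2)[OF v] by simp
      qed
      have outside: "v (F u) \<le> 1" if v: "v \<in> places \<iota>" "v \<notin> S" and u: "u \<in> L" for v u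
      proof -
        interpret v: nonarch_abs v by (rule na[OF v(1)])
        have vy: "v y = 1" and vx: "\<And>s. s \<in> E \<Longrightarrow> v (x s) \<le> 1" using v unfolding S_def by (auto simp: not_less)
        have "set u \<subseteq> E" using u unfolding L_def by simp
        then show ?thesis unfolding F_def
          by (induction u) (auto intro!: v.ultra_bound vx simp: v.mult vy)
      qed
      \<comment> \<open>The difference has size below 1 at the places of \<open>S\<close>, among
        them \<open>v0\<close>, and at most 1 elsewhere; if it were nonzero, it would have a zero
        but no pole.\<close>
      have "F w - F w' = 0"
      proof (rule ccontr)
        assume nz: "F w - F w' \<noteq> 0"
        have "v0 (F w - F w') < 1" using small Zr(3) S(3) by blast
        then obtain v where v: "v \<in> places \<iota>" "1 < v (F w - F w')"
          using no_zero_without_pole[OF nz v0(1)] by blast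
        interpret v: nonarch_abs v by (rule na[OF v(1)])
        show False
        proof (cases "v \<in> S")
          case True
          then show ?thesis using small[OF True] v(2) by simp
        next
          case False
          then show ?thesis using v.ultra_diff_bound[OF outside[OF v(1) False ww(1)] outside[OF v(1) False ww(2)]] v(2) by simp
        qed
      qed
      then have "F w = F w'" by simp
      then show "w = w'" using F_inj[of w w'] ww(1,2) unfolding L_def by simp
    qed
    moreover have "(\<lambda>w. restrict (\<Phi> w) S) ` L \<subseteq> PiE S W" using \<Phi> by auto
    moreover have "finite (PiE S W)" using S(1) Wfin by (intro finite_PiE) auto
    ultimately have "card L \<le> card (PiE S W)" by (intro card_inj_on_le)
    then have "card E ^ l \<le> (\<Prod>v\<in>S. card (W v))" unfolding cardL using S(1) by (simp add: card_PiE)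
    then have "real (card E) ^ l \<le> (\<Prod>v\<in>S. real (card (W v)))"
      by (metis of_nat_le_iff of_nat_power of_nat_prod)
    moreover have cE: "0 < real (card E)" unfolding E_def using Zr Zcard by (simp add: card_PiE prod_pos)
    ultimately have "log (real q) (real (card E) ^ l) \<le> log (real q) (\<Prod>v\<in>S. real (card (W v)))"
      using q_gt_1 by (intro log_mono) auto
    also have "\<dots> = (\<Sum>v\<in>S. log (real q) (real (card (W v))))"
      using Wcard S(1) q_gt_1 by (intro log_prod_pos) auto
    also have "\<dots> = (\<Sum>v\<in>S. real (local_degree \<iota> v) * (log (real q) (v (\<beta> v)) - log (real q) (v (g v))) + real l * (log_size y v * Po v))"
      using W(2) mod(3) by (intro sum.cong) (auto simp: log_size_def algebra_simps)
    also have "\<dots> = C + real l * B" unfolding C_def B_def by (simp add: sum.distrib sum_distrib_left)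
    finally show ?thesis using cE by (simp add: log_nat_power)
  qed
  \<comment> \<open>Letting \<open>l\<close> grow removes \<open>C\<close>.\<close>
  then have "log (real q) (real (card E)) \<le> B" by (rule le_of_linear_bound)
  moreover have "log (real q) (real (card E)) = (\<Sum>v\<in>Zr. - log_size y v)"
  proof -
    have "log (real q) (real (card E)) = log (real q) (\<Prod>v\<in>Zr. real (card (Z v)))"
      unfolding E_def using Zr(1) by (simp add: card_PiE)
    also have "\<dots> = (\<Sum>v\<in>Zr. log (real q) (real (card (Z v))))"
      using Zcard Zr(1) q_gt_1 by (intro log_prod_pos) auto
    finally show ?thesis using Z(2) by simp
  qed
  moreover have "B + (\<Sum>v\<in>Zr. log_size y v) = (\<Sum>v\<in>{v \<in> places \<iota>. v y \<noteq> 1}. log_size y v)"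
  proof -
    have "(\<Sum>v\<in>Zr. log_size y v) = (\<Sum>v\<in>S. log_size y v * (if v y < 1 then 1 else 0))"
      using S by (intro sum.mono_neutral_cong_left) (auto simp: Zr_def)
    then have "B + (\<Sum>v\<in>Zr. log_size y v) = (\<Sum>v\<in>S. log_size y v * (Po v + (if v y < 1 then 1 else 0)))"
      unfolding B_def by (simp add: sum.distrib distrib_left)
    also have "\<dots> = (\<Sum>v\<in>{v \<in> places \<iota>. v y \<noteq> 1}. log_size y v)"
      using S by (intro sum.mono_neutral_cong_right) (auto simp: S_def Po_def)
    finally show ?thesis .
  qed
  ultimately show ?thesis by (simp add: sum_negf)
qed

text \<open>The inequality for the inverse of \<open>y\<close> is the opposite one.\<close>

lemma product_formula:
  assumes "y \<noteq> 0"
  shows "(\<Sum>v\<in>{v \<in> places \<iota>. v y \<noteq> 1}. log_size y v) = 0"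
proof -
  have inv: "v (inverse y) = inverse (v y)" if "v \<in> places \<iota>" for v
    by (rule nonarch_abs.inverse[OF places_nonarch[OF that]])
  have "{v \<in> places \<iota>. v (inverse y) \<noteq> 1} = {v \<in> places \<iota>. v y \<noteq> 1}" using inv by force
  moreover have "log_size (inverse y) v = - log_size y v" if "v \<in> places \<iota>" for v
    unfolding log_size_def inv[OF that]
    using nonarch_abs.pos_iff[OF places_nonarch[OF that], of y] assms by (simp add: log_inverse)
  ultimately have "0 \<le> - (\<Sum>v\<in>{v \<in> places \<iota>. v y \<noteq> 1}. log_size y v)"
    using product_formula_nonneg[of "inverse y"] assms by (simp add: sum_negf[symmetric])
  then show ?thesis using product_formula_nonneg[OF assms] by simp
qed

text \<open>Residue bases at all infinite places together remain independent over F by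
  \<open>independent_mod_le\<close>. The bound makes the local degrees at infinity, divided by the
  degree of K, weights of total at most 1.\<close>

lemma sum_local_degree_infinite: "(\<Sum>v\<in>{v. infinite_place v}. local_degree \<iota> v) \<le> extension_degree \<iota>"
proof (cases "{v. infinite_place v} = {}")
  case False
  then obtain v0 where v0: "infinite_place v0" by blast
  define \<pi> :: "'k poly fract" where "\<pi> = Fraction_Field.Fract 1 [:0, 1:]"
  define T where "T = range (\<lambda>c :: 'k. Fraction_Field.Fract [:c:] 1)"
  have b: "base_place v \<pi> 1 T" if "infinite_place v" for v
    using infinite_place_base[OF that] unfolding \<pi>_def T_def .
  have "\<exists>u. place.residue_basis \<iota> v \<pi> (local_degree \<iota> v) u" if v: "infinite_place v" for v
  proof -
    interpret place \<iota> q v \<pi> 1 T using v b[OF v] unfolding infinite_place_def by unfold_locales auto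
    obtain n u where "residue_basis n u" using exists_residue_basis .
    then show ?thesis using local_degree_eq by blast
  qed
  then obtain u where u: "\<And>v. infinite_place v \<Longrightarrow> place.residue_basis \<iota> v \<pi> (local_degree \<iota> v) (u v)" by metis
  have "(\<Sum>v\<in>{v. infinite_place v}. card {..<local_degree \<iota> v}) \<le> extension_degree \<iota>"
  proof (rule independent_mod_le[where u = u and S = "{v. infinite_place v}" and \<pi> = \<pi> and d = 1 and T = T])
    show "finite {v. infinite_place v}" by (rule finite_infinite_places)
    show "{v. infinite_place v} \<subseteq> places \<iota>" unfolding infinite_place_def by blast
    show "base_place v \<pi> 1 T" if "v \<in> {v. infinite_place v}" for v using b that by simp
    show "v (\<iota> x) = w (\<iota> x)" if "v \<in> {v. infinite_place v}" "w \<in> {v. infinite_place v}" for v w x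
      using infinite_place_\<iota>_eq that by simp
    show "finite {..<local_degree \<iota> v}" for v by simp
    show "\<forall>i\<in>{..<local_degree \<iota> v}. v (\<iota> (c i)) < 1"
      if v: "v \<in> {v. infinite_place v}" "\<And>i. i \<in> {..<local_degree \<iota> v} \<Longrightarrow> v (\<iota> (c i)) \<le> 1"
        "v (\<Sum>i\<in>{..<local_degree \<iota> v}. \<iota> (c i) * u v i) \<le> v (\<iota> \<pi>)" for v c
    proof -
      have iv: "infinite_place v" using v(1) by simp
      interpret place \<iota> q v \<pi> 1 T using iv b[OF iv] unfolding infinite_place_def by unfold_locales auto
      show ?thesis
        using residue_independentD[OF u[OF iv], of c] v(2,3) unfolding \<theta>_def by auto
    qed
  qed
  then show ?thesis by simp
qed simp

end

subsection \<open>Isogenies of Drinfeld modules\<close>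

lemma poly_eqI_infinite:
  fixes p p' :: "'c::field poly"
  assumes inf: "infinite (UNIV :: 'c set)" and eq: "\<And>x. poly p x = poly p' x"
  shows "p = p'"
proof (rule ccontr)
  assume "p \<noteq> p'"
  then have "finite {x. poly (p - p') x = 0}" by (intro poly_roots_finite) simp
  then show False using inf eq by simp
qed

lemma card_roots_separable:
  fixes p :: "'c::alg_closed_field poly"
  assumes "p \<noteq> 0" "\<And>x. poly p x = 0 \<Longrightarrow> poly (pderiv p) x \<noteq> 0"
  shows "card {x. poly p x = 0} = Polynomial.degree p"
  using assms
proof (induction "Polynomial.degree p" arbitrary: p)
  case 0
  then obtain c where "p = [:c:]" using degree_eq_zeroE by metis
  then show ?case using 0 by simp
next
  case (Suc n)
  obtain a where a: "poly p a = 0" using alg_closed_imp_poly_has_root[of p] Suc(2) by auto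
  then obtain p' where p': "p = [:- a, 1:] * p'" unfolding poly_eq_0_iff_dvd by auto
  have nz: "p' \<noteq> 0" using Suc(3) p' by auto
  have deg: "Polynomial.degree p = Suc (Polynomial.degree p')" unfolding p' using nz by (subst degree_mult_eq) auto
  have der: "poly (pderiv p) x = poly p' x + (x - a) * poly (pderiv p') x" for x
    unfolding p' pderiv_mult by (simp add: pderiv_pCons algebra_simps)
  have "card {x. poly p' x = 0} = Polynomial.degree p'"
  proof (rule Suc(1))
    show "n = Polynomial.degree p'" using Suc(2) deg by simp
    fix x assume x: "poly p' x = 0"
    then have "poly p x = 0" unfolding p' by simp
    then show "poly (pderiv p') x \<noteq> 0" using Suc(4)[of x] der[of x] x by auto
  qed (rule nz)
  moreover have "{x. poly p x = 0} = insert a {x. poly p' x = 0}" unfolding p' by auto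
  moreover have "poly p' a \<noteq> 0" using Suc(4)[OF a] der[of a] by auto
  ultimately show ?case using poly_roots_finite[OF nz] deg by simp
qed

lemma additive_0:
  fixes F :: "'c::group_add \<Rightarrow> 'd::group_add"
  assumes "\<And>x y. F (x + y) = F x + F y"
  shows "F 0 = 0"
  by (metis add.right_neutral add_left_cancel assms)

lemma coeff_1_pcompose:
  fixes p p' :: "'c::field poly"
  assumes "Polynomial.coeff p 0 = 0" "Polynomial.coeff p' 0 = 0"
  shows "Polynomial.coeff (pcompose p p') 1 = Polynomial.coeff p 1 * Polynomial.coeff p' 1"
proof -
  obtain s where s: "p = pCons 0 s" using assms(1) by (metis coeff_pCons_0 pCons_cases)
  obtain s' where s': "p' = pCons 0 s'" using assms(2) by (metis coeff_pCons_0 pCons_cases)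
  have "pcompose p p' = pCons 0 (s' * pcompose s p')" unfolding s by (simp add: pcompose_pCons s')
  then have "Polynomial.coeff (pcompose p p') 1 = poly (s' * pcompose s p') 0" by (simp add: poly_0_coeff_0)
  then show ?thesis unfolding poly_mult poly_pcompose using s s' by (simp add: poly_0_coeff_0 mult.commute)
qed

lemma pcompose_right_cancel:
  fixes f :: "'c::field poly"
  assumes "pcompose a f = pcompose b f" "0 < Polynomial.degree f"
  shows "a = b"
proof -
  have "pcompose (a - b) f = 0" using assms(1) by (simp add: pcompose_diff)
  then have "a - b = 0" by (rule pcompose_eq_0[OF _ assms(2)])
  then show ?thesis by simp
qed

text \<open>Comparing the lowest terms of \<open>f \<circ> T\<close> and \<open>T' \<circ> f\<close>: an order of vanishing \<open>m > 1\<close>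
  of \<open>f\<close> at 0 would force \<open>t\<^sup>m = t\<close>.\<close>

lemma isogeny_linear_coeff:
  fixes f T T' :: "'c::field poly"
  assumes "f \<noteq> 0" "Polynomial.coeff f 0 = 0" and comm: "pcompose f T = pcompose T' f"
    and T: "Polynomial.coeff T 0 = 0" "Polynomial.coeff T 1 = t"
    and T': "Polynomial.coeff T' 0 = 0" "Polynomial.coeff T' 1 = t"
    and t: "\<And>m. t ^ m = t \<Longrightarrow> m = 1"
  shows "Polynomial.coeff f 1 \<noteq> 0"
proof -
  define m where "m = Polynomial.order 0 f"
  obtain s where s: "T = pCons 0 s" using T(1) by (metis coeff_pCons_0 pCons_cases)
  obtain s' where s': "T' = pCons 0 s'" using T'(1) by (metis coeff_pCons_0 pCons_cases)
  obtain f' where f': "f = [:0, 1:] ^ m * f'" "\<not> [:0, 1:] dvd f'"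
    using order_decomp[OF assms(1), of 0] unfolding m_def by auto
  have f'0: "poly f' 0 \<noteq> 0" using f'(2) poly_eq_0_iff_dvd[of f' 0] by simp
  have pT: "T = [:0, 1:] * s" using s by simp
  have comp_power: "pcompose (p ^ n) r = pcompose p r ^ n" for p r :: "'c poly" and n
    by (induction n) (simp_all add: pcompose_mult pcompose_1)
  have "pcompose f T = T ^ m * pcompose f' T"
    unfolding f'(1) by (simp add: pcompose_mult comp_power pcompose_pCons)
  also have "\<dots> = [:0, 1:] ^ m * (s ^ m * pcompose f' T)" unfolding pT power_mult_distrib by (simp only: mult.assoc)
  finally have l: "pcompose f T = [:0, 1:] ^ m * (s ^ m * pcompose f' T)" .
  have "pcompose T' f = f * pcompose s' f" unfolding s' by (simp add: pcompose_pCons)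
  also have "\<dots> = [:0, 1:] ^ m * (f' * pcompose s' f)" by (subst (1) f'(1)) (simp only: mult.assoc)
  finally have "[:0, 1:] ^ m * (s ^ m * pcompose f' T) = [:0, 1:] ^ m * (f' * pcompose s' f)" using l comm by simp
  then have "s ^ m * pcompose f' T = f' * pcompose s' f"
    by (subst (asm) mult_left_cancel) auto
  \<comment> \<open>At 0 both \<open>s\<close> and \<open>s'\<close> take the value
    \<open>t\<close>, and \<open>f'\<close> does not vanish there by the choice of
    \<open>m\<close>.\<close>
  then have "poly (s ^ m * pcompose f' T) 0 = poly (f' * pcompose s' f) 0" by simp
  then have "t ^ m * poly f' 0 = poly f' 0 * t"
    using T T' assms(2) s s' unfolding poly_mult poly_power poly_pcompose by (simp add: poly_0_coeff_0[of f] poly_0_coeff_0[of s] poly_0_coeff_0[of s'])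
  then have "m = 1" using f'0 t[of m] by simp
  then have "f = pCons 0 f'" using f'(1) by simp
  then show ?thesis using f'0 by (simp add: poly_0_coeff_0)
qed

text \<open>Over an infinite field, additivity of the polynomial function is a formal identity; the
  nonzero linear coefficient expresses separability.\<close>

locale additive_poly =
  fixes f :: "'c::alg_closed_field poly"
  assumes inf: "infinite (UNIV :: 'c set)" and additive: "poly f (x + y) = poly f x + poly f y"
    and coeff_1: "Polynomial.coeff f 1 \<noteq> 0"
begin

lemma nonzero: "f \<noteq> 0" using coeff_1 by auto

lemma poly_0: "poly f 0 = 0" using additive by (rule additive_0)

lemma coeff_0: "Polynomial.coeff f 0 = 0" using poly_0 by (simp add: poly_0_coeff_0)

lemma degree_pos: "0 < Polynomial.degree f" using le_degree[OF coeff_1] by simp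

text \<open>By additivity a translation changes \<open>f\<close> only by a constant, so the
  derivative of \<open>f\<close> is constant and equal to the linear coefficient. Hence all roots
  are simple.\<close>

lemma card_kernel: "card (poly_kernel f) = Polynomial.degree f"
  unfolding poly_kernel_def
proof (rule card_roots_separable[OF nonzero])
  fix x
  have "pcompose f [:x, 1:] = f + [:poly f x:]"
    by (rule poly_eqI_infinite[OF inf]) (simp add: poly_pcompose additive)
  then have "pderiv (pcompose f [:x, 1:]) = pderiv (f + [:poly f x:])" by simp
  then have "poly (pcompose (pderiv f) [:x, 1:]) 0 = poly (pderiv f) 0"
    unfolding pderiv_pcompose by (simp add: pderiv_pCons pderiv_add)
  then show "poly (pderiv f) x \<noteq> 0"
    using coeff_1 by (simp add: poly_pcompose poly_0_coeff_0[of "pderiv f"] coeff_pderiv)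
qed

text \<open>\<open>H\<close> minus its value at 0 vanishes on the kernel of \<open>f\<close> and is
  divisible by \<open>f\<close>, which has as many roots as its degree. The quotient is again
  invariant under translation by the kernel and has smaller degree.\<close>

lemma factor_through:
  assumes "\<And>a. poly f a = 0 \<Longrightarrow> pcompose H [:a, 1:] = H"
  shows "\<exists>h. H = pcompose h f"
  using assms
proof (induction "Polynomial.degree H" arbitrary: H rule: less_induct)
  case less
  show ?case
  proof (cases "Polynomial.degree H = 0")
    case True
    then obtain c where "H = [:c:]" using degree_eq_zeroE by metis
    then have "H = pcompose [:c:] f" by simp
    then show ?thesis by blast
  next
    case False
    define R where "R = H - [:poly H 0:]"
    have R0: "poly R a = 0" if a: "poly f a = 0" for a
    proof -
      have "poly (pcompose H [:a, 1:]) 0 = poly H 0" using less(2)[OF a] by simp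
      then show ?thesis unfolding R_def by (simp add: poly_pcompose)
    qed
    have "R mod f = 0"
    proof (rule ccontr)
      assume nz: "R mod f \<noteq> 0"
      have "poly_kernel f \<subseteq> {x. poly (R mod f) x = 0}"
      proof
        fix x assume "x \<in> poly_kernel f"
        then have x: "poly f x = 0" unfolding poly_kernel_def by simp
        have "poly R x = poly (R div f) x * poly f x + poly (R mod f) x"
          by (metis div_mult_mod_eq poly_add poly_mult)
        then show "x \<in> {x. poly (R mod f) x = 0}" using R0[OF x] x by simp
      qed
      then have "Polynomial.degree f \<le> card {x. poly (R mod f) x = 0}"
        unfolding card_kernel[symmetric] by (intro card_mono poly_roots_finite nz)
      also have "\<dots> \<le> Polynomial.degree (R mod f)" by (rule card_poly_roots_bound[OF nz])
      also have "\<dots> < Polynomial.degree f"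
        using degree_mod_less[OF nonzero, of R] nz by simp
      finally show False by simp
    qed
    then obtain H1 where H1: "R = f * H1" by (metis mod_0_imp_dvd dvdE)
    have "R = H + (- [:poly H 0:])" unfolding R_def by (rule diff_conv_add_uminus)
    then have "Polynomial.degree R = Polynomial.degree H"
      using False by (metis degree_add_eq_left degree_minus degree_pCons_0 neq0_conv)
    then have "R \<noteq> 0" using False by auto
    then have "Polynomial.degree H1 < Polynomial.degree H"
      using H1 degree_pos \<open>Polynomial.degree R = _\<close> by (simp add: degree_mult_eq)
    moreover have "pcompose H1 [:a, 1:] = H1" if a: "poly f a = 0" for a
    proof -
      have fa: "pcompose f [:a, 1:] = f"
        by (rule poly_eqI_infinite[OF inf]) (simp add: poly_pcompose additive a)
      have "pcompose R [:a, 1:] = R" unfolding R_def by (simp add: pcompose_diff less(2)[OF a])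
      then have "f * pcompose H1 [:a, 1:] = f * H1" unfolding H1 by (simp add: pcompose_mult fa)
      then show ?thesis using nonzero by simp
    qed
    ultimately obtain h where h: "H1 = pcompose h f" using less(1) by blast
    have "H = pcompose (pCons (poly H 0) h) f"
      using H1 unfolding R_def by (simp add: pcompose_pCons h[symmetric] algebra_simps)
    then show ?thesis by blast
  qed
qed

end

section \<open>Drinfeld modules and isogenies over the algebraic closure\<close>

locale closure_of_function_field = function_field \<iota> q + \<kappa>: field_morphism \<kappa>
  for \<iota> :: "'k::{field,finite} poly fract \<Rightarrow> 'a::field" and q :: nat
    and \<kappa> :: "'a \<Rightarrow> 'c::alg_closed_field" +
  assumes \<kappa>_algebraic: "algebraic_via \<kappa> y"
begin

abbreviation "e c \<equiv> \<kappa> (\<epsilon> c)"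
abbreviation "t \<equiv> embed_A \<iota> [:0, 1:]"
abbreviation "\<Phi> \<phi> N \<equiv> map_poly \<kappa> (\<phi> N)"

text \<open>Generic characteristic enters here, through the injectivity of A into the closure; by
  \<open>isogeny_linear_coeff\<close> it makes every isogeny separable.\<close>

lemma t_power_eq: "\<kappa> t ^ m = \<kappa> t \<Longrightarrow> m = 1"
proof -
  assume "\<kappa> t ^ m = \<kappa> t"
  then have "embed_A \<iota> ([:0, 1:] ^ m - [:0, 1:]) = 0"
    using \<kappa>.inj by (simp add: \<kappa>.power[symmetric] embed_A_power embed_A_simps inj_eq)
  then have "[:0, 1:] ^ m = ([:0, 1:] :: 'k poly)" by (simp del: embed_A_simps)
  then have "Polynomial.degree ([:0, 1:] ^ m :: 'k poly) = 1" by simp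
  then show "m = 1" by (simp only: degree_linear_power)
qed

lemma infinite_closure: "infinite (UNIV :: 'c set)"
proof
  assume fin: "finite (UNIV :: 'c set)"
  have "inj (\<lambda>n. \<kappa> (embed_A \<iota> ([:0, 1:] ^ n)))"
  proof (rule injI)
    fix m n assume "\<kappa> (embed_A \<iota> ([:0, 1:] ^ m)) = \<kappa> (embed_A \<iota> ([:0, 1:] ^ n))"
    then have "embed_A \<iota> ([:0, 1:] ^ m - [:0, 1:] ^ n) = 0" using \<kappa>.inj by (simp add: embed_A_simps inj_eq)
    then have "[:0, 1:] ^ m = ([:0, 1:] ^ n :: 'k poly)" by simp
    then show "m = n" by (metis degree_linear_power)
  qed
  then show False using finite_subset[OF subset_UNIV fin, of "range _"] range_inj_infinite by blast
qed

lemmas poly_ext = poly_eqI_infinite[OF infinite_closure]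

lemma \<epsilon>_Frobenius: "\<epsilon> c ^ q = \<epsilon> c"
proof (cases "c = 0")
  case True
  then show ?thesis using q_ge_2 by simp
next
  case False
  define N where "N = UNIV - {0 :: 'k}"
  have "(\<Prod>x\<in>N. c * x) = (\<Prod>x\<in>N. x)"
    by (rule prod.reindex_bij_witness[of _ "\<lambda>x. x / c" "\<lambda>x. c * x"]) (use False in \<open>auto simp: N_def\<close>)
  then have "c ^ card N * (\<Prod>x\<in>N. x) = (\<Prod>x\<in>N. x)" by (simp add: prod.distrib)
  moreover have "(\<Prod>x\<in>N. x) \<noteq> 0" unfolding N_def by simp
  ultimately have "c ^ card N = 1" by simp
  moreover have "card N + 1 = q" unfolding N_def q_eq using q_ge_2 q_eq by (simp add: card_Diff_singleton)
  ultimately have "c ^ q = c" by (metis power_add mult_1 power_one_right)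
  then show ?thesis by (simp add: \<epsilon>_power[symmetric])
qed

lemma inj_e: "inj e"
proof (rule injI)
  fix a b assume "e a = e b"
  then have "embed_A \<iota> ([:a:] - [:b:]) = 0" using \<kappa>.inj unfolding \<epsilon>_def embed_A_simps by (simp add: inj_eq)
  then show "a = b" by simp
qed

text \<open>The difference \<open>(x + Y)\<^sup>q - x\<^sup>q - Y\<^sup>q\<close> has degree less than \<open>q\<close> in \<open>Y\<close>, so it suffices that it
  vanishes on the \<open>q\<close> elements of the finite field; the same argument in \<open>x\<close> reduces to \<open>x\<close> in the
  finite field.\<close>

lemma Frobenius_add_aux:
  assumes "\<And>c. (e c + x) ^ q = e c + x ^ q"
  shows "(y + x) ^ q = y ^ q + (x :: 'c) ^ q"
proof -
  define p where "p = [:x, 1:] ^ q - Polynomial.monom 1 q - [:x ^ q:]"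
  have val: "poly p y = (y + x) ^ q - y ^ q - x ^ q" for y
    unfolding p_def by (simp add: poly_monom poly_power add.commute)
  have "p = 0"
  proof (rule ccontr)
    assume nz: "p \<noteq> 0"
    have "range e \<subseteq> {y. poly p y = 0}"
      using assms by (auto simp: val \<kappa>.power[symmetric] \<epsilon>_Frobenius)
    then have "card (range e) \<le> card {y. poly p y = 0}" by (intro card_mono poly_roots_finite nz)
    then have "q \<le> card {y. poly p y = 0}" using inj_e by (simp add: card_image q_eq)
    also have "\<dots> \<le> Polynomial.degree p" by (rule card_poly_roots_bound[OF nz])
    finally have "q \<le> Polynomial.degree p" .
    moreover have "Polynomial.degree p \<le> q" unfolding p_def
      by (intro degree_diff_le) (simp_all add: degree_linear_power degree_monom_le)
    ultimately have "Polynomial.degree p = q" by simp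
    moreover have "Polynomial.coeff p q = 0"
    proof -
      have "Polynomial.coeff ([:x, 1:] ^ q) q = 1"
        using lead_coeff_power[of "[:x, 1:]" q] by (simp add: degree_linear_power)
      then show ?thesis unfolding p_def using q_ge_2 by (simp add: coeff_pCons split: nat.split)
    qed
    ultimately show False using nz by (metis leading_coeff_0_iff)
  qed
  then show ?thesis using val[of y] by (simp add: algebra_simps)
qed

lemma Frobenius_add: "(x + y) ^ q = x ^ q + (y :: 'c) ^ q"
proof (rule Frobenius_add_aux)
  fix c
  have "(x + e c) ^ q = x ^ q + e c ^ q" for x
  proof (rule Frobenius_add_aux)
    fix d
    have "(e d + e c) ^ q = e (d + c)"
      by (simp add: \<kappa>.add[symmetric] \<kappa>.power[symmetric] \<epsilon>_add[symmetric] \<epsilon>_Frobenius)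
    then show "(e d + e c) ^ q = e d + e c ^ q"
      by (simp add: \<kappa>.add \<kappa>.power[symmetric] \<epsilon>_add \<epsilon>_Frobenius)
  qed
  from this[of y] show "(e c + y) ^ q = e c + y ^ q"
    by (simp add: \<kappa>.power[symmetric] \<epsilon>_Frobenius add.commute)
qed

lemma Frobenius_power_add: "(x + y) ^ (q ^ i) = x ^ (q ^ i) + (y :: 'c) ^ (q ^ i)"
  by (induction i arbitrary: x y) (simp_all add: power_mult Frobenius_add)

lemma drinfeld_add: "drinfeld_module \<iota> r \<phi> \<Longrightarrow> \<Phi> \<phi> (a + b) = \<Phi> \<phi> a + \<Phi> \<phi> b"
  unfolding drinfeld_module_def by (simp add: \<kappa>.map_poly_add)

lemma drinfeld_mult: "drinfeld_module \<iota> r \<phi> \<Longrightarrow> \<Phi> \<phi> (a * b) = pcompose (\<Phi> \<phi> a) (\<Phi> \<phi> b)"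
  unfolding drinfeld_module_def by (simp add: \<kappa>.map_poly_pcompose)

lemma drinfeld_const: "drinfeld_module \<iota> r \<phi> \<Longrightarrow> \<Phi> \<phi> [:c:] = [:0, e c:]"
  unfolding drinfeld_module_def \<epsilon>_def by (simp add: map_poly_pCons)

lemma drinfeld_0: "drinfeld_module \<iota> r \<phi> \<Longrightarrow> \<Phi> \<phi> 0 = 0"
  using drinfeld_const[of r \<phi> 0] by simp

lemma drinfeld_pCons:
  assumes "drinfeld_module \<iota> r \<phi>"
  shows "\<Phi> \<phi> (pCons c N) = [:0, e c:] + pcompose (\<Phi> \<phi> [:0, 1:]) (\<Phi> \<phi> N)"
proof -
  have "pCons c N = [:c:] + [:0, 1:] * N" by simp
  then show ?thesis using drinfeld_add[OF assms] drinfeld_mult[OF assms] drinfeld_const[OF assms] by metis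
qed

lemma drinfeld_tau_poly:
  assumes "drinfeld_module \<iota> r \<phi>"
  shows "tau_poly q r (\<kappa> t) (\<lambda>i. \<kappa> (drinfeld_coeff \<phi> i)) (\<Phi> \<phi> [:0, 1:])"
    and "1 \<le> r \<Longrightarrow> drinfeld_coeff \<phi> r \<noteq> 0"
proof -
  obtain g where g: "g r \<noteq> 0" "\<phi> [:0, 1:] = [:0, t:] + (\<Sum>i=1..r. Polynomial.monom (g i) (q ^ i))"
    using assms unfolding drinfeld_module_def q_eq by blast
  have inj: "q ^ i = q ^ j \<longleftrightarrow> i = j" for i j using q_ge_2 by simp
  have coeff: "Polynomial.coeff (\<phi> [:0, 1:]) n =
      (if n = 1 then t else 0) + (\<Sum>i=1..r. if q ^ i = n then g i else 0)" for n
    unfolding g(2) by (auto simp: coeff_sum coeff_monom coeff_pCons split: nat.split intro!: sum.cong)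
  have gi: "drinfeld_coeff \<phi> i = g i" if "i \<in> {1..r}" for i
  proof -
    have "q ^ i \<noteq> 1" using one_less_q_power[OF q_ge_2 that] by linarith
    then show ?thesis using that unfolding drinfeld_coeff_def q_eq[symmetric] coeff by (simp add: inj)
  qed
  show "1 \<le> r \<Longrightarrow> drinfeld_coeff \<phi> r \<noteq> 0" using gi g(1) by simp
  have "q ^ i \<noteq> 1" if "i \<in> {1..r}" for i using one_less_q_power[OF q_ge_2 that] by linarith
  then have c1: "Polynomial.coeff (\<phi> [:0, 1:]) 1 = t" unfolding coeff by (simp add: sum.neutral)
  show "tau_poly q r (\<kappa> t) (\<lambda>i. \<kappa> (drinfeld_coeff \<phi> i)) (\<Phi> \<phi> [:0, 1:])"
    unfolding tau_poly_def
  proof (intro conjI allI ballI impI)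
    show "Polynomial.coeff (\<Phi> \<phi> [:0, 1:]) 1 = \<kappa> t" using c1 by (simp add: \<kappa>.coeff_map)
    fix i assume "i \<in> {1..r}"
    then show "Polynomial.coeff (\<Phi> \<phi> [:0, 1:]) (q ^ i) = \<kappa> (drinfeld_coeff \<phi> i)"
      by (simp add: \<kappa>.coeff_map drinfeld_coeff_def q_eq)
  next
    fix n assume n: "n \<noteq> 1 \<and> n \<notin> (\<lambda>i. q ^ i) ` {1..r}"
    then have "(\<Sum>i=1..r. if q ^ i = n then g i else 0) = 0" by (intro sum.neutral) auto
    then show "Polynomial.coeff (\<Phi> \<phi> [:0, 1:]) n = 0" using n unfolding \<kappa>.coeff_map coeff by simp
  qed
qed

lemma drinfeld_additive:
  assumes \<phi>: "drinfeld_module \<iota> r \<phi>"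
  shows "poly (\<Phi> \<phi> N) (x + y) = poly (\<Phi> \<phi> N) x + poly (\<Phi> \<phi> N) y"
proof -
  obtain g where g: "\<phi> [:0, 1:] = [:0, t:] + (\<Sum>i=1..r. Polynomial.monom (g i) (q ^ i))"
    using \<phi> unfolding drinfeld_module_def q_eq by blast
  have sum: "map_poly \<kappa> (\<Sum>i\<in>I. p i) = (\<Sum>i\<in>I. map_poly \<kappa> (p i))" for p :: "nat \<Rightarrow> 'a poly" and I
    by (induction I rule: infinite_finite_induct) (simp_all add: \<kappa>.map_poly_add)
  have "poly (\<Phi> \<phi> [:0, 1:]) x = x * \<kappa> t + (\<Sum>i=1..r. \<kappa> (g i) * x ^ (q ^ i))" for x
    unfolding g by (simp add: \<kappa>.map_poly_add sum poly_sum map_poly_monom poly_monom map_poly_pCons)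
  then have T: "poly (\<Phi> \<phi> [:0, 1:]) (x + y) = poly (\<Phi> \<phi> [:0, 1:]) x + poly (\<Phi> \<phi> [:0, 1:]) y" for x y
    by (simp add: Frobenius_power_add algebra_simps sum.distrib)
  show ?thesis
  proof (induction N)
    case (pCons c N)
    then show ?case unfolding drinfeld_pCons[OF \<phi>, of c N] by (simp add: poly_pcompose T algebra_simps)
  qed (simp add: drinfeld_0[OF \<phi>])
qed

lemma drinfeld_coeffs:
  assumes \<phi>: "drinfeld_module \<iota> r \<phi>"
  shows "Polynomial.coeff (\<Phi> \<phi> N) 0 = 0" "Polynomial.coeff (\<Phi> \<phi> N) 1 = \<kappa> (embed_A \<iota> N)"
proof -
  show z: "Polynomial.coeff (\<Phi> \<phi> N) 0 = 0" for N
    using additive_0[of "poly (\<Phi> \<phi> N)"] drinfeld_additive[OF \<phi>, of N] unfolding poly_0_coeff_0 by blast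
  have t: "Polynomial.coeff (\<Phi> \<phi> [:0, 1:]) 1 = \<kappa> t" using drinfeld_tau_poly[OF \<phi>] unfolding tau_poly_def by simp
  show "Polynomial.coeff (\<Phi> \<phi> N) 1 = \<kappa> (embed_A \<iota> N)"
  proof (induction N)
    case 0
    then show ?case using drinfeld_0[OF \<phi>] by (simp add: embed_A_simps)
  next
    case (pCons c N)
    have "Polynomial.coeff (\<Phi> \<phi> (pCons c N)) 1 = e c + \<kappa> t * \<kappa> (embed_A \<iota> N)"
      unfolding drinfeld_pCons[OF \<phi>, of c N] Polynomial.coeff_add coeff_1_pcompose[OF z z, of "[:0, 1:]" N] t pCons
      by simp
    then show ?case by (subst embed_A_pCons) (simp add: \<kappa>.add \<kappa>.mult)
  qed
qed

text \<open>An isogeny commutes with t by definition and with constants by linearity, and these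
  generate A. The identity is checked on values, where the additivity of \<open>f\<close> can be
  used, and then lifted to polynomials over the infinite field.\<close>

lemma isogeny_intertwines:
  assumes \<phi>: "drinfeld_module \<iota> r \<phi>" and \<phi>': "drinfeld_module \<iota> r \<phi>'" and f: "isogeny \<iota> \<kappa> \<phi> \<phi>' f"
  shows "pcompose f (\<Phi> \<phi> N) = pcompose (\<Phi> \<phi>' N) f"
proof (rule poly_ext)
  fix x
  have add: "poly f (x + y) = poly f x + poly f y" for x y
    using f unfolding isogeny_def Fq_linear_def by blast
  have lin: "poly f (e c * x) = e c * poly f x" for c x
    using f unfolding isogeny_def Fq_linear_def by (simp add: \<epsilon>_def embed_A_def)
  have "poly (pcompose f (\<Phi> \<phi> [:0, 1:])) x = poly (pcompose (\<Phi> \<phi>' [:0, 1:]) f) x" for x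
    using f unfolding isogeny_def by simp
  then have T: "poly f (poly (\<Phi> \<phi> [:0, 1:]) x) = poly (\<Phi> \<phi>' [:0, 1:]) (poly f x)" for x by (simp add: poly_pcompose)
  have z: "poly f 0 = 0" using add by (rule additive_0)
  show "poly (pcompose f (\<Phi> \<phi> N)) x = poly (pcompose (\<Phi> \<phi>' N) f) x"
  proof (induction N)
    case (pCons c N)
    then show ?case
      unfolding drinfeld_pCons[OF \<phi>, of c N] drinfeld_pCons[OF \<phi>', of c N]
      using lin[of c x] by (simp add: poly_pcompose add T mult.commute[of x] mult.commute[of "poly f x"])
  qed (simp add: drinfeld_0[OF \<phi>] drinfeld_0[OF \<phi>'] poly_pcompose z)
qed

lemma isogeny_additive_poly:
  assumes \<phi>: "drinfeld_module \<iota> r \<phi>" and \<phi>': "drinfeld_module \<iota> r \<phi>'" and f: "isogeny \<iota> \<kappa> \<phi> \<phi>' f"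
  shows "additive_poly f"
proof
  show "infinite (UNIV :: 'c set)" by (rule infinite_closure)
  show add: "poly f (x + y) = poly f x + poly f y" for x y
    using f unfolding isogeny_def Fq_linear_def by blast
  have z: "Polynomial.coeff f 0 = 0" using additive_0[of "poly f", OF add] unfolding poly_0_coeff_0 .
  have nz: "f \<noteq> 0" using f unfolding isogeny_def by blast
  show "Polynomial.coeff f 1 \<noteq> 0"
    by (rule isogeny_linear_coeff[OF nz z isogeny_intertwines[OF assms, of "[:0, 1:]"]])
      (use drinfeld_coeffs[OF \<phi>, of "[:0, 1:]"] drinfeld_coeffs[OF \<phi>', of "[:0, 1:]"] t_power_eq in auto)
qed

text \<open>As the kernel of \<open>f\<close> lies in \<open>\<phi>[N]\<close>, the additive
  polynomial \<open>\<phi>\<^sub>N\<close> is invariant under translation by it and factors through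
  \<open>f\<close>. The two other identities hold after composition with \<open>f\<close> on the
  right, which can be cancelled.\<close>

lemma dual_isogeny:
  assumes \<phi>: "drinfeld_module \<iota> r \<phi>" and \<phi>': "drinfeld_module \<iota> r \<phi>'" and f: "isogeny \<iota> \<kappa> \<phi> \<phi>' f"
    and N: "N \<noteq> 0" "poly_kernel f \<subseteq> torsion \<kappa> \<phi> N"
  obtains h where "pcompose h f = \<Phi> \<phi> N" "pcompose f h = \<Phi> \<phi>' N"
    "pcompose h (\<Phi> \<phi>' [:0, 1:]) = pcompose (\<Phi> \<phi> [:0, 1:]) h"
    "Polynomial.coeff h 0 = 0" "Polynomial.coeff h 1 \<noteq> 0"
proof -
  interpret f: additive_poly f by (rule isogeny_additive_poly[OF assms(1-3)])
  have "\<exists>h. \<Phi> \<phi> N = pcompose h f"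
  proof (rule f.factor_through)
    fix a assume "poly f a = 0"
    then have "poly (\<Phi> \<phi> N) a = 0" using N(2) unfolding torsion_def poly_kernel_def by auto
    then show "pcompose (\<Phi> \<phi> N) [:a, 1:] = \<Phi> \<phi> N"
      by (intro poly_ext) (simp add: poly_pcompose drinfeld_additive[OF \<phi>])
  qed
  then obtain h where h: "pcompose h f = \<Phi> \<phi> N" by metis
  show ?thesis
  proof (rule that)
    show "pcompose h f = \<Phi> \<phi> N" by fact
    have "pcompose (pcompose f h) f = pcompose (\<Phi> \<phi>' N) f"
      using isogeny_intertwines[OF assms(1-3), of N] by (simp add: pcompose_assoc[symmetric] h)
    then show "pcompose f h = \<Phi> \<phi>' N" by (rule pcompose_right_cancel[OF _ f.degree_pos])
    have "pcompose (pcompose h (\<Phi> \<phi>' [:0, 1:])) f = pcompose h (pcompose f (\<Phi> \<phi> [:0, 1:]))"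
      using isogeny_intertwines[OF assms(1-3), of "[:0, 1:]"] by (simp add: pcompose_assoc[symmetric])
    also have "\<dots> = pcompose (\<Phi> \<phi> N) (\<Phi> \<phi> [:0, 1:])" by (simp add: pcompose_assoc h)
    also have "\<dots> = pcompose (\<Phi> \<phi> [:0, 1:]) (\<Phi> \<phi> N)"
      using drinfeld_mult[OF \<phi>] by (metis mult.commute)
    also have "\<dots> = pcompose (pcompose (\<Phi> \<phi> [:0, 1:]) h) f" by (simp add: pcompose_assoc[symmetric] h)
    finally show "pcompose h (\<Phi> \<phi>' [:0, 1:]) = pcompose (\<Phi> \<phi> [:0, 1:]) h"
      by (rule pcompose_right_cancel[OF _ f.degree_pos])
    have "poly (pcompose h f) 0 = 0" using drinfeld_coeffs(1)[OF \<phi>, of N] unfolding h poly_0_coeff_0 .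
    then have "poly h 0 = 0" unfolding poly_pcompose f.poly_0 .
    then show h0: "Polynomial.coeff h 0 = 0" unfolding poly_0_coeff_0 .
    have "Polynomial.coeff h 1 * Polynomial.coeff f 1 = \<kappa> (embed_A \<iota> N)"
      using coeff_1_pcompose[OF h0 f.coeff_0] drinfeld_coeffs(2)[OF \<phi>, of N] h by simp
    then show "Polynomial.coeff h 1 \<noteq> 0" using N(1) by auto
  qed
qed

end

subsection \<open>Comparison of heights\<close>

text \<open>Scaling by \<open>c\<close> multiplies the i-th entry of the maximum by
  \<open>c powr (1 / (q ^ i - 1))\<close>, whose exponent is largest at \<open>i = 1\<close> and
  smallest at \<open>i = r\<close>. For \<open>c = q\<close>, the size of t at infinity, these
  extremes produce the constants of the theorem.\<close>

lemma graded_size_scale: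
  assumes q: "2 \<le> q" and r: "1 \<le> r" and c: "1 \<le> c" and G: "\<And>i. 0 \<le> G i"
  shows "graded_size q r G \<le> c powr (1 / (real q - 1)) * graded_size q r (\<lambda>i. G i / c)"
    and "c powr (1 / (real q ^ r - 1)) * graded_size q r (\<lambda>i. G i / c) \<le> graded_size q r G"
proof -
  have split: "G i powr a = c powr a * (G i / c) powr a" for i a
    using c by (simp add: powr_mult[symmetric])
  have mono: "real q \<le> real q ^ i" "real q ^ i \<le> real q ^ r" if "i \<in> {1..r}" for i
    using that q self_le_power[of "real q" i] by (auto intro: power_increasing)
  have q1: "1 < real q" using q by simp
  have q1i: "1 < real q ^ i" if "i \<in> {1..r}" for i using mono(1)[OF that] q1 by linarith
  show "graded_size q r G \<le> c powr (1 / (real q - 1)) * graded_size q r (\<lambda>i. G i / c)"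
    unfolding graded_size_def[of q r G]
  proof (intro Max.boundedI)
    fix a assume "a \<in> (\<lambda>i. G i powr (1 / (real q ^ i - 1))) ` {1..r}"
    then obtain i where i: "i \<in> {1..r}" and a: "a = G i powr (1 / (real q ^ i - 1))" by blast
    have "(G i / c) powr (1 / (real q ^ i - 1)) \<le> graded_size q r (\<lambda>i. G i / c)"
      unfolding graded_size_def using i by (intro Max_ge) auto
    moreover have "c powr (1 / (real q ^ i - 1)) \<le> c powr (1 / (real q - 1))"
      using c q1 mono(1)[OF i] by (intro powr_mono frac_le) linarith+
    ultimately show "a \<le> c powr (1 / (real q - 1)) * graded_size q r (\<lambda>i. G i / c)"
      unfolding a split[of i] by (intro mult_mono) auto
  qed (use r in auto)
  have "graded_size q r (\<lambda>i. G i / c) \<in> (\<lambda>i. (G i / c) powr (1 / (real q ^ i - 1))) ` {1..r}"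
    unfolding graded_size_def using r by (intro Max_in) auto
  then obtain i where i: "i \<in> {1..r}"
    and m: "graded_size q r (\<lambda>i. G i / c) = (G i / c) powr (1 / (real q ^ i - 1))" by blast
  have "c powr (1 / (real q ^ r - 1)) \<le> c powr (1 / (real q ^ i - 1))"
    using c q1 q1i[OF i] mono(2)[OF i] by (intro powr_mono frac_le) linarith+
  then have "c powr (1 / (real q ^ r - 1)) * graded_size q r (\<lambda>i. G i / c) \<le> G i powr (1 / (real q ^ i - 1))"
    unfolding m split[of i] by (intro mult_right_mono) auto
  also have "\<dots> \<le> graded_size q r G" unfolding graded_size_def using i by (intro Max_ge) auto
  finally show "c powr (1 / (real q ^ r - 1)) * graded_size q r (\<lambda>i. G i / c) \<le> graded_size q r G" .
qed

lemma graded_size_unit: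
  assumes "1 \<le> r" "G r = 1" "\<And>i. G i = 0 \<or> G i = 1"
  shows "graded_size q r G = 1"
  unfolding graded_size_def
proof (rule Max_eqI)
  show "1 \<in> (\<lambda>i. G i powr (1 / (real q ^ i - 1))) ` {1..r}" using assms by (intro image_eqI[of _ _ r]) auto
  fix y assume "y \<in> (\<lambda>i. G i powr (1 / (real q ^ i - 1))) ` {1..r}"
  then obtain i where "y = G i powr (1 / (real q ^ i - 1))" by blast
  then show "y \<le> 1" using assms(3)[of i] by auto
qed simp

lemma infsum_finite_support:
  fixes F :: "'i \<Rightarrow> real"
  assumes "finite S" "S \<subseteq> A" "\<And>x. x \<in> A \<Longrightarrow> x \<notin> S \<Longrightarrow> F x = 0"
  shows "infsum F A = sum F S"
proof -
  have "infsum F A = infsum F S" using assms by (intro infsum_cong_neutral) auto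
  then show ?thesis using assms(1) by (simp add: infsum_finite)
qed

text \<open>The power \<open>q ^ 2 - 1\<close> of the size is
  \<open>max (G 1 ^ (q + 1)) (G 2)\<close>, from which \<open>G 2\<close> is factored out. Summed
  over all places, the term \<open>log (G 2)\<close> vanishes by the product formula.\<close>

lemma graded_size_2:
  assumes q: "2 \<le> q" and G: "0 \<le> G 1" "0 < G 2"
  shows "(real q ^ 2 - 1) * log (real q) (graded_size q 2 G)
    = log (real q) (max 1 (G 1 ^ (q + 1) / G 2)) + log (real q) (G 2)"
proof -
  define M where "M = graded_size q 2 G"
  have M: "0 < M" unfolding M_def using G(2) by (intro graded_size_pos) auto
  have q1: "1 < real q" "1 < real q ^ 2" using q by (simp_all add: power2_eq_square less_1_mult)
  have set: "{1..2::nat} = {1, 2}" by auto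
  have M': "M = max (G 1 powr (1 / (real q - 1))) (G 2 powr (1 / (real q ^ 2 - 1)))"
    unfolding M_def graded_size_def set by simp
  have "M powr (real q ^ 2 - 1) = max (G 1 ^ (q + 1)) (G 2)"
  proof -
    have max: "(max a b) powr c = max (a powr c) (b powr c)" if "0 \<le> a" "0 \<le> b" "0 < c" for a b c :: real
      using that powr_mono2[of c a b] powr_mono2[of c b a] by (auto simp: max_def)
    have e: "1 / (real q - 1) * (real q ^ 2 - 1) = real (q + 1)"
      using q1 by (simp add: field_simps power2_eq_square)
    have "(G 1 powr (1 / (real q - 1))) powr (real q ^ 2 - 1) = G 1 ^ (q + 1)"
    proof (cases "G 1 = 0")
      case False
      then have "0 < G 1" using G(1) by simp
      then show ?thesis unfolding powr_powr e by (rule powr_realpow)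
    qed simp
    moreover have "(G 2 powr (1 / (real q ^ 2 - 1))) powr (real q ^ 2 - 1) = G 2"
      using G(2) q1(2) by (simp only: powr_powr) simp
    ultimately show ?thesis unfolding M' using q1 by (subst max) auto
  qed
  moreover have "max (G 1 ^ (q + 1)) (G 2) = max 1 (G 1 ^ (q + 1) / G 2) * G 2"
    using G(2) by (auto simp: max_def field_simps)
  moreover have "log (real q) (M powr (real q ^ 2 - 1)) = (real q ^ 2 - 1) * log (real q) M"
    using M by (simp add: log_powr)
  ultimately show ?thesis unfolding M_def[symmetric]
    using G(2) by (simp add: log_mult_pos)
qed

text \<open>Concavity of the logarithm, with weights whose sum \<open>s\<close> may be less than 1: the tangent at
  the mean leaves the defect \<open>(1 - s) X / (1 + X)\<close>, which \<open>(1 - s) ln (1 + X)\<close> absorbs.\<close>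

lemma log_sum_le_log_mean:
  assumes b: "1 < b" and "finite S" and p: "\<And>i. i \<in> S \<Longrightarrow> 0 \<le> p i" "(\<Sum>i\<in>S. p i) \<le> 1"
    and x: "\<And>i. i \<in> S \<Longrightarrow> 0 \<le> (x i :: real)"
  shows "(\<Sum>i\<in>S. p i * log b (1 + x i)) \<le> log b (1 + (\<Sum>i\<in>S. p i * x i))"
proof -
  define m where "m = (\<Sum>i\<in>S. p i * x i)"
  define s where "s = (\<Sum>i\<in>S. p i)"
  have m: "0 \<le> m" unfolding m_def using p(1) x by (intro sum_nonneg) simp
  have tangent: "ln (1 + y) \<le> ln (1 + m) + (y - m) / (1 + m)" if "0 \<le> y" for y
  proof -
    have "ln ((1 + y) / (1 + m)) \<le> (1 + y) / (1 + m) - 1" using that m by (intro ln_le_minus_one) simp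
    moreover have "ln ((1 + y) / (1 + m)) = ln (1 + y) - ln (1 + m)" using that m by (intro ln_divide_pos) auto
    moreover have "(1 + y) / (1 + m) - 1 = (y - m) / (1 + m)" using m by (simp add: field_simps)
    ultimately show ?thesis by simp
  qed
  have "(\<Sum>i\<in>S. p i * ln (1 + x i)) \<le> (\<Sum>i\<in>S. p i * (ln (1 + m) + (x i - m) / (1 + m)))"
    using p(1) x tangent by (intro sum_mono mult_left_mono) auto
  also have "\<dots> = (\<Sum>i\<in>S. p i * (ln (1 + m) - m / (1 + m)) + p i * x i * (1 / (1 + m)))"
    by (simp add: algebra_simps diff_divide_distrib)
  also have "\<dots> = s * (ln (1 + m) - m / (1 + m)) + m * (1 / (1 + m))"
    unfolding sum.distrib s_def m_def sum_distrib_right ..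
  also have "\<dots> \<le> ln (1 + m)"
  proof -
    have "0 \<le> ln (1 + m) - m / (1 + m)" using tangent[of 0] m by simp
    then have "s * (ln (1 + m) - m / (1 + m)) \<le> 1 * (ln (1 + m) - m / (1 + m))"
      using p(2) unfolding s_def by (intro mult_right_mono) auto
    then show ?thesis by simp
  qed
  finally have "(\<Sum>i\<in>S. p i * ln (1 + x i)) / ln b \<le> ln (1 + m) / ln b" using b by (intro divide_right_mono) auto
  then show ?thesis unfolding m_def log_def sum_divide_distrib by simp
qed

context closure_of_function_field
begin

definition size_at :: "nat \<Rightarrow> ('k poly \<Rightarrow> 'a poly) \<Rightarrow> ('a \<Rightarrow> real) \<Rightarrow> real" where
  "size_at r \<phi> v = graded_size q r (\<lambda>i. v (drinfeld_coeff \<phi> i))"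

lemma size_at_pos:
  assumes "drinfeld_module \<iota> r \<phi>" "1 \<le> r" "v \<in> places \<iota>"
  shows "0 < size_at r \<phi> v"
proof -
  interpret v: nonarch_abs v by (rule places_nonarch[OF assms(3)])
  show ?thesis unfolding size_at_def
    using drinfeld_tau_poly(2)[OF assms(1,2)] assms(2) by (intro graded_size_pos) simp_all
qed

lemma finite_size_at_support:
  assumes \<phi>: "drinfeld_module \<iota> r \<phi>" and r: "1 \<le> r"
  shows "finite {v \<in> places \<iota>. size_at r \<phi> v \<noteq> 1}"
proof (rule finite_subset)
  define I where "I = {i \<in> {1..r}. drinfeld_coeff \<phi> i \<noteq> 0}"
  show "finite (\<Union>i\<in>I. {v \<in> places \<iota>. v (drinfeld_coeff \<phi> i) \<noteq> 1})"
    unfolding I_def using finite_support by (intro finite_UN_I) auto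
  show "{v \<in> places \<iota>. size_at r \<phi> v \<noteq> 1} \<subseteq> (\<Union>i\<in>I. {v \<in> places \<iota>. v (drinfeld_coeff \<phi> i) \<noteq> 1})"
  proof (rule subsetI, rule ccontr)
    fix v assume v: "v \<in> {v \<in> places \<iota>. size_at r \<phi> v \<noteq> 1}"
      and none: "v \<notin> (\<Union>i\<in>I. {v \<in> places \<iota>. v (drinfeld_coeff \<phi> i) \<noteq> 1})"
    interpret v: nonarch_abs v using v places_nonarch by blast
    \<comment> \<open>Indices outside \<open>{1..r}\<close> do not enter the size; the value 0 there
      meets the hypothesis of \<open>graded_size_unit\<close>.\<close>
    define G where "G i = (if i \<in> {1..r} then v (drinfeld_coeff \<phi> i) else 0)" for i
    have "graded_size q r G = 1"
    proof (rule graded_size_unit[OF r])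
      show "G r = 1" using none v r drinfeld_tau_poly(2)[OF \<phi> r] unfolding G_def I_def by auto
      show "G i = 0 \<or> G i = 1" for i using none v unfolding G_def I_def by auto
    qed
    moreover have "graded_size q r G = size_at r \<phi> v"
      unfolding size_at_def graded_size_def G_def by (intro arg_cong[where f = Max] image_cong) auto
    ultimately show False using v by simp
  qed
qed

lemma graded_height_eq_sum:
  assumes \<phi>: "drinfeld_module \<iota> r \<phi>" and r: "1 \<le> r"
    and S: "finite S" "S \<subseteq> places \<iota>" "{v \<in> places \<iota>. size_at r \<phi> v \<noteq> 1} \<subseteq> S"
  shows "graded_height \<iota> r \<phi> =
    (\<Sum>v\<in>S. real (local_degree \<iota> v) * log (real q) (size_at r \<phi> v)) / real (extension_degree \<iota>)"
proof -
  have "(\<Sum>\<^sub>\<infinity>v\<in>places \<iota>. real (local_degree \<iota> v) * log (real q) (size_at r \<phi> v))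
      = (\<Sum>v\<in>S. real (local_degree \<iota> v) * log (real q) (size_at r \<phi> v))"
    using S by (intro infsum_finite_support) auto
  then show ?thesis
    unfolding graded_height_def size_at_def graded_size_def q_eq[symmetric] by simp
qed

lemma sum_log_size:
  assumes "y \<noteq> 0" "finite S" "S \<subseteq> places \<iota>" "{v \<in> places \<iota>. v y \<noteq> 1} \<subseteq> S"
  shows "(\<Sum>v\<in>S. log_size y v) = 0"
proof -
  have "(\<Sum>v\<in>S. log_size y v) = (\<Sum>v\<in>{v \<in> places \<iota>. v y \<noteq> 1}. log_size y v)"
    using assms by (intro sum.mono_neutral_right) (auto simp: log_size_def)
  then show ?thesis using product_formula[OF assms(1)] by simp
qed

lemma infinite_places: "infinite_place v \<Longrightarrow> v \<in> places \<iota>"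
  unfolding infinite_place_def by simp

text \<open>The derivative \<open>c\<close> of an isogeny lies in the algebraic closure, not in \<open>K\<close>. Choosing above
  each place an extension at which \<open>1/c\<close> is small relative to the constant term of its minimal
  polynomial, the product formula for this constant term replaces the one for \<open>c\<close>.\<close>

lemma height_comparison:
  assumes \<phi>: "drinfeld_module \<iota> r \<phi>" and \<phi>': "drinfeld_module \<iota> r \<phi>'" and r: "1 \<le> r"
    and f: "Polynomial.coeff f 0 = 0" "Polynomial.coeff f 1 \<noteq> 0"
    and comm: "pcompose f (\<Phi> \<phi> [:0, 1:]) = pcompose (\<Phi> \<phi>' [:0, 1:]) f"
    and B: "\<And>v w. infinite_place v \<Longrightarrow> nonarch_abs w \<Longrightarrow> (\<And>x. w (\<kappa> x) = v x) \<Longrightarrow>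
      log (real q) (size_at r \<phi>' v) - log (real q) (size_at r \<phi> v) \<le> - log (real q) (w (Polynomial.coeff f 1)) + B v"
  shows "graded_height \<iota> r \<phi>' - graded_height \<iota> r \<phi>
    \<le> (\<Sum>v\<in>{v. infinite_place v}. real (local_degree \<iota> v) * B v) / real (extension_degree \<iota>)"
proof -
  \<comment> \<open>The inverse is taken because the linear coefficient of \<open>f\<close> has to
    be bounded from below, while the extension \<open>w\<close> is controlled from above.\<close>
  define c where "c = inverse (Polynomial.coeff f 1)"
  have c: "c \<noteq> 0" using f unfolding c_def by simp
  obtain m where m: "minimal_polynomial \<kappa> c m" using \<kappa>.exists_minimal_polynomial[OF \<kappa>_algebraic] .
  define n where "n = Polynomial.degree m"
  define a where "a = Polynomial.coeff m 0"
  have a: "a \<noteq> 0" and n: "0 < n" using \<kappa>.minimal_polynomial_coeff_0[OF m c] unfolding a_def n_def by auto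
  have fnz: "f \<noteq> 0" using f by auto
  have local: "log (real q) (size_at r \<phi>' v) - log (real q) (size_at r \<phi> v)
      \<le> log (real q) (v a) / real n + (if infinite_place v then B v else 0)" if v: "v \<in> places \<iota>" for v
  proof -
    interpret v: nonarch_abs v by (rule places_nonarch[OF v])
    obtain \<pi> d T where b: "base_place v \<pi> d T" using places_base[OF v] .
    have \<pi>: "\<iota> \<pi> \<noteq> 0" "v (\<iota> \<pi>) < 1" using base_placeD[OF b] by auto
    obtain w where w: "nonarch_abs w" "\<And>x. w (\<kappa> x) = v x" "w c ^ n \<le> v a"
      using v.extend_abs_le_constant_term[OF \<kappa>.field_morphism_axioms \<kappa>_algebraic \<pi> places_value[OF v b] m c]
      unfolding n_def a_def by metis
    interpret w: nonarch_abs w by fact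
    have wf: "0 < w (Polynomial.coeff f 1)" using f by simp
    have "log (real q) (w c ^ n) \<le> log (real q) (v a)" using w(3) c q_gt_1 by (intro log_mono) auto
    then have "real n * log (real q) (w c) \<le> log (real q) (v a)" using c by (simp add: log_nat_power)
    then have "log (real q) (w c) \<le> log (real q) (v a) / real n" using n by (simp add: field_simps)
    moreover have "log (real q) (w c) = - log (real q) (w (Polynomial.coeff f 1))"
      unfolding c_def w.inverse using wf by (simp add: log_inverse)
    ultimately have c_le: "- log (real q) (w (Polynomial.coeff f 1)) \<le> log (real q) (v a) / real n" by simp
    show ?thesis
    proof (cases "infinite_place v")
      case True
      then show ?thesis using B[OF True w(1,2)] c_le by simp
    next
      case False
      then obtain P where P: "finite_place P v" using places_cases[OF v] by blast
      have "v t \<le> 1" using finite_place_less_1_iff(2)[OF P, of "[:0, 1:]"] by simp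
      then have "size_at r \<phi>' v * w (Polynomial.coeff f 1) \<le> size_at r \<phi> v"
        using w.graded_size_isogeny_le[OF q_ge_2 r drinfeld_tau_poly(1)[OF \<phi>] drinfeld_tau_poly(1)[OF \<phi>'] _ fnz f(1) comm]
          drinfeld_tau_poly(2)[OF \<phi> r] unfolding size_at_def w(2) by simp
      then have "log (real q) (size_at r \<phi>' v * w (Polynomial.coeff f 1)) \<le> log (real q) (size_at r \<phi> v)"
        using size_at_pos[OF \<phi>' r v] size_at_pos[OF \<phi> r v] wf q_gt_1 by (intro log_mono) auto
      then have "log (real q) (size_at r \<phi>' v) + log (real q) (w (Polynomial.coeff f 1)) \<le> log (real q) (size_at r \<phi> v)"
        using size_at_pos[OF \<phi>' r v] wf by (simp add: log_mult_pos)
      then show ?thesis using c_le False by simp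
    qed
  qed
  \<comment> \<open>One finite set carrying all nonzero local terms of both heights and of the
    product formula for \<open>a\<close>, as well as all infinite places.\<close>
  define S where "S = {v \<in> places \<iota>. size_at r \<phi> v \<noteq> 1} \<union> {v \<in> places \<iota>. size_at r \<phi>' v \<noteq> 1} \<union>
    {v \<in> places \<iota>. v a \<noteq> 1} \<union> {v. infinite_place v}"
  have S: "finite S" "S \<subseteq> places \<iota>" unfolding S_def
    using finite_size_at_support[OF \<phi> r] finite_size_at_support[OF \<phi>' r] finite_support[OF a] finite_infinite_places infinite_places
    by auto
  have "(\<Sum>v\<in>S. real (local_degree \<iota> v) * log (real q) (size_at r \<phi>' v)) - (\<Sum>v\<in>S. real (local_degree \<iota> v) * log (real q) (size_at r \<phi> v))
      = (\<Sum>v\<in>S. real (local_degree \<iota> v) * (log (real q) (size_at r \<phi>' v) - log (real q) (size_at r \<phi> v)))"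
    by (simp add: sum_subtractf right_diff_distrib)
  also have "\<dots> \<le> (\<Sum>v\<in>S. real (local_degree \<iota> v) * (log (real q) (v a) / real n + (if infinite_place v then B v else 0)))"
    using S(2) by (intro sum_mono mult_left_mono local) auto
  also have "\<dots> = (\<Sum>v\<in>S. log_size a v) / real n + (\<Sum>v\<in>S. if infinite_place v then real (local_degree \<iota> v) * B v else 0)"
    unfolding sum_divide_distrib sum.distrib[symmetric] log_size_def by (intro sum.cong) (auto simp: algebra_simps)
  also have "(\<Sum>v\<in>S. log_size a v) = 0" by (rule sum_log_size[OF a S]) (auto simp: S_def)
  also have "(\<Sum>v\<in>S. if infinite_place v then real (local_degree \<iota> v) * B v else 0)
      = (\<Sum>v\<in>{v. infinite_place v}. real (local_degree \<iota> v) * B v)"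
    using S(1) by (intro sum.mono_neutral_cong_right) (auto simp: S_def)
  finally have le: "(\<Sum>v\<in>S. real (local_degree \<iota> v) * log (real q) (size_at r \<phi>' v)) - (\<Sum>v\<in>S. real (local_degree \<iota> v) * log (real q) (size_at r \<phi> v))
      \<le> (\<Sum>v\<in>{v. infinite_place v}. real (local_degree \<iota> v) * B v)" by simp
  have "graded_height \<iota> r \<phi>' - graded_height \<iota> r \<phi> = ((\<Sum>v\<in>S. real (local_degree \<iota> v) * log (real q) (size_at r \<phi>' v))
      - (\<Sum>v\<in>S. real (local_degree \<iota> v) * log (real q) (size_at r \<phi> v))) / real (extension_degree \<iota>)"
    unfolding diff_divide_distrib
    by (intro arg_cong2[where f = minus] graded_height_eq_sum[OF \<phi>' r S] graded_height_eq_sum[OF \<phi> r S]) (auto simp: S_def)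
  also have "\<dots> \<le> (\<Sum>v\<in>{v. infinite_place v}. real (local_degree \<iota> v) * B v) / real (extension_degree \<iota>)"
    using le by (intro divide_right_mono) auto
  finally show ?thesis .
qed

text \<open>Division by \<open>q\<close>, the size of t at an infinite place, makes this the radius
  at which the linear term of \<open>\<phi>\<^sub>t\<close> is first matched by another one.\<close>

definition radius_at :: "nat \<Rightarrow> ('k poly \<Rightarrow> 'a poly) \<Rightarrow> ('a \<Rightarrow> real) \<Rightarrow> real" where
  "radius_at r \<phi> v = 1 / graded_size q r (\<lambda>i. v (drinfeld_coeff \<phi> i) / real q)"

text \<open>The width of the interval that contains \<open>log size + log radius\<close> at infinite
  places: subtracting 1 from each fraction leaves \<open>1/(q - 1) - 1/(q ^ r - 1)\<close>.\<close>

abbreviation "gap r \<equiv> real q / (real q - 1) - real q ^ r / (real q ^ r - 1)"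

lemma gap_eq: "1 \<le> r \<Longrightarrow> gap r = 1 / (real q - 1) - 1 / (real q ^ r - 1)"
proof -
  assume "1 \<le> r"
  then have "1 < real q ^ r" using q_gt_1 by (intro one_less_power) auto
  then show ?thesis using q_gt_1 by (simp add: field_simps)
qed

lemma gap_nonneg: assumes "1 \<le> r" shows "0 \<le> gap r"
proof -
  have "real q \<le> real q ^ r" using q_gt_1 assms by (intro self_le_power) auto
  then show ?thesis unfolding gap_eq[OF assms] using q_gt_1 by (simp add: frac_le)
qed

lemma radius_at_infinite:
  assumes \<phi>: "drinfeld_module \<iota> r \<phi>" and r: "1 \<le> r" and v: "infinite_place v"
  shows "0 < radius_at r \<phi> v"
    and "i \<in> {1..r} \<Longrightarrow> v (drinfeld_coeff \<phi> i) * radius_at r \<phi> v ^ (q ^ i) \<le> real q * radius_at r \<phi> v"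
    and "\<exists>i\<in>{1..r}. v (drinfeld_coeff \<phi> i) * radius_at r \<phi> v ^ (q ^ i) = real q * radius_at r \<phi> v"
    and "log (real q) (size_at r \<phi> v) \<le> 1 / (real q - 1) - log (real q) (radius_at r \<phi> v)"
    and "1 / (real q ^ r - 1) - log (real q) (radius_at r \<phi> v) \<le> log (real q) (size_at r \<phi> v)"
proof -
  interpret v: nonarch_abs v by (rule places_nonarch[OF infinite_places[OF v]])
  have q0: "0 < real q" "1 \<le> real q" using q_gt_1 by auto
  have "0 < v (drinfeld_coeff \<phi> r)" using drinfeld_tau_poly(2)[OF \<phi> r] by simp
  note rad = graded_size_radius[where G = "\<lambda>i. v (drinfeld_coeff \<phi> i)", OF q_ge_2 r q0(1) v.nonneg this radius_at_def]
  show pos: "0 < radius_at r \<phi> v" by (rule rad(1))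
  show "i \<in> {1..r} \<Longrightarrow> v (drinfeld_coeff \<phi> i) * radius_at r \<phi> v ^ (q ^ i) \<le> real q * radius_at r \<phi> v" by (rule rad(2))
  show "\<exists>i\<in>{1..r}. v (drinfeld_coeff \<phi> i) * radius_at r \<phi> v ^ (q ^ i) = real q * radius_at r \<phi> v" by (rule rad(3))
  define m where "m = graded_size q r (\<lambda>i. v (drinfeld_coeff \<phi> i) / real q)"
  have m: "0 < m" "log (real q) m = - log (real q) (radius_at r \<phi> v)"
    using pos unfolding radius_at_def m_def[symmetric] by (simp_all add: log_divide)
  have scaled: "log (real q) (real q powr x * m) = x - log (real q) (radius_at r \<phi> v)" for x
    using m q_gt_1 by (simp add: log_mult_pos)
  have s: "0 < size_at r \<phi> v" by (rule size_at_pos[OF \<phi> r infinite_places[OF v]])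
  note sc = graded_size_scale[OF q_ge_2 r q0(2), of "\<lambda>i. v (drinfeld_coeff \<phi> i)", OF v.nonneg, folded size_at_def m_def]
  have "log (real q) (size_at r \<phi> v) \<le> log (real q) (real q powr (1 / (real q - 1)) * m)"
    using s sc(1) q_gt_1 m(1) by (intro log_mono) auto
  then show "log (real q) (size_at r \<phi> v) \<le> 1 / (real q - 1) - log (real q) (radius_at r \<phi> v)" unfolding scaled .
  have "log (real q) (real q powr (1 / (real q ^ r - 1)) * m) \<le> log (real q) (size_at r \<phi> v)"
    using s sc(2) q_gt_1 m(1) by (intro log_mono) auto
  then show "1 / (real q ^ r - 1) - log (real q) (radius_at r \<phi> v) \<le> log (real q) (size_at r \<phi> v)" unfolding scaled .
qed

lemma sum_infinite_places_le:
  assumes "0 \<le> c"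
  shows "(\<Sum>v\<in>{v. infinite_place v}. real (local_degree \<iota> v) * c) / real (extension_degree \<iota>) \<le> c"
proof -
  have "(\<Sum>v\<in>{v. infinite_place v}. real (local_degree \<iota> v) * c) = real (\<Sum>v\<in>{v. infinite_place v}. local_degree \<iota> v) * c"
    by (simp add: sum_distrib_right)
  also have "\<dots> \<le> real (extension_degree \<iota>) * c"
    using sum_local_degree_infinite assms by (intro mult_right_mono) (simp_all only: of_nat_le_iff)
  finally show ?thesis using extension_degree_pos by (simp add: field_simps)
qed

text \<open>Only \<open>h \<circ> f = \<phi>\<^sub>N\<close> is asked of \<open>h\<close>, so the
  lemma serves for an isogeny and for its dual. The local bound is nonnegative and the same at all
  infinite places, so its weighted mean does not exceed it.\<close>

lemma graded_height_le_torsion: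
  assumes \<phi>: "drinfeld_module \<iota> r \<phi>" and \<phi>': "drinfeld_module \<iota> r \<phi>'" and r: "1 \<le> r"
    and f: "Polynomial.coeff f 0 = 0" "Polynomial.coeff f 1 \<noteq> 0"
    and comm: "pcompose f (\<Phi> \<phi> [:0, 1:]) = pcompose (\<Phi> \<phi>' [:0, 1:]) f"
    and N: "N \<noteq> 0" "pcompose h f = \<Phi> \<phi> N"
  shows "graded_height \<iota> r \<phi>' - graded_height \<iota> r \<phi> \<le> real (Polynomial.degree N) + gap r"
proof -
  have fnz: "f \<noteq> 0" using f by auto
  have "log (real q) (size_at r \<phi>' v) - log (real q) (size_at r \<phi> v)
      \<le> - log (real q) (w (Polynomial.coeff f 1)) + (real (Polynomial.degree N) + gap r)"
    if v: "infinite_place v" and w: "nonarch_abs w" "\<And>x. w (\<kappa> x) = v x" for v w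
  proof -
    interpret v: nonarch_abs v by (rule places_nonarch[OF infinite_places[OF v]])
    interpret w: nonarch_abs w by fact
    note rad = radius_at_infinite[OF \<phi> r v]
    note rad' = radius_at_infinite[OF \<phi>' r v]
    have vt: "v t = real q" using infinite_place_degree[OF v, of "[:0, 1:]"] by simp
    have wf: "0 < w (Polynomial.coeff f 1)" using f by simp
    have "w (Polynomial.coeff f 1) * radius_at r \<phi> v \<le> real q ^ Polynomial.degree N * radius_at r \<phi>' v"
    proof (rule w.radius_isogeny_le[OF q_ge_2 drinfeld_tau_poly(1)[OF \<phi>] drinfeld_tau_poly(1)[OF \<phi>'] _ fnz f comm rad(1) rad'(1)])
      show "1 < w (\<kappa> t)" using vt q_gt_1 unfolding w(2) by simp
      show "w (\<kappa> (drinfeld_coeff \<phi> i)) * radius_at r \<phi> v ^ q ^ i \<le> w (\<kappa> t) * radius_at r \<phi> v" if "i \<in> {1..r}" for i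
        unfolding w(2) vt by (rule rad(2)[OF that])
      show "\<exists>i\<in>{1..r}. w (\<kappa> (drinfeld_coeff \<phi>' i)) * radius_at r \<phi>' v ^ q ^ i = w (\<kappa> t) * radius_at r \<phi>' v"
        unfolding w(2) vt by (rule rad'(3))
      show "1 \<le> real q ^ Polynomial.degree N" using q_gt_1 by (intro one_le_power) simp
      fix \<rho> :: real assume \<rho>: "0 < \<rho>" "\<rho> * real q ^ Polynomial.degree N < w (\<kappa> t) * radius_at r \<phi> v"
      have "dominates \<rho> (\<Phi> \<phi> N) 1 (w (\<kappa> t) ^ Polynomial.degree N * \<rho>)"
        if d: "dominates = nonarch_abs.dominates w" for dominates
        unfolding d
      proof (rule w.dominates_module_action[OF q_ge_2 drinfeld_tau_poly(1)[OF \<phi>], where \<sigma> = "radius_at r \<phi> v" and \<epsilon> = e and \<Phi> = "\<Phi> \<phi>"])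
        show "1 < w (\<kappa> t)" using vt q_gt_1 unfolding w(2) by simp
        show "w (\<kappa> (drinfeld_coeff \<phi> i)) * radius_at r \<phi> v ^ q ^ i \<le> w (\<kappa> t) * radius_at r \<phi> v" if "i \<in> {1..r}" for i
          unfolding w(2) vt by (rule rad(2)[OF that])
        show "\<Phi> \<phi> 0 = 0" by (rule drinfeld_0[OF \<phi>])
        show "\<Phi> \<phi> (pCons c N) = [:0, e c:] + pcompose (\<Phi> \<phi> [:0, 1:]) (\<Phi> \<phi> N)" for c N by (rule drinfeld_pCons[OF \<phi>])
        show "w (e c) = 1" if "c \<noteq> 0" for c unfolding w(2) by (rule abs_\<epsilon>[OF v.nonarch_abs_axioms that])
        show "\<rho> * w (\<kappa> t) ^ Polynomial.degree N < w (\<kappa> t) * radius_at r \<phi> v" using \<rho>(2) unfolding w(2) vt .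
      qed (use N \<rho> in simp_all)
      then show "w.dominates \<rho> (pcompose h f) 1 (real q ^ Polynomial.degree N * \<rho>)" unfolding N(2) w(2) vt by simp
    qed
    then have "log (real q) (w (Polynomial.coeff f 1) * radius_at r \<phi> v) \<le> log (real q) (real q ^ Polynomial.degree N * radius_at r \<phi>' v)"
      using wf rad(1) rad'(1) q_gt_1 by (intro log_mono) auto
    then have "log (real q) (w (Polynomial.coeff f 1)) + log (real q) (radius_at r \<phi> v)
        \<le> real (Polynomial.degree N) + log (real q) (radius_at r \<phi>' v)"
      using wf rad(1) rad'(1) q_gt_1 by (simp add: log_mult_pos log_nat_power)
    then show ?thesis using rad(5) rad'(4) unfolding gap_eq[OF r] by linarith
  qed
  then have "graded_height \<iota> r \<phi>' - graded_height \<iota> r \<phi> \<le>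
      (\<Sum>v\<in>{v. infinite_place v}. real (local_degree \<iota> v) * (real (Polynomial.degree N) + gap r)) / real (extension_degree \<iota>)"
    by (rule height_comparison[OF \<phi> \<phi>' r f comm])
  also have "\<dots> \<le> real (Polynomial.degree N) + gap r" using gap_nonneg[OF r] by (intro sum_infinite_places_le) simp
  finally show ?thesis .
qed

lemma weil_height_eq_sum:
  assumes "finite S" "S \<subseteq> places \<iota>" "\<And>v. v \<in> places \<iota> \<Longrightarrow> 1 < v x \<Longrightarrow> v \<in> S"
  shows "weil_height \<iota> x = (\<Sum>v\<in>S. real (local_degree \<iota> v) * log (real q) (max 1 (v x))) / real (extension_degree \<iota>)"
proof -
  have "(\<Sum>\<^sub>\<infinity>v\<in>places \<iota>. real (local_degree \<iota> v) * log (real q) (max 1 (v x)))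
      = (\<Sum>v\<in>S. real (local_degree \<iota> v) * log (real q) (max 1 (v x)))"
  proof (rule infsum_finite_support[OF assms(1,2)])
    fix v assume "v \<in> places \<iota>" "v \<notin> S"
    then have "max 1 (v x) = 1" using assms(3)[of v] by linarith
    then show "real (local_degree \<iota> v) * log (real q) (max 1 (v x)) = 0" by simp
  qed
  then show ?thesis unfolding weil_height_def q_eq[symmetric] by simp
qed

text \<open>By \<open>graded_size_2\<close> the two sides differ at each place by the logarithm of
  the size of the top coefficient, and these sum to 0.\<close>

lemma weil_height_j:
  assumes \<phi>: "drinfeld_module \<iota> 2 \<phi>"
  shows "weil_height \<iota> (j_invariant \<phi>) = (real q ^ 2 - 1) * graded_height \<iota> 2 \<phi>"
proof -
  define g where "g = drinfeld_coeff \<phi> 2"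
  have g: "g \<noteq> 0" unfolding g_def using drinfeld_tau_poly(2)[OF \<phi>] by simp
  define S where "S = {v \<in> places \<iota>. size_at 2 \<phi> v \<noteq> 1} \<union> {v \<in> places \<iota>. v g \<noteq> 1} \<union> {v \<in> places \<iota>. 1 < v (j_invariant \<phi>)}"
  have S: "finite S" "S \<subseteq> places \<iota>"
    unfolding S_def using finite_size_at_support[OF \<phi>] finite_support[OF g] finite_poles[of "j_invariant \<phi>"] by auto
  have "(real q ^ 2 - 1) * (\<Sum>v\<in>S. real (local_degree \<iota> v) * log (real q) (size_at 2 \<phi> v))
      = (\<Sum>v\<in>S. real (local_degree \<iota> v) * log (real q) (max 1 (v (j_invariant \<phi>))) + log_size g v)"
    unfolding sum_distrib_left
  proof (rule sum.cong[OF refl])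
    fix v assume "v \<in> S"
    then have v: "v \<in> places \<iota>" using S(2) by blast
    interpret v: nonarch_abs v by (rule places_nonarch[OF v])
    have "v (j_invariant \<phi>) = v (drinfeld_coeff \<phi> 1) ^ (q + 1) / v g"
      unfolding j_invariant_def g_def v.divide v.power q_eq ..
    then have "(real q ^ 2 - 1) * log (real q) (size_at 2 \<phi> v) = log (real q) (max 1 (v (j_invariant \<phi>))) + log (real q) (v g)"
      unfolding size_at_def using graded_size_2[OF q_ge_2, of "\<lambda>i. v (drinfeld_coeff \<phi> i)"] g unfolding g_def by simp
    then show "(real q ^ 2 - 1) * (real (local_degree \<iota> v) * log (real q) (size_at 2 \<phi> v))
        = real (local_degree \<iota> v) * log (real q) (max 1 (v (j_invariant \<phi>))) + log_size g v"
      unfolding log_size_def by (metis distrib_left mult.left_commute)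
  qed
  also have "\<dots> = (\<Sum>v\<in>S. real (local_degree \<iota> v) * log (real q) (max 1 (v (j_invariant \<phi>))))"
    unfolding sum.distrib using sum_log_size[OF g S] by (simp add: S_def subset_iff)
  finally have "(real q ^ 2 - 1) * (\<Sum>v\<in>S. real (local_degree \<iota> v) * log (real q) (size_at 2 \<phi> v))
      = (\<Sum>v\<in>S. real (local_degree \<iota> v) * log (real q) (max 1 (v (j_invariant \<phi>))))" .
  moreover have "weil_height \<iota> (j_invariant \<phi>)
      = (\<Sum>v\<in>S. real (local_degree \<iota> v) * log (real q) (max 1 (v (j_invariant \<phi>)))) / real (extension_degree \<iota>)"
    by (rule weil_height_eq_sum[OF S]) (simp add: S_def)
  moreover have "graded_height \<iota> 2 \<phi> = (\<Sum>v\<in>S. real (local_degree \<iota> v) * log (real q) (size_at 2 \<phi> v)) / real (extension_degree \<iota>)"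
    by (rule graded_height_eq_sum[OF \<phi> _ S]) (auto simp: S_def)
  ultimately show ?thesis by simp
qed

lemma weil_height_ge_infinite:
  "(\<Sum>v\<in>{v. infinite_place v}. real (local_degree \<iota> v) * log (real q) (max 1 (v x))) / real (extension_degree \<iota>) \<le> weil_height \<iota> x"
proof -
  define S where "S = {v. infinite_place v} \<union> {v \<in> places \<iota>. 1 < v x}"
  have S: "finite S" "S \<subseteq> places \<iota>"
    unfolding S_def using finite_infinite_places finite_poles[of x] infinite_places by auto
  have "(\<Sum>v\<in>{v. infinite_place v}. real (local_degree \<iota> v) * log (real q) (max 1 (v x)))
      \<le> (\<Sum>v\<in>S. real (local_degree \<iota> v) * log (real q) (max 1 (v x)))"
    using S(1) q_gt_1 by (intro sum_mono2) (auto simp: S_def)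
  then show ?thesis
    unfolding weil_height_eq_sum[OF S, of x, unfolded S_def, simplified, folded S_def]
    by (intro divide_right_mono) auto
qed

text \<open>Here the local error depends on the place through the size of \<open>j'\<close>. The
  weights \<open>p v\<close> have total at most 1, so concavity moves their mean inside the
  logarithm, where it is the infinite part of the height of \<open>j'\<close> divided by
  \<open>q\<close>.\<close>

lemma graded_height_le_degree:
  assumes \<phi>: "drinfeld_module \<iota> 2 \<phi>" and \<phi>': "drinfeld_module \<iota> 2 \<phi>'"
    and f: "Polynomial.coeff f 0 = 0" "Polynomial.coeff f 1 \<noteq> 0"
    and comm: "pcompose f (\<Phi> \<phi> [:0, 1:]) = pcompose (\<Phi> \<phi>' [:0, 1:]) f"
  shows "graded_height \<iota> 2 \<phi>' - graded_height \<iota> 2 \<phi> \<le> log (real q) (real (Polynomial.degree f)) / 2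
    + log (real q) (1 + weil_height \<iota> (j_invariant \<phi>') / real q) / 2 + gap 2"
proof -
  define D where "D = real (Polynomial.degree f)"
  define l where "l v = log (real q) (max 1 (v (j_invariant \<phi>')))" for v
  define p where "p v = real (local_degree \<iota> v) / real (extension_degree \<iota>)" for v
  have D: "1 \<le> D" unfolding D_def using le_degree[OF f(2)] by simp
  have l: "0 \<le> l v" for v unfolding l_def using q_gt_1 by simp
  have q0: "0 < real q" using q_gt_1 by simp
  have "log (real q) (size_at 2 \<phi>' v) - log (real q) (size_at 2 \<phi> v)
      \<le> - log (real q) (w (Polynomial.coeff f 1)) + (log (real q) D / 2 + gap 2 + log (real q) (1 + l v / real q) / 2)"
    if v: "infinite_place v" and w: "nonarch_abs w" "\<And>x. w (\<kappa> x) = v x" for v w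
  proof -
    interpret v: nonarch_abs v by (rule places_nonarch[OF infinite_places[OF v]])
    interpret w: nonarch_abs w by fact
    have r: "1 \<le> (2 :: nat)" by simp
    note rad = radius_at_infinite[OF \<phi> r v]
    note rad' = radius_at_infinite[OF \<phi>' r v]
    have vt: "v t = real q" using infinite_place_degree[OF v, of "[:0, 1:]"] by simp
    have wf: "0 < w (Polynomial.coeff f 1)" using f by simp
    have "(w (Polynomial.coeff f 1) * radius_at 2 \<phi> v / radius_at 2 \<phi>' v) ^ 2 \<le> real (Polynomial.degree f) * (1 + l v / real q)"
    proof (rule w.degree_isogeny_bound[OF q_ge_2 drinfeld_tau_poly(1)[OF \<phi>] drinfeld_tau_poly(1)[OF \<phi>'] _ f comm rad(1) _ rad'(1)])
      show "w (\<kappa> t) = real q" unfolding w(2) by (rule vt)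
      show "w (\<kappa> (drinfeld_coeff \<phi> i)) * radius_at 2 \<phi> v ^ q ^ i \<le> w (\<kappa> t) * radius_at 2 \<phi> v" if "i \<in> {1..2}" for i
        unfolding w(2) vt by (rule rad(2)[OF that])
      show "w (\<kappa> (drinfeld_coeff \<phi>' i)) * radius_at 2 \<phi>' v ^ q ^ i \<le> w (\<kappa> t) * radius_at 2 \<phi>' v" if "i \<in> {1..2}" for i
        unfolding w(2) vt by (rule rad'(2)[OF that])
      show "\<exists>i\<in>{1..2}. w (\<kappa> (drinfeld_coeff \<phi>' i)) * radius_at 2 \<phi>' v ^ q ^ i = w (\<kappa> t) * radius_at 2 \<phi>' v"
        unfolding w(2) vt by (rule rad'(3))
      \<comment> \<open>\<open>J = 1 + l v / q\<close> meets both conditions: it is at least 1, and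
        \<open>q * J = q + l v\<close> bounds the logarithm of the size of
        \<open>j'\<close>.\<close>
      show "1 \<le> 1 + l v / real q" using l[of v] q0 by simp
      have "v (j_invariant \<phi>') = v (drinfeld_coeff \<phi>' 1) ^ (q + 1) / v (drinfeld_coeff \<phi>' 2)"
        unfolding j_invariant_def v.divide v.power q_eq ..
      moreover have "log (real q) (v (j_invariant \<phi>')) \<le> l v"
      \<comment> \<open>For \<open>j' = 0\<close> the logarithm of 0 is 0 by convention.\<close>
      proof (cases "j_invariant \<phi>' = 0")
        case True
        then show ?thesis using l[of v] by (simp add: log_def)
      next
        case False
        then show ?thesis unfolding l_def using q_gt_1 by (intro log_mono) auto
      qed
      moreover have "real q * (1 + l v / real q) = real q + l v" using q0 by (simp add: field_simps)
      ultimately show "log (real q) (w (\<kappa> (drinfeld_coeff \<phi>' 1)) ^ (q + 1) / w (\<kappa> (drinfeld_coeff \<phi>' 2))) \<le> real q * (1 + l v / real q)"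
        unfolding w(2) using q0 by simp
      show "\<kappa> (drinfeld_coeff \<phi>' 2) \<noteq> 0" using drinfeld_tau_poly(2)[OF \<phi>'] by simp
    qed
    then have "log (real q) ((w (Polynomial.coeff f 1) * radius_at 2 \<phi> v / radius_at 2 \<phi>' v) ^ 2) \<le> log (real q) (D * (1 + l v / real q))"
      unfolding D_def[symmetric] using wf rad(1) rad'(1) q_gt_1 D l[of v] by (intro log_mono) (auto intro!: mult_pos_pos add_pos_nonneg)
    moreover have "log (real q) (D * (1 + l v / real q)) = log (real q) D + log (real q) (1 + l v / real q)"
      using D l[of v] q0 by (intro log_mult_pos add_pos_nonneg) auto
    moreover have "log (real q) ((w (Polynomial.coeff f 1) * radius_at 2 \<phi> v / radius_at 2 \<phi>' v) ^ 2) =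
        2 * (log (real q) (w (Polynomial.coeff f 1)) + log (real q) (radius_at 2 \<phi> v) - log (real q) (radius_at 2 \<phi>' v))"
      using wf rad(1) rad'(1) by (simp add: log_nat_power log_divide_pos log_mult_pos)
    ultimately show ?thesis using rad(5) rad'(4) unfolding gap_eq[OF r] by argo
  qed
  then have "graded_height \<iota> 2 \<phi>' - graded_height \<iota> 2 \<phi> \<le> (\<Sum>v\<in>{v. infinite_place v}.
      real (local_degree \<iota> v) * (log (real q) D / 2 + gap 2 + log (real q) (1 + l v / real q) / 2)) / real (extension_degree \<iota>)"
    by (intro height_comparison[OF \<phi> \<phi>' _ f comm]) auto
  also have "\<dots> = (\<Sum>v\<in>{v. infinite_place v}. real (local_degree \<iota> v) * (log (real q) D / 2 + gap 2)) / real (extension_degree \<iota>)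
      + (\<Sum>v\<in>{v. infinite_place v}. p v * log (real q) (1 + l v / real q)) / 2"
    unfolding p_def sum_divide_distrib sum.distrib[symmetric] by (intro sum.cong) (simp_all add: add_divide_distrib distrib_left)
  also have "\<dots> \<le> (log (real q) D / 2 + gap 2) + log (real q) (1 + weil_height \<iota> (j_invariant \<phi>') / real q) / 2"
  proof (intro add_mono divide_right_mono)
    show "(\<Sum>v\<in>{v. infinite_place v}. real (local_degree \<iota> v) * (log (real q) D / 2 + gap 2)) / real (extension_degree \<iota>) \<le> log (real q) D / 2 + gap 2"
      using gap_nonneg[of 2] D q_gt_1 by (intro sum_infinite_places_le add_nonneg_nonneg) auto
    have "(\<Sum>v\<in>{v. infinite_place v}. p v * log (real q) (1 + l v / real q)) \<le> log (real q) (1 + (\<Sum>v\<in>{v. infinite_place v}. p v * (l v / real q)))"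
    proof (rule log_sum_le_log_mean)
      show "(\<Sum>v\<in>{v. infinite_place v}. p v) \<le> 1"
        using sum_infinite_places_le[of 1] unfolding p_def by (simp add: sum_divide_distrib)
      show "0 \<le> l v / real q" for v using l[of v] by simp
    qed (use q_gt_1 finite_infinite_places in \<open>auto simp: p_def\<close>)
    also have "(\<Sum>v\<in>{v. infinite_place v}. p v * (l v / real q))
        = (\<Sum>v\<in>{v. infinite_place v}. real (local_degree \<iota> v) * l v) / real (extension_degree \<iota>) / real q"
      unfolding p_def sum_divide_distrib by simp
    also have "log (real q) (1 + \<dots>) \<le> log (real q) (1 + weil_height \<iota> (j_invariant \<phi>') / real q)"
    proof (rule log_mono)
      have "0 \<le> (\<Sum>v\<in>{v. infinite_place v}. real (local_degree \<iota> v) * l v)" using l by (intro sum_nonneg) simp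
      then show "0 < 1 + (\<Sum>v\<in>{v. infinite_place v}. real (local_degree \<iota> v) * l v) / real (extension_degree \<iota>) / real q"
        by (intro add_pos_nonneg) simp_all
      have "(\<Sum>v\<in>{v. infinite_place v}. real (local_degree \<iota> v) * l v) / real (extension_degree \<iota>) / real q
          \<le> weil_height \<iota> (j_invariant \<phi>') / real q"
        unfolding l_def using q0 by (intro divide_right_mono weil_height_ge_infinite) simp
      then show "1 + (\<Sum>v\<in>{v. infinite_place v}. real (local_degree \<iota> v) * l v) / real (extension_degree \<iota>) / real q
          \<le> 1 + weil_height \<iota> (j_invariant \<phi>') / real q" by simp
    qed (use q_gt_1 in simp)
    finally show "(\<Sum>v\<in>{v. infinite_place v}. p v * log (real q) (1 + l v / real q)) \<le> log (real q) (1 + weil_height \<iota> (j_invariant \<phi>') / real q)" .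
  qed simp
  finally show ?thesis unfolding D_def by simp
qed

end

theorem theorem3p1:
  fixes \<iota> :: "'k::{field,finite} poly fract \<Rightarrow> 'a::field"
    and \<kappa> :: "'a \<Rightarrow> 'c::alg_closed_field"
    and \<phi> \<phi>' :: "'k poly \<Rightarrow> 'a poly"
    and f :: "'c poly"
    and q r :: nat
  assumes "q = CARD('k)"
    and "finite_extension \<iota>"
    and "is_algebraic_closure \<kappa>"
    and "r \<ge> 2"
    and "drinfeld_module \<iota> r \<phi>"
    and "drinfeld_module \<iota> r \<phi>'"
    and "isogeny \<iota> \<kappa> \<phi> \<phi>' f"
  shows "(\<forall>N. N \<noteq> 0 \<and> poly_kernel f \<subseteq> torsion \<kappa> \<phi> N \<longrightarrow>
            \<bar>graded_height \<iota> r \<phi>' - graded_height \<iota> r \<phi>\<bar>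
              \<le> real (Polynomial.degree N)
                + (real q / (real q - 1) - real q ^ r / (real q ^ r - 1)))
       \<and> (r = 2 \<longrightarrow>
            weil_height \<iota> (j_invariant \<phi>') - weil_height \<iota> (j_invariant \<phi>)
              \<le> (real q ^ 2 - 1) / 2 * log (real q) (real (isogeny_degree f))
                + (real q ^ 2 - 1) / 2
                    * log (real q) (1 + 1 / real q * weil_height \<iota> (j_invariant \<phi>'))
                + real q)"
proof -
  interpret closure_of_function_field \<iota> q \<kappa>
  proof (intro closure_of_function_field.intro closure_of_function_field_axioms.intro)
    show "function_field \<iota> q" using assms(1,2) by unfold_locales
    show "field_morphism \<kappa>" using assms(3) unfolding is_algebraic_closure_def field_embedding_iff by blast
    show "algebraic_via \<kappa> y" for y using assms(3) unfolding is_algebraic_closure_def algebraic_via_def by blast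
  qed
  note \<phi> = assms(5) and \<phi>' = assms(6) and iso = assms(7)
  have r: "1 \<le> r" using assms(4) by simp
  interpret f: additive_poly f by (rule isogeny_additive_poly[OF \<phi> \<phi>' iso])
  note comm = isogeny_intertwines[OF \<phi> \<phi>' iso, of "[:0, 1:]"]
  show ?thesis
  proof (intro conjI allI impI)
    fix N assume N: "N \<noteq> 0 \<and> poly_kernel f \<subseteq> torsion \<kappa> \<phi> N"
    then obtain h where h: "pcompose h f = \<Phi> \<phi> N" "pcompose f h = \<Phi> \<phi>' N"
        "pcompose h (\<Phi> \<phi>' [:0, 1:]) = pcompose (\<Phi> \<phi> [:0, 1:]) h"
        "Polynomial.coeff h 0 = 0" "Polynomial.coeff h 1 \<noteq> 0"
      using dual_isogeny[OF \<phi> \<phi>' iso] by metis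
    have "graded_height \<iota> r \<phi>' - graded_height \<iota> r \<phi> \<le> real (Polynomial.degree N) + gap r"
      by (rule graded_height_le_torsion[OF \<phi> \<phi>' r f.coeff_0 f.coeff_1 comm conjunct1[OF N] h(1)])
    \<comment> \<open>The dual \<open>h\<close> commutes with t from \<open>\<phi>'\<close> to
      \<open>\<phi>\<close>, and \<open>f \<circ> h = \<phi>'\<^sub>N\<close> takes the place of
      \<open>h \<circ> f = \<phi>\<^sub>N\<close>.\<close>
    moreover have "graded_height \<iota> r \<phi> - graded_height \<iota> r \<phi>' \<le> real (Polynomial.degree N) + gap r"
      by (rule graded_height_le_torsion[OF \<phi>' \<phi> r h(4,5,3) conjunct1[OF N] h(2)])
    ultimately show "\<bar>graded_height \<iota> r \<phi>' - graded_height \<iota> r \<phi>\<bar> \<le> real (Polynomial.degree N) + gap r" by linarith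
  next
    assume r2: "r = 2"
    have deg: "isogeny_degree f = Polynomial.degree f" unfolding isogeny_degree_def by (rule f.card_kernel)
    have q2: "1 < real q ^ 2" using q_gt_1 by (intro one_less_power) auto
    \<comment> \<open>This product is \<open>(q + 1) - 1\<close>, the additive constant of the
      second part.\<close>
    have "(real q ^ 2 - 1) * gap 2 = (real q ^ 2 - 1) * (1 / (real q - 1)) - (real q ^ 2 - 1) * (1 / (real q ^ 2 - 1))"
      unfolding gap_eq[of 2, simplified] by (simp only: right_diff_distrib)
    also have "(real q ^ 2 - 1) * (1 / (real q - 1)) = real q + 1" using q_gt_1 by (simp add: field_simps power2_eq_square)
    finally have gap: "(real q ^ 2 - 1) * gap 2 = real q" using q2 by simp
    have "weil_height \<iota> (j_invariant \<phi>') - weil_height \<iota> (j_invariant \<phi>) = (real q ^ 2 - 1) * (graded_height \<iota> 2 \<phi>' - graded_height \<iota> 2 \<phi>)"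
      using weil_height_j \<phi> \<phi>' r2 by (simp add: right_diff_distrib)
    also have "\<dots> \<le> (real q ^ 2 - 1) * (log (real q) (real (Polynomial.degree f)) / 2
        + log (real q) (1 + weil_height \<iota> (j_invariant \<phi>') / real q) / 2 + gap 2)"
      using q2 by (intro mult_left_mono graded_height_le_degree[OF \<phi>[unfolded r2] \<phi>'[unfolded r2] f.coeff_0 f.coeff_1 comm]) simp
    also have "\<dots> = (real q ^ 2 - 1) / 2 * log (real q) (real (isogeny_degree f))
        + (real q ^ 2 - 1) / 2 * log (real q) (1 + 1 / real q * weil_height \<iota> (j_invariant \<phi>')) + real q"
      unfolding distrib_left gap deg by simp
    finally show "weil_height \<iota> (j_invariant \<phi>') - weil_height \<iota> (j_invariant \<phi>)
        \<le> (real q ^ 2 - 1) / 2 * log (real q) (real (isogeny_degree f))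
        + (real q ^ 2 - 1) / 2 * log (real q) (1 + 1 / real q * weil_height \<iota> (j_invariant \<phi>')) + real q" .
  qed
qed

end
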